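(* Let $m \geq 1$, $n \geq 1$, and $N_t \in \mathbb{Z}$ be integers. Let $g_0,g_1:[0,\infty)\to\mathbb{R}$ be functions ($m+2$ and $m+1$ times weakly differentiable, respectively) satisfying $$\begin{cases} (1+t)^n(g_0(t) - 2\pi N_t) \in L^1([0,\infty)),\\ (1+t)^n\partial^i g_0(t) \in L^1([0,\infty)), \quad i = 1, \dots, m+2,\\ (1+t)^n\partial^i g_1(t) \in L^1([0,\infty)), \quad i = 0,1, \dots, m+1. \end{cases}$$ Then, as $k \to 0$, $T$ and $U$ coincide to order $m$ with $\mathcal{G}_0\hat{T}_{formal}$ and $\mathcal{G}_0\hat{U}_{formal} e^{-i\theta_2 t \hat{\sigma}_3}\mathcal{G}_0^{-1}(0)$ respectively in the following sense: there is a constant $C>0$ (independent of $t$ and $k$) such that for each $j = 0, 1, \dots, n$, and for $k\ne0$, $$\bigg|\frac{\partial^j}{\partial k^j}\big(T - \mathcal{G}_0\hat{T}_p\big) \bigg| \leq \frac{C|k|^{m+1-2j}}{(1+t)^{n-j}}, \qquad t \geq 0, \ k \in (\bar{D}_2, \bar{D}_3),$$ $$\bigg|\frac{\partial^j}{\partial k^j}\big(U - \mathcal{G}_0\hat{U}_p e^{-i\theta_2 t \hat{\sigma}_3}\mathcal{G}_0^{-1}(0)\big) \bigg| \leq C(1 + t)^{j+2}|k|^{m+1-2j}e^{Ct|k|^{m+1}}, \qquad t \geq 0, \ k \in (\bar{D}_3, \bar{D}_2),$$ $$\bigg|\frac{\partial^j}{\partial k^j}\Big(\big(U - \mathcal{G}_0\hat{U}_p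 e^{-i\theta_2 t \hat{\sigma}_3}\mathcal{G}_0^{-1}(0)\big)e^{-2i\theta_2 t\sigma_3}\Big) \bigg| \leq C(1 + t)^{j+2} |k|^{m+1-2j} e^{Ct|k|^{m+1}}, \qquad t \geq 0, \ k \in (\bar{D}_2, \bar{D}_3).$$ In particular, for each $t \geq 0$, it holds (for $k\ne0$) that $T(t,\cdot)$ is bounded for $k \in (\bar{D}_-, \bar{D}_+)$; $U(t,\cdot)$ is bounded for $k \in (\bar{D}_+, \bar{D}_-)$; and $U(t,\cdot)e^{-2i\theta_2 t\sigma_3}$ is bounded for $k \in (\bar{D}_-, \bar{D}_+)$.
   Context: Pauli matrices: $\sigma_1=\begin{pmatrix}0&1\\1&0\end{pmatrix}$, $\sigma_2=\begin{pmatrix}0&-i\\i&0\end{pmatrix}$, $\sigma_3=\begin{pmatrix}1&0\\0&-1\end{pmatrix}$. $e^{\alpha\hat\sigma_3}A=e^{\alpha\sigma_3}Ae^{-\alpha\sigma_3}$ for a $2\times2$ matrix $A$. $|A|^2=\sum_{i,j}|A_{ij}|^2$. $A^{(d)}$ and $A^{(o)}$ are the diagonal and off-diagonal parts of $A$. $\theta_2=\theta_2(k)=\frac14(k+\frac1k)$ and $$\mathsf{V}(t,k)=-\frac{i(g_1+g_{0t})}{4}\sigma_2+\frac1k\Big(-\frac{i\sin g_0}{4}\sigma_1-\frac{i(\cos g_0-1)}{4}\sigma_3\Big).$$ $T,U$ are the solutions of $T_t+i\theta_2[\sigma_3,T]=\mathsf{V}T$ defined by the Volterra equations $$T(t,k)=I+\int_\infty^te^{i\theta_2(t'-t)\hat\sigma_3}(\mathsf{V}T)(t',k)dt',\qquad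 U(t,k)=I+\int_0^te^{i\theta_2(t'-t)\hat\sigma_3}(\mathsf{V}U)(t',k)dt',$$ $T$ being defined for $k\in(\bar D_-,\bar D_+)\setminus\{0\}$ (columnwise) and $U$ for $k\in\mathbb{C}\setminus\{0\}$. $$\mathcal{G}_0(t)=(-1)^{N_t}\begin{pmatrix}\cos\frac{g_0(t)}2&-\sin\frac{g_0(t)}2\\ \sin\frac{g_0(t)}2&\cos\frac{g_0(t)}2\end{pmatrix}.$$ The expression $\mathcal{G}_0\hat U_pe^{-i\theta_2t\hat\sigma_3}\mathcal{G}_0^{-1}(0)$ means $\mathcal{G}_0(t)\hat U_p(t,k)\big(e^{-i\theta_2t\sigma_3}\mathcal{G}_0(0)^{-1}e^{i\theta_2t\sigma_3}\big)$, and similarly with $\hat U_{formal}$. Domains: $D_1=\{\operatorname{Im}k>0,|k|>1\}$, $D_2=\{\operatorname{Im}k>0,|k|<1\}$, $D_3=\{\operatorname{Im}k<0,|k|<1\}$, $D_4=\{\operatorname{Im}k<0,|k|>1\}$, $D_+=D_1\cup D_3$, $D_-=D_2\cup D_4$; bars denote closures. For a statement about a $2\times2$ matrix, "$k\in(A,B)$" means it holds for the first column when $k\in A$ and for the second column when $k\in B$. Derivatives at boundary points are continuous extensions from the interior. Set $\hat{\mathsf{V}}_0=-\frac{i(g_1-g_{0t})}{4}\sigma_2$ and $\hat{\mathsf{V}}_1=\frac{i\sin g_0}{4}\sigma_1-\frac{i(\cos g_0-1)}{4}\sigma_3$. The formal series $$\hat T_{formal}=I+\hat T_1(t)k+\hat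 T_2(t)k^2+\cdots,\qquad \hat U_{formal}=I+\hat Z_1(t)k+\cdots+\big(\hat W_1(t)k+\hat W_2(t)k^2+\cdots\big)e^{2i\theta_2t\sigma_3}$$ have coefficients determined recursively from $\hat T_{-1}=\hat Z_{-1}=0$, $\hat T_0=\hat Z_0=I$, $\hat W_{-1}=\hat W_0=0$, the normalizations $\lim_{t\to\infty}\hat T_j(t)=0$, $\hat Z_j(0)+\hat W_j(0)=0$ for $j\ge1$, and, for $j\ge0$, the relations $$\hat T_{j+1}^{(o)}=-2i\sigma_3\big(-\partial_t\hat T_j^{(o)}-\tfrac i2\sigma_3\hat T_{j-1}^{(o)}+\hat{\mathsf{V}}_0\hat T_j^{(d)}+\hat{\mathsf{V}}_1^{(o)}\hat T_{j-1}^{(d)}+\hat{\mathsf{V}}_1^{(d)}\hat T_{j-1}^{(o)}\big),$$ $$\partial_t\hat T_{j+1}^{(d)}=\hat{\mathsf{V}}_0\hat T_{j+1}^{(o)}+\hat{\mathsf{V}}_1^{(o)}\hat T_j^{(o)}+\hat{\mathsf{V}}_1^{(d)}\hat T_j^{(d)},$$ the same two relations with every $\hat T_i$ replaced by $\hat Z_i$, and $$\hat W_{j+1}^{(d)}=-2i\sigma_3\big(-\partial_t\hat W_j^{(d)}-\tfrac i2\sigma_3\hat W_{j-1}^{(d)}+\hat{\mathsf{V}}_0\hat W_j^{(o)}+\hat{\mathsf{V}}_1^{(o)}\hat W_{j-1}^{(o)}+\hat{\mathsf{V}}_1^{(d)}\hat W_{j-1}^{(d)}\big),$$ $$\partial_t\hat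 W_{j+1}^{(o)}=\hat{\mathsf{V}}_0\hat W_{j+1}^{(d)}+\hat{\mathsf{V}}_1^{(o)}\hat W_j^{(d)}+\hat{\mathsf{V}}_1^{(d)}\hat W_j^{(o)}.$$ The truncations are $\hat T_p=I+\hat T_1k+\cdots+\hat T_{m+1}k^{m+1}$ and $\hat U_p=I+\hat Z_1k+\cdots+\hat Z_{m+1}k^{m+1}+\big(\hat W_1k+\cdots+\hat W_{m+1}k^{m+1}\big)e^{2i\theta_2t\sigma_3}$. *)

theory Defs
  imports "HOL-Analysis.Analysis"
begin

type_synonym cmat = "complex^2^2"

definition mat2 :: "complex \<Rightarrow> complex \<Rightarrow> complex \<Rightarrow> complex \<Rightarrow> cmat" where
  "mat2 a b c d = vector [vector [a, b], vector [c, d]]"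

definition smat :: "complex \<Rightarrow> cmat \<Rightarrow> cmat" (infixr "*\<^sub>M" 75) where
  "c *\<^sub>M A = map_matrix (\<lambda>x. c * x) A"

definition sigma1 :: cmat where "sigma1 = mat2 0 1 1 0"
definition sigma2 :: cmat where "sigma2 = mat2 0 (-\<i>) \<i> 0"
definition sigma3 :: cmat where "sigma3 = mat2 1 0 0 (-1)"

definition diag_part :: "cmat \<Rightarrow> cmat" where
  "diag_part A = mat2 (A $ 1 $ 1) 0 0 (A $ 2 $ 2)"

definition off_part :: "cmat \<Rightarrow> cmat" where
  "off_part A = mat2 0 (A $ 1 $ 2) (A $ 2 $ 1) 0"

(* exp_sigma3 a is the matrix exponential of a * sigma3;
   exp_ad_sigma3 a A is its conjugation action on A. *)
definition exp_sigma3 :: "complex \<Rightarrow> cmat" where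
  "exp_sigma3 a = mat2 (exp a) 0 0 (exp (- a))"

definition exp_ad_sigma3 :: "complex \<Rightarrow> cmat \<Rightarrow> cmat" where
  "exp_ad_sigma3 a A = exp_sigma3 a ** A ** exp_sigma3 (- a)"

definition theta2 :: "complex \<Rightarrow> complex" where
  "theta2 k = (k + 1 / k) / 4"

definition D1 :: "complex set" where "D1 = {k. Im k > 0 \<and> cmod k > 1}"
definition D2 :: "complex set" where "D2 = {k. Im k > 0 \<and> cmod k < 1}"
definition D3 :: "complex set" where "D3 = {k. Im k < 0 \<and> cmod k < 1}"
definition D4 :: "complex set" where "D4 = {k. Im k < 0 \<and> cmod k > 1}"
definition Dplus :: "complex set" where "Dplus = D1 \<union> D3"
definition Dminus :: "complex set" where "Dminus = D2 \<union> D4"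

subsection \<open>Weak derivatives on the half-line\<close>

definition test_function :: "(real \<Rightarrow> real) \<Rightarrow> bool" where
  "test_function \<phi> \<longleftrightarrow>
     (\<forall>i. (deriv ^^ i) \<phi> differentiable_on UNIV) \<and>
     (\<exists>a b. 0 < a \<and> (\<forall>x. \<phi> x \<noteq> 0 \<longrightarrow> x \<in> {a..b}))"

definition has_weak_deriv :: "(real \<Rightarrow> real) \<Rightarrow> (real \<Rightarrow> real) \<Rightarrow> bool" where
  "has_weak_deriv u v \<longleftrightarrow>
     (\<forall>a b. 0 < a \<longrightarrow> u absolutely_integrable_on {a..b} \<and> v absolutely_integrable_on {a..b}) \<and>
     (\<forall>\<phi>. test_function \<phi> \<longrightarrow>
        integral {0..} (\<lambda>x. u x * deriv \<phi> x) = - integral {0..} (\<lambda>x. v x * \<phi> x))"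

(* d i is the i-th weak derivative of g. Every derivative of order < p has a continuous
   representative on [0, \<infinity>) (when the next one is integrable up to 0); d i denotes that
   representative, since the values of these functions at single points are used below. *)
definition weak_derivs :: "nat \<Rightarrow> (real \<Rightarrow> real) \<Rightarrow> (nat \<Rightarrow> real \<Rightarrow> real) \<Rightarrow> bool" where
  "weak_derivs p g d \<longleftrightarrow>
     d 0 = g \<and> (\<forall>i<p. continuous_on {0..} (d i) \<and> has_weak_deriv (d i) (d (Suc i)))"

subsection \<open>The solutions T and U\<close>

(* g0t stands for the derivative of g0. *)
definition Vmat :: "(real \<Rightarrow> real) \<Rightarrow> (real \<Rightarrow> real) \<Rightarrow> (real \<Rightarrow> real) \<Rightarrow> real \<Rightarrow> complex \<Rightarrow> cmat" where
  "Vmat g0 g0t g1 t k =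
     (- (\<i> * of_real (g1 t + g0t t) / 4)) *\<^sub>M sigma2
     + (1 / k) *\<^sub>M ((- (\<i> * of_real (sin (g0 t)) / 4)) *\<^sub>M sigma1
                - (\<i> * of_real (cos (g0 t) - 1) / 4) *\<^sub>M sigma3)"

(* Column j of the integrand depends only on column j of X. *)
definition volterra_integrand ::
    "(real \<Rightarrow> complex \<Rightarrow> cmat) \<Rightarrow> (real \<Rightarrow> complex \<Rightarrow> cmat) \<Rightarrow> real \<Rightarrow> complex \<Rightarrow> real \<Rightarrow> cmat" where
  "volterra_integrand V X t k s =
     exp_ad_sigma3 (\<i> * theta2 k * of_real (s - t)) (V s k ** X s k)"

(* The integral from \<infinity> to t is minus the integral over [t, \<infinity>). The entries of T t k
   outside the stated columnwise domain are unconstrained. *)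
definition volterra_infinity_col ::
    "(real \<Rightarrow> complex \<Rightarrow> cmat) \<Rightarrow> (real \<Rightarrow> complex \<Rightarrow> cmat) \<Rightarrow> 2 \<Rightarrow> complex \<Rightarrow> bool" where
  "volterra_infinity_col V T j k \<longleftrightarrow>
     (\<forall>t\<ge>0. (\<lambda>s. column j (volterra_integrand V T t k s)) absolutely_integrable_on {t..} \<and>
            column j (T t k) =
              column j (mat 1) - integral {t..} (\<lambda>s. column j (volterra_integrand V T t k s)))"

definition is_T :: "(real \<Rightarrow> complex \<Rightarrow> cmat) \<Rightarrow> (real \<Rightarrow> complex \<Rightarrow> cmat) \<Rightarrow> bool" where
  "is_T V T \<longleftrightarrow>
     (\<forall>k \<in> closure Dminus - {0}. volterra_infinity_col V T 1 k) \<and>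
     (\<forall>k \<in> closure Dplus - {0}. volterra_infinity_col V T 2 k)"

definition is_U :: "(real \<Rightarrow> complex \<Rightarrow> cmat) \<Rightarrow> (real \<Rightarrow> complex \<Rightarrow> cmat) \<Rightarrow> bool" where
  "is_U V U \<longleftrightarrow>
     (\<forall>k. k \<noteq> 0 \<longrightarrow> (\<forall>t\<ge>0.
        volterra_integrand V U t k absolutely_integrable_on {0..t} \<and>
        U t k = mat 1 + integral {0..t} (volterra_integrand V U t k)))"

subsection \<open>Formal solutions at k = 0\<close>

definition G0 :: "int \<Rightarrow> (real \<Rightarrow> real) \<Rightarrow> real \<Rightarrow> cmat" where
  "G0 N g0 t = ((-1) powi N) *\<^sub>M
     mat2 (of_real (cos (g0 t / 2))) (- of_real (sin (g0 t / 2)))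
          (of_real (sin (g0 t / 2))) (of_real (cos (g0 t / 2)))"

definition Vhat0 :: "(real \<Rightarrow> real) \<Rightarrow> (real \<Rightarrow> real) \<Rightarrow> real \<Rightarrow> cmat" where
  "Vhat0 g0t g1 t = (- (\<i> * of_real (g1 t - g0t t) / 4)) *\<^sub>M sigma2"

definition Vhat1 :: "(real \<Rightarrow> real) \<Rightarrow> real \<Rightarrow> cmat" where
  "Vhat1 g0 t = (\<i> * of_real (sin (g0 t)) / 4) *\<^sub>M sigma1
     - (\<i> * of_real (cos (g0 t) - 1) / 4) *\<^sub>M sigma3"

(* The coefficient with index j - 1; the coefficient with index -1 is 0. *)
definition prev :: "(nat \<Rightarrow> real \<Rightarrow> cmat) \<Rightarrow> nat \<Rightarrow> real \<Rightarrow> cmat" where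
  "prev X j = (if j = 0 then (\<lambda>t. 0) else X (j - 1))"

(* The recursion for j = 0, ..., m, which involves the coefficients up to index m + 1.
   With P = off_part, Q = diag_part these are the relations for the coefficients T_j and Z_j;
   with P and Q exchanged they are the relations for W_j. *)
definition formal_recursion ::
    "(cmat \<Rightarrow> cmat) \<Rightarrow> (cmat \<Rightarrow> cmat) \<Rightarrow> (real \<Rightarrow> cmat) \<Rightarrow> (real \<Rightarrow> cmat) \<Rightarrow> nat \<Rightarrow>
     (nat \<Rightarrow> real \<Rightarrow> cmat) \<Rightarrow> bool" where
  "formal_recursion P Q V0 V1 m X \<longleftrightarrow>
     (\<forall>j\<le>m. \<forall>t\<ge>0.
        (\<lambda>s. P (X j s)) differentiable (at t within {0..}) \<and>
        P (X (Suc j) t) = (- 2 * \<i>) *\<^sub>M (sigma3 **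
          (- vector_derivative (\<lambda>s. P (X j s)) (at t within {0..})
           - (\<i> / 2) *\<^sub>M (sigma3 ** P (prev X j t))
           + V0 t ** Q (X j t)
           + off_part (V1 t) ** Q (prev X j t)
           + diag_part (V1 t) ** P (prev X j t))) \<and>
        ((\<lambda>s. Q (X (Suc j) s)) has_vector_derivative
          (V0 t ** P (X (Suc j) t)
           + off_part (V1 t) ** P (X j t)
           + diag_part (V1 t) ** Q (X j t))) (at t within {0..}))"

definition T_coeffs ::
    "(real \<Rightarrow> cmat) \<Rightarrow> (real \<Rightarrow> cmat) \<Rightarrow> nat \<Rightarrow> (nat \<Rightarrow> real \<Rightarrow> cmat) \<Rightarrow> bool" where
  "T_coeffs V0 V1 m Th \<longleftrightarrow>
     (\<forall>t\<ge>0. Th 0 t = mat 1) \<and>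
     formal_recursion off_part diag_part V0 V1 m Th \<and>
     (\<forall>j\<in>{1..m+1}. (Th j \<longlongrightarrow> 0) at_top)"

definition U_coeffs ::
    "(real \<Rightarrow> cmat) \<Rightarrow> (real \<Rightarrow> cmat) \<Rightarrow> nat \<Rightarrow> (nat \<Rightarrow> real \<Rightarrow> cmat) \<Rightarrow> (nat \<Rightarrow> real \<Rightarrow> cmat) \<Rightarrow> bool" where
  "U_coeffs V0 V1 m Zh Wh \<longleftrightarrow>
     (\<forall>t\<ge>0. Zh 0 t = mat 1 \<and> Wh 0 t = 0) \<and>
     formal_recursion off_part diag_part V0 V1 m Zh \<and>
     formal_recursion diag_part off_part V0 V1 m Wh \<and>
     (\<forall>j\<in>{1..m+1}. Zh j 0 + Wh j 0 = 0)"

definition That_p :: "nat \<Rightarrow> (nat \<Rightarrow> real \<Rightarrow> cmat) \<Rightarrow> real \<Rightarrow> complex \<Rightarrow> cmat" where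
  "That_p m Th t k = mat 1 + (\<Sum>j=1..m+1. (k ^ j) *\<^sub>M Th j t)"

definition Uhat_p ::
    "nat \<Rightarrow> (nat \<Rightarrow> real \<Rightarrow> cmat) \<Rightarrow> (nat \<Rightarrow> real \<Rightarrow> cmat) \<Rightarrow> real \<Rightarrow> complex \<Rightarrow> cmat" where
  "Uhat_p m Zh Wh t k = mat 1 + (\<Sum>j=1..m+1. (k ^ j) *\<^sub>M Zh j t)
     + (\<Sum>j=1..m+1. (k ^ j) *\<^sub>M Wh j t) ** exp_sigma3 (2 * \<i> * theta2 k * of_real t)"

definition U_approx ::
    "int \<Rightarrow> (real \<Rightarrow> real) \<Rightarrow> nat \<Rightarrow> (nat \<Rightarrow> real \<Rightarrow> cmat) \<Rightarrow> (nat \<Rightarrow> real \<Rightarrow> cmat) \<Rightarrow>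
     real \<Rightarrow> complex \<Rightarrow> cmat" where
  "U_approx N g0 m Zh Wh t k =
     G0 N g0 t ** Uhat_p m Zh Wh t k
       ** exp_ad_sigma3 (- \<i> * theta2 k * of_real t) (matrix_inv (G0 N g0 0))"

subsection \<open>Columnwise estimates of k-derivatives up to the boundary\<close>

(* g is the j-th complex derivative of f on the open set D, continuously extended to the
   closure of D without 0. Continuity of f itself makes g = f there when j = 0. *)
definition has_ext_deriv ::
    "nat \<Rightarrow> complex set \<Rightarrow> (complex \<Rightarrow> complex^2) \<Rightarrow> (complex \<Rightarrow> complex^2) \<Rightarrow> bool" where
  "has_ext_deriv j D f g \<longleftrightarrow>
     (\<forall>i. (\<lambda>k. f k $ i) holomorphic_on D) \<and>
     continuous_on (closure D - {0}) f \<and>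
     continuous_on (closure D - {0}) g \<and>
     (\<forall>k\<in>D. \<forall>i. g k $ i = (deriv ^^ j) (\<lambda>z. f z $ i) k)"

definition col_deriv_le ::
    "nat \<Rightarrow> complex set \<Rightarrow> (complex \<Rightarrow> complex^2) \<Rightarrow> (complex \<Rightarrow> real) \<Rightarrow> bool" where
  "col_deriv_le j D f b \<longleftrightarrow>
     (\<exists>g. has_ext_deriv j D f g \<and> (\<forall>k \<in> closure D - {0}. norm (g k) \<le> b k))"

(* The estimate |d^j F / dk^j| \<le> b for nonzero k in (closure A, closure B): first column on
   the closure of A, second column on the closure of B, in the Euclidean norm of the column. *)
definition cols_deriv_le ::
    "nat \<Rightarrow> complex set \<Rightarrow> complex set \<Rightarrow> (complex \<Rightarrow> cmat) \<Rightarrow> (complex \<Rightarrow> real) \<Rightarrow> bool" where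
  "cols_deriv_le j A B F b \<longleftrightarrow>
     col_deriv_le j A (\<lambda>k. column 1 (F k)) b \<and>
     col_deriv_le j B (\<lambda>k. column 2 (F k)) b"

definition cols_bounded :: "complex set \<Rightarrow> complex set \<Rightarrow> (complex \<Rightarrow> cmat) \<Rightarrow> bool" where
  "cols_bounded A B F \<longleftrightarrow>
     bounded ((\<lambda>k. column 1 (F k)) ` (closure A - {0})) \<and>
     bounded ((\<lambda>k. column 2 (F k)) ` (closure B - {0}))"

end

theory Submission
  imports Defs "HOL-Complex_Analysis.Complex_Analysis"
begin

text \<open>
  At k = 0 the coefficient matrix of the time part has a pole, and the rotation by half the angle
  \<open>g0\<close> removes it: if X solves the original system, then \<open>G0\<inverse> X\<close> solves a system whose
  coefficients are \<open>q = g1 - g0'\<close> and k times \<open>s = sin g0\<close>, \<open>c = cos g0 - 1\<close>. The functions q, s, c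
  are integrable, so that Gronwall's inequality bounds solutions uniformly for \<open>0 < |k| \<le> 1\<close>. A column is
  written as a pair (u, w): its diagonal entry u is slow, and its off-diagonal entry w carries the phase
  \<open>h = 2 i \<epsilon> \<theta>\<^sub>2(k)\<close>, where \<open>\<epsilon> = 1\<close> for the first and \<open>\<epsilon> = -1\<close> for the second column. Both columns
  are thereby instances of one scalar system, and multiplication by \<open>exp (- h t)\<close> exchanges the roles of
  the two entries and the sign \<open>\<epsilon>\<close>.

  The recursion for the formal coefficients says that a truncated series solves the gauged system up to a
  residual of size \<open>|k|^(m+1) \<phi>(t)\<close>, where \<open>(1 + t)^n \<phi>(t)\<close> is integrable
  (\<open>truncated_solution\<close>). The difference of an exact solution and its truncation solves the
  inhomogeneous system with this residual, and is therefore \<open>O(|k|^(m+1))\<close>, forward in time for U and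
  backward in time for T.

  Derivatives in k come from Cauchy's inequality on the disc of radius \<open>|k|\<^sup>2 / (4 (1 + R))\<close> around k.
  On that disc the phase varies by at most \<open>1 / (1 + R)\<close>, because \<open>\<theta>\<^sub>2'(k)\<close> has size \<open>|k|^(-2)\<close>, so the
  exponentials over times up to R exceed those at the centre by a factor of at most e. Every
  derivative costs a factor \<open>(1 + R) |k|^(-2)\<close>. For U one takes \<open>R = t\<close> (\<open>forward_error\<close>,
  \<open>U_error\<close>).

  The columns of T are holomorphic in the interior of the domain only, and the estimate has to hold up to
  the boundary. The gain of \<open>(1 + t)^(j-n)\<close> and the continuous extension come from one device
  (\<open>backward_error\<close>): T is the limit of the solutions that agree with the truncated series at the
  times \<open>R\<^sub>i = 2^i (1 + t) - 1\<close>. These solutions are holomorphic on the punctured plane, since they are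
  combinations of solutions with initial values at time 0. Two consecutive ones differ by
  the residual on \<open>[R\<^sub>i, R\<^sub>i\<^sub>+\<^sub>1]\<close>, and the discs for \<open>R\<^sub>i\<^sub>+\<^sub>1\<close> lose at most a constant times
  \<open>(1 + R\<^sub>i)^j\<close>, which the weight \<open>(1 + t)^n\<close> of \<open>\<phi>\<close> absorbs for \<open>j \<le> n\<close>. The series of the
  differences and of their j-th derivatives converges locally uniformly away from
  0, up to the boundary, so both pass to the limit.

  Everything is done with absolutely continuous functions in integrated form (\<open>antideriv\<close>), since the
  derivatives of highest order of the boundary values are integrable only. Mollified test functions turn
  the weak derivatives into such antiderivatives (\<open>weak_deriv_imp_antideriv\<close>), and the weighted
  classes \<open>wl\<close> and \<open>bl\<close> propagate the decay through the recursion (\<open>coefficient_classes\<close>).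
\<close>

(* The dollar sign is kept for the components of vectors. *)
no_notation fps_nth (infixl \<open>$\<close> 75)

section \<open>Antiderivatives of integrable functions\<close>

text \<open>F is absolutely continuous on every compact interval of the half-line, with derivative f almost
  everywhere. All differential equations below are stated in this form.\<close>

definition antideriv :: "(real \<Rightarrow> complex) \<Rightarrow> (real \<Rightarrow> complex) \<Rightarrow> bool" where
  "antideriv F f \<longleftrightarrow>
     (\<forall>t\<ge>0. f absolutely_integrable_on {0..t} \<and> F t = F 0 + integral {0..t} f)"

lemma antideriv_at: "antideriv F f \<Longrightarrow> 0 \<le> t \<Longrightarrow> F t = F 0 + integral {0..t} f"
  unfolding antideriv_def by blast

lemma antideriv_abs_int0: "antideriv F f \<Longrightarrow> 0 \<le> t \<Longrightarrow> f absolutely_integrable_on {0..t}"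
  unfolding antideriv_def by blast

lemma abs_int_cont_mult:
  fixes f g :: "real \<Rightarrow> complex"
  assumes f: "continuous_on {a..b} f" and g: "g absolutely_integrable_on {a..b}"
  shows "(\<lambda>x. f x * g x) absolutely_integrable_on {a..b}"
proof (rule absolutely_integrable_bounded_measurable_product[where h = "(*)"])
  show "bilinear ((*) :: complex \<Rightarrow> complex \<Rightarrow> complex)"
    by (simp add: bilinear_conv_bounded_bilinear bounded_bilinear_mult)
  show "f \<in> borel_measurable (lebesgue_on {a..b})"
    by (rule continuous_imp_measurable_on_sets_lebesgue[OF f]) simp
  show "bounded (f ` {a..b})"
    by (intro compact_imp_bounded compact_continuous_image[OF f]) simp
  show "{a..b} \<in> sets lebesgue" by simp
qed (rule g)

lemma abs_int_bounded_mult: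
  fixes f g :: "real \<Rightarrow> complex"
  assumes f: "continuous_on {0..} f" "\<And>t. t \<ge> 0 \<Longrightarrow> norm (f t) \<le> B"
    and g: "g absolutely_integrable_on {0..}"
  shows "(\<lambda>x. f x * g x) absolutely_integrable_on {0..}"
proof (rule absolutely_integrable_bounded_measurable_product[where h = "(*)"])
  show "bilinear ((*) :: complex \<Rightarrow> complex \<Rightarrow> complex)"
    by (simp add: bilinear_conv_bounded_bilinear bounded_bilinear_mult)
  show "f \<in> borel_measurable (lebesgue_on {0..})"
    by (rule continuous_imp_measurable_on_sets_lebesgue[OF f(1)]) simp
  show "bounded (f ` {0..})"
    using f(2) by (auto simp: bounded_iff)
  show "{0..} \<in> sets (lebesgue :: real measure)" by simp
qed (rule g)

lemma antideriv_abs_int: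
  assumes "antideriv F f" "0 \<le> a"
  shows "f absolutely_integrable_on {a..b}"
proof -
  have "0 \<le> max a b" using assms(2) by simp
  then have "f absolutely_integrable_on {0..max a b}"
    by (rule antideriv_abs_int0[OF assms(1)])
  then show ?thesis
    by (rule absolutely_integrable_on_subinterval) (use assms(2) in simp)
qed

lemma antideriv_int:
  assumes "antideriv F f" "0 \<le> a"
  shows "f integrable_on {a..b}"
  using antideriv_abs_int[OF assms] by (rule set_lebesgue_integral_eq_integral(1))

lemma antideriv_diff_eq:
  assumes "antideriv F f" "0 \<le> a" "a \<le> b"
  shows "F b - F a = integral {a..b} f"
proof -
  have "F b = F 0 + integral {0..b} f" "F a = F 0 + integral {0..a} f"
    using assms by (auto intro!: antideriv_at)
  moreover have "integral {0..a} f + integral {a..b} f = integral {0..b} f"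
    using assms by (intro Henstock_Kurzweil_Integration.integral_combine antideriv_int) auto
  ultimately show ?thesis by (simp add: algebra_simps)
qed

lemma antideriv_cong:
  assumes "antideriv F f" "\<And>t. t \<ge> 0 \<Longrightarrow> F t = G t" "\<And>t. t \<ge> 0 \<Longrightarrow> f t = g t"
  shows "antideriv G g"
  unfolding antideriv_def
proof safe
  fix t :: real assume t: "0 \<le> t"
  have "f absolutely_integrable_on {0..t}" by (rule antideriv_abs_int0[OF assms(1) t])
  then show "g absolutely_integrable_on {0..t}"
    by (rule absolutely_integrable_spike[where S = "{}"]) (auto simp: assms)
  have "integral {0..t} f = integral {0..t} g" by (rule integral_cong) (auto simp: assms)
  then show "G t = G 0 + integral {0..t} g"
    using antideriv_at[OF assms(1) t] assms(2)[OF t] assms(2)[of 0] by simp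
qed

lemma antideriv_add:
  assumes "antideriv F f" "antideriv G g"
  shows "antideriv (\<lambda>t. F t + G t) (\<lambda>t. f t + g t)"
  unfolding antideriv_def
proof safe
  fix t :: real assume t: "0 \<le> t"
  have "f absolutely_integrable_on {0..t}" "g absolutely_integrable_on {0..t}"
    using assms t by (auto intro: antideriv_abs_int0)
  then show "(\<lambda>t. f t + g t) absolutely_integrable_on {0..t}" by (rule set_integral_add(1))
  have "integral {0..t} (\<lambda>t. f t + g t) = integral {0..t} f + integral {0..t} g"
    using assms by (intro integral_add antideriv_int) auto
  moreover have "F t = F 0 + integral {0..t} f" "G t = G 0 + integral {0..t} g"
    using assms t by (auto intro!: antideriv_at)
  ultimately show "F t + G t = F 0 + G 0 + integral {0..t} (\<lambda>t. f t + g t)" by simp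
qed

lemma antideriv_const: "antideriv (\<lambda>t. c) (\<lambda>t. 0)"
  by (auto simp: antideriv_def)

lemma antideriv_deriv:
  assumes "antideriv F f" "continuous_on {0..} f" "t \<ge> 0"
  shows "(F has_vector_derivative f t) (at t within {0..})"
proof -
  have "continuous_on {0..t+1} f" by (rule continuous_on_subset[OF assms(2)]) auto
  then have "((\<lambda>u. integral {0..u} f) has_vector_derivative f t) (at t within {0..t+1})"
    using assms by (intro integral_has_vector_derivative) auto
  then have "((\<lambda>u. F 0 + integral {0..u} f) has_vector_derivative f t) (at t within {0..t+1})"
    by (auto intro!: derivative_eq_intros)
  then have "(F has_vector_derivative f t) (at t within {0..t+1})"
    by (rule has_vector_derivative_transform[rotated 2]) (use assms in \<open>auto intro!: antideriv_at\<close>)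
  moreover have "at t within {0..t+1} = at t within {0..}"
  proof (rule at_within_nhd[where S = "{..<t+1}"])
    show "{0..t+1} \<inter> {..<t+1} - {t} = {0..} \<inter> {..<t+1} - {t}" by auto
  qed auto
  ultimately show ?thesis by simp
qed

lemma antideriv_of_deriv:
  assumes "continuous_on {0..} f"
    and "\<And>t. t \<ge> 0 \<Longrightarrow> (F has_vector_derivative f t) (at t within {0..})"
  shows "antideriv F f"
  unfolding antideriv_def
proof safe
  fix t :: real assume t: "0 \<le> t"
  show "f absolutely_integrable_on {0..t}"
    by (rule absolutely_integrable_continuous_real, rule continuous_on_subset[OF assms(1)]) auto
  have "(f has_integral (F t - F 0)) {0..t}"
    using t by (intro fundamental_theorem_of_calculus)
      (auto intro!: has_vector_derivative_within_subset[OF assms(2)])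
  then show "F t = F 0 + integral {0..t} f" by (simp add: integral_unique)
qed

lemma antideriv_continuous:
  assumes "antideriv F f" shows "continuous_on {0..} F"
proof -
  have "continuous (at x within {0..}) F" if "x \<ge> 0" for x
  proof -
    have "continuous_on {0..x+1} (\<lambda>t. F 0 + integral {0..t} f)"
      by (intro continuous_intros indefinite_integral_continuous_1 antideriv_int[OF assms]) auto
    then have "continuous_on {0..x+1} F"
      by (rule continuous_on_eq) (use assms in \<open>auto intro!: antideriv_at[symmetric]\<close>)
    then have "continuous (at x within {0..x+1}) F"
      using that by (auto simp: continuous_on_eq_continuous_within)
    moreover have "at x within {0..x+1} = at x within {0..}"
    proof (rule at_within_nhd[where S = "{..<x+1}"])
      show "{0..x+1} \<inter> {..<x+1} - {x} = {0..} \<inter> {..<x+1} - {x}" by auto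
    qed auto
    ultimately show ?thesis by simp
  qed
  then show ?thesis by (auto simp: continuous_on_eq_continuous_within)
qed

text \<open>One factor is continuously differentiable, which is enough for the products with exponentials and with
  the entries of the gauge matrix.\<close>

lemma antideriv_mult:
  assumes F: "antideriv F f" and f: "continuous_on {0..} f" and G: "antideriv G g"
  shows "antideriv (\<lambda>t. F t * G t) (\<lambda>t. f t * G t + F t * g t)"
proof -
  let ?p = "\<lambda>t. f t * G t + F t * g t"
  have cF: "continuous_on {0..} F" and cG: "continuous_on {0..} G"
    using antideriv_continuous F G by auto
  have ai: "?p absolutely_integrable_on {a..b}" if "0 \<le> a" for a b
  proof (rule set_integral_add(1))
    show "(\<lambda>t. f t * G t) absolutely_integrable_on {a..b}"
      using that by (intro absolutely_integrable_continuous_real continuous_intros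
          continuous_on_subset[OF f] continuous_on_subset[OF cG]) auto
    show "(\<lambda>t. F t * g t) absolutely_integrable_on {a..b}"
      using that by (intro abs_int_cont_mult continuous_on_subset[OF cF] antideriv_abs_int[OF G]) auto
  qed
  define N where "N t = integral {0..t} (\<lambda>s. norm (g s))" for t
  define P where "P t = F t * G t - integral {0..t} ?p" for t
  have gi: "(\<lambda>s. norm (g s)) integrable_on {a..b}" if "0 \<le> a" for a b
    using antideriv_abs_int[OF G that, of b] by (simp add: absolutely_integrable_on_def)
  have Nd: "N b - N a = integral {a..b} (\<lambda>s. norm (g s))" if "0 \<le> a" "a \<le> b" for a b
    using Henstock_Kurzweil_Integration.integral_combine[of 0 a b "\<lambda>s. norm (g s)"] that gi by (auto simp: N_def)
  have Nc: "continuous_on {0..T} N" for T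
    unfolding N_def by (intro indefinite_integral_continuous_1 gi) auto
  have P0: "P T = P 0" if T: "0 \<le> T" for T
  proof -
    obtain B where B: "\<And>t. t \<in> {0..T} \<Longrightarrow> norm (f t) \<le> B" "B > 0"
    proof -
      have "compact (f ` {0..T})"
        by (intro compact_continuous_image continuous_on_subset[OF f]) auto
      then have "bounded (f ` {0..T})" by (rule compact_imp_bounded)
      then obtain b where "b > 0" "\<forall>x\<in>{0..T}. cmod (f x) \<le> b" by (auto simp: bounded_pos)
      then show ?thesis using that[of b] by auto
    qed
    have FB: "norm (F b - F s) \<le> B * (b - a)" if "0 \<le> a" "a \<le> s" "s \<le> b" "b \<le> T" for a b s
    proof -
      have "F b - F s = integral {s..b} f" using antideriv_diff_eq[OF F] that by auto
      also have "norm \<dots> \<le> B * (b - s)"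
        using that by (intro integral_bound continuous_on_subset[OF f] B(1)) auto
      also have "\<dots> \<le> B * (b - a)" using that B(2) by (intro mult_left_mono) auto
      finally show ?thesis .
    qed
    have GB: "norm (G s - G a) \<le> N b - N a" if "0 \<le> a" "a \<le> s" "s \<le> b" for a b s
    proof -
      have "G s - G a = integral {a..s} g" using antideriv_diff_eq[OF G] that by auto
      also have "norm \<dots> \<le> integral {a..s} (\<lambda>s. norm (g s))"
        using that by (intro integral_norm_bound_integral gi antideriv_int[OF G]) auto
      also have "\<dots> \<le> integral {a..b} (\<lambda>s. norm (g s))"
        using that by (intro integral_subset_le gi) auto
      finally show ?thesis using Nd[of a b] that by auto
    qed
    have step: "norm (P b - P a) \<le> 2 * B * (b - a) * (N b - N a)" if ab: "0 \<le> a" "a \<le> b" "b \<le> T" for a b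
    proof -
      have i1: "(\<lambda>s. F b * g s) integrable_on {a..b}" "(\<lambda>s. f s * G a) integrable_on {a..b}"
        using antideriv_int[OF G ab(1), of b] antideriv_int[OF F ab(1), of b]
        by (auto intro: integrable_on_mult_right integrable_on_mult_left)
      have pi: "?p integrable_on {a..b}" by (rule set_lebesgue_integral_eq_integral(1)[OF ai[OF ab(1)]])
      have "integral {0..b} ?p = integral {0..a} ?p + integral {a..b} ?p"
        using ab by (intro Henstock_Kurzweil_Integration.integral_combine[symmetric] set_lebesgue_integral_eq_integral(1)[OF ai]) auto
      then have "P b - P a = F b * (G b - G a) + (F b - F a) * G a - integral {a..b} ?p"
        by (simp add: P_def algebra_simps)
      also have "\<dots> = integral {a..b} (\<lambda>s. F b * g s) + integral {a..b} (\<lambda>s. f s * G a) - integral {a..b} ?p"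
        using antideriv_diff_eq[OF G] antideriv_diff_eq[OF F] ab by simp
      also have "\<dots> = integral {a..b} (\<lambda>s. F b * g s + f s * G a - ?p s)"
        using i1 pi by (simp add: integral_diff integral_add integrable_add)
      also have "norm \<dots> \<le> integral {a..b} (\<lambda>s. B * (b - a) * norm (g s) + B * (N b - N a))"
      proof (rule integral_norm_bound_integral)
        show "(\<lambda>s. F b * g s + f s * G a - ?p s) integrable_on {a..b}"
          by (intro integrable_diff integrable_add i1 pi)
        show "(\<lambda>s. B * (b - a) * norm (g s) + B * (N b - N a)) integrable_on {a..b}"
          by (intro integrable_add integrable_on_mult_right gi ab) auto
        fix s assume s: "s \<in> {a..b}"
        have "F b * g s + f s * G a - ?p s = (F b - F s) * g s - f s * (G s - G a)"
          by (simp add: algebra_simps)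
        also have "norm \<dots> \<le> norm (F b - F s) * norm (g s) + norm (f s) * norm (G s - G a)"
          by (metis norm_mult norm_triangle_ineq4)
        also have "\<dots> \<le> B * (b - a) * norm (g s) + B * (N b - N a)"
          using s ab B by (intro add_mono mult_mono FB GB) auto
        finally show "norm (F b * g s + f s * G a - ?p s) \<le> B * (b - a) * norm (g s) + B * (N b - N a)" .
      qed
      also have "\<dots> = B * (b - a) * (N b - N a) + B * (N b - N a) * (b - a)"
        using ab gi[OF ab(1), of b] Nd[of a b] by (subst integral_add) (auto intro: integrable_on_mult_right)
      finally show ?thesis by (simp add: algebra_simps)
    qed
    have "(P has_vector_derivative 0) (at x within {0..T})" if x: "x \<in> {0..T}" for x
    proof -
      have "((\<lambda>y. 2 * B * \<bar>N y - N x\<bar>) \<longlongrightarrow> 2 * B * \<bar>N x - N x\<bar>) (at x within {0..T})"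
        using Nc[of T] x by (intro tendsto_intros) (auto simp: continuous_on_def)
      then have lim: "((\<lambda>y. 2 * B * \<bar>N y - N x\<bar>) \<longlongrightarrow> 0) (at x within {0..T})" by simp
      have bd: "norm (P y - P x) / norm (y - x) \<le> 2 * B * \<bar>N y - N x\<bar>" if "y \<in> {0..T}" "y \<noteq> x" for y
      proof (cases "x \<le> y")
        case True
        have "norm (P y - P x) \<le> 2 * B * (y - x) * (N y - N x)" using step True x that by auto
        also have "\<dots> \<le> 2 * B * (y - x) * \<bar>N y - N x\<bar>" using B(2) True by (intro mult_left_mono) auto
        finally show ?thesis using True that by (auto simp: field_simps)
      next
        case False
        have "norm (P x - P y) \<le> 2 * B * (x - y) * (N x - N y)" using step False x that by auto
        also have "\<dots> \<le> 2 * B * (x - y) * \<bar>N y - N x\<bar>" using B(2) False by (intro mult_left_mono) auto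
        finally show ?thesis using False that by (auto simp: field_simps norm_minus_commute)
      qed
      have "((\<lambda>y. norm (P y - P x) / norm (y - x)) \<longlongrightarrow> 0) (at x within {0..T})"
      proof (rule tendsto_sandwich[OF _ _ tendsto_const lim])
        show "\<forall>\<^sub>F y in at x within {0..T}. norm (P y - P x) / norm (y - x) \<le> 2 * B * \<bar>N y - N x\<bar>"
          using bd by (auto simp: eventually_at_filter)
      qed auto
      then have "((\<lambda>y. (1 / norm (y - x)) *\<^sub>R (P y - P x)) \<longlongrightarrow> 0) (at x within {0..T})"
        by (rule_tac tendsto_norm_zero_cancel) simp
      then show ?thesis
        unfolding has_vector_derivative_def has_derivative_within
        by (simp add: divide_inverse)
    qed
    then obtain c where "\<And>x. x \<in> {0..T} \<Longrightarrow> P x = c"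
      using has_vector_derivative_zero_constant[of "{0..T}" P] by auto
    then show ?thesis using T by auto
  qed
  have "F t * G t = F 0 * G 0 + integral {0..t} ?p" if "0 \<le> t" for t
  proof -
    have "P t = P 0" by (rule P0[OF that])
    then show ?thesis by (simp add: P_def algebra_simps)
  qed
  then show ?thesis unfolding antideriv_def using ai by blast
qed

lemma antideriv_cmult:
  assumes "antideriv G g"
  shows "antideriv (\<lambda>t. c * G t) (\<lambda>t. c * g t)"
  using antideriv_mult[OF antideriv_const[of c] _ assms] by simp

lemma antideriv_diff:
  assumes "antideriv F f" "antideriv G g"
  shows "antideriv (\<lambda>t. F t - G t) (\<lambda>t. f t - g t)"
  using antideriv_add[OF assms(1) antideriv_cmult[OF assms(2), of "-1"]] by simp

lemma antideriv_exp: "antideriv (\<lambda>t. exp (c * of_real t)) (\<lambda>t. c * exp (c * of_real t))"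
proof (rule antideriv_of_deriv)
  show "continuous_on {0..} (\<lambda>t. c * exp (c * of_real t))" by (intro continuous_intros)
  fix t :: real assume "t \<ge> 0"
  have "((\<lambda>t. exp (c * of_real t)) has_vector_derivative c * exp (c * of_real t)) (at t)"
    by (rule has_vector_derivative_real_field) (auto intro!: derivative_eq_intros)
  then show "((\<lambda>t. exp (c * of_real t)) has_vector_derivative c * exp (c * of_real t)) (at t within {0..})"
    by (rule has_vector_derivative_at_within)
qed

lemma antideriv_exp_mult:
  assumes "antideriv G g"
  shows "antideriv (\<lambda>t. exp (c * of_real t) * G t) (\<lambda>t. exp (c * of_real t) * (c * G t + g t))"
  by (rule antideriv_cong[OF antideriv_mult[OF antideriv_exp[of c] _ assms]])
    (auto intro!: continuous_intros simp: algebra_simps)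

text \<open>The product of w with the exponential \<open>exp (- h t)\<close> has the derivative \<open>exp (- h t) g(t)\<close>.\<close>

lemma antideriv_variation:
  assumes w: "antideriv w (\<lambda>t. h * w t + g t)" and ab: "0 \<le> a" "a \<le> b"
  shows "w b = exp (h * of_real (b - a)) * w a + integral {a..b} (\<lambda>s. exp (h * of_real (b - s)) * g s)"
    and "(\<lambda>s. exp (h * of_real (b - s)) * g s) absolutely_integrable_on {a..b}"
proof -
  have 1: "antideriv (\<lambda>t. exp (- h * of_real t) * w t) (\<lambda>t. exp (- h * of_real t) * g t)"
    using antideriv_exp_mult[OF w, of "- h"] by simp
  have eq: "(\<lambda>s. exp (h * of_real (b - s)) * g s) = (\<lambda>s. exp (h * of_real b) * (exp (- h * of_real s) * g s))"
    by (auto simp: fun_eq_iff exp_diff exp_minus field_simps)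
  show "(\<lambda>s. exp (h * of_real (b - s)) * g s) absolutely_integrable_on {a..b}"
    unfolding eq using antideriv_abs_int[OF antideriv_cmult[OF 1] ab(1)] .
  have "exp (- h * of_real b) * w b = exp (- h * of_real a) * w a + integral {a..b} (\<lambda>s. exp (- h * of_real s) * g s)"
    using antideriv_diff_eq[OF 1 ab] by (simp add: algebra_simps)
  then have "exp (h * of_real b) * (exp (- h * of_real b) * w b) =
     exp (h * of_real b) * (exp (- h * of_real a) * w a) + exp (h * of_real b) * integral {a..b} (\<lambda>s. exp (- h * of_real s) * g s)"
    by (simp only: distrib_left)
  moreover have "exp (h * of_real b) * exp (- h * of_real b) = 1"
    by (simp flip: exp_add)
  then have "exp (h * of_real b) * (exp (- h * of_real b) * w b) = w b"
    by (simp flip: mult.assoc)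
  moreover have "exp (h * of_real b) * exp (- h * of_real a) = exp (h * of_real (b - a))"
    by (simp add: algebra_simps flip: exp_add)
  then have "exp (h * of_real b) * (exp (- h * of_real a) * w a) = exp (h * of_real (b - a)) * w a"
    by (simp only: mult.assoc[symmetric])
  ultimately show "w b = exp (h * of_real (b - a)) * w a + integral {a..b} (\<lambda>s. exp (h * of_real (b - s)) * g s)"
    unfolding eq by (simp only: integral_mult_right)
qed

section \<open>Gronwall inequalities\<close>

text \<open>Only an integrated inequality is assumed, so y need not be differentiable; the product of the right-hand
  side with the exponential of minus the integral of v is nonincreasing.\<close>

lemma gronwall_forward:
  fixes y v :: "real \<Rightarrow> real"
  assumes ab: "a \<le> b" and y: "continuous_on {a..b} y" and v: "continuous_on {a..b} v"
    and v0: "\<And>t. t \<in> {a..b} \<Longrightarrow> 0 \<le> v t"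
    and le: "\<And>t. t \<in> {a..b} \<Longrightarrow> y t \<le> c + integral {a..t} (\<lambda>s. v s * y s)"
  shows "y b \<le> c * exp (integral {a..b} v)"
proof -
  define I where "I t = integral {a..t} (\<lambda>s. v s * y s)" for t
  define K where "K t = integral {a..t} v" for t
  have cI: "continuous_on {a..b} I" and cK: "continuous_on {a..b} K"
    unfolding I_def K_def using y v
    by (auto intro!: indefinite_integral_continuous_1 integrable_continuous_real continuous_intros)
  have "(c + I b) * exp (- K b) \<le> (c + I a) * exp (- K a)"
  proof (rule DERIV_nonpos_imp_decreasing_open[OF ab])
    show "continuous_on {a..b} (\<lambda>t. (c + I t) * exp (- K t))"
      by (intro continuous_intros cI cK)
    fix x assume x: "a < x" "x < b"
    have nh: "at x within {a..b} = at x" using x by (simp add: at_within_Icc_at)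
    have dI: "(I has_real_derivative v x * y x) (at x)"
      using integral_has_real_derivative[of a b "\<lambda>s. v s * y s" x] x y v nh
      unfolding I_def by (auto intro!: continuous_intros)
    have dK: "(K has_real_derivative v x) (at x)"
      using integral_has_real_derivative[of a b v x] x v nh unfolding K_def by auto
    have "((\<lambda>t. (c + I t) * exp (- K t)) has_real_derivative
        (v x * y x - v x * (c + I x)) * exp (- K x)) (at x)"
      by (auto intro!: derivative_eq_intros dI dK simp: algebra_simps)
    moreover have "v x * y x \<le> v x * (c + I x)"
      using le[of x] v0[of x] x by (auto simp: I_def intro!: mult_left_mono)
    then have "(v x * y x - v x * (c + I x)) * exp (- K x) \<le> 0"
      by (intro mult_nonpos_nonneg) auto
    ultimately show "\<exists>z. ((\<lambda>t. (c + I t) * exp (- K t)) has_real_derivative z) (at x) \<and> z \<le> 0" by blast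
  qed
  then have "(c + I b) * exp (- K b) \<le> c" by (simp add: I_def K_def)
  then have "(c + I b) * exp (- K b) * exp (K b) \<le> c * exp (K b)"
    by (intro mult_right_mono) auto
  then have "c + I b \<le> c * exp (K b)" by (simp add: mult.assoc flip: exp_add)
  then show ?thesis using le[of b] ab by (auto simp: I_def K_def)
qed

lemma gronwall_backward:
  fixes y v :: "real \<Rightarrow> real"
  assumes ab: "a \<le> b" and y: "continuous_on {a..b} y" and v: "continuous_on {a..b} v"
    and v0: "\<And>t. t \<in> {a..b} \<Longrightarrow> 0 \<le> v t"
    and le: "\<And>t. t \<in> {a..b} \<Longrightarrow> y t \<le> c + integral {t..b} (\<lambda>s. v s * y s)"
  shows "y a \<le> c * exp (integral {a..b} v)"
proof -
  have cm: "continuous_on {-b..-a} (\<lambda>t. f (- t))" if "continuous_on {a..b} f" for f :: "real \<Rightarrow> real"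
    by (rule continuous_on_compose2[OF that]) (auto intro!: continuous_intros)
  have "y (- (- a)) \<le> c * exp (integral {- b..- a} (\<lambda>t. v (- t)))"
  proof (rule gronwall_forward[where y = "\<lambda>t. y (- t)"])
    fix t assume t: "t \<in> {- b..- a}"
    have "integral {- b..t} (\<lambda>s. v (- s) * y (- s)) = integral {- t..b} (\<lambda>s. v s * y s)"
      using Henstock_Kurzweil_Integration.integral_reflect_real[of b "- t" "\<lambda>s. v s * y s"] by simp
    then show "y (- t) \<le> c + integral {- b..t} (\<lambda>s. v (- s) * y (- s))"
      using le[of "- t"] t by auto
  qed (use ab v0 cm y v in auto)
  then show ?thesis using Henstock_Kurzweil_Integration.integral_reflect_real[of b a v] by simp
qed

section \<open>Systems with a slow and a fast component\<close>

lemma antideriv_variation_backward: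
  assumes w: "antideriv w (\<lambda>t. h * w t + g t)" and ab: "0 \<le> a" "a \<le> b"
  shows "w a = exp (h * of_real (a - b)) * w b - integral {a..b} (\<lambda>s. exp (h * of_real (a - s)) * g s)"
    and "(\<lambda>s. exp (h * of_real (a - s)) * g s) absolutely_integrable_on {a..b}"
proof -
  let ?E = "exp (h * of_real (a - b))"
  note v = antideriv_variation[OF assms]
  have eq: "(\<lambda>s. exp (h * of_real (a - s)) * g s) = (\<lambda>s. ?E * (exp (h * of_real (b - s)) * g s))"
    by (simp add: algebra_simps fun_eq_iff flip: exp_add)
  show "(\<lambda>s. exp (h * of_real (a - s)) * g s) absolutely_integrable_on {a..b}"
    unfolding eq by (intro abs_int_cont_mult v(2) continuous_intros)
  have 1: "?E * exp (h * of_real (b - a)) = 1"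
    by (simp add: algebra_simps flip: exp_add)
  have "?E * w b = ?E * exp (h * of_real (b - a)) * w a + ?E * integral {a..b} (\<lambda>s. exp (h * of_real (b - s)) * g s)"
    by (subst v(1)) (simp only: distrib_left mult.assoc)
  also have "?E * integral {a..b} (\<lambda>s. exp (h * of_real (b - s)) * g s) = integral {a..b} (\<lambda>s. exp (h * of_real (a - s)) * g s)"
    unfolding eq by (simp only: Henstock_Kurzweil_Integration.integral_mult_right)
  finally show "w a = ?E * w b - integral {a..b} (\<lambda>s. exp (h * of_real (a - s)) * g s)"
    unfolding 1 by simp
qed

text \<open>The slow component u has no phase and the fast component w has the phase h. A column of a solution of the
  matrix equation is such a pair, with its diagonal entry as u.\<close>

definition colsys where
  "colsys h a b c d f g u w \<longleftrightarrow>
     antideriv u (\<lambda>t. a t * u t + b t * w t + f t) \<and>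
     antideriv w (\<lambda>t. h * w t + (c t * u t + d t * w t + g t))"

lemma colsys_cong:
  assumes "colsys h a b c d f g u w"
    and "\<And>t. t \<ge> 0 \<Longrightarrow> a t = a' t" "\<And>t. t \<ge> 0 \<Longrightarrow> b t = b' t"
    and "\<And>t. t \<ge> 0 \<Longrightarrow> c t = c' t" "\<And>t. t \<ge> 0 \<Longrightarrow> d t = d' t"
    and "\<And>t. t \<ge> 0 \<Longrightarrow> f t = f' t" "\<And>t. t \<ge> 0 \<Longrightarrow> g t = g' t"
    and "\<And>t. t \<ge> 0 \<Longrightarrow> u t = u' t" "\<And>t. t \<ge> 0 \<Longrightarrow> w t = w' t"
  shows "colsys h a' b' c' d' f' g' u' w'"
proof -
  have "antideriv u (\<lambda>t. a t * u t + b t * w t + f t)" "antideriv w (\<lambda>t. h * w t + (c t * u t + d t * w t + g t))"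
    using assms(1) by (auto simp: colsys_def)
  from this(1)[THEN antideriv_cong, of u'] this(2)[THEN antideriv_cong, of w'] show ?thesis
    unfolding colsys_def by (simp add: assms(2-))
qed

lemma colsys_lincomb:
  assumes "colsys h a b c d f1 g1 u1 w1" "colsys h a b c d f2 g2 u2 w2"
  shows "colsys h a b c d (\<lambda>t. x * f1 t + y * f2 t) (\<lambda>t. x * g1 t + y * g2 t)
           (\<lambda>t. x * u1 t + y * u2 t) (\<lambda>t. x * w1 t + y * w2 t)"
proof -
  have "antideriv (\<lambda>t. x * u1 t + y * u2 t) (\<lambda>t. x * (a t * u1 t + b t * w1 t + f1 t) + y * (a t * u2 t + b t * w2 t + f2 t))"
    "antideriv (\<lambda>t. x * w1 t + y * w2 t) (\<lambda>t. x * (h * w1 t + (c t * u1 t + d t * w1 t + g1 t)) + y * (h * w2 t + (c t * u2 t + d t * w2 t + g2 t)))"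
    using assms by (auto simp: colsys_def intro!: antideriv_add antideriv_cmult)
  then show ?thesis
    unfolding colsys_def by (auto elim!: antideriv_cong simp: algebra_simps)
qed

lemma colsys_absorb:
  "colsys h a b c d f g u w \<Longrightarrow> colsys 0 a b c (\<lambda>t. h + d t) f g u w"
  unfolding colsys_def by (auto elim!: antideriv_cong simp: algebra_simps)

text \<open>After multiplication by \<open>exp (- h t)\<close> the fast component has lost its phase and the slow one has acquired
  the phase \<open>- h\<close>. This is what turns estimates for one half of the plane into estimates for the other.\<close>

lemma colsys_swap:
  assumes "colsys h a b c d f g u w"
  shows "colsys (- h) d c b a (\<lambda>t. exp (- h * of_real t) * g t) (\<lambda>t. exp (- h * of_real t) * f t)
           (\<lambda>t. exp (- h * of_real t) * w t) (\<lambda>t. exp (- h * of_real t) * u t)"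
proof -
  have u: "antideriv u (\<lambda>t. a t * u t + b t * w t + f t)"
    and w: "antideriv w (\<lambda>t. h * w t + (c t * u t + d t * w t + g t))"
    using assms by (auto simp: colsys_def)
  show ?thesis unfolding colsys_def
    by (intro conjI antideriv_cong[OF antideriv_exp_mult[OF u, of "- h"]]
        antideriv_cong[OF antideriv_exp_mult[OF w, of "- h"]]) (auto simp: algebra_simps)
qed

text \<open>The function v bounds the column sums of the coefficient matrix, so that the sum of the norms of the
  two components obeys a scalar Gronwall inequality.\<close>

locale column_bounds =
  fixes h :: complex and a b c d f g u w :: "real \<Rightarrow> complex" and v \<phi> :: "real \<Rightarrow> real"
  assumes sys: "colsys h a b c d f g u w"
    and ca: "continuous_on {0..} a" and cb: "continuous_on {0..} b"
    and cc: "continuous_on {0..} c" and cd: "continuous_on {0..} d"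
    and cv: "continuous_on {0..} v"
    and v1: "\<And>t. t \<ge> 0 \<Longrightarrow> norm (a t) + norm (c t) \<le> v t"
    and v2: "\<And>t. t \<ge> 0 \<Longrightarrow> norm (b t) + norm (d t) \<le> v t"
    and fg: "\<And>t. t \<ge> 0 \<Longrightarrow> norm (f t) + norm (g t) \<le> \<phi> t"
begin

lemma cu: "continuous_on {0..} u" and cw: "continuous_on {0..} w"
  using sys antideriv_continuous by (auto simp: colsys_def)

lemma au: "antideriv u (\<lambda>t. a t * u t + b t * w t + f t)"
  and aw: "antideriv w (\<lambda>t. h * w t + (c t * u t + d t * w t + g t))"
  using sys by (auto simp: colsys_def)

definition Y where "Y t = norm (u t) + norm (w t)"

lemma cY: "continuous_on {0..} Y"
  unfolding Y_def by (intro continuous_intros cu cw)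

lemma v_nonneg: "t \<ge> 0 \<Longrightarrow> v t \<ge> 0"
  using v1[of t] by (smt (verit) norm_ge_zero)

lemma norm_sum_le:
  assumes "t \<ge> 0"
  shows "norm (a t * u t + b t * w t + f t) + norm (c t * u t + d t * w t + g t) \<le> v t * Y t + \<phi> t"
proof -
  have "norm (a t * u t + b t * w t + f t) \<le> norm (a t) * norm (u t) + norm (b t) * norm (w t) + norm (f t)"
    by (metis add_mono_thms_linordered_semiring(1) norm_mult norm_triangle_le order_refl norm_triangle_ineq)
  moreover have "norm (c t * u t + d t * w t + g t) \<le> norm (c t) * norm (u t) + norm (d t) * norm (w t) + norm (g t)"
    by (metis add_mono_thms_linordered_semiring(1) norm_mult norm_triangle_le order_refl norm_triangle_ineq)
  moreover have "(norm (a t) + norm (c t)) * norm (u t) \<le> v t * norm (u t)"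
    "(norm (b t) + norm (d t)) * norm (w t) \<le> v t * norm (w t)"
    using v1 v2 assms by (auto intro!: mult_right_mono)
  ultimately show ?thesis using fg[OF assms] unfolding Y_def by (simp add: algebra_simps)
qed

lemma iv: "0 \<le> x \<Longrightarrow> (\<lambda>s. v s * Y s) integrable_on {x..y}"
  by (intro integrable_continuous_real continuous_intros continuous_on_subset[OF cv] continuous_on_subset[OF cY]) auto

lemma ai_slow: "0 \<le> x \<Longrightarrow> (\<lambda>t. a t * u t + b t * w t + f t) absolutely_integrable_on {x..y}"
  using antideriv_abs_int[OF au] by simp

lemma ai_fast: assumes "0 \<le> x" shows "(\<lambda>t. c t * u t + d t * w t + g t) absolutely_integrable_on {x..y}"
proof -
  have "(\<lambda>t. h * w t + (c t * u t + d t * w t + g t)) absolutely_integrable_on {x..y}"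
    using antideriv_abs_int[OF aw assms] .
  moreover have "(\<lambda>t. h * w t) absolutely_integrable_on {x..y}"
    using assms by (intro absolutely_integrable_continuous_real continuous_intros continuous_on_subset[OF cw]) auto
  ultimately have "(\<lambda>t. (h * w t + (c t * u t + d t * w t + g t)) - h * w t) absolutely_integrable_on {x..y}"
    by (rule set_integral_diff(1))
  then show ?thesis by simp
qed

lemma integral_sum_le:
  assumes "0 \<le> x" "x \<le> y" "\<phi> integrable_on {x..y}"
  shows "integral {x..y} (\<lambda>t. norm (a t * u t + b t * w t + f t)) +
    integral {x..y} (\<lambda>t. norm (c t * u t + d t * w t + g t)) \<le> integral {x..y} (\<lambda>s. v s * Y s) + integral {x..y} \<phi>"
proof -
  have 1: "(\<lambda>t. norm (a t * u t + b t * w t + f t)) integrable_on {x..y}" "(\<lambda>t. norm (c t * u t + d t * w t + g t)) integrable_on {x..y}"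
    using ai_slow[OF assms(1), of y] ai_fast[OF assms(1), of y] unfolding absolutely_integrable_on_def by auto
  then have "integral {x..y} (\<lambda>t. norm (a t * u t + b t * w t + f t)) +
    integral {x..y} (\<lambda>t. norm (c t * u t + d t * w t + g t)) =
    integral {x..y} (\<lambda>t. norm (a t * u t + b t * w t + f t) + norm (c t * u t + d t * w t + g t))"
    by (simp add: Henstock_Kurzweil_Integration.integral_add)
  also have "\<dots> \<le> integral {x..y} (\<lambda>s. v s * Y s + \<phi> s)"
    using 1 assms iv[OF assms(1)] norm_sum_le
    by (intro integral_le integrable_add) auto
  also have "\<dots> = integral {x..y} (\<lambda>s. v s * Y s) + integral {x..y} \<phi>"
    using assms iv[OF assms(1)] by (simp add: Henstock_Kurzweil_Integration.integral_add)
  finally show ?thesis .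
qed

lemma \<phi>_nonneg: "t \<ge> 0 \<Longrightarrow> \<phi> t \<ge> 0"
  using fg[of t] by (smt (verit) norm_ge_zero)

text \<open>The variation of constants formula for w, whose kernel is bounded by M, reduces the claim to the Gronwall
  inequality.\<close>

lemma forward_bound:
  assumes xy: "0 \<le> x" "x \<le> y" and \<phi>: "\<phi> integrable_on {x..y}" and M1: "1 \<le> M"
    and M: "\<And>s t. x \<le> s \<Longrightarrow> s \<le> t \<Longrightarrow> t \<le> y \<Longrightarrow> norm (exp (h * of_real (t - s))) \<le> M"
  shows "Y y \<le> M * (Y x + integral {x..y} \<phi>) * exp (M * integral {x..y} v)"
proof -
  have "Y y \<le> M * (Y x + integral {x..y} \<phi>) * exp (integral {x..y} (\<lambda>s. M * v s))"
  proof (rule gronwall_forward[OF xy(2)])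
    show "continuous_on {x..y} Y" using xy by (intro continuous_on_subset[OF cY]) auto
    show "continuous_on {x..y} (\<lambda>s. M * v s)" using xy by (intro continuous_intros continuous_on_subset[OF cv]) auto
    fix t assume t: "t \<in> {x..y}"
    show "0 \<le> M * v t" using v_nonneg[of t] M1 t xy by simp
    have u: "u t = u x + integral {x..t} (\<lambda>t. a t * u t + b t * w t + f t)"
      using antideriv_diff_eq[OF au, of x t] t xy by (simp add: algebra_simps)
    have w: "w t = exp (h * of_real (t - x)) * w x + integral {x..t} (\<lambda>s. exp (h * of_real (t - s)) * (c s * u s + d s * w s + g s))"
      using antideriv_variation[OF aw, of x t] t xy by auto
    have ni: "(\<lambda>t. norm (c t * u t + d t * w t + g t)) integrable_on {x..t}" "(\<lambda>t. norm (a t * u t + b t * w t + f t)) integrable_on {x..t}"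
      using ai_slow[OF xy(1), of t] ai_fast[OF xy(1), of t] unfolding absolutely_integrable_on_def by auto
    have n1: "norm (u t) \<le> norm (u x) + integral {x..t} (\<lambda>t. norm (a t * u t + b t * w t + f t))"
      using u norm_triangle_ineq[of "u x"] integral_norm_bound_integral[OF set_lebesgue_integral_eq_integral(1)[OF ai_slow[OF xy(1), of t]] ni(2)]
      by (smt (verit))
    have "norm (integral {x..t} (\<lambda>s. exp (h * of_real (t - s)) * (c s * u s + d s * w s + g s)))
        \<le> integral {x..t} (\<lambda>s. M * norm (c s * u s + d s * w s + g s))"
    proof (rule integral_norm_bound_integral)
      show "(\<lambda>s. exp (h * of_real (t - s)) * (c s * u s + d s * w s + g s)) integrable_on {x..t}"
        using antideriv_variation(2)[OF aw, of x t] t xy by (intro set_lebesgue_integral_eq_integral(1)) auto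
      show "(\<lambda>s. M * norm (c s * u s + d s * w s + g s)) integrable_on {x..t}"
        by (intro integrable_on_mult_right ni)
      fix s assume "s \<in> {x..t}"
      then show "norm (exp (h * of_real (t - s)) * (c s * u s + d s * w s + g s)) \<le> M * norm (c s * u s + d s * w s + g s)"
        unfolding norm_mult using t by (intro mult_right_mono M) auto
    qed
    moreover have "norm (exp (h * of_real (t - x)) * w x) \<le> M * norm (w x)"
      unfolding norm_mult using t by (intro mult_right_mono M) auto
    ultimately have n2: "norm (w t) \<le> M * norm (w x) + M * integral {x..t} (\<lambda>s. norm (c s * u s + d s * w s + g s))"
      using norm_triangle_ineq[of "exp (h * of_real (t - x)) * w x"] unfolding w
      by (simp only: Henstock_Kurzweil_Integration.integral_mult_right) (smt (verit))
    have \<phi>t: "\<phi> integrable_on {x..t}" by (rule integrable_on_subinterval[OF \<phi>]) (use t in auto)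
    have "Y t \<le> M * Y x + M * (integral {x..t} (\<lambda>t. norm (a t * u t + b t * w t + f t)) + integral {x..t} (\<lambda>s. norm (c s * u s + d s * w s + g s)))"
    proof -
      have "1 * norm (u x) \<le> M * norm (u x)" using M1 by (intro mult_right_mono) auto
      moreover have "1 * integral {x..t} (\<lambda>t. norm (a t * u t + b t * w t + f t)) \<le> M * integral {x..t} (\<lambda>t. norm (a t * u t + b t * w t + f t))"
        using M1 ni by (intro mult_right_mono integral_nonneg) auto
      ultimately show ?thesis using n1 n2 unfolding Y_def by (simp add: algebra_simps)
    qed
    also have "\<dots> \<le> M * Y x + M * (integral {x..t} (\<lambda>s. v s * Y s) + integral {x..t} \<phi>)"
      using integral_sum_le[OF xy(1) _ \<phi>t] t M1 by (intro add_left_mono mult_left_mono) auto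
    also have "integral {x..t} \<phi> \<le> integral {x..y} \<phi>"
      using t xy \<phi> \<phi>t \<phi>_nonneg by (intro integral_subset_le) auto
    finally show "Y t \<le> M * (Y x + integral {x..y} \<phi>) + integral {x..t} (\<lambda>s. M * v s * Y s)"
      using M1 by (simp add: algebra_simps)
  qed
  then show ?thesis by simp
qed

lemma backward_bound:
  assumes xy: "0 \<le> x" "x \<le> y" and \<phi>: "\<phi> integrable_on {x..y}" and M1: "1 \<le> M"
    and M: "\<And>s t. x \<le> t \<Longrightarrow> t \<le> s \<Longrightarrow> s \<le> y \<Longrightarrow> norm (exp (h * of_real (t - s))) \<le> M"
  shows "Y x \<le> M * (Y y + integral {x..y} \<phi>) * exp (M * integral {x..y} v)"
proof -
  have "Y x \<le> M * (Y y + integral {x..y} \<phi>) * exp (integral {x..y} (\<lambda>s. M * v s))"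
  proof (rule gronwall_backward[OF xy(2)])
    show "continuous_on {x..y} Y" using xy by (intro continuous_on_subset[OF cY]) auto
    show "continuous_on {x..y} (\<lambda>s. M * v s)" using xy by (intro continuous_intros continuous_on_subset[OF cv]) auto
    fix t assume t: "t \<in> {x..y}"
    then have t0: "0 \<le> t" using xy by auto
    show "0 \<le> M * v t" using v_nonneg[of t] M1 t xy by simp
    have u: "u t = u y - integral {t..y} (\<lambda>t. a t * u t + b t * w t + f t)"
      using antideriv_diff_eq[OF au, of t y] t xy by (simp add: algebra_simps)
    have w: "w t = exp (h * of_real (t - y)) * w y - integral {t..y} (\<lambda>s. exp (h * of_real (t - s)) * (c s * u s + d s * w s + g s))"
      using antideriv_variation_backward[OF aw, of t y] t xy by auto
    have ni: "(\<lambda>t. norm (c t * u t + d t * w t + g t)) integrable_on {t..y}" "(\<lambda>t. norm (a t * u t + b t * w t + f t)) integrable_on {t..y}"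
      using ai_slow[OF t0, of y] ai_fast[OF t0, of y] unfolding absolutely_integrable_on_def by auto
    have n1: "norm (u t) \<le> norm (u y) + integral {t..y} (\<lambda>t. norm (a t * u t + b t * w t + f t))"
      using u norm_triangle_ineq4[of "u y"] integral_norm_bound_integral[OF set_lebesgue_integral_eq_integral(1)[OF ai_slow[OF t0, of y]] ni(2)]
      by (smt (verit))
    have "norm (integral {t..y} (\<lambda>s. exp (h * of_real (t - s)) * (c s * u s + d s * w s + g s)))
        \<le> integral {t..y} (\<lambda>s. M * norm (c s * u s + d s * w s + g s))"
    proof (rule integral_norm_bound_integral)
      show "(\<lambda>s. exp (h * of_real (t - s)) * (c s * u s + d s * w s + g s)) integrable_on {t..y}"
        using antideriv_variation_backward(2)[OF aw, of t y] t xy by (intro set_lebesgue_integral_eq_integral(1)) auto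
      show "(\<lambda>s. M * norm (c s * u s + d s * w s + g s)) integrable_on {t..y}"
        by (intro integrable_on_mult_right ni)
      fix s assume "s \<in> {t..y}"
      then show "norm (exp (h * of_real (t - s)) * (c s * u s + d s * w s + g s)) \<le> M * norm (c s * u s + d s * w s + g s)"
        unfolding norm_mult using t by (intro mult_right_mono M) auto
    qed
    moreover have "norm (exp (h * of_real (t - y)) * w y) \<le> M * norm (w y)"
      unfolding norm_mult using t by (intro mult_right_mono M) auto
    ultimately have n2: "norm (w t) \<le> M * norm (w y) + M * integral {t..y} (\<lambda>s. norm (c s * u s + d s * w s + g s))"
      using norm_triangle_ineq4[of "exp (h * of_real (t - y)) * w y"] unfolding w
      by (simp only: Henstock_Kurzweil_Integration.integral_mult_right) (smt (verit))
    have \<phi>t: "\<phi> integrable_on {t..y}" by (rule integrable_on_subinterval[OF \<phi>]) (use t in auto)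
    have "Y t \<le> M * Y y + M * (integral {t..y} (\<lambda>t. norm (a t * u t + b t * w t + f t)) + integral {t..y} (\<lambda>s. norm (c s * u s + d s * w s + g s)))"
    proof -
      have "1 * norm (u y) \<le> M * norm (u y)" using M1 by (intro mult_right_mono) auto
      moreover have "1 * integral {t..y} (\<lambda>t. norm (a t * u t + b t * w t + f t)) \<le> M * integral {t..y} (\<lambda>t. norm (a t * u t + b t * w t + f t))"
        using M1 ni by (intro mult_right_mono integral_nonneg) auto
      ultimately show ?thesis using n1 n2 unfolding Y_def by (simp add: algebra_simps)
    qed
    also have "\<dots> \<le> M * Y y + M * (integral {t..y} (\<lambda>s. v s * Y s) + integral {t..y} \<phi>)"
      using integral_sum_le[OF t0 _ \<phi>t] t M1 by (intro add_left_mono mult_left_mono) auto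
    also have "integral {t..y} \<phi> \<le> integral {x..y} \<phi>"
      using t xy \<phi> \<phi>t \<phi>_nonneg by (intro integral_subset_le) auto
    finally show "Y t \<le> M * (Y y + integral {x..y} \<phi>) + integral {t..y} (\<lambda>s. M * v s * Y s)"
      using M1 by (simp add: algebra_simps)
  qed
  then show ?thesis by simp
qed

end

text \<open>The determinant of two solutions has the logarithmic derivative \<open>a + h + d\<close>; here the trace of the
  coefficient matrix without the phase vanishes.\<close>

lemma colsys_wronskian:
  assumes 1: "colsys h a b c d (\<lambda>_. 0) (\<lambda>_. 0) u1 w1" and 2: "colsys h a b c d (\<lambda>_. 0) (\<lambda>_. 0) u2 w2"
    and c: "continuous_on {0..} a" "continuous_on {0..} b" "continuous_on {0..} c" "continuous_on {0..} d"
    and tr: "\<And>t. t \<ge> 0 \<Longrightarrow> a t + d t = 0" and t: "t \<ge> 0"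
  shows "u1 t * w2 t - w1 t * u2 t = exp (h * of_real t) * (u1 0 * w2 0 - w1 0 * u2 0)"
proof -
  have a: "antideriv u1 (\<lambda>t. a t * u1 t + b t * w1 t + 0)" "antideriv w1 (\<lambda>t. h * w1 t + (c t * u1 t + d t * w1 t + 0))"
    "antideriv u2 (\<lambda>t. a t * u2 t + b t * w2 t + 0)" "antideriv w2 (\<lambda>t. h * w2 t + (c t * u2 t + d t * w2 t + 0))"
    using 1 2 by (auto simp: colsys_def)
  note cs = a[THEN antideriv_continuous]
  have "antideriv (\<lambda>t. u1 t * w2 t - w1 t * u2 t)
    (\<lambda>t. ((a t * u1 t + b t * w1 t + 0) * w2 t + u1 t * (h * w2 t + (c t * u2 t + d t * w2 t + 0)))
       - ((h * w1 t + (c t * u1 t + d t * w1 t + 0)) * u2 t + w1 t * (a t * u2 t + b t * w2 t + 0)))"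
    by (intro antideriv_diff antideriv_mult a continuous_intros c cs)
  then have "antideriv (\<lambda>t. u1 t * w2 t - w1 t * u2 t) (\<lambda>t. h * (u1 t * w2 t - w1 t * u2 t) + 0)"
  proof (rule antideriv_cong)
    fix t :: real assume "t \<ge> 0"
    have "((a t * u1 t + b t * w1 t + 0) * w2 t + u1 t * (h * w2 t + (c t * u2 t + d t * w2 t + 0)))
       - ((h * w1 t + (c t * u1 t + d t * w1 t + 0)) * u2 t + w1 t * (a t * u2 t + b t * w2 t + 0))
       = (a t + d t) * (u1 t * w2 t - w1 t * u2 t) + h * (u1 t * w2 t - w1 t * u2 t)" by algebra
    then show "((a t * u1 t + b t * w1 t + 0) * w2 t + u1 t * (h * w2 t + (c t * u2 t + d t * w2 t + 0)))
       - ((h * w1 t + (c t * u1 t + d t * w1 t + 0)) * u2 t + w1 t * (a t * u2 t + b t * w2 t + 0))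
      = h * (u1 t * w2 t - w1 t * u2 t) + 0" using tr[OF \<open>t \<ge> 0\<close>] by simp
  qed simp
  from antideriv_variation(1)[OF this, of 0 t] t show ?thesis by simp
qed

section \<open>Holomorphic dependence on the spectral parameter\<close>

text \<open>A derivative at z exists as soon as the difference quotients form a Cauchy family; its value need not be
  known beforehand. This avoids solving the variational equation.\<close>

lemma quotient_cauchy_differentiable:
  fixes f :: "complex \<Rightarrow> complex"
  assumes \<delta>: "\<delta> > 0" and C: "C \<ge> 0"
    and Q: "\<And>k k'. k \<in> ball z \<delta> - {z} \<Longrightarrow> k' \<in> ball z \<delta> - {z} \<Longrightarrow>
      norm ((f k - f z) / (k - z) - (f k' - f z) / (k' - z)) \<le> C * (norm (k - z) + norm (k' - z))"
  shows "f field_differentiable (at z)"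
proof -
  define q where "q k = (f k - f z) / (k - z)" for k
  define x where "x n = z + of_real (\<delta> / (real n + 2))" for n :: nat
  have xz: "norm (x n - z) = \<delta> / (real n + 2)" for n
    using \<delta> by (simp only: x_def add_diff_cancel_left' norm_of_real) simp
  have xin: "x n \<in> ball z \<delta> - {z}" for n
  proof -
    have "norm (x n - z) < \<delta>" unfolding xz using \<delta> by (simp add: divide_less_eq)
    moreover have "x n \<noteq> z" using xz[of n] \<delta> by (metis divide_pos_pos add_nonneg_pos of_nat_0_le_iff zero_less_numeral less_irrefl norm_zero diff_self)
    ultimately show ?thesis by (simp add: dist_norm norm_minus_commute)
  qed
  have lim0: "(\<lambda>n. norm (x n - z)) \<longlonglongrightarrow> 0" unfolding xz by real_asymp
  have "Cauchy (\<lambda>n. q (x n))"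
  proof (rule metric_CauchyI)
    fix e :: real assume e: "e > 0"
    define e' where "e' = e / (2 * (C + 1))"
    have e': "e' > 0" using e C by (simp add: e'_def)
    then obtain N where N: "\<And>n. n \<ge> N \<Longrightarrow> norm (x n - z) < e'"
      using LIMSEQ_D[OF lim0 e'] by force
    have ee: "2 * (C + 1) * e' = e" using C by (simp add: e'_def)
    have "dist (q (x m)) (q (x n)) < e" if "m \<ge> N" "n \<ge> N" for m n
    proof -
      have "dist (q (x m)) (q (x n)) \<le> C * (norm (x m - z) + norm (x n - z))"
        using Q[OF xin xin] by (auto simp: q_def dist_norm)
      also have "\<dots> \<le> C * (e' + e')" using N[OF that(1)] N[OF that(2)] C by (intro mult_left_mono) auto
      also have "\<dots> < 2 * (C + 1) * e'" using e' by (simp add: algebra_simps)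
      finally show ?thesis unfolding ee .
    qed
    then show "\<exists>M. \<forall>m\<ge>M. \<forall>n\<ge>M. dist (q (x m)) (q (x n)) < e" by blast
  qed
  then obtain L where L: "(\<lambda>n. q (x n)) \<longlonglongrightarrow> L" using Cauchy_convergent convergent_def by blast
  have qL: "norm (q k - L) \<le> C * norm (k - z)" if k: "k \<in> ball z \<delta> - {z}" for k
  proof (rule LIMSEQ_le)
    show "(\<lambda>n. norm (q k - q (x n))) \<longlonglongrightarrow> norm (q k - L)" by (intro tendsto_intros L)
    have "(\<lambda>n. C * (norm (k - z) + norm (x n - z))) \<longlonglongrightarrow> C * (norm (k - z) + 0)" by (intro tendsto_intros lim0)
    then show "(\<lambda>n. C * (norm (k - z) + norm (x n - z))) \<longlonglongrightarrow> C * norm (k - z)" by simp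
    show "\<exists>N. \<forall>n\<ge>N. norm (q k - q (x n)) \<le> C * (norm (k - z) + norm (x n - z))"
      using Q[OF k xin] by (auto simp: q_def)
  qed
  have "(q \<longlongrightarrow> L) (at z)"
  proof (rule Lim_transform_bound[of _ "\<lambda>k. C * norm (k - z)", THEN Lim_null[THEN iffD2]])
    show "\<forall>\<^sub>F k in at z. norm (q k - L) \<le> norm (C * norm (k - z))"
      using \<delta> C qL by (auto simp: eventually_at dist_norm norm_minus_commute intro!: exI[of _ \<delta>])
    have "((\<lambda>k. C * norm (k - z)) \<longlongrightarrow> C * norm (z - z)) (at z)" by (intro tendsto_intros)
    then show "((\<lambda>k. C * norm (k - z)) \<longlongrightarrow> 0) (at z)" by simp
  qed
  then have "(f has_field_derivative L) (at z)"
    unfolding has_field_derivative_iff q_def .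
  then show ?thesis unfolding field_differentiable_def by blast
qed

text \<open>The coefficients of the original system: Laurent polynomials in k with exponents from -1 to 1.\<close>

definition laurent_coef :: "(complex \<Rightarrow> real \<Rightarrow> complex) \<Rightarrow> bool" where
  "laurent_coef A \<longleftrightarrow> (\<exists>p r l. continuous_on {0..} p \<and> continuous_on {0..} r \<and> continuous_on {0..} l \<and>
     (\<forall>k t. k \<noteq> 0 \<longrightarrow> A k t = p t + k * r t + l t / k))"

lemma laurent_coefI:
  assumes "continuous_on {0..} p" "continuous_on {0..} r" "continuous_on {0..} l"
    and "\<And>k t. k \<noteq> 0 \<Longrightarrow> A k t = p t + k * r t + l t / k"
  shows "laurent_coef A"
  using assms unfolding laurent_coef_def by blast

lemma laurent_coef_continuous:
  assumes "laurent_coef A" "k \<noteq> 0" shows "continuous_on {0..} (A k)"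
proof -
  obtain p r l where c: "continuous_on {0..} p" "continuous_on {0..} r" "continuous_on {0..} l"
    "\<And>k t. k \<noteq> 0 \<Longrightarrow> A k t = p t + k * r t + l t / k"
    using assms(1) unfolding laurent_coef_def by blast
  have "A k = (\<lambda>t. p t + k * r t + l t / k)" using c(4)[OF assms(2)] by blast
  then show ?thesis using assms(2) by (auto intro!: continuous_intros c(1-3))
qed

lemma laurent_coef_quotient_bound:
  assumes A: "laurent_coef A" and z: "z \<noteq> 0" and T: "0 \<le> T"
  obtains B where "B \<ge> 0" "\<And>k t. k \<in> ball z (norm z / 2) \<Longrightarrow> t \<in> {0..T} \<Longrightarrow> norm (A k t) \<le> B"
    "\<And>k t. k \<in> ball z (norm z / 2) - {z} \<Longrightarrow> t \<in> {0..T} \<Longrightarrow> norm ((A k t - A z t) / (k - z)) \<le> B"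
    "\<And>k k' t. k \<in> ball z (norm z / 2) - {z} \<Longrightarrow> k' \<in> ball z (norm z / 2) - {z} \<Longrightarrow> t \<in> {0..T} \<Longrightarrow>
       norm ((A k t - A z t) / (k - z) - (A k' t - A z t) / (k' - z)) \<le> B * (norm (k - z) + norm (k' - z))"
proof -
  obtain p r l where c: "continuous_on {0..} p" "continuous_on {0..} r" "continuous_on {0..} l"
    and Aeq: "\<And>k t. k \<noteq> 0 \<Longrightarrow> A k t = p t + k * r t + l t / k"
    using A unfolding laurent_coef_def by blast
  have bd: "\<exists>b. b \<ge> 0 \<and> (\<forall>t\<in>{0..T}. norm (f t) \<le> b)" if "continuous_on {0..} f" for f :: "real \<Rightarrow> complex"
  proof -
    have "bounded (f ` {0..T})"
      by (intro compact_imp_bounded compact_continuous_image continuous_on_subset[OF that]) auto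
    then obtain b where "b > 0" "\<forall>t\<in>{0..T}. norm (f t) \<le> b" by (auto simp: bounded_pos)
    then show ?thesis by (intro exI[of _ b]) auto
  qed
  obtain bp where bp: "bp \<ge> 0" "\<And>t. t \<in> {0..T} \<Longrightarrow> norm (p t) \<le> bp" using bd[OF c(1)] by blast
  obtain br where br: "br \<ge> 0" "\<And>t. t \<in> {0..T} \<Longrightarrow> norm (r t) \<le> br" using bd[OF c(2)] by blast
  obtain bl where bl: "bl \<ge> 0" "\<And>t. t \<in> {0..T} \<Longrightarrow> norm (l t) \<le> bl" using bd[OF c(3)] by blast
  define m where "m = norm z / 2"
  have m: "m > 0" using z by (simp add: m_def)
  have k: "norm k \<ge> m" "norm k \<le> 3 * m" "k \<noteq> 0" if "k \<in> ball z m" for k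
  proof -
    have "norm (z - k) < m" using that by (simp add: dist_norm)
    moreover have "norm z - norm k \<le> norm (z - k)" "norm k - norm z \<le> norm (z - k)"
      using norm_triangle_ineq2[of z k] norm_triangle_ineq2[of k z] by (auto simp: norm_minus_commute)
    moreover have "norm z = 2 * m" by (simp add: m_def)
    ultimately show "norm k \<ge> m" "norm k \<le> 3 * m" by linarith+
    then show "k \<noteq> 0" using m by auto
  qed
  define B where "B = (bp + 3 * m * br + bl / m) + (br + bl / m^2) + bl / m^3"
  have B0: "bp + 3 * m * br + bl / m \<ge> 0" "br + bl / m^2 \<ge> 0" "bl / m^3 \<ge> 0"
    using bp br bl m by auto
  have Q: "(A k t - A z t) / (k - z) = r t - l t / (k * z)" if "k \<in> ball z m - {z}" for k t
    using k[of k] z that by (simp add: Aeq field_simps)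
  have nz: "norm z \<ge> m" using m by (simp add: m_def)
  show ?thesis
  proof (rule that[of B, folded m_def])
    show "B \<ge> 0" using B0 by (simp add: B_def)
    fix k t assume kt: "k \<in> ball z m" "t \<in> {0..T}"
    have "norm (A k t) \<le> norm (p t) + norm k * norm (r t) + norm (l t) / norm k"
      using k[OF kt(1)] by (simp add: Aeq norm_mult norm_divide norm_triangle_le add_mono norm_triangle_ineq)
    also have "\<dots> \<le> bp + 3 * m * br + bl / m"
      using k[OF kt(1)] bp br bl kt m by (intro add_mono mult_mono frac_le) auto
    also have "\<dots> \<le> B" using B0 by (simp add: B_def)
    finally show "norm (A k t) \<le> B" .
  next
    fix k t assume kt: "k \<in> ball z m - {z}" "t \<in> {0..T}"
    have "norm (r t - l t / (k * z)) \<le> norm (r t) + norm (l t) / (norm k * norm z)"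
      by (metis norm_divide norm_mult norm_triangle_ineq4)
    also have "\<dots> \<le> br + bl / (m * m)"
      using k[of k] nz bp br bl kt m by (intro add_mono mult_mono frac_le) auto
    also have "\<dots> \<le> B" using B0 by (simp add: B_def power2_eq_square)
    finally show "norm ((A k t - A z t) / (k - z)) \<le> B" using Q kt by simp
  next
    fix k k' t assume kt: "k \<in> ball z m - {z}" "k' \<in> ball z m - {z}" "t \<in> {0..T}"
    have nz0: "k \<noteq> 0" "k' \<noteq> 0" using k kt by blast+
    have "(A k t - A z t) / (k - z) - (A k' t - A z t) / (k' - z) = l t / (k' * z) - l t / (k * z)"
      using Q kt by simp
    also have "\<dots> = l t / (k * k' * z) * ((k - z) - (k' - z))" using nz0 z by (simp add: field_simps)
    also have "norm \<dots> \<le> norm (l t) / (norm k * norm k' * norm z) * (norm (k - z) + norm (k' - z))"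
      unfolding norm_mult norm_divide by (intro mult_left_mono norm_triangle_ineq4) auto
    also have "\<dots> \<le> bl / (m * m * m) * (norm (k - z) + norm (k' - z))"
      using k[of k] k[of k'] nz bl kt m by (intro mult_right_mono frac_le mult_mono) auto
    also have "\<dots> \<le> B * (norm (k - z) + norm (k' - z))"
      using B0 by (intro mult_right_mono) (auto simp: B_def power3_eq_cube)
    finally show "norm ((A k t - A z t) / (k - z) - (A k' t - A z t) / (k' - z)) \<le> B * (norm (k - z) + norm (k' - z))" .
  qed
qed

lemma colsys_bound0:
  assumes sys: "colsys 0 a b c d f g u w" and cont: "continuous_on {0..} a" "continuous_on {0..} b"
    "continuous_on {0..} c" "continuous_on {0..} d"
    and B: "\<And>t. t \<in> {0..T} \<Longrightarrow> norm (a t) \<le> B" "\<And>t. t \<in> {0..T} \<Longrightarrow> norm (b t) \<le> B"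
      "\<And>t. t \<in> {0..T} \<Longrightarrow> norm (c t) \<le> B" "\<And>t. t \<in> {0..T} \<Longrightarrow> norm (d t) \<le> B"
    and F: "continuous_on {0..} f" "continuous_on {0..} g" "\<And>t. t \<in> {0..T} \<Longrightarrow> norm (f t) + norm (g t) \<le> F"
    and t: "t \<in> {0..T}"
  shows "norm (u t) + norm (w t) \<le> (norm (u 0) + norm (w 0) + T * F) * exp (4 * B * T)"
proof -
  define v where "v s = norm (a s) + norm (b s) + norm (c s) + norm (d s)" for s
  define \<phi> where "\<phi> s = norm (f s) + norm (g s)" for s
  have cv: "continuous_on {0..} v" and c\<phi>: "continuous_on {0..} \<phi>"
    unfolding v_def \<phi>_def by (intro continuous_intros cont F)+
  interpret column_bounds 0 a b c d f g u w v \<phi>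
    by unfold_locales (auto intro!: sys cont cv[unfolded v_def] simp: v_def \<phi>_def)
  have iv: "v integrable_on {0..t}" "\<phi> integrable_on {0..t}"
    by (auto intro!: integrable_continuous_real continuous_on_subset[OF cv] continuous_on_subset[OF c\<phi>])
  have Bn: "B \<ge> 0" "F \<ge> 0" using B(1)[OF t] F(3)[OF t] by (smt (verit) norm_ge_zero)+
  have "integral {0..t} v \<le> integral {0..t} (\<lambda>_. 4 * B)"
  proof (rule integral_le[OF iv(1)])
    fix s assume "s \<in> {0..t}" then have "s \<in> {0..T}" using t by auto
    from B(1,2,3,4)[OF this] show "v s \<le> 4 * B" unfolding v_def by linarith
  qed auto
  also have "\<dots> \<le> 4 * B * T" using t Bn mult_left_mono[of t T "4 * B"] by (simp add: mult.commute)
  finally have 1: "integral {0..t} v \<le> 4 * B * T" .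
  have "integral {0..t} \<phi> \<le> integral {0..t} (\<lambda>_. F)"
    using F(3) t by (intro integral_le[OF iv(2)]) (auto simp: \<phi>_def)
  also have "\<dots> \<le> T * F" using t Bn by (simp add: mult_right_mono)
  finally have 2: "integral {0..t} \<phi> \<le> T * F" .
  have "Y t \<le> 1 * (Y 0 + integral {0..t} \<phi>) * exp (1 * integral {0..t} v)"
    using t iv by (intro forward_bound) auto
  also have "\<dots> \<le> (Y 0 + T * F) * exp (4 * B * T)"
    using 1 2 Bn t by (simp, intro mult_mono) (auto simp: Y_def)
  finally show ?thesis by (simp add: Y_def)
qed

text \<open>Difference quotients in k solve the same system with an inhomogeneity that depends on k in a Lipschitz
  way, so they form a Cauchy family by the Gronwall bound. The values at time 0 do not
  depend on k, so the differences vanish there.\<close>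

lemma colsys_holomorphic:
  fixes a b c d u w :: "complex \<Rightarrow> real \<Rightarrow> complex"
  assumes L: "laurent_coef a" "laurent_coef b" "laurent_coef c" "laurent_coef d"
    and sys: "\<And>k. k \<noteq> 0 \<Longrightarrow> colsys 0 (a k) (b k) (c k) (d k) (\<lambda>_. 0) (\<lambda>_. 0) (u k) (w k)"
    and init: "\<And>k. k \<noteq> 0 \<Longrightarrow> u k 0 = u0" "\<And>k. k \<noteq> 0 \<Longrightarrow> w k 0 = w0"
    and T: "T \<ge> 0"
  shows "(\<lambda>k. u k T) holomorphic_on - {0}" "(\<lambda>k. w k T) holomorphic_on - {0}"
proof -
  have "(\<lambda>k. u k T) field_differentiable at z \<and> (\<lambda>k. w k T) field_differentiable at z" if z: "z \<noteq> 0" for z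
  proof -
    define m where "m = norm z / 2"
    have m: "m > 0" using z by (simp add: m_def)
    define q where "q A k t = (A k t - A z t) / (k - z)" for A :: "complex \<Rightarrow> real \<Rightarrow> complex" and k t
    have ex: "\<exists>B. B \<ge> 0 \<and> (\<forall>k\<in>ball z m. \<forall>t\<in>{0..T}. norm (A k t) \<le> B) \<and>
       (\<forall>k\<in>ball z m - {z}. \<forall>t\<in>{0..T}. norm (q A k t) \<le> B) \<and>
       (\<forall>k\<in>ball z m - {z}. \<forall>k'\<in>ball z m - {z}. \<forall>t\<in>{0..T}. norm (q A k t - q A k' t) \<le> B * (norm (k - z) + norm (k' - z)))"
      if "laurent_coef A" for A
      unfolding q_def m_def by (rule laurent_coef_quotient_bound[OF that z T]) blast
    define PB where "PB A B \<longleftrightarrow> B \<ge> 0 \<and> (\<forall>k\<in>ball z m. \<forall>t\<in>{0..T}. norm (A k t) \<le> B) \<and>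
       (\<forall>k\<in>ball z m - {z}. \<forall>t\<in>{0..T}. norm (q A k t) \<le> B) \<and>
       (\<forall>k\<in>ball z m - {z}. \<forall>k'\<in>ball z m - {z}. \<forall>t\<in>{0..T}. norm (q A k t - q A k' t) \<le> B * (norm (k - z) + norm (k' - z)))" for A B
    have PBmono: "PB A B'" if "PB A B" "B \<le> B'" for A B B'
      using that unfolding PB_def by (smt (verit, best) mult_right_mono norm_ge_zero)
    obtain B1 B2 B3 B4 where B14: "PB a B1" "PB b B2" "PB c B3" "PB d B4"
      using ex[OF L(1), folded PB_def] ex[OF L(2), folded PB_def] ex[OF L(3), folded PB_def] ex[OF L(4), folded PB_def]
      by blast
    define B where "B = B1 + B2 + B3 + B4"
    have nn: "B1 \<ge> 0" "B2 \<ge> 0" "B3 \<ge> 0" "B4 \<ge> 0" using B14 unfolding PB_def by auto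
    then have PB: "PB a B" "PB b B" "PB c B" "PB d B" and B0: "B \<ge> 0"
      using B14 by (auto intro: PBmono simp: B_def)
    have bd: "norm (A k t) \<le> B" if "PB A B" "k \<in> ball z m" "t \<in> {0..T}" for A k t
      using that unfolding PB_def by blast
    have bq: "norm (q A k t) \<le> B" if "PB A B" "k \<in> ball z m - {z}" "t \<in> {0..T}" for A k t
      using that unfolding PB_def by blast
    have bqq: "norm (q A k t - q A k' t) \<le> B * (norm (k - z) + norm (k' - z))"
      if "PB A B" "k \<in> ball z m - {z}" "k' \<in> ball z m - {z}" "t \<in> {0..T}" for A k k' t
      using that unfolding PB_def by blast
    have nz: "k \<noteq> 0" if "k \<in> ball z m" for k
      using that z by (auto simp: m_def)
    note Lc = L[THEN laurent_coef_continuous]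
    have zin: "z \<in> ball z m" using m by simp
    define E where "E = exp (4 * B * T)"
    define C1 where "C1 = (norm u0 + norm w0) * E"
    have C10: "C1 \<ge> 0" by (simp add: C1_def E_def)
    have Y1: "norm (u k t) + norm (w k t) \<le> C1" if k: "k \<in> ball z m" and t: "t \<in> {0..T}" for k t
    proof -
      have "norm (u k t) + norm (w k t) \<le> (norm (u k 0) + norm (w k 0) + T * 0) * exp (4 * B * T)"
        by (rule colsys_bound0[OF sys[OF nz[OF k]] Lc[OF nz[OF k]] bd[OF PB(1) k] bd[OF PB(2) k] bd[OF PB(3) k] bd[OF PB(4) k]])
          (use t in auto)
      then show ?thesis using nz[OF k] by (simp add: init C1_def E_def)
    qed
    have cu: "continuous_on {0..} (u k)" "continuous_on {0..} (w k)" if "k \<in> ball z m" for k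
      using sys[OF nz[OF that]] antideriv_continuous by (auto simp: colsys_def)
    define f where "f k t = q a k t * u k t + q b k t * w k t" for k t
    define g where "g k t = q c k t * u k t + q d k t * w k t" for k t
    have cf: "continuous_on {0..} (f k)" "continuous_on {0..} (g k)" if k: "k \<in> ball z m - {z}" for k
      using k nz[of k] unfolding f_def g_def q_def by (auto intro!: continuous_intros Lc z cu)
    define Qu where "Qu k t = (u k t - u z t) / (k - z)" for k t
    define Qw where "Qw k t = (w k t - w z t) / (k - z)" for k t
    have sysQ: "colsys 0 (a z) (b z) (c z) (d z) (f k) (g k) (Qu k) (Qw k)" if k: "k \<in> ball z m - {z}" for k
    proof -
      have kz: "k - z \<noteq> 0" using k by auto
      have q: "A k t = A z t + (k - z) * q A k t" for A t using kz by (simp add: q_def)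
      have "colsys 0 (a z) (b z) (c z) (d z) (\<lambda>t. (k - z) * f k t) (\<lambda>t. (k - z) * g k t) (u k) (w k)"
        using sys[OF nz[of k]] k unfolding colsys_def f_def g_def
        by (simp add: q[of a] q[of b] q[of c] q[of d] algebra_simps)
      from colsys_lincomb[OF this sys[OF z], of "1 / (k - z)" "- 1 / (k - z)"]
      show ?thesis by (rule colsys_cong) (use kz in \<open>auto simp: Qu_def Qw_def diff_divide_distrib\<close>)
    qed
    have Q0: "Qu k 0 = 0" "Qw k 0 = 0" if "k \<in> ball z m - {z}" for k
      using that nz[of k] z by (auto simp: Qu_def Qw_def init)
    have one: "norm x * norm y \<le> p * r" if "norm x \<le> p" "norm y \<le> r" for x y :: complex and p r
      using that by (intro mult_mono) (auto intro: order_trans[OF norm_ge_zero])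
    define C2 where "C2 = T * (4 * (B * C1)) * E"
    have C20: "C2 \<ge> 0" using T B0 C10 by (simp add: C2_def E_def)
    have Y2: "norm (Qu k t) + norm (Qw k t) \<le> C2" if k: "k \<in> ball z m - {z}" and t: "t \<in> {0..T}" for k t
    proof -
      have "norm (f k s) + norm (g k s) \<le> 4 * (B * C1)" if s: "s \<in> {0..T}" for s
      proof -
        have uw: "norm (u k s) \<le> C1" "norm (w k s) \<le> C1" using Y1[of k s] k s by (smt (verit) DiffD1 norm_ge_zero)+
        have "norm (f k s) \<le> B * C1 + B * C1" "norm (g k s) \<le> B * C1 + B * C1"
          unfolding f_def g_def
          by (intro norm_triangle_le add_mono; simp add: norm_mult one bq[OF _ k s] PB uw)+
        then show ?thesis by simp
      qed
      from colsys_bound0[OF sysQ[OF k] Lc[OF z] bd[OF PB(1) zin] bd[OF PB(2) zin] bd[OF PB(3) zin] bd[OF PB(4) zin] cf[OF k] this t]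
      show ?thesis using Q0[OF k] by (simp add: C2_def E_def)
    qed
    define C3 where "C3 = T * (4 * (B * C1 + B * C2)) * E"
    have C30: "C3 \<ge> 0" using T B0 C10 C20 by (simp add: C3_def E_def)
    have Y3: "norm (Qu k T - Qu k' T) + norm (Qw k T - Qw k' T) \<le> C3 * (norm (k - z) + norm (k' - z))"
      if k: "k \<in> ball z m - {z}" and k': "k' \<in> ball z m - {z}" for k k'
    proof -
      define \<eta> where "\<eta> = norm (k - z) + norm (k' - z)"
      have \<eta>0: "\<eta> \<ge> 0" by (simp add: \<eta>_def)
      have du: "norm (x k s - x k' s) \<le> C2 * \<eta>" if "norm ((x k s - x z s) / (k - z)) \<le> C2" "norm ((x k' s - x z s) / (k' - z)) \<le> C2"
        for x :: "complex \<Rightarrow> real \<Rightarrow> complex" and s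
      proof -
        have "norm (x k s - x z s) \<le> C2 * norm (k - z)" "norm (x k' s - x z s) \<le> C2 * norm (k' - z)"
          using that k k' by (simp_all add: norm_divide divide_le_eq)
        then show ?thesis using norm_triangle_ineq4[of "x k s - x z s" "x k' s - x z s"]
          by (simp add: \<eta>_def algebra_simps)
      qed
      have prod_le: "norm (q A k s * x k s - q A k' s * x k' s) \<le> (B * C1 + B * C2) * \<eta>"
        if A: "PB A B" and s: "s \<in> {0..T}" and x: "norm (x k s) \<le> C1" "norm (x k s - x k' s) \<le> C2 * \<eta>" for A x s
      proof -
        have "q A k s * x k s - q A k' s * x k' s = (q A k s - q A k' s) * x k s + q A k' s * (x k s - x k' s)"
          by (simp add: algebra_simps)
        also have "norm \<dots> \<le> (B * \<eta>) * C1 + B * (C2 * \<eta>)"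
          using bqq[OF A k k' s] bq[OF A k' s] x
          by (intro norm_triangle_le add_mono) (simp_all add: norm_mult one \<eta>_def)
        finally show ?thesis by (simp add: algebra_simps)
      qed
      have sysd: "colsys 0 (a z) (b z) (c z) (d z) (\<lambda>t. f k t - f k' t) (\<lambda>t. g k t - g k' t) (\<lambda>t. Qu k t - Qu k' t) (\<lambda>t. Qw k t - Qw k' t)"
        using colsys_lincomb[OF sysQ[OF k] sysQ[OF k'], of 1 "-1"] by simp
      have "norm (f k s - f k' s) + norm (g k s - g k' s) \<le> 4 * ((B * C1 + B * C2) * \<eta>)" if s: "s \<in> {0..T}" for s
      proof -
        have uw: "norm (u k s) \<le> C1" "norm (w k s) \<le> C1" using Y1[of k s] k s by (smt (verit) DiffD1 norm_ge_zero)+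
        have dd: "norm (u k s - u k' s) \<le> C2 * \<eta>" "norm (w k s - w k' s) \<le> C2 * \<eta>"
          using Y2[OF k s] Y2[OF k' s] unfolding Qu_def Qw_def
          by (intro du; smt (verit) norm_ge_zero)+
        note t4 = prod_le[of _ _ u, OF PB(1) s uw(1) dd(1)] prod_le[of _ _ w, OF PB(2) s uw(2) dd(2)]
          prod_le[of _ _ u, OF PB(3) s uw(1) dd(1)] prod_le[of _ _ w, OF PB(4) s uw(2) dd(2)]
        have "f k s - f k' s = (q a k s * u k s - q a k' s * u k' s) + (q b k s * w k s - q b k' s * w k' s)"
          "g k s - g k' s = (q c k s * u k s - q c k' s * u k' s) + (q d k s * w k s - q d k' s * w k' s)"
          by (simp_all add: f_def g_def)
        then have "norm (f k s - f k' s) \<le> norm (q a k s * u k s - q a k' s * u k' s) + norm (q b k s * w k s - q b k' s * w k' s)"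
          "norm (g k s - g k' s) \<le> norm (q c k s * u k s - q c k' s * u k' s) + norm (q d k s * w k s - q d k' s * w k' s)"
          by (simp_all only: norm_triangle_ineq)
        then show ?thesis using t4 by linarith
      qed
      from colsys_bound0[OF sysd Lc[OF z] bd[OF PB(1) zin] bd[OF PB(2) zin] bd[OF PB(3) zin] bd[OF PB(4) zin] _ _ this, of T]
      show ?thesis using Q0[OF k] Q0[OF k'] T cf[OF k] cf[OF k']
        by (simp add: C3_def E_def \<eta>_def algebra_simps continuous_on_diff)
    qed
    have "(\<lambda>k. u k T) field_differentiable at z"
      by (rule quotient_cauchy_differentiable[OF m C30]) (use Y3 in \<open>unfold Qu_def, smt (verit) norm_ge_zero\<close>)
    moreover have "(\<lambda>k. w k T) field_differentiable at z"
      by (rule quotient_cauchy_differentiable[OF m C30]) (use Y3 in \<open>unfold Qw_def, smt (verit) norm_ge_zero\<close>)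
    ultimately show ?thesis by blast
  qed
  then show "(\<lambda>k. u k T) holomorphic_on - {0}" "(\<lambda>k. w k T) holomorphic_on - {0}"
    unfolding holomorphic_on_def by (auto intro: field_differentiable_at_within)
qed

section \<open>The phase and Cauchy estimates on small discs\<close>

text \<open>The exponent 2 i \<open>\<theta>\<^sub>2\<close> of the off-diagonal entry of the first column, and its negative for the second
  column.\<close>

definition phase :: "complex \<Rightarrow> complex \<Rightarrow> complex" where
  "phase \<epsilon> k = 2 * \<i> * \<epsilon> * theta2 k"

lemma disc_nonzero:
  fixes k k' :: complex
  assumes k: "k \<noteq> 0" "norm k \<le> 1" and R: "0 \<le> R" and d: "norm (k' - k) \<le> (norm k)\<^sup>2 / (4 * (1 + R))"
  shows "k' \<noteq> 0" "norm k' \<le> 2 * norm k" "3/4 * norm k \<le> norm k'"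
proof -
  have "(norm k)\<^sup>2 \<le> 1 * norm k" unfolding power2_eq_square using k by (intro mult_right_mono) auto
  moreover have "(norm k)\<^sup>2 / (4 * (1 + R)) \<le> (norm k)\<^sup>2 / 4"
    using R by (intro divide_left_mono) auto
  ultimately have "norm (k' - k) \<le> norm k / 4" using d by linarith
  moreover have "norm k' - norm k \<le> norm (k' - k)" "norm k - norm k' \<le> norm (k' - k)"
    using norm_triangle_ineq2[of k' k] norm_triangle_ineq2[of k k'] by (auto simp: norm_minus_commute)
  ultimately show "norm k' \<le> 2 * norm k" "3/4 * norm k \<le> norm k'" using norm_ge_zero[of k] by linarith+
  then show "k' \<noteq> 0" using k by auto
qed

text \<open>The derivative of \<open>\<theta>\<^sub>2\<close> has size \<open>|k|^(-2)\<close>, and on this disc k changes by a small multiple of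
  \<open>|k|\<^sup>2\<close> only.\<close>

lemma phase_disc:
  assumes e: "norm \<epsilon> = 1" and k: "k \<noteq> 0" "norm k \<le> 1" and R: "0 \<le> R" and d: "norm (k' - k) \<le> (norm k)\<^sup>2 / (4 * (1 + R))"
  shows "norm (phase \<epsilon> k' - phase \<epsilon> k) \<le> 1 / (1 + R)"
proof -
  note n = disc_nonzero[OF k R d]
  have "phase \<epsilon> k' - phase \<epsilon> k = \<i> * \<epsilon> / 2 * (k' - k) * (1 - 1 / (k * k'))"
    using k n by (simp add: phase_def theta2_def field_simps)
  then have "norm (phase \<epsilon> k' - phase \<epsilon> k) = norm (k' - k) / 2 * norm (1 - 1 / (k * k'))"
    by (simp only: norm_mult norm_divide e norm_ii) simp
  also have "norm (1 - 1 / (k * k')) \<le> 1 + 1 / (norm k * norm k')"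
    using norm_triangle_ineq4[of 1 "1 / (k * k')"] by (simp add: norm_divide norm_mult)
  also have "1 / (norm k * norm k') \<le> 1 / (norm k * (3/4 * norm k))"
    using n k by (intro divide_left_mono mult_left_mono) auto
  also have "1 + 1 / (norm k * (3/4 * norm k)) \<le> 3 / (norm k)\<^sup>2"
  proof -
    have "1 \<le> 1 / (norm k)\<^sup>2" using k by (simp add: power_le_one)
    then show ?thesis by (simp add: power2_eq_square)
  qed
  finally have "norm (phase \<epsilon> k' - phase \<epsilon> k) \<le> norm (k' - k) / 2 * (3 / (norm k)\<^sup>2)"
    by (auto simp: mult_left_mono)
  also have "\<dots> \<le> (norm k)\<^sup>2 / (4 * (1 + R)) / 2 * (3 / (norm k)\<^sup>2)"
    using d by (intro mult_right_mono divide_right_mono) auto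
  also have "\<dots> = 3 / 8 / (1 + R)" using k R by (simp add: field_simps)
  also have "\<dots> \<le> 1 / (1 + R)" using R by (intro divide_right_mono) auto
  finally show ?thesis .
qed

text \<open>An exponential that does not grow at the centre of the disc stays bounded on the disc over times
  up to R.\<close>

lemma phase_exp_le:
  assumes e: "norm \<epsilon> = 1" and k: "k \<noteq> 0" "norm k \<le> 1" and R: "0 \<le> R" and d: "norm (k' - k) \<le> (norm k)\<^sup>2 / (4 * (1 + R))"
    and t: "\<bar>\<tau>\<bar> \<le> R" and s: "Re (phase \<epsilon> k) * \<tau> \<le> 0"
  shows "norm (exp (phase \<epsilon> k' * of_real \<tau>)) \<le> exp 1"
proof -
  have "\<bar>Re (phase \<epsilon> k' - phase \<epsilon> k)\<bar> * \<bar>\<tau>\<bar> \<le> 1 / (1 + R) * R"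
    using phase_disc[OF e k R d] abs_Re_le_cmod[of "phase \<epsilon> k' - phase \<epsilon> k"] t R by (intro mult_mono) auto
  also have "\<dots> \<le> 1" using R by simp
  finally have "Re (phase \<epsilon> k' - phase \<epsilon> k) * \<tau> \<le> 1" by (simp flip: abs_mult)
  then have "Re (phase \<epsilon> k' * of_real \<tau>) \<le> 1" using s by (simp add: algebra_simps)
  then show ?thesis by (simp add: norm_exp_eq_Re)
qed

text \<open>The radius \<open>|k|\<^sup>2 / (4 (1 + R))\<close> is the source of the factors \<open>(1 + R) |k|^(-2)\<close> per derivative.\<close>

lemma cauchy_on_disc:
  assumes hol: "f holomorphic_on - {0}" and k: "k \<noteq> 0" "norm k \<le> 1" and R: "0 \<le> R"
    and B: "\<And>k'. norm (k' - k) \<le> (norm k)\<^sup>2 / (4 * (1 + R)) \<Longrightarrow> norm (f k') \<le> B"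
  shows "norm ((deriv ^^ j) f k) \<le> fact j * 4 ^ j * B * (1 + R) ^ j / norm k ^ (2 * j)"
proof -
  let ?r = "(norm k)\<^sup>2 / (4 * (1 + R))"
  have sub: "cball k ?r \<subseteq> - {0}"
    using disc_nonzero(1)[OF k R, of 0] by (auto simp: dist_norm)
  have "norm ((deriv ^^ j) f k) \<le> fact j * B / ?r ^ j"
  proof (rule Cauchy_inequality)
    show "f holomorphic_on ball k ?r" by (rule holomorphic_on_subset[OF hol]) (use sub in auto)
    show "continuous_on (cball k ?r) f"
      by (rule holomorphic_on_imp_continuous_on[OF holomorphic_on_subset[OF hol sub]])
    show "0 < ?r" using k R by simp
  qed (auto intro!: B simp: norm_minus_commute)
  also have "\<dots> = fact j * 4 ^ j * B * (1 + R) ^ j / norm k ^ (2 * j)"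
    by (simp add: power_divide power_mult_distrib power_mult del: distrib_left_numeral)
  finally show ?thesis .
qed

lemma integral_tail:
  fixes f :: "real \<Rightarrow> 'a::euclidean_space"
  assumes f: "f absolutely_integrable_on {0..}"
  shows "((\<lambda>t. integral {0..t} f) \<longlongrightarrow> integral {0..} f) at_top"
    and "t \<ge> 0 \<Longrightarrow> integral {0..t} f + integral {t..} f = integral {0..} f"
    and "((\<lambda>t. integral {t..} f) \<longlongrightarrow> 0) at_top"
proof -
  have sub: "f absolutely_integrable_on S" if "S \<subseteq> {0..}" "S \<in> sets lebesgue" for S
    using set_integrable_subset[OF f] that by auto
  have "((\<lambda>b. LINT x:{0..b}|lebesgue. f x) \<longlongrightarrow> (LINT x:{0..}|lebesgue. f x)) at_top"
    by (rule tendsto_set_lebesgue_integral_at_top[OF _ f]) auto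
  moreover have "(LINT x:{0..b}|lebesgue. f x) = integral {0..b} f" for b
    by (intro set_lebesgue_integral_eq_integral sub) auto
  moreover have "(LINT x:{0..}|lebesgue. f x) = integral {0..} f"
    by (intro set_lebesgue_integral_eq_integral f)
  ultimately show 1: "((\<lambda>t. integral {0..t} f) \<longlongrightarrow> integral {0..} f) at_top" by simp
  show 2: "integral {0..t} f + integral {t..} f = integral {0..} f" if t: "t \<ge> 0" for t
  proof -
    have "(f has_integral (integral {0..t} f + integral {t..} f)) ({0..t} \<union> {t..})"
    proof (rule has_integral_Un)
      show "(f has_integral integral {0..t} f) {0..t}" "(f has_integral integral {t..} f) {t..}"
        using t by (auto intro!: integrable_integral set_lebesgue_integral_eq_integral(1) sub)
      have "{0..t} \<inter> {t..} = (if t \<ge> 0 then {t} else {})" by auto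
      then show "negligible ({0..t} \<inter> {t..})" by simp
    qed
    moreover have "{0..t} \<union> {t..} = {0..}" using t by auto
    ultimately show ?thesis by (simp add: integral_unique)
  qed
  have "((\<lambda>t. integral {0..} f - integral {0..t} f) \<longlongrightarrow> integral {0..} f - integral {0..} f) at_top"
    by (intro tendsto_intros 1)
  from Lim_transform_eventually[OF this] have "\<forall>\<^sub>F t in at_top. integral {0..} f - integral {0..t} f = integral {t..} f \<Longrightarrow> ((\<lambda>t. integral {t..} f) \<longlongrightarrow> 0) at_top"
    by simp
  moreover have "\<forall>\<^sub>F t in at_top. integral {0..} f - integral {0..t} f = integral {t..} f"
    using eventually_ge_at_top[of 0]
  proof eventually_elim
    case (elim t)
    then show ?case using 2[of t] by (simp add: algebra_simps)
  qed
  ultimately show "((\<lambda>t. integral {t..} f) \<longlongrightarrow> 0) at_top"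
    by blast
qed

section \<open>Derivative bounds up to the boundary\<close>

text \<open>The scalar counterpart of the columnwise estimates: g extends the j-th derivative continuously to the
  boundary.\<close>

definition scal_deriv_le :: "nat \<Rightarrow> complex set \<Rightarrow> (complex \<Rightarrow> complex) \<Rightarrow> (complex \<Rightarrow> real) \<Rightarrow> bool" where
  "scal_deriv_le j D f b \<longleftrightarrow> (\<exists>g. f holomorphic_on D \<and> continuous_on (closure D - {0}) f \<and>
     continuous_on (closure D - {0}) g \<and> (\<forall>k\<in>D. g k = (deriv ^^ j) f k) \<and>
     (\<forall>k\<in>closure D - {0}. norm (g k) \<le> b k))"

lemma scal_deriv_le_lincomb:
  assumes "scal_deriv_le j D f b" "scal_deriv_le j D g b'" and D: "open D"
  shows "scal_deriv_le j D (\<lambda>k. x * f k + y * g k) (\<lambda>k. norm x * b k + norm y * b' k)"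
proof -
  obtain F where F: "f holomorphic_on D" "continuous_on (closure D - {0}) f"
     "continuous_on (closure D - {0}) F" "\<forall>k\<in>D. F k = (deriv ^^ j) f k" "\<forall>k\<in>closure D - {0}. norm (F k) \<le> b k"
    using assms(1) unfolding scal_deriv_le_def by blast
  obtain G where G: "g holomorphic_on D" "continuous_on (closure D - {0}) g"
     "continuous_on (closure D - {0}) G" "\<forall>k\<in>D. G k = (deriv ^^ j) g k" "\<forall>k\<in>closure D - {0}. norm (G k) \<le> b' k"
    using assms(2) unfolding scal_deriv_le_def by blast
  show ?thesis unfolding scal_deriv_le_def
  proof (intro exI[of _ "\<lambda>k. x * F k + y * G k"] conjI ballI)
    fix k assume k: "k \<in> D"
    have "(deriv ^^ j) (\<lambda>k. x * f k + y * g k) k = (deriv ^^ j) (\<lambda>k. x * f k) k + (deriv ^^ j) (\<lambda>k. y * g k) k"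
      by (rule higher_deriv_add[OF _ _ D k]) (auto intro!: holomorphic_intros F G)
    also have "\<dots> = x * (deriv ^^ j) f k + y * (deriv ^^ j) g k"
      using higher_deriv_cmult[OF F(1) k D] higher_deriv_cmult[OF G(1) k D] by simp
    finally show "x * F k + y * G k = (deriv ^^ j) (\<lambda>k. x * f k + y * g k) k" using F G k by simp
  next
    fix k assume k: "k \<in> closure D - {0}"
    show "norm (x * F k + y * G k) \<le> norm x * b k + norm y * b' k"
      using F(5) G(5) k by (intro norm_triangle_le add_mono) (auto simp: norm_mult mult_left_mono)
  qed (intro holomorphic_intros continuous_intros F G)+
qed

lemma scal_deriv_le_mono:
  assumes "scal_deriv_le j D f b" "\<And>k. k \<in> closure D - {0} \<Longrightarrow> b k \<le> b' k"
  shows "scal_deriv_le j D f b'"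
  using assms unfolding scal_deriv_le_def by (meson order_trans)

lemma scal_deriv_le_holomorphic:
  assumes f: "f holomorphic_on - {0}" and D: "0 \<notin> D"
    and b: "\<And>k. k \<in> closure D - {0} \<Longrightarrow> norm ((deriv ^^ j) f k) \<le> b k"
  shows "scal_deriv_le j D f b"
  unfolding scal_deriv_le_def
proof (intro exI[of _ "(deriv ^^ j) f"] conjI ballI)
  show "f holomorphic_on D" by (rule holomorphic_on_subset[OF f]) (use D in auto)
  show "continuous_on (closure D - {0}) f"
    by (rule holomorphic_on_imp_continuous_on, rule holomorphic_on_subset[OF f]) auto
  have "(deriv ^^ j) f holomorphic_on - {0}" by (rule holomorphic_higher_deriv[OF f]) auto
  then show "continuous_on (closure D - {0}) ((deriv ^^ j) f)"
    by (intro holomorphic_on_imp_continuous_on) (rule holomorphic_on_subset, auto)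
qed (use b in auto)

lemma higher_deriv_sum_lessThan:
  fixes N :: nat
  assumes "\<And>i. d i holomorphic_on S" "open S" "z \<in> S"
  shows "(deriv ^^ j) (\<lambda>k. \<Sum>i<N. d i k) z = (\<Sum>i<N. (deriv ^^ j) (d i) z)"
proof (induction N)
  case 0 then show ?case by (simp add: higher_deriv_const)
next
  case (Suc N)
  have "(deriv ^^ j) (\<lambda>k. (\<Sum>i<N. d i k) + d N k) z = (deriv ^^ j) (\<lambda>k. \<Sum>i<N. d i k) z + (deriv ^^ j) (d N) z"
    by (rule higher_deriv_add) (auto intro!: holomorphic_intros assms)
  then show ?case using Suc by simp
qed

text \<open>The partial sums are holomorphic on the punctured plane, hence continuous up to the boundary together
  with their derivatives. The majorants make the convergence of the derivatives up to order n locally uniform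
  away from 0, up to the boundary, so the limit inherits the extension as well as the bound.\<close>

lemma scal_deriv_le_series:
  fixes d :: "nat \<Rightarrow> complex \<Rightarrow> complex" and \<alpha> :: "nat \<Rightarrow> real"
  assumes hol: "\<And>i. d i holomorphic_on - {0}" and D: "open D" "0 \<notin> D" and sub: "closure D - {0} \<subseteq> S"
    and c: "\<And>j. j \<le> n \<Longrightarrow> c j \<ge> 0"
    and bd: "\<And>i j k. j \<le> n \<Longrightarrow> k \<in> S \<Longrightarrow> norm ((deriv ^^ j) (d i) k) \<le> c j * norm k ^ p / norm k ^ (2 * j) * \<alpha> i"
    and S: "\<And>k. k \<in> S \<Longrightarrow> k \<noteq> 0 \<and> norm k \<le> 1"
    and \<alpha>: "summable \<alpha>" "suminf \<alpha> \<le> A" "\<And>i. 0 \<le> \<alpha> i"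
    and lim: "\<And>k. k \<in> S \<Longrightarrow> (\<lambda>N. \<Sum>i<N. d i k) \<longlonglongrightarrow> f k"
    and j: "j \<le> n"
  shows "scal_deriv_le j D f (\<lambda>k. c j * norm k ^ p / norm k ^ (2 * j) * A)"
proof -
  define g where "g j k = (\<Sum>i. (deriv ^^ j) (d i) k)" for j k
  define S' where "S' \<delta> = S \<inter> {k. \<delta> < norm k}" for \<delta> :: real
  have ul: "uniform_limit (S' \<delta>) (\<lambda>N k. \<Sum>i<N. (deriv ^^ j) (d i) k) (g j) sequentially"
    if "\<delta> > 0" "j \<le> n" for \<delta> j
    unfolding g_def
  proof (rule Weierstrass_m_test)
    fix i k assume k: "k \<in> S' \<delta>"
    have "norm ((deriv ^^ j) (d i) k) \<le> c j * norm k ^ p / norm k ^ (2 * j) * \<alpha> i"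
      using bd[OF \<open>j \<le> n\<close>] k by (auto simp: S'_def)
    also have "\<dots> \<le> c j * 1 / \<delta> ^ (2 * j) * \<alpha> i"
    proof (intro mult_right_mono frac_le mult_left_mono \<alpha>(3))
      show "norm k ^ p \<le> 1" using S[of k] k by (auto simp: S'_def intro: power_le_one)
      show "\<delta> ^ (2 * j) \<le> norm k ^ (2 * j)" using k that by (auto simp: S'_def intro!: power_mono)
    qed (use c that in auto)
    finally show "norm ((deriv ^^ j) (d i) k) \<le> c j * 1 / \<delta> ^ (2 * j) * \<alpha> i" .
  next
    show "summable (\<lambda>i. c j * 1 / \<delta> ^ (2 * j) * \<alpha> i)" by (intro summable_mult \<alpha>)
  qed
  have holj: "(deriv ^^ j) (d i) holomorphic_on - {0}" for i j
    by (rule holomorphic_higher_deriv[OF hol]) auto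
  have cont: "continuous_on (closure D - {0}) (g j)" if "j \<le> n" for j
    unfolding continuous_on_eq_continuous_within
  proof
    fix z assume z: "z \<in> closure D - {0}"
    define \<delta> where "\<delta> = norm z / 2"
    have \<delta>: "\<delta> > 0" using z by (simp add: \<delta>_def)
    have "continuous_on (S' \<delta>) (g j)"
    proof (rule uniform_limit_theorem[OF _ ul[OF \<delta> that]])
      have "continuous_on (S' \<delta>) (\<lambda>k. \<Sum>i<N. (deriv ^^ j) (d i) k)" for N
        using \<delta> by (intro continuous_on_sum continuous_on_subset[OF holomorphic_on_imp_continuous_on[OF holj]]) (auto simp: S'_def)
      then show "\<forall>\<^sub>F N in sequentially. continuous_on (S' \<delta>) (\<lambda>k. \<Sum>i<N. (deriv ^^ j) (d i) k)" by simp
    qed simp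
    then have "continuous_on ((closure D - {0}) \<inter> {k. \<delta> < norm k}) (g j)"
      by (rule continuous_on_subset) (use sub in \<open>auto simp: S'_def\<close>)
    moreover have "z \<in> (closure D - {0}) \<inter> {k. \<delta> < norm k}" using z by (simp add: \<delta>_def)
    ultimately have "continuous (at z within (closure D - {0}) \<inter> {k. \<delta> < norm k}) (g j)"
      by (simp add: continuous_on_eq_continuous_within)
    moreover have "at z within (closure D - {0}) \<inter> {k. \<delta> < norm k} = at z within (closure D - {0})"
    proof (rule at_within_nhd[where S = "{k. \<delta> < norm k}"])
      show "z \<in> {k. \<delta> < norm k}" using z by (simp add: \<delta>_def)
      show "open {k::complex. \<delta> < norm k}" by (intro open_Collect_less continuous_intros)
    qed auto
    ultimately show "continuous (at z within closure D - {0}) (g j)" by simp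
  qed
  have fg: "f k = g 0 k" if "k \<in> S" for k
  proof -
    have "k \<in> S' (norm k / 2)" "norm k / 2 > 0" using S[OF that] that by (auto simp: S'_def)
    then have "(\<lambda>N. \<Sum>i<N. (deriv ^^ 0) (d i) k) \<longlonglongrightarrow> g 0 k"
      by (intro tendsto_uniform_limitI[OF ul]) auto
    then show ?thesis using LIMSEQ_unique[OF lim[OF that]] by simp
  qed
  have DS: "D \<subseteq> S" using sub D closure_subset[of D] by auto
  have near: "\<exists>r>0. cball z r \<subseteq> D \<and> (\<exists>\<delta>>0. cball z r \<subseteq> S' \<delta>)" if z: "z \<in> D" for z
  proof -
    have z0: "z \<noteq> 0" using z D by auto
    have "open (D \<inter> {k. norm z / 2 < norm k})"
      by (intro open_Int D open_Collect_less continuous_intros)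
    moreover have "z \<in> D \<inter> {k. norm z / 2 < norm k}" using z z0 by simp
    ultimately obtain r where "r > 0" "cball z r \<subseteq> D \<inter> {k. norm z / 2 < norm k}"
      using open_contains_cball by blast
    then show ?thesis using z0 DS by (intro exI[of _ r]) (auto simp: S'_def intro!: exI[of _ "norm z / 2"])
  qed
  have ulf: "uniform_limit X (\<lambda>N k. \<Sum>i<N. d i k) f sequentially" if "X \<subseteq> S' \<delta>" "\<delta> > 0" for X \<delta>
  proof -
    have "uniform_limit X (\<lambda>N k. \<Sum>i<N. d i k) (g 0) sequentially"
      using uniform_limit_on_subset[OF ul[OF that(2), of 0] that(1)] by simp
    then show ?thesis
      by (rule uniform_limit_cong'[THEN iffD1, rotated -1]) (use that fg in \<open>auto simp: S'_def\<close>)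
  qed
  have holsum: "(\<lambda>k. \<Sum>i<N. d i k) holomorphic_on - {0}" for N by (intro holomorphic_intros hol)
  show ?thesis unfolding scal_deriv_le_def
  proof (intro exI[of _ "g j"] conjI ballI)
    show "f holomorphic_on D"
    proof (rule holomorphic_uniform_sequence[OF D(1)])
      show "(\<lambda>k. \<Sum>i<N. d i k) holomorphic_on D" for N
        by (rule holomorphic_on_subset[OF holsum]) (use D in auto)
      fix z assume "z \<in> D"
      then show "\<exists>r>0. cball z r \<subseteq> D \<and> uniform_limit (cball z r) (\<lambda>N k. \<Sum>i<N. d i k) f sequentially"
        using near[of z] ulf by meson
    qed
    show "continuous_on (closure D - {0}) f"
      using cont[of 0] by (rule continuous_on_eq) (use sub fg in auto)
    show "continuous_on (closure D - {0}) (g j)" by (rule cont[OF j])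
  next
    fix z assume z: "z \<in> D"
    obtain r \<delta> where r: "r > 0" "cball z r \<subseteq> D" "\<delta> > 0" "cball z r \<subseteq> S' \<delta>" using near[OF z] by auto
    have "(\<lambda>N. (deriv ^^ j) (\<lambda>k. \<Sum>i<N. d i k) z) \<longlonglongrightarrow> (deriv ^^ j) f z"
    proof (rule higher_deriv_complex_uniform_limit)
      show "uniform_limit (ball z r) (\<lambda>N k. \<Sum>i<N. d i k) f sequentially"
        by (rule ulf[OF _ r(3)]) (use r ball_subset_cball in blast)
      have "0 \<notin> cball z r" using r(2) D(2) by blast
      then have "(\<lambda>k. \<Sum>i<N. d i k) holomorphic_on ball z r" for N
        by (intro holomorphic_on_subset[OF holsum]) auto
      then show "\<forall>\<^sub>F N in sequentially. (\<lambda>k. \<Sum>i<N. d i k) holomorphic_on ball z r" by simp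
    qed (use r in auto)
    moreover have "(\<lambda>N. \<Sum>i<N. (deriv ^^ j) (d i) z) \<longlonglongrightarrow> g j z"
      by (intro tendsto_uniform_limitI[OF ul[OF r(3) j]]) (use r in auto)
    moreover have "(deriv ^^ j) (\<lambda>k. \<Sum>i<N. d i k) z = (\<Sum>i<N. (deriv ^^ j) (d i) z)" for N
      by (rule higher_deriv_sum_lessThan[OF hol]) (use z D in auto)
    ultimately show "g j z = (deriv ^^ j) f z" using LIMSEQ_unique by simp
  next
    fix k assume k: "k \<in> closure D - {0}"
    then have kS: "k \<in> S" using sub by blast
    define b where "b = c j * norm k ^ p / norm k ^ (2 * j)"
    have b0: "b \<ge> 0" using c[OF j] by (simp add: b_def)
    have "norm (g j k) \<le> (\<Sum>i. b * \<alpha> i)"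
      unfolding g_def
    proof (rule norm_suminf_le)
      show "norm ((deriv ^^ j) (d i) k) \<le> b * \<alpha> i" for i using bd[OF j kS] by (simp add: b_def)
      show "summable (\<lambda>i. b * \<alpha> i)" by (intro summable_mult \<alpha>)
    qed
    also have "\<dots> = b * suminf \<alpha>" by (rule suminf_mult[OF \<alpha>(1)])
    also have "\<dots> \<le> b * A" using \<alpha>(2) b0 by (rule mult_left_mono)
    finally show "norm (g j k) \<le> c j * norm k ^ p / norm k ^ (2 * j) * A" by (simp add: b_def)
  qed
qed

section \<open>The gauged system\<close>

text \<open>The system satisfied by a column after the gauge transformation: the coefficients s and c carry a
  factor k instead of \<open>1 / k\<close>.\<close>

definition gsys where
  "gsys \<epsilon> k q s c = colsys (phase \<epsilon> k) (\<lambda>t. - \<epsilon> * \<i> * k * c t / 4) (\<lambda>t. - \<epsilon> * q t / 4 + \<i> * k * s t / 4)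
      (\<lambda>t. \<epsilon> * q t / 4 + \<i> * k * s t / 4) (\<lambda>t. \<epsilon> * \<i> * k * c t / 4)"

lemma phase_minus: "phase (- \<epsilon>) k = - phase \<epsilon> k"
  by (simp add: phase_def)

lemma gsys_swap:
  assumes "gsys \<epsilon> k q s c f g u w"
  shows "gsys (- \<epsilon>) k q s c (\<lambda>t. exp (- phase \<epsilon> k * of_real t) * g t) (\<lambda>t. exp (- phase \<epsilon> k * of_real t) * f t)
           (\<lambda>t. exp (- phase \<epsilon> k * of_real t) * w t) (\<lambda>t. exp (- phase \<epsilon> k * of_real t) * u t)"
  using colsys_swap[OF assms[unfolded gsys_def]] unfolding gsys_def phase_minus by simp

lemmas gsys_lincomb = colsys_lincomb[where a = "\<lambda>t. - \<epsilon> * \<i> * k * c t / 4" and b = "\<lambda>t. - \<epsilon> * q t / 4 + \<i> * k * s t / 4"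
   and c = "\<lambda>t. \<epsilon> * q t / 4 + \<i> * k * s t / 4" and d = "\<lambda>t. \<epsilon> * \<i> * k * c t / 4" and h = "phase \<epsilon> k" for \<epsilon> k q s c, folded gsys_def]

text \<open>Integrability of q, s and c on the whole half-line makes the bounds below uniform in time, with the
  constant E for \<open>|k| \<le> 1\<close>.\<close>

locale potential =
  fixes q s c :: "real \<Rightarrow> complex"
  assumes cq: "continuous_on {0..} q" and cs: "continuous_on {0..} s" and cc: "continuous_on {0..} c"
    and Lq: "q absolutely_integrable_on {0..}" and Ls: "s absolutely_integrable_on {0..}"
    and Lc: "c absolutely_integrable_on {0..}"
begin

definition v where "v t = norm (q t) + norm (s t) + norm (c t)"
definition E where "E = exp 1 * exp (exp 1 * integral {0..} v)"

lemma v_nonneg: "v t \<ge> 0" by (simp add: v_def)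

lemma v_integrable: "v integrable_on {0..}"
  using Lq Ls Lc unfolding v_def absolutely_integrable_on_def by (intro integrable_add) auto

lemma v_continuous: "continuous_on {0..} v"
  unfolding v_def by (intro continuous_intros cq cs cc)

lemma v_integral_le: "0 \<le> x \<Longrightarrow> integral {x..y} v \<le> integral {0..} v"
  using v_integrable v_nonneg
  by (intro integral_subset_le) (auto intro: integrable_on_subinterval)

lemma E_ge_1: "E \<ge> 1"
proof -
  have "integral {0..} v \<ge> 0" by (rule integral_nonneg[OF v_integrable v_nonneg])
  then show ?thesis unfolding E_def exp_add[symmetric] one_le_exp_iff by (intro add_nonneg_nonneg mult_nonneg_nonneg) auto
qed

lemma gsys_bounds:
  assumes sys: "gsys \<epsilon> k q s c f g u w" and e: "norm \<epsilon> = 1" and k: "norm k \<le> 2"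
    and fg: "\<And>t. t \<ge> 0 \<Longrightarrow> norm (f t) + norm (g t) \<le> \<phi> t"
  shows "column_bounds (phase \<epsilon> k) (\<lambda>t. - \<epsilon> * \<i> * k * c t / 4) (\<lambda>t. - \<epsilon> * q t / 4 + \<i> * k * s t / 4)
      (\<lambda>t. \<epsilon> * q t / 4 + \<i> * k * s t / 4) (\<lambda>t. \<epsilon> * \<i> * k * c t / 4) f g u w v \<phi>"
proof
  fix t :: real assume t: "t \<ge> 0"
  have kx: "norm k * x \<le> x * 4" if "x \<ge> 0" for x
    using mult_right_mono[OF k that] that by linarith
  have d: "norm (\<epsilon> * \<i> * k * c t / 4) \<le> norm (c t)" "norm (- \<epsilon> * \<i> * k * c t / 4) \<le> norm (c t)"
    using kx[of "norm (c t)"] by (simp_all add: norm_mult norm_divide e)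
  have ks: "norm (\<i> * k * s t / 4) \<le> norm (s t)"
    using kx[of "norm (s t)"] by (simp_all add: norm_mult norm_divide e)
  have "norm (\<epsilon> * q t / 4 + \<i> * k * s t / 4) \<le> norm (\<epsilon> * q t / 4) + norm (\<i> * k * s t / 4)"
    by (rule norm_triangle_ineq)
  moreover have "norm (- \<epsilon> * q t / 4 + \<i> * k * s t / 4) \<le> norm (- \<epsilon> * q t / 4) + norm (\<i> * k * s t / 4)"
    by (rule norm_triangle_ineq)
  moreover have "norm (\<epsilon> * q t / 4) \<le> norm (q t)" "norm (- \<epsilon> * q t / 4) \<le> norm (q t)"
    by (simp_all add: norm_mult norm_divide e)
  ultimately show "norm (- \<epsilon> * \<i> * k * c t / 4) + norm (\<epsilon> * q t / 4 + \<i> * k * s t / 4) \<le> v t"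
    "norm (- \<epsilon> * q t / 4 + \<i> * k * s t / 4) + norm (\<epsilon> * \<i> * k * c t / 4) \<le> v t"
    using d ks unfolding v_def by linarith+
next
  show "colsys (phase \<epsilon> k) (\<lambda>t. - \<epsilon> * \<i> * k * c t / 4) (\<lambda>t. - \<epsilon> * q t / 4 + \<i> * k * s t / 4)
      (\<lambda>t. \<epsilon> * q t / 4 + \<i> * k * s t / 4) (\<lambda>t. \<epsilon> * \<i> * k * c t / 4) f g u w"
    using sys by (simp add: gsys_def)
qed (auto intro!: continuous_intros cq cs cc v_continuous fg)

lemma E_mono:
  assumes "x \<ge> 0" "0 \<le> A"
  shows "exp 1 * A * exp (exp 1 * integral {x..y} v) \<le> E * A"
proof -
  have "exp 1 * A * exp (exp 1 * integral {x..y} v) \<le> exp 1 * A * exp (exp 1 * integral {0..} v)"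
    using v_integral_le[OF assms(1)] assms(2) by (intro mult_left_mono) auto
  then show ?thesis by (simp add: E_def algebra_simps)
qed

lemma gsys_forward:
  assumes sys: "gsys \<epsilon> k' q s c f g u w" and e: "norm \<epsilon> = 1" and k: "k \<noteq> 0" "norm k \<le> 1"
    and R: "0 \<le> R" and d: "norm (k' - k) \<le> (norm k)\<^sup>2 / (4 * (1 + R))" and re: "Re (phase \<epsilon> k) \<le> 0"
    and fg: "\<And>t. t \<ge> 0 \<Longrightarrow> norm (f t) + norm (g t) \<le> \<phi> t"
    and xy: "0 \<le> x" "x \<le> y" "y \<le> R" and \<phi>: "\<phi> integrable_on {x..y}"
  shows "norm (u y) + norm (w y) \<le> E * (norm (u x) + norm (w x) + integral {x..y} \<phi>)"
proof -
  have k2: "norm k' \<le> 2" using disc_nonzero(2)[OF k R d] k by linarith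
  interpret column_bounds "phase \<epsilon> k'" "\<lambda>t. - \<epsilon> * \<i> * k' * c t / 4" "\<lambda>t. - \<epsilon> * q t / 4 + \<i> * k' * s t / 4"
      "\<lambda>t. \<epsilon> * q t / 4 + \<i> * k' * s t / 4" "\<lambda>t. \<epsilon> * \<i> * k' * c t / 4" f g u w v \<phi>
    by (rule gsys_bounds[OF sys e k2 fg])
  have "Y y \<le> exp 1 * (Y x + integral {x..y} \<phi>) * exp (exp 1 * integral {x..y} v)"
  proof (rule forward_bound[OF xy(1,2) \<phi>])
    fix r t assume "x \<le> r" "r \<le> t" "t \<le> y"
    then show "norm (exp (phase \<epsilon> k' * of_real (t - r))) \<le> exp 1"
      using xy re by (intro phase_exp_le[OF e k R d]) (auto intro: mult_nonpos_nonneg)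
  qed simp
  also have "\<dots> \<le> E * (Y x + integral {x..y} \<phi>)"
    using xy \<phi>_nonneg integral_nonneg[OF \<phi>] by (intro E_mono) (auto simp: Y_def intro!: add_nonneg_nonneg)
  finally show ?thesis by (simp add: Y_def)
qed

lemma gsys_backward:
  assumes sys: "gsys \<epsilon> k' q s c f g u w" and e: "norm \<epsilon> = 1" and k: "k \<noteq> 0" "norm k \<le> 1"
    and R: "0 \<le> R" and d: "norm (k' - k) \<le> (norm k)\<^sup>2 / (4 * (1 + R))" and re: "Re (phase \<epsilon> k) \<ge> 0"
    and fg: "\<And>t. t \<ge> 0 \<Longrightarrow> norm (f t) + norm (g t) \<le> \<phi> t"
    and xy: "0 \<le> x" "x \<le> y" "y \<le> R" and \<phi>: "\<phi> integrable_on {x..y}"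
  shows "norm (u x) + norm (w x) \<le> E * (norm (u y) + norm (w y) + integral {x..y} \<phi>)"
proof -
  have k2: "norm k' \<le> 2" using disc_nonzero(2)[OF k R d] k by linarith
  interpret column_bounds "phase \<epsilon> k'" "\<lambda>t. - \<epsilon> * \<i> * k' * c t / 4" "\<lambda>t. - \<epsilon> * q t / 4 + \<i> * k' * s t / 4"
      "\<lambda>t. \<epsilon> * q t / 4 + \<i> * k' * s t / 4" "\<lambda>t. \<epsilon> * \<i> * k' * c t / 4" f g u w v \<phi>
    by (rule gsys_bounds[OF sys e k2 fg])
  have "Y x \<le> exp 1 * (Y y + integral {x..y} \<phi>) * exp (exp 1 * integral {x..y} v)"
  proof (rule backward_bound[OF xy(1,2) \<phi>])
    fix r t assume "x \<le> t" "t \<le> r" "r \<le> y"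
    then show "norm (exp (phase \<epsilon> k' * of_real (t - r))) \<le> exp 1"
      using xy re by (intro phase_exp_le[OF e k R d]) (auto intro: mult_nonneg_nonpos)
  qed simp
  also have "\<dots> \<le> E * (Y y + integral {x..y} \<phi>)"
    using xy \<phi>_nonneg integral_nonneg[OF \<phi>] by (intro E_mono) (auto simp: Y_def intro!: add_nonneg_nonneg)
  finally show ?thesis by (simp add: Y_def)
qed

section \<open>Error estimates for the gauged system\<close>

text \<open>The Gronwall bound holds on the disc of radius \<open>|k|\<^sup>2 / (4 (1 + t))\<close> around k, where the
  exponentials up to time t are bounded although the sign of the real part of the phase may change there.
  Cauchy's inequality gives the derivatives.\<close>

lemma forward_error:
  fixes u w f g :: "complex \<Rightarrow> real \<Rightarrow> complex"
  assumes e: "norm \<epsilon> = 1"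
    and sys: "\<And>k. k \<noteq> 0 \<Longrightarrow> gsys \<epsilon> k q s c (f k) (g k) (u k) (w k)"
    and init: "\<And>k. k \<noteq> 0 \<Longrightarrow> u k 0 = 0" "\<And>k. k \<noteq> 0 \<Longrightarrow> w k 0 = 0"
    and fg: "\<And>k t. k \<noteq> 0 \<Longrightarrow> norm k \<le> 2 \<Longrightarrow> t \<ge> 0 \<Longrightarrow>
       norm (f k t) + norm (g k t) \<le> norm k ^ p * (1 + norm (exp (phase \<epsilon> k * of_real t))) * \<phi> t"
    and \<phi>: "\<phi> integrable_on {0..}" "\<And>t. t \<ge> 0 \<Longrightarrow> \<phi> t \<ge> 0"
    and k: "k \<noteq> 0" "norm k \<le> 1" and re: "Re (phase \<epsilon> k) \<le> 0"
    and t: "t \<ge> 0"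
    and hol: "(\<lambda>k. u k t) holomorphic_on - {0}" "(\<lambda>k. w k t) holomorphic_on - {0}"
  shows "norm ((deriv ^^ j) (\<lambda>k. u k t) k) \<le> fact j * 4 ^ j * (E * (2 ^ p * (1 + exp 1) * integral {0..} \<phi>)) * ((1 + t) ^ j * norm k ^ p / norm k ^ (2 * j))" (is ?th1)
    and "norm ((deriv ^^ j) (\<lambda>k. w k t) k) \<le> fact j * 4 ^ j * (E * (2 ^ p * (1 + exp 1) * integral {0..} \<phi>)) * ((1 + t) ^ j * norm k ^ p / norm k ^ (2 * j))" (is ?th2)
proof -
  define B where "B = E * (2 ^ p * (1 + exp 1) * integral {0..} \<phi>) * norm k ^ p"
  have \<phi>t: "\<phi> integrable_on {0..t}" by (rule integrable_on_subinterval[OF \<phi>(1)]) auto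
  have bd: "norm (u k' t) + norm (w k' t) \<le> B" if k': "norm (k' - k) \<le> (norm k)\<^sup>2 / (4 * (1 + t))" for k'
  proof -
    note n = disc_nonzero[OF k t k']
    define C where "C = 2 ^ p * norm k ^ p * (1 + exp 1)"
    define f' where "f' r = (if r \<le> t then f k' r else 0)" for r
    define g' where "g' r = (if r \<le> t then g k' r else 0)" for r
    define \<psi> where "\<psi> r = (if r \<le> t then C * \<phi> r else norm (f k' r) + norm (g k' r))" for r
    have \<psi>: "norm (f k' r) + norm (g k' r) \<le> \<psi> r" if r: "r \<ge> 0" for r
    proof (cases "r \<le> t")
      case True
      have "norm k' \<le> 2" using n k by linarith
      from fg[OF n(1) this r]
      have "norm (f k' r) + norm (g k' r) \<le> norm k' ^ p * (1 + norm (exp (phase \<epsilon> k' * of_real r))) * \<phi> r" .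
      also have "\<dots> \<le> (2 * norm k) ^ p * (1 + exp 1) * \<phi> r"
        using n phase_exp_le[OF e k t k', of r] True r re \<phi>
        by (intro mult_right_mono mult_mono power_mono) (auto intro: mult_nonpos_nonneg)
      finally show ?thesis using True by (simp add: \<psi>_def C_def power_mult_distrib)
    qed (simp add: \<psi>_def)
    have ie: "integral {0..t} \<psi> = C * integral {0..t} \<phi>"
      unfolding \<psi>_def Henstock_Kurzweil_Integration.integral_mult_right[symmetric]
      by (rule Henstock_Kurzweil_Integration.integral_cong) auto
    have "\<psi> integrable_on {0..t}"
      using integrable_on_mult_right[OF \<phi>t, of C] by (rule integrable_eq) (auto simp: \<psi>_def)
    from gsys_forward[OF sys[OF n(1)] e k t k' re \<psi> _ t _ this]
    have "norm (u k' t) + norm (w k' t) \<le> E * (norm (u k' 0) + norm (w k' 0) + integral {0..t} \<psi>)" by simp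
    also have "\<dots> = E * (C * integral {0..t} \<phi>)" using init[OF n(1)] ie by simp
    also have "\<dots> \<le> E * (C * integral {0..} \<phi>)"
      using E_ge_1 \<phi> \<phi>t by (intro mult_left_mono integral_subset_le) (auto simp: C_def)
    finally show ?thesis by (simp add: B_def C_def algebra_simps)
  qed
  have 1: "norm ((deriv ^^ j) (\<lambda>k. u k t) k) \<le> fact j * 4 ^ j * B * (1 + t) ^ j / norm k ^ (2 * j)"
    by (rule cauchy_on_disc[OF hol(1) k t]) (use bd in \<open>smt (verit) norm_ge_zero\<close>)
  have 2: "norm ((deriv ^^ j) (\<lambda>k. w k t) k) \<le> fact j * 4 ^ j * B * (1 + t) ^ j / norm k ^ (2 * j)"
    by (rule cauchy_on_disc[OF hol(2) k t]) (use bd in \<open>smt (verit) norm_ge_zero\<close>)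
  show ?th1 using 1 by (simp add: B_def mult_ac)
  show ?th2 using 2 by (simp add: B_def mult_ac)
qed

text \<open>The pair (xu, xw) approaches the approximate solution at infinity, and is known at parameters with a
  phase of nonnegative real part only. It is approximated by the solutions that agree with the approximate
  solution at a time R, expressed by the fundamental solutions p and r.\<close>

lemma backward_error:
  fixes pu pw ru rw \<tau>u \<tau>w xu xw f g :: "complex \<Rightarrow> real \<Rightarrow> complex"
  assumes e: "norm \<epsilon> = 1"
    and p: "\<And>k. k \<noteq> 0 \<Longrightarrow> gsys \<epsilon> k q s c (\<lambda>_. 0) (\<lambda>_. 0) (pu k) (pw k)"
    and r: "\<And>k. k \<noteq> 0 \<Longrightarrow> gsys \<epsilon> k q s c (\<lambda>_. 0) (\<lambda>_. 0) (ru k) (rw k)"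
    and det: "\<And>k t. k \<noteq> 0 \<Longrightarrow> t \<ge> 0 \<Longrightarrow> pu k t * rw k t - pw k t * ru k t \<noteq> 0"
    and hol: "\<And>t. t \<ge> 0 \<Longrightarrow> (\<lambda>k. pu k t) holomorphic_on - {0}" "\<And>t. t \<ge> 0 \<Longrightarrow> (\<lambda>k. pw k t) holomorphic_on - {0}"
      "\<And>t. t \<ge> 0 \<Longrightarrow> (\<lambda>k. ru k t) holomorphic_on - {0}" "\<And>t. t \<ge> 0 \<Longrightarrow> (\<lambda>k. rw k t) holomorphic_on - {0}"
      "\<And>t. t \<ge> 0 \<Longrightarrow> (\<lambda>k. \<tau>u k t) holomorphic_on - {0}" "\<And>t. t \<ge> 0 \<Longrightarrow> (\<lambda>k. \<tau>w k t) holomorphic_on - {0}"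
    and \<tau>: "\<And>k. k \<noteq> 0 \<Longrightarrow> gsys \<epsilon> k q s c (f k) (g k) (\<tau>u k) (\<tau>w k)"
    and fg: "\<And>k t. k \<noteq> 0 \<Longrightarrow> norm k \<le> 2 \<Longrightarrow> t \<ge> 0 \<Longrightarrow> norm (f k t) + norm (g k t) \<le> norm k ^ p * \<phi> t"
    and \<phi>: "(\<lambda>t. (1 + t) ^ n * \<phi> t) integrable_on {0..}" "\<And>t. t \<ge> 0 \<Longrightarrow> \<phi> t \<ge> 0"
      "\<And>a b. 0 \<le> a \<Longrightarrow> \<phi> integrable_on {a..b}"
    and x: "\<And>k. k \<noteq> 0 \<Longrightarrow> norm k \<le> 1 \<Longrightarrow> Re (phase \<epsilon> k) \<ge> 0 \<Longrightarrow> gsys \<epsilon> k q s c (\<lambda>_. 0) (\<lambda>_. 0) (xu k) (xw k)"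
    and x_lim: "\<And>k. k \<noteq> 0 \<Longrightarrow> norm k \<le> 1 \<Longrightarrow> Re (phase \<epsilon> k) \<ge> 0 \<Longrightarrow> ((\<lambda>t. xu k t - \<tau>u k t) \<longlongrightarrow> 0) at_top"
      "\<And>k. k \<noteq> 0 \<Longrightarrow> norm k \<le> 1 \<Longrightarrow> Re (phase \<epsilon> k) \<ge> 0 \<Longrightarrow> ((\<lambda>t. xw k t - \<tau>w k t) \<longlongrightarrow> 0) at_top"
    and D: "open D" "0 \<notin> D" "\<And>k. k \<in> closure D - {0} \<Longrightarrow> norm k \<le> 1 \<and> Re (phase \<epsilon> k) \<ge> 0"
    and j: "j \<le> n" and t: "t \<ge> 0"
  defines "C \<equiv> \<lambda>j. fact j * 4 ^ j * 2 ^ j * (E * E * 2 ^ p)"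
  defines "A \<equiv> integral {0..} (\<lambda>t. (1 + t) ^ n * \<phi> t)"
  shows "scal_deriv_le j D (\<lambda>k. xu k t - \<tau>u k t) (\<lambda>k. C j / (1 + t) ^ (n - j) * norm k ^ p / norm k ^ (2 * j) * A)"
    and "scal_deriv_le j D (\<lambda>k. xw k t - \<tau>w k t) (\<lambda>k. C j / (1 + t) ^ (n - j) * norm k ^ p / norm k ^ (2 * j) * A)"
proof -
  define det where "det k R = pu k R * rw k R - pw k R * ru k R" for k R
  \<comment> \<open>Cramer's rule for the solution that equals the approximate one at time R.\<close>
  define al where "al R k = (\<tau>u k R * rw k R - \<tau>w k R * ru k R) / det k R" for R k
  define be where "be R k = (pu k R * \<tau>w k R - pw k R * \<tau>u k R) / det k R" for R k
  define yu where "yu R k t = al R k * pu k t + be R k * ru k t" for R k t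
  define yw where "yw R k t = al R k * pw k t + be R k * rw k t" for R k t
  define eu where "eu R k t = yu R k t - \<tau>u k t" for R k t
  define ew where "ew R k t = yw R k t - \<tau>w k t" for R k t
  have ysys: "gsys \<epsilon> k q s c (\<lambda>_. 0) (\<lambda>_. 0) (yu R k) (yw R k)" if "k \<noteq> 0" for R k
    using gsys_lincomb[OF p[OF that] r[OF that], of "al R k" "be R k"] unfolding yu_def yw_def by simp
  have esys: "gsys \<epsilon> k q s c (\<lambda>t. - f k t) (\<lambda>t. - g k t) (eu R k) (ew R k)" if "k \<noteq> 0" for R k
    using gsys_lincomb[OF ysys[OF that] \<tau>[OF that], of 1 "-1"] unfolding eu_def ew_def by simp
  have e0: "eu R k R = 0" "ew R k R = 0" if "k \<noteq> 0" "R \<ge> 0" for R k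
  proof -
    have d: "det k R \<noteq> 0" using assms(4)[OF that] by (simp add: det_def)
    have "al R k * pu k R + be R k * ru k R = \<tau>u k R * det k R / det k R"
      unfolding al_def be_def times_divide_eq_left add_divide_distrib[symmetric] by (simp add: det_def algebra_simps)
    then show "eu R k R = 0" using d by (simp add: eu_def yu_def)
    have "al R k * pw k R + be R k * rw k R = \<tau>w k R * det k R / det k R"
      unfolding al_def be_def times_divide_eq_left add_divide_distrib[symmetric] by (simp add: det_def algebra_simps)
    then show "ew R k R = 0" using d by (simp add: ew_def yw_def)
  qed
  have hole: "(\<lambda>k. eu R k r) holomorphic_on - {0}" "(\<lambda>k. ew R k r) holomorphic_on - {0}" if "R \<ge> 0" "r \<ge> 0" for R r
    using assms(4)[OF _ that(1)] unfolding eu_def ew_def yu_def yw_def al_def be_def det_def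
    by (auto intro!: holomorphic_intros hol that)
  \<comment> \<open>Dyadic times starting at t: \<open>1 + R (Suc i)\<close> is twice \<open>1 + R i\<close>.\<close>
  define R where "R i = 2 ^ i * (1 + t) - 1" for i :: nat
  have R1: "1 + R i = 2 ^ i * (1 + t)" for i by (simp add: R_def)
  have Rt: "t \<le> R i" for i
  proof -
    have "1 * (1 + t) \<le> 2 ^ i * (1 + t)" using t by (intro mult_right_mono) auto
    then show ?thesis by (simp add: R_def)
  qed
  have R0: "0 \<le> R i" for i using Rt[of i] t by linarith
  have Rm: "R i \<le> R (Suc i)" for i using R1[of i] R1[of "Suc i"] R0[of i] by (simp add: mult.assoc)
  define \<alpha> where "\<alpha> i = integral {R i..R (Suc i)} (\<lambda>t. (1 + t) ^ n * \<phi> t)" for i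
  have iw: "(\<lambda>t. (1 + t) ^ n * \<phi> t) integrable_on {a..b}" if "0 \<le> a" for a b
    by (rule integrable_on_subinterval[OF \<phi>(1)]) (use that in auto)
  have \<alpha>0: "0 \<le> \<alpha> i" for i
    unfolding \<alpha>_def using R0[of i] \<phi>(2) by (intro integral_nonneg iw) auto
  have \<alpha>sum: "(\<Sum>i<N. \<alpha> i) = integral {R 0..R N} (\<lambda>t. (1 + t) ^ n * \<phi> t)" for N
  proof (induction N)
    case (Suc N)
    have "R 0 \<le> R N" using Rt[of N] by (simp add: R_def)
    then show ?case using Suc R0[of 0] Rm[of N]
      by (simp add: \<alpha>_def) (intro Henstock_Kurzweil_Integration.integral_combine iw, auto)
  qed simp
  have \<alpha>le: "(\<Sum>i<N. \<alpha> i) \<le> A" for N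
    unfolding \<alpha>sum A_def using R0[of 0] \<phi>(2) by (intro integral_subset_le iw \<phi>(1)) auto
  have \<alpha>s: "summable \<alpha>" by (rule summableI_nonneg_bounded[OF \<alpha>0 \<alpha>le])
  have \<alpha>A: "suminf \<alpha> \<le> A" by (rule suminf_le_const[OF \<alpha>s \<alpha>le])
  have \<phi>\<alpha>: "integral {R i..R (Suc i)} \<phi> \<le> \<alpha> i / (1 + R i) ^ n" for i
  proof -
    have "integral {R i..R (Suc i)} \<phi> \<le> integral {R i..R (Suc i)} (\<lambda>t. (1 / (1 + R i) ^ n) * ((1 + t) ^ n * \<phi> t))"
    proof (rule integral_le)
      fix z assume z: "z \<in> {R i..R (Suc i)}"
      have "(1 + R i) ^ n \<le> (1 + z) ^ n" using z R0[of i] by (intro power_mono) auto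
      then have "1 \<le> (1 + z) ^ n / (1 + R i) ^ n" using R0[of i] by (simp add: le_divide_eq)
      then have "1 * \<phi> z \<le> (1 + z) ^ n / (1 + R i) ^ n * \<phi> z"
        using \<phi>(2)[of z] z R0[of i] by (intro mult_right_mono) auto
      then show "\<phi> z \<le> (1 / (1 + R i) ^ n) * ((1 + z) ^ n * \<phi> z)" by simp
    next
      show "(\<lambda>t. (1 / (1 + R i) ^ n) * ((1 + t) ^ n * \<phi> t)) integrable_on {R i..R (Suc i)}"
        by (intro integrable_on_mult_right iw R0)
    qed (intro \<phi>(3) R0)
    also have "\<dots> = \<alpha> i / (1 + R i) ^ n" by (simp add: \<alpha>_def)
    finally show ?thesis .
  qed
  define du where "du i k = eu (R (Suc i)) k t - eu (R i) k t" for i k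
  define dw where "dw i k = ew (R (Suc i)) k t - ew (R i) k t" for i k
  have hold: "du i holomorphic_on - {0}" "dw i holomorphic_on - {0}" for i
    unfolding du_def dw_def by (intro holomorphic_intros hole R0 t)+
  have dbd: "norm (du i k') + norm (dw i k') \<le> E * E * 2 ^ p * norm k ^ p * \<alpha> i / (1 + R i) ^ n"
    if k: "k \<noteq> 0" "norm k \<le> 1" "Re (phase \<epsilon> k) \<ge> 0"
      and k': "norm (k' - k) \<le> (norm k)\<^sup>2 / (4 * (1 + R (Suc i)))" for i k k'
  proof -
    note nz = disc_nonzero[OF k(1,2) R0 k']
    let ?K = "norm k' ^ p"
    have "norm (eu (R (Suc i)) k' (R i)) + norm (ew (R (Suc i)) k' (R i))
      \<le> E * (norm (eu (R (Suc i)) k' (R (Suc i))) + norm (ew (R (Suc i)) k' (R (Suc i))) + integral {R i..R (Suc i)} (\<lambda>t. ?K * \<phi> t))"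
    proof (rule gsys_backward[OF esys[OF nz(1)] e k(1,2) R0 k' k(3)])
      fix z :: real assume "z \<ge> 0"
      then show "norm (- f k' z) + norm (- g k' z) \<le> ?K * \<phi> z" using fg[OF nz(1)] nz(2) k(2) by simp
    qed (intro R0 Rm order_refl integrable_on_mult_right \<phi>(3))+
    also have "\<dots> = E * (?K * integral {R i..R (Suc i)} \<phi>)" using e0[OF nz(1) R0] by simp
    finally have 1: "norm (eu (R (Suc i)) k' (R i)) + norm (ew (R (Suc i)) k' (R i)) \<le> E * (?K * integral {R i..R (Suc i)} \<phi>)" .
    have dsys: "gsys \<epsilon> k' q s c (\<lambda>_. 0) (\<lambda>_. 0) (\<lambda>t. eu (R (Suc i)) k' t - eu (R i) k' t) (\<lambda>t. ew (R (Suc i)) k' t - ew (R i) k' t)"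
      using gsys_lincomb[OF esys[OF nz(1), of "R (Suc i)"] esys[OF nz(1), of "R i"], of 1 "-1"] by simp
    have "norm (du i k') + norm (dw i k') \<le> E * (norm (eu (R (Suc i)) k' (R i) - eu (R i) k' (R i)) + norm (ew (R (Suc i)) k' (R i) - ew (R i) k' (R i)) + integral {t..R i} (\<lambda>_. 0))"
      unfolding du_def dw_def
      by (rule gsys_backward[OF dsys e k(1,2) R0 k' k(3)]) (use t Rt Rm in auto)
    also have "\<dots> = E * (norm (eu (R (Suc i)) k' (R i)) + norm (ew (R (Suc i)) k' (R i)))"
      using e0[OF nz(1) R0] by simp
    also have "\<dots> \<le> E * (E * (?K * integral {R i..R (Suc i)} \<phi>))"
      using 1 E_ge_1 by (intro mult_left_mono) auto
    also have "\<dots> \<le> E * (E * ((2 * norm k) ^ p * (\<alpha> i / (1 + R i) ^ n)))"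
      using E_ge_1 nz(2) \<phi>\<alpha>[of i] R0[of i] \<phi>(2)
      by (intro mult_left_mono mult_mono power_mono integral_nonneg \<phi>(3)) auto
    finally show ?thesis by (simp add: power_mult_distrib algebra_simps)
  qed
  have Cb: "fact j * 4 ^ j * (E * E * 2 ^ p * norm k ^ p * \<alpha> i / (1 + R i) ^ n) * (1 + R (Suc i)) ^ j / norm k ^ (2 * j)
      \<le> C j / (1 + t) ^ (n - j) * norm k ^ p / norm k ^ (2 * j) * \<alpha> i" if j: "j \<le> n" for i j k
  proof -
    have "(1 + R (Suc i)) ^ j / (1 + R i) ^ n = 2 ^ j * ((1 + R i) ^ j / (1 + R i) ^ n)"
      unfolding R1 by (simp add: power_mult_distrib)
    also have "(1 + R i) ^ j / (1 + R i) ^ n = 1 / (1 + R i) ^ (n - j)"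
    proof -
      have "(1 + R i) ^ n = (1 + R i) ^ j * (1 + R i) ^ (n - j)" using j by (simp flip: power_add)
      then show ?thesis using R0[of i] by simp
    qed
    also have "\<dots> \<le> 1 / (1 + t) ^ (n - j)"
      using Rt[of i] t by (intro divide_left_mono power_mono mult_pos_pos) auto
    finally have *: "(1 + R (Suc i)) ^ j / (1 + R i) ^ n \<le> 2 ^ j * (1 / (1 + t) ^ (n - j))" by simp
    have "fact j * 4 ^ j * (E * E * 2 ^ p * norm k ^ p * \<alpha> i / (1 + R i) ^ n) * (1 + R (Suc i)) ^ j / norm k ^ (2 * j)
      = fact j * 4 ^ j * (E * E * 2 ^ p) * (norm k ^ p / norm k ^ (2 * j)) * \<alpha> i * ((1 + R (Suc i)) ^ j / (1 + R i) ^ n)"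
      by (simp add: mult_ac)
    also have "\<dots> \<le> fact j * 4 ^ j * (E * E * 2 ^ p) * (norm k ^ p / norm k ^ (2 * j)) * \<alpha> i * (2 ^ j * (1 / (1 + t) ^ (n - j)))"
      using E_ge_1 \<alpha>0[of i] by (intro mult_left_mono[OF *]) auto
    finally show ?thesis by (simp add: C_def mult_ac)
  qed
  have cau: "norm ((deriv ^^ j) (du i) k) \<le> C j / (1 + t) ^ (n - j) * norm k ^ p / norm k ^ (2 * j) * \<alpha> i"
    "norm ((deriv ^^ j) (dw i) k) \<le> C j / (1 + t) ^ (n - j) * norm k ^ p / norm k ^ (2 * j) * \<alpha> i"
    if k: "k \<noteq> 0" "norm k \<le> 1" "Re (phase \<epsilon> k) \<ge> 0" and j: "j \<le> n" for i j k
  proof -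
    have "norm ((deriv ^^ j) (du i) k) \<le> fact j * 4 ^ j * (E * E * 2 ^ p * norm k ^ p * \<alpha> i / (1 + R i) ^ n) * (1 + R (Suc i)) ^ j / norm k ^ (2 * j)"
      by (rule cauchy_on_disc[OF hold(1) k(1,2) R0]) (use dbd[OF k] in \<open>smt (verit) norm_ge_zero\<close>)
    then show "norm ((deriv ^^ j) (du i) k) \<le> C j / (1 + t) ^ (n - j) * norm k ^ p / norm k ^ (2 * j) * \<alpha> i"
      using Cb[OF j] by (rule order_trans)
    have "norm ((deriv ^^ j) (dw i) k) \<le> fact j * 4 ^ j * (E * E * 2 ^ p * norm k ^ p * \<alpha> i / (1 + R i) ^ n) * (1 + R (Suc i)) ^ j / norm k ^ (2 * j)"
      by (rule cauchy_on_disc[OF hold(2) k(1,2) R0]) (use dbd[OF k] in \<open>smt (verit) norm_ge_zero\<close>)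
    then show "norm ((deriv ^^ j) (dw i) k) \<le> C j / (1 + t) ^ (n - j) * norm k ^ p / norm k ^ (2 * j) * \<alpha> i"
      using Cb[OF j] by (rule order_trans)
  qed
  define S where "S = {k. k \<noteq> 0 \<and> norm k \<le> 1 \<and> Re (phase \<epsilon> k) \<ge> 0}"
  have Rinf: "filterlim R at_top sequentially"
    unfolding R_def using t by real_asymp
  have lim: "(\<lambda>N. \<Sum>i<N. du i k) \<longlonglongrightarrow> xu k t - \<tau>u k t" "(\<lambda>N. \<Sum>i<N. dw i k) \<longlonglongrightarrow> xw k t - \<tau>w k t" if k: "k \<in> S" for k
  proof -
    have k': "k \<noteq> 0" "norm k \<le> 1" "Re (phase \<epsilon> k) \<ge> 0" using k by (auto simp: S_def)
    have R00: "R 0 = t" by (simp add: R_def)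
    have s: "(\<Sum>i<N. du i k) = eu (R N) k t" "(\<Sum>i<N. dw i k) = ew (R N) k t" for N
      using sum_lessThan_telescope[of "\<lambda>i. eu (R i) k t" N] sum_lessThan_telescope[of "\<lambda>i. ew (R i) k t" N] e0[OF k'(1) t] R00
      by (auto simp: du_def dw_def)
    have l: "(\<lambda>N. xu k (R N) - \<tau>u k (R N)) \<longlonglongrightarrow> 0" "(\<lambda>N. xw k (R N) - \<tau>w k (R N)) \<longlonglongrightarrow> 0"
      by (rule filterlim_compose[OF x_lim(1)[OF k'] Rinf], rule filterlim_compose[OF x_lim(2)[OF k'] Rinf])
    define b where "b N = E * (norm (xu k (R N) - \<tau>u k (R N)) + norm (xw k (R N) - \<tau>w k (R N)))" for N
    have "b \<longlonglongrightarrow> E * (norm (0::complex) + norm (0::complex))"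
      unfolding b_def by (intro tendsto_intros l)
    then have b0: "b \<longlonglongrightarrow> 0" by simp
    have bN: "norm (xu k t - yu (R N) k t) + norm (xw k t - yw (R N) k t) \<le> b N" for N
    proof -
      have dsys: "gsys \<epsilon> k q s c (\<lambda>_. 0) (\<lambda>_. 0) (\<lambda>t. xu k t - yu (R N) k t) (\<lambda>t. xw k t - yw (R N) k t)"
        using gsys_lincomb[OF x[OF k'] ysys[OF k'(1), of "R N"], of 1 "-1"] by simp
      have "norm (xu k t - yu (R N) k t) + norm (xw k t - yw (R N) k t) \<le>
         E * (norm (xu k (R N) - yu (R N) k (R N)) + norm (xw k (R N) - yw (R N) k (R N)) + integral {t..R N} (\<lambda>_. 0))"
        by (rule gsys_backward[OF dsys e k'(1,2) R0[of N] _ k'(3)]) (use t Rt R0[of N] in auto)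
      moreover have "yu (R N) k (R N) = \<tau>u k (R N)" "yw (R N) k (R N) = \<tau>w k (R N)"
        using e0[OF k'(1) R0[of N]] by (auto simp: eu_def ew_def)
      ultimately show ?thesis by (simp add: b_def)
    qed
    have bN1: "norm (xu k t - yu (R N) k t) \<le> b N" "norm (xw k t - yw (R N) k t) \<le> b N" for N
      using bN[of N] by (smt (verit) norm_ge_zero)+
    have "(\<lambda>N. xu k t - yu (R N) k t) \<longlonglongrightarrow> 0"
      by (rule Lim_null_comparison[OF _ b0]) (use bN1 in \<open>auto intro!: always_eventually\<close>)
    then have "(\<lambda>N. xu k t - \<tau>u k t - (xu k t - yu (R N) k t)) \<longlonglongrightarrow> xu k t - \<tau>u k t - 0" by (intro tendsto_intros)
    then show "(\<lambda>N. \<Sum>i<N. du i k) \<longlonglongrightarrow> xu k t - \<tau>u k t" unfolding s by (simp add: eu_def algebra_simps)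
    have "(\<lambda>N. xw k t - yw (R N) k t) \<longlonglongrightarrow> 0"
      by (rule Lim_null_comparison[OF _ b0]) (use bN1 in \<open>auto intro!: always_eventually\<close>)
    then have "(\<lambda>N. xw k t - \<tau>w k t - (xw k t - yw (R N) k t)) \<longlonglongrightarrow> xw k t - \<tau>w k t - 0" by (intro tendsto_intros)
    then show "(\<lambda>N. \<Sum>i<N. dw i k) \<longlonglongrightarrow> xw k t - \<tau>w k t" unfolding s by (simp add: ew_def algebra_simps)
  qed
  have DS: "closure D - {0} \<subseteq> S" using D(3) by (auto simp: S_def)
  have C0: "0 \<le> C j / (1 + t) ^ (n - j)" for j using t E_ge_1 by (simp add: C_def)
  have SS: "k \<noteq> 0 \<and> norm k \<le> 1" if "k \<in> S" for k using that by (auto simp: S_def)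
  have cauS: "norm ((deriv ^^ j) (du i) k) \<le> C j / (1 + t) ^ (n - j) * norm k ^ p / norm k ^ (2 * j) * \<alpha> i"
    "norm ((deriv ^^ j) (dw i) k) \<le> C j / (1 + t) ^ (n - j) * norm k ^ p / norm k ^ (2 * j) * \<alpha> i"
    if "j \<le> n" "k \<in> S" for i j k
    using cau[OF _ _ _ that(1)] that(2) by (auto simp: S_def)
  show "scal_deriv_le j D (\<lambda>k. xu k t - \<tau>u k t) (\<lambda>k. C j / (1 + t) ^ (n - j) * norm k ^ p / norm k ^ (2 * j) * A)"
    by (rule scal_deriv_le_series[OF hold(1) D(1,2) DS C0 cauS(1) SS \<alpha>s \<alpha>A \<alpha>0 lim(1) j])
  show "scal_deriv_le j D (\<lambda>k. xw k t - \<tau>w k t) (\<lambda>k. C j / (1 + t) ^ (n - j) * norm k ^ p / norm k ^ (2 * j) * A)"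
    by (rule scal_deriv_le_series[OF hold(2) D(1,2) DS C0 cauS(2) SS \<alpha>s \<alpha>A \<alpha>0 lim(2) j])
qed

end

section \<open>Weak derivatives\<close>

text \<open>A family that is closed under differentiation, up to the polynomial and the exponent N, and contains
  the standard smooth function with support [a, b]; this gives smoothness of all orders at once.\<close>

definition bump :: "real \<Rightarrow> real \<Rightarrow> real poly \<Rightarrow> nat \<Rightarrow> real \<Rightarrow> real" where
  "bump a b p N x = (if a < x \<and> x < b
     then poly p x / ((x - a) * (b - x)) ^ N * exp (- 1 / ((x - a) * (b - x))) else 0)"

lemma exp_inverse_le:
  fixes y :: real
  assumes "y > 0"
  shows "exp (- 1 / y) \<le> fact M * y ^ M"
proof -
  have "(\<Sum>n\<in>{M}. (1 / y) ^ n /\<^sub>R fact n) \<le> exp (1 / y)"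
    unfolding exp_def using assms by (intro sum_le_suminf summable_exp_generic) auto
  then have "(1 / y) ^ M / fact M \<le> exp (1 / y)"
    by (simp only: sum.insert sum.empty finite.emptyI empty_iff not_False_eq_True) (simp add: divide_inverse mult.commute)
  then have "1 / exp (1 / y) \<le> 1 / ((1 / y) ^ M / fact M)"
    using assms by (intro divide_left_mono) auto
  then show ?thesis using assms by (simp add: exp_minus divide_inverse power_inverse mult.commute)
qed

lemma bump_quadratic:
  obtains K where "\<And>x z. \<not> (a < x \<and> x < b) \<Longrightarrow> \<bar>bump a b p N z\<bar> \<le> K * (z - x)\<^sup>2"
proof -
  have "compact (poly p ` {a..b})" by (intro compact_continuous_image continuous_intros) auto
  then obtain P where P: "P > 0" "\<And>z. z \<in> {a..b} \<Longrightarrow> \<bar>poly p z\<bar> \<le> P"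
    using compact_imp_bounded by (metis (no_types, lifting) bounded_pos imageI real_norm_def)
  define K where "K = P * fact (N + 2) * (b - a)\<^sup>2"
  have "\<bar>bump a b p N z\<bar> \<le> K * (z - x)\<^sup>2" if x: "\<not> (a < x \<and> x < b)" for x z
  proof (cases "a < z \<and> z < b")
    case True
    define y where "y = (z - a) * (b - z)"
    have y: "y > 0" using True by (simp add: y_def)
    have "\<bar>bump a b p N z\<bar> = \<bar>poly p z\<bar> / y ^ N * exp (- 1 / y)"
      using True y by (simp add: bump_def y_def abs_mult)
    also have "\<dots> \<le> P / y ^ N * (fact (N + 2) * y ^ (N + 2))"
      using True y P by (intro mult_mono divide_right_mono exp_inverse_le) auto
    also have "\<dots> = P * fact (N + 2) * y\<^sup>2" using y by (simp add: power_add power2_eq_square)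
    also have "y \<le> (b - a) * \<bar>z - x\<bar>"
    proof (cases "x \<le> a")
      case c: True
      then have "(z - a) * (b - z) \<le> (z - x) * (b - a)" using True by (intro mult_mono) auto
      then show ?thesis using True c by (simp add: y_def mult.commute)
    next
      case c: False
      then have "(z - a) * (b - z) \<le> (b - a) * (x - z)" using True x by (intro mult_mono) auto
      then show ?thesis using True c x by (simp add: y_def)
    qed
    then have "y\<^sup>2 \<le> ((b - a) * \<bar>z - x\<bar>)\<^sup>2" using y by (intro power_mono) auto
    finally show ?thesis using P by (simp add: K_def power_mult_distrib mult_ac)
  next
    case False
    then show ?thesis using P by (auto simp: bump_def K_def)
  qed
  then show ?thesis by (rule that)
qed

lemma bump_deriv: "\<exists>p' N'. \<forall>x. (bump a b p N has_real_derivative bump a b p' N' x) (at x)"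
proof -
  define Y where "Y = [:- a * b, a + b, -1:]"
  have Y: "poly Y x = (x - a) * (b - x)" for x by (simp add: Y_def algebra_simps)
  have Y': "poly (pderiv Y) x = (b - x) - (x - a)" for x by (simp add: Y_def pderiv_pCons algebra_simps)
  define p' where "p' = pderiv p * Y\<^sup>2 - of_nat N * p * pderiv Y * Y + p * pderiv Y"
  have "(bump a b p N has_real_derivative bump a b p' (N + 2) x) (at x)" for x
  proof (cases "a < x \<and> x < b")
    case True
    define r where "r z = 1 / poly Y z" for z
    define F where "F z = poly p z * r z ^ N * exp (- r z)" for z
    have y: "poly Y x > 0" using True by (simp add: Y)
    then have yr: "poly Y x * r x = 1" by (simp add: r_def)
    have dr: "(r has_real_derivative (- (poly (pderiv Y) x * (r x)\<^sup>2))) (at x)"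
      unfolding r_def using y by (auto intro!: derivative_eq_intros poly_DERIV simp: power2_eq_square)
    have "(F has_real_derivative (poly (pderiv p) x * r x ^ N + poly p x * (of_nat N * r x ^ (N - 1) * (- (poly (pderiv Y) x * (r x)\<^sup>2)))) * exp (- r x)
       + poly p x * r x ^ N * (exp (- r x) * (poly (pderiv Y) x * (r x)\<^sup>2))) (at x)"
      unfolding F_def by (rule derivative_eq_intros poly_DERIV dr refl)+ (simp add: algebra_simps)
    moreover have "(poly (pderiv p) x * r x ^ N + poly p x * (of_nat N * r x ^ (N - 1) * (- (poly (pderiv Y) x * (r x)\<^sup>2)))) * exp (- r x)
       + poly p x * r x ^ N * (exp (- r x) * (poly (pderiv Y) x * (r x)\<^sup>2)) = bump a b p' (N + 2) x"
    proof -
      have alg: "(p1 * R + p0 * (m * Q * (- (y1 * (r x)\<^sup>2)))) * e + p0 * R * (e * (y1 * (r x)\<^sup>2))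
          = (p1 * (poly Y x)\<^sup>2 - m * p0 * y1 * poly Y x + p0 * y1) * (R * (r x)\<^sup>2) * e"
        if "m * R = m * Q * r x" for p1 p0 m Q R y1 e
        using yr that by algebra
      have "bump a b p' (N + 2) x = poly p' x * (r x ^ N * (r x)\<^sup>2) * exp (- r x)"
        using True by (simp add: bump_def r_def Y power_add power_divide power2_eq_square)
      also have "poly p' x = poly (pderiv p) x * (poly Y x)\<^sup>2 - of_nat N * poly p x * poly (pderiv Y) x * poly Y x + poly p x * poly (pderiv Y) x"
        by (simp add: p'_def)
      finally show ?thesis by (subst alg) (cases N; simp)+
    qed
    ultimately have "(F has_real_derivative bump a b p' (N + 2) x) (at x)" by simp
    then show ?thesis
    proof (rule DERIV_cong_ev[THEN iffD1, rotated -1])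
      have "\<forall>\<^sub>F z in nhds x. z \<in> {a<..<b}" using True by (intro eventually_nhds_in_open) auto
      then show "\<forall>\<^sub>F z in nhds x. F z = bump a b p N z"
        by eventually_elim (auto simp: F_def r_def bump_def Y power_divide)
    qed auto
  next
    case False
    obtain K where K: "\<And>z. \<bar>bump a b p N z\<bar> \<le> K * (z - x)\<^sup>2" using bump_quadratic False by metis
    have 0: "bump a b p N x = 0" "bump a b p' (N + 2) x = 0" using False by (auto simp: bump_def)
    have "((\<lambda>z. (bump a b p N z - bump a b p N x) / (z - x)) \<longlongrightarrow> 0) (at x)"
    proof (rule Lim_null_comparison)
      show "\<forall>\<^sub>F z in at x. norm ((bump a b p N z - bump a b p N x) / (z - x)) \<le> K * \<bar>z - x\<bar>"
      proof (rule eventually_at_filter[THEN iffD2], rule always_eventually, intro allI impI)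
        fix z assume "z \<noteq> x"
        then have "\<bar>z - x\<bar> > 0" by simp
        then show "norm ((bump a b p N z - bump a b p N x) / (z - x)) \<le> K * \<bar>z - x\<bar>"
          using K[of z] unfolding 0 real_norm_def abs_divide diff_0_right
          by (subst divide_le_eq) (simp only: if_True power2_eq_square abs_mult_self_eq mult.assoc)
      qed
      have "((\<lambda>z. K * \<bar>z - x\<bar>) \<longlongrightarrow> K * \<bar>x - x\<bar>) (at x)" by (intro tendsto_intros)
      then show "((\<lambda>z. K * \<bar>z - x\<bar>) \<longlongrightarrow> 0) (at x)" by simp
    qed
    then show ?thesis unfolding has_field_derivative_iff 0 .
  qed
  then show ?thesis by blast
qed

lemma bump_lincomb_smooth:
  fixes x y :: real
  shows "\<exists>p N p' N'. (deriv ^^ i) (\<lambda>z. x * bump a b P M z + y * bump a' b' P' M' z) =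
    (\<lambda>z. x * bump a b p N z + y * bump a' b' p' N' z)"
proof (induction i)
  case 0 show ?case by (intro exI[of _ P] exI[of _ M] exI[of _ P'] exI[of _ M']) simp
next
  case (Suc i)
  then obtain p N p' N' where 1: "(deriv ^^ i) (\<lambda>z. x * bump a b P M z + y * bump a' b' P' M' z) =
    (\<lambda>z. x * bump a b p N z + y * bump a' b' p' N' z)" by blast
  obtain q L q' L' where 2: "\<And>z. (bump a b p N has_real_derivative bump a b q L z) (at z)"
    "\<And>z. (bump a' b' p' N' has_real_derivative bump a' b' q' L' z) (at z)"
    using bump_deriv by metis
  have "deriv (\<lambda>z. x * bump a b p N z + y * bump a' b' p' N' z) = (\<lambda>z. x * bump a b q L z + y * bump a' b' q' L' z)"
  proof
    fix z show "deriv (\<lambda>z. x * bump a b p N z + y * bump a' b' p' N' z) z = x * bump a b q L z + y * bump a' b' q' L' z"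
      by (rule DERIV_imp_deriv) (auto intro!: derivative_eq_intros 2)
  qed
  then have "(deriv ^^ Suc i) (\<lambda>z. x * bump a b P M z + y * bump a' b' P' M' z) = (\<lambda>z. x * bump a b q L z + y * bump a' b' q' L' z)"
    using 1 by simp
  then show ?case by (intro exI)
qed

lemma bump_continuous: "continuous_on S (bump a b p N)"
  using bump_deriv[of a b p N] by (meson DERIV_continuous continuous_at_imp_continuous_on)

lemma bump_bound_deriv_combination:
  fixes x y :: real
  shows "(\<lambda>z. x * bump a b P M z + y * bump a' b' P' M' z) differentiable_on UNIV"
proof -
  obtain q L q' L' where 2: "\<And>z. (bump a b P M has_real_derivative bump a b q L z) (at z)"
    "\<And>z. (bump a' b' P' M' has_real_derivative bump a' b' q' L' z) (at z)"
    using bump_deriv by metis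
  have "((\<lambda>z. x * bump a b P M z + y * bump a' b' P' M' z) has_real_derivative (x * bump a b q L z + y * bump a' b' q' L' z)) (at z)" for z
    by (auto intro!: derivative_eq_intros 2)
  then show ?thesis unfolding differentiable_on_def
    by (auto simp: real_differentiable_def intro!: differentiable_at_withinI)
qed

text \<open>For \<open>a > 0\<close> the support stays away from 0, as the test functions on the half-line require.\<close>

definition mollifier :: "real \<Rightarrow> real \<Rightarrow> real \<Rightarrow> real" where
  "mollifier a e x = bump a (a + e) 1 0 x / integral {a..a + e} (bump a (a + e) 1 0)"

lemma mollifier_props:
  assumes e: "e > 0"
  shows "mollifier a e x \<ge> 0" "x \<notin> {a<..<a+e} \<Longrightarrow> mollifier a e x = 0"
    "continuous_on S (mollifier a e)" "integral {a..a+e} (mollifier a e) = 1"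
    "mollifier a e = (\<lambda>x. (1 / integral {a..a + e} (bump a (a + e) 1 0)) * bump a (a + e) 1 0 x)"
proof -
  let ?I = "integral {a..a + e} (bump a (a + e) 1 0)"
  have nn: "bump a (a + e) 1 0 x \<ge> 0" for x by (simp add: bump_def)
  have I: "?I > 0"
  proof -
    have "?I \<noteq> 0"
    proof
      assume "?I = 0"
      then have "bump a (a + e) 1 0 (a + e / 2) = 0"
        using integral_eq_0_iff[of a "a + e" "bump a (a + e) 1 0"] bump_continuous nn e by force
      then show False using e by (simp add: bump_def)
    qed
    moreover have "?I \<ge> 0" by (intro integral_nonneg integrable_continuous_real bump_continuous nn)
    ultimately show ?thesis by simp
  qed
  show "mollifier a e x \<ge> 0" using nn I by (simp add: mollifier_def)
  show "x \<notin> {a<..<a+e} \<Longrightarrow> mollifier a e x = 0" by (auto simp: mollifier_def bump_def)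
  show "continuous_on S (mollifier a e)" unfolding mollifier_def
    using I by (intro continuous_intros bump_continuous) auto
  show eq: "mollifier a e = (\<lambda>x. (1 / ?I) * bump a (a + e) 1 0 x)"
    by (simp add: mollifier_def fun_eq_iff)
  show "integral {a..a+e} (mollifier a e) = 1" using I unfolding eq
    by (simp only: Henstock_Kurzweil_Integration.integral_mult_right) simp
qed

lemma mollifier_approx:
  assumes e: "e > 0" and a: "L \<le> a" "a + e \<le> M" and W: "continuous_on {L..M} W"
    and \<eta>: "\<And>x. x \<in> {a..a+e} \<Longrightarrow> \<bar>W x - W a\<bar> \<le> \<eta>"
  shows "\<bar>integral {L..M} (\<lambda>x. W x * mollifier a e x) - W a\<bar> \<le> \<eta>"
proof -
  note mp = mollifier_props[OF e, where a = a]
  have cW: "continuous_on {a..a+e} W" by (rule continuous_on_subset[OF W]) (use a in auto)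
  have "((\<lambda>x. W x * mollifier a e x) has_integral integral {a..a+e} (\<lambda>x. W x * mollifier a e x)) {L..M}"
    by (rule has_integral_on_superset[where S = "{a..a+e}"])
      (use a mp(2) in \<open>auto intro!: integrable_integral integrable_continuous_real continuous_intros cW mp\<close>)
  then have eqI: "integral {L..M} (\<lambda>x. W x * mollifier a e x) = integral {a..a+e} (\<lambda>x. W x * mollifier a e x)"
    by (rule integral_unique)
  have "integral {L..M} (\<lambda>x. W x * mollifier a e x) - W a = integral {a..a+e} (\<lambda>x. W x * mollifier a e x) - integral {a..a+e} (\<lambda>x. W a * mollifier a e x)"
    unfolding eqI using mp(4) by simp
  also have "\<dots> = integral {a..a+e} (\<lambda>x. (W x - W a) * mollifier a e x)"
    by (subst Henstock_Kurzweil_Integration.integral_diff[symmetric])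
      (auto intro!: integrable_continuous_real continuous_intros cW mp simp: algebra_simps)
  also have "norm \<dots> \<le> integral {a..a+e} (\<lambda>x. \<eta> * mollifier a e x)"
    by (rule integral_norm_bound_integral)
      (auto intro!: integrable_continuous_real continuous_intros cW mp mult_right_mono \<eta> simp: abs_mult mp(1))
  also have "\<dots> = \<eta>" using mp(4) by simp
  finally show ?thesis by simp
qed

text \<open>The difference W of u and the integral of v has weak derivative 0. The integral of the difference of two
  mollifiers, concentrated near points \<open>0 < a < b\<close>, is a test function; used in the weak formulation it
  shows that \<open>W a\<close> and \<open>W b\<close> are equal up to the oscillation of W near these points. Continuity extends this to
  the endpoint 0.\<close>

lemma weak_deriv_imp_antideriv:
  fixes u v :: "real \<Rightarrow> real"
  assumes u: "continuous_on {0..} u" and wd: "has_weak_deriv u v"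
    and v: "\<And>t. t \<ge> 0 \<Longrightarrow> v absolutely_integrable_on {0..t}"
  shows "antideriv (\<lambda>t. of_real (u t)) (\<lambda>t. of_real (v t))"
proof -
  have vi: "v integrable_on {a..b}" if "0 \<le> a" for a b
  proof -
    have "v integrable_on {0..max 0 b}" using v[of "max 0 b"] by (simp add: absolutely_integrable_on_def)
    then show ?thesis by (rule integrable_on_subinterval) (use that in auto)
  qed
  have vc: "(\<lambda>t. complex_of_real (v t)) absolutely_integrable_on {0..t}" if "t \<ge> 0" for t
    using absolutely_integrable_linear[OF v[OF that] bounded_linear_of_real] by (simp add: o_def)
  define V where "V t = integral {0..t} v" for t
  have V: "antideriv (\<lambda>t. of_real (V t)) (\<lambda>t. of_real (v t))"
  proof -
    have "integral {0..t} (\<lambda>t. complex_of_real (v t)) = of_real (V t)" if "t \<ge> 0" for t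
      using integral_linear[OF vi[OF order_refl] bounded_linear_of_real] by (simp add: V_def o_def)
    then show ?thesis unfolding antideriv_def using vc by (simp add: V_def)
  qed
  define W where "W t = u t - V t" for t
  have cV: "continuous_on {0..} V"
  proof -
    have "continuous_on {0..} (\<lambda>t. Re (of_real (V t)))" by (intro continuous_intros antideriv_continuous[OF V])
    then show ?thesis by simp
  qed
  have cW: "continuous_on {0..} W" unfolding W_def by (intro continuous_intros u cV)
  have eqW: "W a = W b" if ab: "0 < a" "a < b" for a b
  proof -
    have "\<bar>W a - W b\<bar> \<le> \<eta>" if \<eta>: "\<eta> > 0" for \<eta>
    proof -
      have nb: "\<exists>e>0. \<forall>e'\<le>e. \<forall>x\<in>{r..r+e'}. \<bar>W x - W r\<bar> \<le> \<eta> / 2" if r: "r > 0" for r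
      proof -
        obtain d where d: "d > 0" "\<And>x. x \<in> {0..} \<Longrightarrow> dist x r < d \<Longrightarrow> dist (W x) (W r) < \<eta> / 2"
          using cW[unfolded continuous_on_iff] r \<eta> by (metis atLeast_iff half_gt_zero less_imp_le)
        show ?thesis
        proof (intro exI[of _ "d / 2"] conjI allI impI ballI)
          fix e' x assume "e' \<le> d / 2" "x \<in> {r..r + e'}"
          then show "\<bar>W x - W r\<bar> \<le> \<eta> / 2" using d(2)[of x] d(1) r by (auto simp: dist_real_def)
        qed (use d in auto)
      qed
      obtain e1 where e1: "e1 > 0" "\<And>e' x. e' \<le> e1 \<Longrightarrow> x \<in> {a..a+e'} \<Longrightarrow> \<bar>W x - W a\<bar> \<le> \<eta> / 2" using nb[OF ab(1)] by blast
      obtain e2 where e2: "e2 > 0" "\<And>e' x. e' \<le> e2 \<Longrightarrow> x \<in> {b..b+e'} \<Longrightarrow> \<bar>W x - W b\<bar> \<le> \<eta> / 2" using nb[of b] ab by auto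
      define e where "e = min (min e1 e2) (b - a)"
      have e: "e > 0" "e \<le> e1" "e \<le> e2" "a + e \<le> b" using e1 e2 ab by (auto simp: e_def)
      define M where "M = b + e"
      define \<psi> where "\<psi> x = mollifier a e x - mollifier b e x" for x
      note ma = mollifier_props[OF e(1), where a = a] and mb = mollifier_props[OF e(1), where a = b]
      have c\<psi>: "continuous_on S \<psi>" for S unfolding \<psi>_def by (intro continuous_intros ma mb)
      have int1: "integral {0..x} (mollifier a e) = 1" if "x \<ge> a + e" for x
        using mollifier_approx[of e 0 a x "\<lambda>_. 1" 0] e ab that by simp
      have int2: "integral {0..x} (mollifier b e) = 1" if "x \<ge> b + e" for x
        using mollifier_approx[of e 0 b x "\<lambda>_. 1" 0] e ab that by simp
      define \<phi> where "\<phi> x = integral {0..x} \<psi>" for x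
      have \<phi>0: "\<phi> x = 0" if "x \<notin> {a..M}" for x
      proof (cases "x < a")
        case True
        have "integral {0..x} \<psi> = integral {0..x} (\<lambda>_. 0)"
          by (rule Henstock_Kurzweil_Integration.integral_cong) (use True ab ma(2) mb(2) in \<open>auto simp: \<psi>_def\<close>)
        then show ?thesis by (simp add: \<phi>_def)
      next
        case False
        then have x: "x \<ge> b + e" using that by (simp add: M_def)
        have "\<phi> x = integral {0..x} (mollifier a e) - integral {0..x} (mollifier b e)"
          unfolding \<phi>_def \<psi>_def by (intro Henstock_Kurzweil_Integration.integral_diff integrable_continuous_real ma mb)
        then show ?thesis using int1 int2 x e by simp
      qed
      have d\<phi>: "(\<phi> has_real_derivative \<psi> x) (at x)" for x
      proof (cases "x > 0")
        case True
        have "(\<phi> has_real_derivative \<psi> x) (at x within {0..x+1})"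
          unfolding \<phi>_def using True by (intro integral_has_real_derivative c\<psi>) auto
        moreover have "at x within {0..x+1} = at x" using True by (intro at_within_Icc_at) auto
        ultimately show ?thesis by simp
      next
        case False
        have "((\<lambda>_. 0) has_real_derivative 0) (at x)" by simp
        then have "(\<phi> has_real_derivative 0) (at x)"
        proof (rule DERIV_cong_ev[THEN iffD1, rotated -1])
          have "\<forall>\<^sub>F z in nhds x. z \<in> {..<a}" using False ab by (intro eventually_nhds_in_open) auto
          then show "\<forall>\<^sub>F z in nhds x. 0 = \<phi> z" by eventually_elim (use \<phi>0 in auto)
        qed auto
        moreover have "\<psi> x = 0" using False ab ma(2) mb(2) by (simp add: \<psi>_def)
        ultimately show ?thesis by simp
      qed
      have deriv\<phi>: "deriv \<phi> = \<psi>" using d\<phi> by (auto simp: fun_eq_iff intro: DERIV_imp_deriv)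
      have test: "test_function \<phi>"
        unfolding test_function_def
      proof (intro conjI allI exI)
        fix i show "(deriv ^^ i) \<phi> differentiable_on UNIV"
        proof (cases i)
          case 0
          then show ?thesis using d\<phi> by (auto simp: differentiable_on_def intro!: differentiable_at_withinI simp: real_differentiable_def)
        next
          case (Suc i')
          define I1 where "I1 = 1 / integral {a..a + e} (bump a (a + e) 1 0)"
          define I2 where "I2 = - 1 / integral {b..b + e} (bump b (b + e) 1 0)"
          have \<psi>eq: "\<psi> = (\<lambda>z. I1 * bump a (a + e) 1 0 z + I2 * bump b (b + e) 1 0 z)"
            by (rule ext) (simp add: \<psi>_def mollifier_def I1_def I2_def)
          have "\<exists>p N p' N'. (deriv ^^ i') \<psi> = (\<lambda>z. I1 * bump a (a + e) p N z + I2 * bump b (b + e) p' N' z)"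
            unfolding \<psi>eq by (rule bump_lincomb_smooth)
          then obtain p N p' N' where "(deriv ^^ i') \<psi> = (\<lambda>z. I1 * bump a (a + e) p N z + I2 * bump b (b + e) p' N' z)"
            by blast
          then show ?thesis unfolding Suc funpow_Suc_right o_def deriv\<phi>
            by (simp add: bump_bound_deriv_combination)
        qed
      next
        show "0 < a" by fact
        show "\<phi> x \<noteq> 0 \<longrightarrow> x \<in> {a..M}" for x using \<phi>0 by blast
      qed
      have M0: "M \<ge> 0" using ab e by (simp add: M_def)
      have restr: "integral {0..} f = integral {0..M} f" if "\<And>x. x > M \<Longrightarrow> f x = 0" for f :: "real \<Rightarrow> real"
      proof -
        have "integral {0..} f = integral {0..} (\<lambda>x. if x \<in> {0..M} then f x else 0)"
          by (rule Henstock_Kurzweil_Integration.integral_cong) (use that in auto)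
        also have "\<dots> = integral {0..M} f"
          by (subst integral_restrict_Int) (auto intro!: arg_cong2[where f = integral])
        finally show ?thesis .
      qed
      have weak: "integral {0..M} (\<lambda>x. u x * \<psi> x) = - integral {0..M} (\<lambda>x. v x * \<phi> x)"
      proof -
        have "integral {0..} (\<lambda>x. u x * deriv \<phi> x) = - integral {0..} (\<lambda>x. v x * \<phi> x)"
          using wd test unfolding has_weak_deriv_def by blast
        moreover have "\<psi> x = 0" "\<phi> x = 0" if "x > M" for x
          using that ma(2)[of x] mb(2)[of x] e ab \<phi>0[of x] by (simp_all add: \<psi>_def M_def)
        ultimately show ?thesis unfolding deriv\<phi> by (subst (asm) (1 2) restr) auto
      qed
      have A\<phi>: "antideriv (\<lambda>t. of_real (\<phi> t)) (\<lambda>t. of_real (\<psi> t))"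
      proof (rule antideriv_of_deriv)
        show "continuous_on {0..} (\<lambda>t. complex_of_real (\<psi> t))" by (intro continuous_intros c\<psi>)
        show "((\<lambda>t. complex_of_real (\<phi> t)) has_vector_derivative complex_of_real (\<psi> t)) (at t within {0..})" for t
        proof -
          have "(\<phi> has_vector_derivative \<psi> t) (at t within {0..})"
            using d\<phi>[of t] has_vector_derivative_at_within
            by (simp add: has_real_derivative_iff_has_vector_derivative)
          from bounded_linear.has_vector_derivative[OF bounded_linear_of_real this] show ?thesis .
        qed
      qed
      have i1: "(\<lambda>x. \<psi> x * V x) integrable_on {0..M}"
        by (intro integrable_continuous_real continuous_intros c\<psi> continuous_on_subset[OF cV]) auto
      have "antideriv (\<lambda>t. of_real (\<phi> t) * of_real (V t)) (\<lambda>t. of_real (\<psi> t) * of_real (V t) + of_real (\<phi> t) * of_real (v t))"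
        by (rule antideriv_mult[OF A\<phi> _ V]) (intro continuous_intros c\<psi>)
      from antideriv_diff_eq[OF this order_refl M0] antideriv_int[OF this order_refl, of M]
      have ii: "(\<lambda>t. complex_of_real (\<psi> t * V t + \<phi> t * v t)) integrable_on {0..M}"
        and eq: "of_real (\<phi> M * V M) - of_real (\<phi> 0 * V 0) = integral {0..M} (\<lambda>t. complex_of_real (\<psi> t * V t + \<phi> t * v t))"
        by simp_all
      have ir: "(\<lambda>t. \<psi> t * V t + \<phi> t * v t) integrable_on {0..M}"
        using integrable_linear[OF ii bounded_linear_Re] by (simp add: o_def)
      have "integral {0..M} (\<lambda>t. complex_of_real (\<psi> t * V t + \<phi> t * v t)) = of_real (integral {0..M} (\<lambda>t. \<psi> t * V t + \<phi> t * v t))"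
        using integral_linear[OF ir bounded_linear_of_real] by (simp add: o_def)
      moreover have "\<phi> M = 0"
        using \<phi>0[of "M + 1"] int1[of M] int2[of M] e
        unfolding \<phi>_def \<psi>_def by (subst Henstock_Kurzweil_Integration.integral_diff) (auto simp: M_def intro!: integrable_continuous_real ma mb)
      moreover have "\<phi> 0 = 0" by (simp add: \<phi>_def)
      ultimately have z: "integral {0..M} (\<lambda>t. \<psi> t * V t + \<phi> t * v t) = 0"
        using eq by simp
      have i2: "(\<lambda>t. \<phi> t * v t) integrable_on {0..M}"
        using integrable_diff[OF ir i1] by simp
      have "integral {0..M} (\<lambda>t. \<psi> t * V t) + integral {0..M} (\<lambda>t. \<phi> t * v t) = 0"
        using z Henstock_Kurzweil_Integration.integral_add[OF i1 i2] by simp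
      then have "integral {0..M} (\<lambda>x. u x * \<psi> x) = integral {0..M} (\<lambda>x. V x * \<psi> x)"
        using weak by (simp add: mult.commute)
      then have "integral {0..M} (\<lambda>x. u x * \<psi> x - V x * \<psi> x) = 0"
        by (subst Henstock_Kurzweil_Integration.integral_diff)
          (auto intro!: integrable_continuous_real continuous_intros c\<psi> continuous_on_subset[OF cV] continuous_on_subset[OF u])
      moreover have "(\<lambda>x. u x * \<psi> x - V x * \<psi> x) = (\<lambda>x. W x * mollifier a e x - W x * mollifier b e x)"
        by (auto simp: W_def \<psi>_def algebra_simps)
      ultimately have 0: "integral {0..M} (\<lambda>x. W x * mollifier a e x - W x * mollifier b e x) = 0"
        by (simp only:)
      have im: "(\<lambda>x. W x * mollifier r e x) integrable_on {0..M}" for r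
        by (intro integrable_continuous_real continuous_intros continuous_on_subset[OF cW] mollifier_props(3)[OF e(1)]) auto
      have "integral {0..M} (\<lambda>x. W x * mollifier a e x) = integral {0..M} (\<lambda>x. W x * mollifier b e x)"
        using Henstock_Kurzweil_Integration.integral_diff[OF im im, of a b] 0 by simp
      moreover have "\<bar>integral {0..M} (\<lambda>x. W x * mollifier a e x) - W a\<bar> \<le> \<eta> / 2"
        using e ab e1(2)[OF e(2)] by (intro mollifier_approx continuous_on_subset[OF cW]) (auto simp: M_def)
      moreover have "\<bar>integral {0..M} (\<lambda>x. W x * mollifier b e x) - W b\<bar> \<le> \<eta> / 2"
        using e ab e2(2)[OF e(3)] by (intro mollifier_approx continuous_on_subset[OF cW]) (auto simp: M_def)
      ultimately show ?thesis by linarith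
    qed
    then have "\<bar>W a - W b\<bar> \<le> 0" by (rule field_le_epsilon[of _ 0, simplified]) auto
    then show ?thesis by simp
  qed
  have W0: "W t = W 0" if "t \<ge> 0" for t
  proof (cases "t = 0")
    case False
    then have t: "t > 0" using that by simp
    have "(W \<longlongrightarrow> W 0) (at 0 within {0..})" using cW by (simp add: continuous_on_def)
    then have "(W \<longlongrightarrow> W 0) (at_right 0)" by (rule tendsto_within_subset) auto
    moreover have "\<forall>\<^sub>F x in at_right 0. W x = W t"
      using eventually_at_right_less[of 0]
    proof eventually_elim
      case (elim x)
      consider "x < t" | "t < x" | "x = t" by linarith
      then show ?case
      proof cases
        case 1
        show ?thesis by (rule eqW[OF elim 1])
      next
        case 2
        show ?thesis by (rule eqW[OF t 2, symmetric])
      qed (simp only:)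
    qed
    then have "(W \<longlongrightarrow> W t) (at_right 0)" by (rule tendsto_eventually)
    ultimately show ?thesis by (intro tendsto_unique[of "at_right (0::real)" W]) auto
  qed simp
  show ?thesis
  proof (rule antideriv_cong[OF antideriv_add[OF V antideriv_const[of "of_real (W 0)"]]])
    fix t :: real assume "t \<ge> 0"
    then have "W t = W 0" by (rule W0)
    then have "u t = V t + W 0" by (simp add: W_def)
    then show "complex_of_real (V t) + of_real (W 0) = of_real (u t)" by simp
  qed simp
qed

section \<open>Weighted integrability classes\<close>

text \<open>f has r weak derivatives, and f and all of them are integrable against \<open>(1 + t)^n\<close>.\<close>

fun wl :: "nat \<Rightarrow> nat \<Rightarrow> (real \<Rightarrow> complex) \<Rightarrow> bool" where
  "wl n 0 f \<longleftrightarrow> (\<lambda>t. of_real ((1 + t) ^ n) * f t) absolutely_integrable_on {0..}"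
| "wl n (Suc r) f \<longleftrightarrow> (\<lambda>t. of_real ((1 + t) ^ n) * f t) absolutely_integrable_on {0..} \<and>
     (\<exists>f'. antideriv f f' \<and> wl n r f')"

text \<open>f is bounded with derivative in the weighted class; constants belong to it, so it contains the coefficients
  that do not decay.\<close>

definition bl :: "nat \<Rightarrow> nat \<Rightarrow> (real \<Rightarrow> complex) \<Rightarrow> bool" where
  "bl n r f \<longleftrightarrow> (\<exists>f'. antideriv f f' \<and> wl n r f')"

lemma wl_Suc: "wl n (Suc r) f \<longleftrightarrow> wl n 0 f \<and> bl n r f"
  by (simp add: bl_def)

declare wl.simps(2) [simp del]

lemma wl_imp_wl0: "wl n r f \<Longrightarrow> wl n 0 f"
  by (cases r) (simp_all only: wl_Suc)

lemma wl_Suc_imp: "wl n (Suc r) f \<Longrightarrow> wl n r f"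
proof (induction r arbitrary: f)
  case (Suc r)
  from Suc.prems have w: "wl n 0 f" and b: "bl n (Suc r) f" by (simp_all only: wl_Suc)
  from b obtain f' where "antideriv f f'" "wl n (Suc r) f'" unfolding bl_def by blast
  then have "bl n r f" unfolding bl_def using Suc.IH by blast
  with w show ?case by (simp only: wl_Suc)
qed (simp only: wl_Suc)

lemma wl_mono:
  assumes "wl n r f" "r' \<le> r" shows "wl n r' f"
  using assms(2)
proof (induction rule: inc_induct)
  case base
  show ?case by (rule assms(1))
next
  case (step k)
  show ?case by (rule wl_Suc_imp[OF step.IH])
qed

lemma bl_mono: "bl n r f \<Longrightarrow> r' \<le> r \<Longrightarrow> bl n r' f"
  unfolding bl_def by (blast intro: wl_mono)

lemma wl_imp_bl:
  assumes "wl n r f" "r' < r" shows "bl n r' f"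
proof -
  have "wl n (Suc r') f" by (rule wl_mono[OF assms(1)]) (use assms(2) in simp)
  then show ?thesis by (simp only: wl_Suc)
qed

lemma wl0_cong:
  assumes "wl n 0 f" "\<And>t. t \<ge> 0 \<Longrightarrow> f t = g t" shows "wl n 0 g"
  using assms(1) unfolding wl.simps
  by (rule absolutely_integrable_spike[where S = "{}"]) (auto simp: assms(2))

lemma bl_cong:
  assumes "bl n r f" "\<And>t. t \<ge> 0 \<Longrightarrow> f t = g t" shows "bl n r g"
proof -
  obtain f' where f': "antideriv f f'" "wl n r f'" using assms(1) unfolding bl_def by blast
  have "antideriv g f'" by (rule antideriv_cong[OF f'(1) assms(2)]) auto
  then show ?thesis unfolding bl_def using f'(2) by blast
qed

lemma wl_cong:
  assumes "wl n r f" "\<And>t. t \<ge> 0 \<Longrightarrow> f t = g t" shows "wl n r g"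
proof (cases r)
  case 0
  then show ?thesis using wl0_cong[of n f g] assms by simp
next
  case (Suc r')
  have "wl n 0 g" by (rule wl0_cong[OF wl_imp_wl0[OF assms(1)] assms(2)])
  moreover have "bl n r' g"
    by (rule bl_cong[OF _ assms(2)]) (use assms(1) Suc in \<open>simp_all only: wl_Suc\<close>)
  ultimately show ?thesis unfolding Suc by (simp only: wl_Suc)
qed

lemma wl0_add: "wl n 0 f \<Longrightarrow> wl n 0 g \<Longrightarrow> wl n 0 (\<lambda>t. f t + g t)"
  unfolding wl.simps using set_integral_add(1)[of lebesgue "{0..}" "\<lambda>t. of_real ((1 + t) ^ n) * f t" "\<lambda>t. of_real ((1 + t) ^ n) * g t"]
  by (simp add: algebra_simps)

lemma wl_add: "wl n r f \<Longrightarrow> wl n r g \<Longrightarrow> wl n r (\<lambda>t. f t + g t)"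
proof (induction r arbitrary: f g)
  case (Suc r)
  obtain f' where f': "antideriv f f'" "wl n r f'" "wl n 0 f" using Suc.prems(1) unfolding wl_Suc bl_def by blast
  obtain g' where g': "antideriv g g'" "wl n r g'" "wl n 0 g" using Suc.prems(2) unfolding wl_Suc bl_def by blast
  have "bl n r (\<lambda>t. f t + g t)" unfolding bl_def
    using antideriv_add[OF f'(1) g'(1)] Suc.IH[OF f'(2) g'(2)] by blast
  then show ?case using wl0_add[OF f'(3) g'(3)] by (simp only: wl_Suc)
qed (rule wl0_add)

lemma wl0_imp_abs_int:
  assumes "wl n 0 f" shows "f absolutely_integrable_on {0..}"
proof -
  have "(\<lambda>t. of_real (1 / (1 + t) ^ n) * (of_real ((1 + t) ^ n) * f t)) absolutely_integrable_on {0..}"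
  proof (rule abs_int_bounded_mult[where B = 1])
    show "continuous_on {0..} (\<lambda>t. complex_of_real (1 / (1 + t) ^ n))"
      by (intro continuous_on_of_real continuous_intros) auto
    show "norm (complex_of_real (1 / (1 + t) ^ n)) \<le> 1" if "t \<ge> 0" for t
      unfolding norm_of_real using that by (simp add: one_le_power)
  qed (use assms in simp)
  then show ?thesis
  proof (rule absolutely_integrable_spike[where S = "{}"])
    fix t :: real assume "t \<in> {0..} - {}"
    then have "complex_of_real (1 / (1 + t) ^ n) * of_real ((1 + t) ^ n) = 1"
      by (simp only: of_real_mult[symmetric]) simp
    then show "f t = of_real (1 / (1 + t) ^ n) * (of_real ((1 + t) ^ n) * f t)"
      by (simp only: mult.assoc[symmetric]) simp
  qed simp
qed

lemma bl_continuous: "bl n r f \<Longrightarrow> continuous_on {0..} f"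
  unfolding bl_def by (blast dest: antideriv_continuous)

lemma wl_continuous: "wl n (Suc r) f \<Longrightarrow> continuous_on {0..} f"
  by (rule bl_continuous[of n r]) (simp only: wl_Suc)

lemma bl_bounded:
  assumes "bl n r f" obtains B where "\<And>t. t \<ge> 0 \<Longrightarrow> norm (f t) \<le> B"
proof -
  obtain f' where f': "antideriv f f'" "wl n r f'" using assms unfolding bl_def by blast
  have ai: "f' absolutely_integrable_on {0..}" by (rule wl0_imp_abs_int[OF wl_imp_wl0[OF f'(2)]])
  have ni: "(\<lambda>s. norm (f' s)) integrable_on {0..}" using ai by (simp add: absolutely_integrable_on_def)
  have "norm (f t) \<le> norm (f 0) + integral {0..} (\<lambda>s. norm (f' s))" if t: "t \<ge> 0" for t
  proof -
    have nt: "(\<lambda>s. norm (f' s)) integrable_on {0..t}" by (rule integrable_on_subinterval[OF ni]) auto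
    have "f t - f 0 = integral {0..t} f'" by (rule antideriv_diff_eq[OF f'(1) order_refl t])
    also have "norm \<dots> \<le> integral {0..t} (\<lambda>s. norm (f' s))"
      by (intro integral_norm_bound_integral nt antideriv_int[OF f'(1)]) auto
    also have "\<dots> \<le> integral {0..} (\<lambda>s. norm (f' s))" by (intro integral_subset_le nt ni) auto
    finally show ?thesis using norm_triangle_ineq2[of "f t" "f 0"] by linarith
  qed
  then show ?thesis by (rule that)
qed

lemma bl_wl0_mult:
  assumes "bl n r b" "wl n 0 f" shows "wl n 0 (\<lambda>t. b t * f t)"
proof -
  obtain B where B: "\<And>t. t \<ge> 0 \<Longrightarrow> norm (b t) \<le> B" using bl_bounded[OF assms(1)] by blast
  have "(\<lambda>t. b t * (of_real ((1 + t) ^ n) * f t)) absolutely_integrable_on {0..}"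
    using assms(2) by (intro abs_int_bounded_mult[OF bl_continuous[OF assms(1)] B]) auto
  then show ?thesis by (simp add: mult_ac)
qed

text \<open>Functions in \<open>bl\<close> are bounded, so that they act on the weighted classes by multiplication.\<close>

lemma wl_mult: "bl n r b \<Longrightarrow> wl n r f \<Longrightarrow> wl n r (\<lambda>t. b t * f t)"
proof (induction r arbitrary: b f)
  case 0
  then show ?case by (rule bl_wl0_mult)
next
  case (Suc r)
  obtain b' where b': "antideriv b b'" "wl n (Suc r) b'" using Suc.prems(1) unfolding bl_def by blast
  obtain f' where f': "antideriv f f'" "wl n r f'" using Suc.prems(2) unfolding wl_Suc bl_def by blast
  have "wl n 0 (\<lambda>t. b t * f t)" by (rule bl_wl0_mult[OF Suc.prems(1) wl_imp_wl0[OF Suc.prems(2)]])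
  moreover have "antideriv (\<lambda>t. b t * f t) (\<lambda>t. b' t * f t + b t * f' t)"
    by (rule antideriv_mult[OF b'(1) wl_continuous[OF b'(2)] f'(1)])
  moreover have "wl n r (\<lambda>t. f t * b' t)"
    by (rule Suc.IH[OF wl_imp_bl[OF Suc.prems(2) lessI] wl_Suc_imp[OF b'(2)]])
  then have "wl n r (\<lambda>t. b' t * f t)" by (simp add: mult.commute)
  moreover have "wl n r (\<lambda>t. b t * f' t)"
    by (rule Suc.IH[OF bl_mono[OF Suc.prems(1)] f'(2)]) simp
  ultimately have w: "wl n 0 (\<lambda>t. b t * f t)" and a: "antideriv (\<lambda>t. b t * f t) (\<lambda>t. b' t * f t + b t * f' t)"
    and d: "wl n r (\<lambda>t. b' t * f t + b t * f' t)"
    by (simp_all only: wl_add)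
  have "bl n r (\<lambda>t. b t * f t)" unfolding bl_def by (rule exI, rule conjI[OF a d])
  with w show ?case by (simp only: wl_Suc)
qed

lemma wl_zero: "wl n r (\<lambda>t. 0)"
proof (induction r)
  case (Suc r)
  have "wl n 0 (\<lambda>t. 0)" by simp
  moreover have "bl n r (\<lambda>t. 0)"
    unfolding bl_def by (rule exI[of _ "\<lambda>t. 0"]) (intro conjI antideriv_const Suc.IH)
  ultimately show ?case by (simp only: wl_Suc)
qed simp

lemma bl_const: "bl n r (\<lambda>t. c)"
  unfolding bl_def
proof (intro exI conjI)
  show "antideriv (\<lambda>t. c) (\<lambda>t. 0)" by (rule antideriv_const)
  show "wl n r (\<lambda>t. 0)" by (rule wl_zero)
qed

lemma wl_cmult:
  assumes "wl n r f" shows "wl n r (\<lambda>t. c * f t)"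
  by (rule wl_mult[where b = "\<lambda>t. c", OF bl_const assms])

lemma wl_uminus:
  assumes "wl n r f" shows "wl n r (\<lambda>t. - f t)"
  by (rule wl_cong[OF wl_cmult[where c = "-1", OF assms]]) simp

lemma wl_diff:
  assumes "wl n r f" "wl n r g" shows "wl n r (\<lambda>t. f t - g t)"
  by (rule wl_cong[OF wl_add[OF assms(1) wl_uminus[OF assms(2)]]]) simp

lemma wl_deriv_unique:
  assumes f: "wl n (Suc (Suc r)) f" and D: "\<And>t. t \<ge> 0 \<Longrightarrow> (f has_vector_derivative D t) (at t within {0..})"
  shows "wl n (Suc r) D"
proof -
  have "bl n (Suc r) f" by (rule wl_imp_bl[OF f lessI])
  then obtain f' where f': "antideriv f f'" "wl n (Suc r) f'" unfolding bl_def by blast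
  have "f' t = D t" if t: "t \<ge> 0" for t
  proof (rule vector_derivative_unique_within[OF _ antideriv_deriv[OF f'(1) wl_continuous[OF f'(2)] t] D[OF t]])
    have "t islimpt {t..t+1}" using t by (simp add: islimpt_Icc)
    then have "t islimpt {0..}" by (rule islimpt_subset) (use t in auto)
    then show "at t within {0..} \<noteq> bot" by (simp add: trivial_limit_within)
  qed
  then show ?thesis by (rule wl_cong[OF f'(2)])
qed

text \<open>The derivatives of s and c are products of p with s and c, so their regularity follows step by step from
  that of p, starting from their own decay.\<close>

lemma wl_trig:
  assumes p: "wl n (Suc M) p" and s0: "wl n 0 s" and c0: "wl n 0 c"
    and s: "antideriv s (\<lambda>t. (c t + 1) * p t)" and c: "antideriv c (\<lambda>t. - s t * p t)"
  shows "r \<le> Suc M \<Longrightarrow> wl n r s \<and> wl n r c"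
proof (induction r)
  case 0 then show ?case using s0 c0 by simp
next
  case (Suc r)
  then have IH: "wl n r s" "wl n r c" by auto
  have pb: "bl n r p" using wl_imp_bl[OF p] Suc.prems by auto
  have pr: "wl n r p" by (rule wl_mono[OF p]) (use Suc.prems in auto)
  have "wl n r (\<lambda>t. p t * c t + p t)" by (intro wl_add wl_mult pb pr IH)
  then have "bl n r s" unfolding bl_def using s by (auto simp: algebra_simps intro!: exI[of _ "\<lambda>t. p t * c t + p t"])
  moreover have "wl n r (\<lambda>t. - (p t * s t))" by (intro wl_uminus wl_mult pb IH)
  then have "bl n r c" unfolding bl_def using c by (auto simp: algebra_simps intro!: exI[of _ "\<lambda>t. - (p t * s t)"])
  ultimately show ?case using s0 c0 wl_Suc by blast
qed

section \<open>Truncated formal series\<close>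

text \<open>The algebraic part of the recursion differentiates the previous fast coefficient, so every step costs one
  derivative; this leads to the orders \<open>m + 2 - j\<close> and \<open>m + 1 - j\<close>.\<close>

lemma coefficient_classes:
  fixes x y :: "nat \<Rightarrow> real \<Rightarrow> complex"
  assumes q: "wl n (Suc m) q" and s: "wl n (Suc m) s" and c: "wl n (Suc m) c"
    and x0: "\<And>t. t \<ge> 0 \<Longrightarrow> x 0 t = c0" and y0: "\<And>t. t \<ge> 0 \<Longrightarrow> y 0 t = 0"
    and ydiff: "\<And>j t. j \<le> m \<Longrightarrow> t \<ge> 0 \<Longrightarrow> (y j has_vector_derivative y' j t) (at t within {0..})"
    and yrec: "\<And>j t. j \<le> m \<Longrightarrow> t \<ge> 0 \<Longrightarrow> y (Suc j) t = 2 * \<i> * \<epsilon> * (- y' j t + \<epsilon> * \<i> / 2 * (if j = 0 then 0 else y (j - 1) t)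
        + \<epsilon> * q t / 4 * x j t + \<i> * s t / 4 * (if j = 0 then 0 else x (j - 1) t) + \<epsilon> * \<i> * c t / 4 * (if j = 0 then 0 else y (j - 1) t))"
    and xrec: "\<And>j t. j \<le> m \<Longrightarrow> t \<ge> 0 \<Longrightarrow> (x (Suc j) has_vector_derivative
        - \<epsilon> * q t / 4 * y (Suc j) t + \<i> * s t / 4 * y j t - \<epsilon> * \<i> * c t / 4 * x j t) (at t within {0..})"
  shows "j \<le> Suc m \<Longrightarrow> wl n (m + 2 - j) (y j) \<and> bl n (m + 1 - j) (x j)"
proof (induction j rule: less_induct)
  case (less j)
  show ?case
  proof (cases j)
    case 0
    show ?thesis unfolding 0
      by (intro conjI wl_cong[OF wl_zero y0[symmetric]] bl_cong[OF bl_const x0[symmetric]])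
  next
    case (Suc i)
    then have i: "i \<le> m" using less.prems by simp
    define N where "N = m - i"
    have IHi: "wl n (Suc (Suc N)) (y i)" "bl n (Suc N) (x i)"
      using less.IH[of i] Suc i by (auto simp: N_def Suc_diff_le)
    have IHp: "wl n (Suc (Suc N)) (if i = 0 then \<lambda>t. 0 else y (i - 1))" "bl n (Suc N) (if i = 0 then \<lambda>t. 0 else x (i - 1))"
      using less.IH[of "i - 1"] Suc i
      by (auto simp: N_def wl_zero bl_const intro: wl_mono[where r = "m + 2 - (i - 1)"] bl_mono[where r = "m + 1 - (i - 1)"])
    have qsc: "wl n (Suc N) q" "wl n (Suc N) s" "wl n (Suc N) c"
      by (rule wl_mono[OF q] wl_mono[OF s] wl_mono[OF c]; simp add: N_def)+
    have qscb: "bl n N q" "bl n N s" "bl n N c"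
      using qsc by (auto simp: wl_Suc)
    have y'c: "wl n (Suc N) (y' i)"
      by (rule wl_deriv_unique[OF IHi(1)]) (use ydiff[OF i] in auto)
    define YP where "YP = (if i = 0 then \<lambda>t. 0 else y (i - 1))"
    define XP where "XP = (if i = 0 then \<lambda>t. 0 else x (i - 1))"
    have xq: "wl n (Suc N) (\<lambda>t. x i t * q t)" by (rule wl_mult[OF IHi(2) qsc(1)])
    have xs: "wl n (Suc N) (\<lambda>t. XP t * s t)" unfolding XP_def by (rule wl_mult[OF IHp(2) qsc(2)])
    have yc: "wl n (Suc N) (\<lambda>t. YP t * c t)" unfolding YP_def
      by (rule wl_mult[OF wl_imp_bl[OF IHp(1) lessI] qsc(3)])
    have yp: "wl n (Suc N) YP" unfolding YP_def by (rule wl_Suc_imp[OF IHp(1)])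
    have "wl n (Suc N) (\<lambda>t. 2 * \<i> * \<epsilon> * (- y' i t + \<epsilon> * \<i> / 2 * YP t
        + \<epsilon> / 4 * (x i t * q t) + \<i> / 4 * (XP t * s t) + \<epsilon> * \<i> / 4 * (YP t * c t)))"
      by (intro wl_cmult[where c = "2 * \<i> * \<epsilon>"] wl_add wl_uminus[OF y'c] wl_cmult[OF yp] wl_cmult[OF xq] wl_cmult[OF xs] wl_cmult[OF yc])
    then have Y: "wl n (Suc N) (y (Suc i))"
      by (rule wl_cong) (simp add: yrec[OF i] XP_def YP_def algebra_simps)
    let ?x' = "\<lambda>t. - \<epsilon> * q t / 4 * y (Suc i) t + \<i> * s t / 4 * y i t - \<epsilon> * \<i> * c t / 4 * x i t"
    have "wl n N (\<lambda>t. (- \<epsilon> / 4) * (q t * y (Suc i) t) + \<i> / 4 * (s t * y i t) - \<epsilon> * \<i> / 4 * (x i t * c t))"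
      by (intro wl_add wl_diff wl_cmult[OF wl_mult[OF qscb(1) wl_Suc_imp[OF Y]]]
          wl_cmult[OF wl_mult[OF qscb(2) wl_Suc_imp[OF wl_Suc_imp[OF IHi(1)]]]]
          wl_cmult[OF wl_mult[OF bl_mono[OF IHi(2)] wl_Suc_imp[OF qsc(3)]]]) simp
    then have 1: "wl n N ?x'" by (rule wl_cong) (simp add: algebra_simps)
    have "antideriv (x (Suc i)) ?x'"
    proof (rule antideriv_of_deriv)
      show "continuous_on {0..} ?x'"
        by (intro continuous_intros wl_continuous[OF Y] wl_continuous[OF IHi(1)] bl_continuous[OF IHi(2)]
            wl_continuous[OF qsc(1)] wl_continuous[OF qsc(2)] wl_continuous[OF qsc(3)]) auto
    qed (rule xrec[OF i])
    then have X: "bl n N (x (Suc i))" unfolding bl_def using 1 by blast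
    have "m + 2 - j = Suc N" "m + 1 - j = N" using Suc i by (auto simp: N_def)
    then show ?thesis using X Y Suc by simp
  qed
qed

text \<open>Inserting the truncated series into the gauged system, all powers below the last cancel by the recursion.
  What remains are the terms with the highest powers of k.\<close>

lemma truncation_identity:
  fixes x y x' y' :: "nat \<Rightarrow> complex"
  assumes k: "k \<noteq> 0" and \<epsilon>: "\<epsilon> * \<epsilon> = 1" and y0: "y 0 = 0" and x'0: "x' 0 = 0"
    and xr: "\<And>j. j \<le> m \<Longrightarrow> x' (Suc j) = - \<epsilon> * Q / 4 * y (Suc j) + \<i> * S / 4 * y j - \<epsilon> * \<i> * C / 4 * x j"
    and yr: "\<And>j. j \<le> m \<Longrightarrow> y (Suc j) = 2 * \<i> * \<epsilon> * (- y' j + \<epsilon> * \<i> / 2 * (if j = 0 then 0 else y (j - 1))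
        + \<epsilon> * Q / 4 * x j + \<i> * S / 4 * (if j = 0 then 0 else x (j - 1)) + \<epsilon> * \<i> * C / 4 * (if j = 0 then 0 else y (j - 1)))"
  shows "N \<le> Suc m \<Longrightarrow> (\<Sum>j\<le>N. k ^ j * x' j) = - \<epsilon> * \<i> * k * C / 4 * (\<Sum>j\<le>N. k ^ j * x j)
      + (- \<epsilon> * Q / 4 + \<i> * k * S / 4) * (\<Sum>j\<le>N. k ^ j * y j)
      + k ^ Suc N * (\<epsilon> * \<i> * C / 4 * x N - \<i> * S / 4 * y N)" (is "_ \<Longrightarrow> ?A N")
   and "N \<le> Suc m \<Longrightarrow> (\<Sum>j\<le>N. k ^ j * y' j) = phase \<epsilon> k * (\<Sum>j\<le>N. k ^ j * y j)
      + ((\<epsilon> * Q / 4 + \<i> * k * S / 4) * (\<Sum>j\<le>N. k ^ j * x j) + \<epsilon> * \<i> * k * C / 4 * (\<Sum>j\<le>N. k ^ j * y j)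
      + k ^ N * (y' N - \<i> * \<epsilon> / 2 * ((if N = 0 then 0 else y (N - 1)) + k * y N) - \<epsilon> * Q / 4 * x N
          - \<i> * S / 4 * ((if N = 0 then 0 else x (N - 1)) + k * x N)
          - \<epsilon> * \<i> * C / 4 * ((if N = 0 then 0 else y (N - 1)) + k * y N)))" (is "_ \<Longrightarrow> ?B N")
proof -
  show "N \<le> Suc m \<Longrightarrow> ?A N"
  proof (induction N)
    case 0 then show ?case using y0 x'0 by (simp add: algebra_simps)
  next
    case (Suc N)
    define K where "K = k ^ N"
    define Sx where "Sx = (\<Sum>j\<le>N. k ^ j * x j)"
    define Sy where "Sy = (\<Sum>j\<le>N. k ^ j * y j)"
    define Sd where "Sd = (\<Sum>j\<le>N. k ^ j * x' j)"
    have x': "x' (Suc N) = - \<epsilon> * Q / 4 * y (Suc N) + \<i> * S / 4 * y N - \<epsilon> * \<i> * C / 4 * x N" using xr Suc.prems by simp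
    have IH: "Sd = - \<epsilon> * \<i> * k * C / 4 * Sx + (- \<epsilon> * Q / 4 + \<i> * k * S / 4) * Sy
      + k * K * (\<epsilon> * \<i> * C / 4 * x N - \<i> * S / 4 * y N)"
      using Suc.IH Suc.prems by (simp add: Sd_def Sy_def Sx_def K_def)
    have "Sd + k * K * x' (Suc N) = - \<epsilon> * \<i> * k * C / 4 * (Sx + k * K * x (Suc N))
      + (- \<epsilon> * Q / 4 + \<i> * k * S / 4) * (Sy + k * K * y (Suc N))
      + k * (k * K) * (\<epsilon> * \<i> * C / 4 * x (Suc N) - \<i> * S / 4 * y (Suc N))"
      unfolding IH x' by (simp add: algebra_simps add_divide_distrib)
    then show ?case by (simp add: Sd_def Sy_def Sx_def K_def)
  qed
  define P where "P = phase \<epsilon> k"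
  have P: "P * k = \<i> * \<epsilon> / 2 * (k * k + 1)" using k by (simp add: P_def phase_def theta2_def field_simps)
  show "N \<le> Suc m \<Longrightarrow> ?B N" unfolding P_def[symmetric]
  proof (induction N)
    case 0 then show ?case using y0 by (simp add: algebra_simps)
  next
    case (Suc N)
    define K where "K = k ^ N"
    define yp where "yp = (if N = 0 then 0 else y (N - 1))"
    define xp where "xp = (if N = 0 then 0 else x (N - 1))"
    define Sx where "Sx = (\<Sum>j\<le>N. k ^ j * x j)"
    define Sy where "Sy = (\<Sum>j\<le>N. k ^ j * y j)"
    define Sd where "Sd = (\<Sum>j\<le>N. k ^ j * y' j)"
    define R where "R = \<epsilon> * \<i> / 2 * yp + \<epsilon> * Q / 4 * x N + \<i> * S / 4 * xp + \<epsilon> * \<i> * C / 4 * yp"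
    have y'N: "y' N = \<i> * \<epsilon> / 2 * y (Suc N) + R"
    proof -
      have yN: "y (Suc N) = 2 * \<i> * \<epsilon> * (- y' N + R)"
        using yr[of N] Suc.prems by (simp add: yp_def xp_def R_def add.assoc)
      define w where "w = \<i> * \<epsilon>"
      have "w * w = (\<i> * \<i>) * (\<epsilon> * \<epsilon>)" by (simp only: w_def mult_ac)
      then have ww: "w * w = -1" by (simp add: \<epsilon>)
      have "w * y (Suc N) = 2 * ((w * w) * (- y' N + R))" unfolding yN w_def by (simp only: mult_ac)
      then have "w * y (Suc N) = 2 * (y' N - R)" by (simp add: ww)
      then show ?thesis by (simp add: w_def field_simps)
    qed
    have IH: "Sd = P * Sy + ((\<epsilon> * Q / 4 + \<i> * k * S / 4) * Sx + \<epsilon> * \<i> * k * C / 4 * Sy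
      + K * (y' N - \<i> * \<epsilon> / 2 * (yp + k * y N) - \<epsilon> * Q / 4 * x N - \<i> * S / 4 * (xp + k * x N) - \<epsilon> * \<i> * C / 4 * (yp + k * y N)))"
      using Suc.IH Suc.prems by (simp add: Sd_def Sy_def Sx_def K_def yp_def xp_def)
    have "Sd + k * K * y' (Suc N) = P * (Sy + k * K * y (Suc N))
      + ((\<epsilon> * Q / 4 + \<i> * k * S / 4) * (Sx + k * K * x (Suc N)) + \<epsilon> * \<i> * k * C / 4 * (Sy + k * K * y (Suc N))
      + k * K * (y' (Suc N) - \<i> * \<epsilon> / 2 * (y N + k * y (Suc N)) - \<epsilon> * Q / 4 * x (Suc N)
          - \<i> * S / 4 * (x N + k * x (Suc N)) - \<epsilon> * \<i> * C / 4 * (y N + k * y (Suc N))))"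
    proof -
      have "P * (Sy + k * K * y (Suc N)) = P * Sy + (\<i> * \<epsilon> / 2 * (k * k + 1)) * K * y (Suc N)"
        unfolding P[symmetric] by (simp add: algebra_simps)
      then show ?thesis unfolding IH y'N R_def by (simp add: algebra_simps add_divide_distrib)
    qed
    then show ?case by (simp add: Sd_def Sy_def Sx_def K_def)
  qed
qed

lemma antideriv_sum:
  "(\<And>j. j \<le> N \<Longrightarrow> antideriv (F j) (f j)) \<Longrightarrow> antideriv (\<lambda>t. \<Sum>j\<le>N. a j * F j t) (\<lambda>t. \<Sum>j\<le>(N::nat). a j * f j t)"
proof (induction N)
  case 0 then show ?case using antideriv_cmult[of "F 0" "f 0" "a 0"] by simp
next
  case (Suc N)
  then have "antideriv (\<lambda>t. (\<Sum>j\<le>N. a j * F j t) + a (Suc N) * F (Suc N) t) (\<lambda>t. (\<Sum>j\<le>N. a j * f j t) + a (Suc N) * f (Suc N) t)"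
    by (intro antideriv_add antideriv_cmult) auto
  then show ?case by simp
qed

lemma wl0_norm_sum:
  assumes "\<And>w. w \<in> set ws \<Longrightarrow> wl n 0 w"
  shows "(\<lambda>t. (1 + t) ^ n * (\<Sum>w\<leftarrow>ws. norm (w t))) integrable_on {0..}"
    and "(\<lambda>t. \<Sum>w\<leftarrow>ws. norm (w t)) integrable_on {0..}"
  using assms
proof (induction ws)
  case (Cons w ws)
  case 1
  have "(\<lambda>t. norm (of_real ((1 + t) ^ n) * w t)) integrable_on {0..}"
    using 1[of w] by (simp add: absolutely_integrable_on_def)
  then have "(\<lambda>t. (1 + t) ^ n * norm (w t)) integrable_on {0..}"
    by (rule integrable_eq) (auto simp: norm_mult norm_power simp flip: of_real_power)
  moreover have "(\<lambda>t. (1 + t) ^ n * (\<Sum>w\<leftarrow>ws. norm (w t))) integrable_on {0..}" using Cons 1 by auto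
  ultimately show ?case by (simp add: distrib_left integrable_add)
next
  case (Cons w ws)
  case 2
  have "(\<lambda>t. norm (w t)) integrable_on {0..}"
    using wl0_imp_abs_int[OF 2[of w]] by (simp add: absolutely_integrable_on_def)
  moreover have "(\<lambda>t. \<Sum>w\<leftarrow>ws. norm (w t)) integrable_on {0..}" using Cons 2 by auto
  ultimately show ?case by (simp add: integrable_add)
qed (auto simp: integrable_0)

text \<open>The residual consists of the last two fast coefficients, the derivative of the last one, and the products of
  the last two coefficients of both kinds with q, s and c. All of these belong to the weighted class.\<close>

lemma truncated_solution:
  fixes x y :: "nat \<Rightarrow> real \<Rightarrow> complex"
  assumes q: "wl n (Suc m) q" and s: "wl n (Suc m) s" and c: "wl n (Suc m) c"
    and \<epsilon>: "\<epsilon> * \<epsilon> = 1"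
    and x0: "\<And>t. t \<ge> 0 \<Longrightarrow> x 0 t = c0" and y0: "\<And>t. t \<ge> 0 \<Longrightarrow> y 0 t = 0"
    and ydiff: "\<And>j t. j \<le> m \<Longrightarrow> t \<ge> 0 \<Longrightarrow> (y j has_vector_derivative y' j t) (at t within {0..})"
    and yrec: "\<And>j t. j \<le> m \<Longrightarrow> t \<ge> 0 \<Longrightarrow> y (Suc j) t = 2 * \<i> * \<epsilon> * (- y' j t + \<epsilon> * \<i> / 2 * (if j = 0 then 0 else y (j - 1) t)
        + \<epsilon> * q t / 4 * x j t + \<i> * s t / 4 * (if j = 0 then 0 else x (j - 1) t) + \<epsilon> * \<i> * c t / 4 * (if j = 0 then 0 else y (j - 1) t))"
    and xrec: "\<And>j t. j \<le> m \<Longrightarrow> t \<ge> 0 \<Longrightarrow> (x (Suc j) has_vector_derivative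
        - \<epsilon> * q t / 4 * y (Suc j) t + \<i> * s t / 4 * y j t - \<epsilon> * \<i> * c t / 4 * x j t) (at t within {0..})"
  shows "\<exists>\<phi> f g. (\<forall>k. k \<noteq> 0 \<longrightarrow> gsys \<epsilon> k q s c (f k) (g k) (\<lambda>t. \<Sum>j\<le>Suc m. k ^ j * x j t) (\<lambda>t. \<Sum>j\<le>Suc m. k ^ j * y j t)) \<and>
     (\<forall>k t. k \<noteq> 0 \<longrightarrow> norm k \<le> 2 \<longrightarrow> t \<ge> 0 \<longrightarrow> norm (f k t) + norm (g k t) \<le> norm k ^ Suc m * \<phi> t) \<and>
     (\<lambda>t. (1 + t) ^ n * \<phi> t) integrable_on {0..} \<and> \<phi> integrable_on {0..} \<and> (\<forall>t. \<phi> t \<ge> 0)"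
proof -
  have cl: "wl n (m + 2 - j) (y j) \<and> bl n (m + 1 - j) (x j)" if "j \<le> Suc m" for j
    by (rule coefficient_classes[where q = q and s = s and c = c and y' = y' and \<epsilon> = \<epsilon> and ?c0.0 = c0, OF q s c])
      (fact x0 | fact y0 | fact ydiff | fact yrec | fact xrec | fact that)+
  define xd where "xd j = (case j of 0 \<Rightarrow> (\<lambda>t. 0) | Suc i \<Rightarrow> (\<lambda>t. - \<epsilon> * q t / 4 * y (Suc i) t + \<i> * s t / 4 * y i t - \<epsilon> * \<i> * c t / 4 * x i t))" for j
  have cy: "continuous_on {0..} (y j)" if "j \<le> Suc m" for j
    using cl[OF that] that by (auto simp: Suc_diff_le intro: wl_continuous)
  have cx: "continuous_on {0..} (x j)" if "j \<le> Suc m" for j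
    using cl[OF that] bl_continuous by blast
  have xa: "antideriv (x j) (xd j)" if "j \<le> Suc m" for j
  proof (cases j)
    case 0
    then show ?thesis using antideriv_cong[OF antideriv_const[of c0], of "x 0" "xd 0"] x0 by (simp add: xd_def)
  next
    case (Suc i)
    show ?thesis unfolding Suc
    proof (rule antideriv_of_deriv)
      show "continuous_on {0..} (xd (Suc i))" unfolding xd_def
        using that Suc by (auto intro!: continuous_intros cx cy wl_continuous[OF q] wl_continuous[OF s] wl_continuous[OF c])
      show "(x (Suc i) has_vector_derivative xd (Suc i) t) (at t within {0..})" if "t \<ge> 0" for t
        using xrec[of i t] that \<open>j \<le> Suc m\<close> Suc by (simp add: xd_def)
    qed
  qed
  have "wl n (Suc 0) (y (Suc m))" using cl[of "Suc m"] by simp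
  then obtain z where z: "antideriv (y (Suc m)) z" "wl n 0 z" unfolding wl_Suc bl_def by blast
  define yd where "yd j = (if j \<le> m then y' j else z)" for j
  have ya: "antideriv (y j) (yd j)" if "j \<le> Suc m" for j
  proof (cases "j \<le> m")
    case True
    have "wl n (Suc (Suc (m - j))) (y j)" using cl[of j] True by (simp add: Suc_diff_le)
    then have "wl n (Suc (m - j)) (y' j)" by (rule wl_deriv_unique) (rule ydiff[OF True])
    then have "antideriv (y j) (y' j)" by (intro antideriv_of_deriv[OF wl_continuous] ydiff[OF True])
    then show ?thesis using True by (simp add: yd_def)
  next
    case False
    then have "j = Suc m" using that by simp
    then show ?thesis using z by (simp add: yd_def)
  qed
  let ?M = "Suc m"
  define f where "f k t = k ^ Suc ?M * (\<epsilon> * \<i> * c t / 4 * x ?M t - \<i> * s t / 4 * y ?M t)" for k t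
  define g where "g k t = k ^ ?M * (z t - \<i> * \<epsilon> / 2 * (y m t + k * y ?M t) - \<epsilon> * q t / 4 * x ?M t
          - \<i> * s t / 4 * (x m t + k * x ?M t) - \<epsilon> * \<i> * c t / 4 * (y m t + k * y ?M t))" for k t
  define ws where "ws = [z, y m, y ?M, \<lambda>t. x ?M t * q t, \<lambda>t. x m t * s t, \<lambda>t. x ?M t * s t, \<lambda>t. s t * y ?M t,
     \<lambda>t. x ?M t * c t, \<lambda>t. c t * y m t, \<lambda>t. c t * y ?M t]"
  define \<phi> where "\<phi> t = (\<Sum>w\<leftarrow>ws. norm (w t))" for t
  have w0: "wl n 0 q" "wl n 0 s" "wl n 0 c" "wl n 0 (y m)" "wl n 0 (y ?M)"
    by (rule wl_imp_wl0[OF q] wl_imp_wl0[OF s] wl_imp_wl0[OF c]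
        wl_imp_wl0[OF conjunct1[OF cl[of m]]] wl_imp_wl0[OF conjunct1[OF cl[of ?M]]]; simp)+
  have b0: "bl n 0 (x m)" "bl n 0 (x ?M)" "bl n 0 s" "bl n 0 c"
    by (rule bl_mono[OF conjunct2[OF cl[of m]]] bl_mono[OF conjunct2[OF cl[of ?M]]]
        wl_imp_bl[OF s] wl_imp_bl[OF c]; simp)+
  have ws: "wl n 0 w" if "w \<in> set ws" for w
  proof -
    note m = bl_wl0_mult[OF b0(2) w0(1)] bl_wl0_mult[OF b0(1) w0(2)] bl_wl0_mult[OF b0(2) w0(2)] bl_wl0_mult[OF b0(3) w0(5)]
      bl_wl0_mult[OF b0(2) w0(3)] bl_wl0_mult[OF b0(4) w0(4)] bl_wl0_mult[OF b0(4) w0(5)]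
    have "w = z \<or> w = y m \<or> w = y ?M \<or> w = (\<lambda>t. x ?M t * q t) \<or> w = (\<lambda>t. x m t * s t) \<or> w = (\<lambda>t. x ?M t * s t)
      \<or> w = (\<lambda>t. s t * y ?M t) \<or> w = (\<lambda>t. x ?M t * c t) \<or> w = (\<lambda>t. c t * y m t) \<or> w = (\<lambda>t. c t * y ?M t)"
      using that unfolding ws_def by (simp only: list.set insert_iff empty_iff simp_thms)
    then show ?thesis
      by (elim disjE) (simp_all only: z(2) w0 m)
  qed
  have ne: "norm \<epsilon> = 1"
  proof -
    have "norm \<epsilon> * norm \<epsilon> = 1" using arg_cong[OF \<epsilon>, of norm] by (simp add: norm_mult)
    then show ?thesis using norm_ge_zero[of \<epsilon>] by (metis power2_eq_square power2_eq_1_iff norm_ge_zero neg_0_le_iff_le not_one_le_zero)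
  qed
  have sys: "gsys \<epsilon> k q s c (f k) (g k) (\<lambda>t. \<Sum>j\<le>?M. k ^ j * x j t) (\<lambda>t. \<Sum>j\<le>?M. k ^ j * y j t)" if k: "k \<noteq> 0" for k
  proof -
    have id: "(\<Sum>j\<le>?M. k ^ j * xd j t) = - \<epsilon> * \<i> * k * c t / 4 * (\<Sum>j\<le>?M. k ^ j * x j t)
      + (- \<epsilon> * q t / 4 + \<i> * k * s t / 4) * (\<Sum>j\<le>?M. k ^ j * y j t) + f k t"
     "(\<Sum>j\<le>?M. k ^ j * yd j t) = phase \<epsilon> k * (\<Sum>j\<le>?M. k ^ j * y j t)
      + ((\<epsilon> * q t / 4 + \<i> * k * s t / 4) * (\<Sum>j\<le>?M. k ^ j * x j t) + \<epsilon> * \<i> * k * c t / 4 * (\<Sum>j\<le>?M. k ^ j * y j t) + g k t)"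
      if t: "t \<ge> 0" for t
    proof -
      have yr: "y (Suc j) t = 2 * \<i> * \<epsilon> * (- yd j t + \<epsilon> * \<i> / 2 * (if j = 0 then 0 else y (j - 1) t)
        + \<epsilon> * q t / 4 * x j t + \<i> * s t / 4 * (if j = 0 then 0 else x (j - 1) t) + \<epsilon> * \<i> * c t / 4 * (if j = 0 then 0 else y (j - 1) t))"
        if "j \<le> m" for j using yrec[OF that t] that by (simp add: yd_def)
      note ti = truncation_identity[OF k \<epsilon>, of "\<lambda>j. y j t" "\<lambda>j. xd j t" m "q t" "s t" "c t" "\<lambda>j. x j t" "\<lambda>j. yd j t" ?M, OF y0[OF t] _ _ yr]
      show "(\<Sum>j\<le>?M. k ^ j * xd j t) = - \<epsilon> * \<i> * k * c t / 4 * (\<Sum>j\<le>?M. k ^ j * x j t)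
      + (- \<epsilon> * q t / 4 + \<i> * k * s t / 4) * (\<Sum>j\<le>?M. k ^ j * y j t) + f k t"
        unfolding f_def by (rule ti(1)) (auto simp: xd_def)
      have "yd ?M = z" by (simp add: yd_def)
      then show "(\<Sum>j\<le>?M. k ^ j * yd j t) = phase \<epsilon> k * (\<Sum>j\<le>?M. k ^ j * y j t)
      + ((\<epsilon> * q t / 4 + \<i> * k * s t / 4) * (\<Sum>j\<le>?M. k ^ j * x j t) + \<epsilon> * \<i> * k * c t / 4 * (\<Sum>j\<le>?M. k ^ j * y j t) + g k t)"
        using ti(2) unfolding g_def by (simp add: xd_def)
    qed
    show ?thesis unfolding gsys_def colsys_def
    proof (intro conjI)
      show "antideriv (\<lambda>t. \<Sum>j\<le>?M. k ^ j * x j t) (\<lambda>t. - \<epsilon> * \<i> * k * c t / 4 * (\<Sum>j\<le>?M. k ^ j * x j t)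
        + (- \<epsilon> * q t / 4 + \<i> * k * s t / 4) * (\<Sum>j\<le>?M. k ^ j * y j t) + f k t)"
        by (rule antideriv_cong[OF antideriv_sum[of ?M x xd "\<lambda>j. k ^ j"]]) (use xa id(1) in auto)
      show "antideriv (\<lambda>t. \<Sum>j\<le>?M. k ^ j * y j t) (\<lambda>t. phase \<epsilon> k * (\<Sum>j\<le>?M. k ^ j * y j t)
      + ((\<epsilon> * q t / 4 + \<i> * k * s t / 4) * (\<Sum>j\<le>?M. k ^ j * x j t) + \<epsilon> * \<i> * k * c t / 4 * (\<Sum>j\<le>?M. k ^ j * y j t) + g k t))"
        by (rule antideriv_cong[OF antideriv_sum[of ?M y yd "\<lambda>j. k ^ j"]]) (use ya id(2) in auto)
    qed
  qed
  have bd: "norm (f k t) + norm (g k t) \<le> norm k ^ ?M * \<phi> t" if k: "norm k \<le> 2" for k t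
  proof -
    have k2: "norm (k * a) \<le> 2 * norm a" for a using k by (simp add: norm_mult mult_right_mono)
    have two: "norm (a + k * b) \<le> norm a + 2 * norm b" for a b
      using norm_triangle_ineq[of a "k * b"] k2[of b] by linarith
    have mul: "norm (u * (a + k * b)) \<le> norm u * norm a + 2 * (norm u * norm b)" for u a b
      unfolding norm_mult using mult_left_mono[OF two[of a b] norm_ge_zero[of u]] by (simp add: distrib_left)
    have five: "norm (a - b - c - d - e) \<le> norm a + norm b + norm c + norm d + norm e" for a b c d e :: complex
      using norm_triangle_ineq4[of "a - b - c - d" e] norm_triangle_ineq4[of "a - b - c" d] norm_triangle_ineq4[of "a - b" c] norm_triangle_ineq4[of a b]
      by linarith
    define G where "G = z t - \<i> * \<epsilon> / 2 * (y m t + k * y ?M t) - \<epsilon> * q t / 4 * x ?M t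
          - \<i> * s t / 4 * (x m t + k * x ?M t) - \<epsilon> * \<i> * c t / 4 * (y m t + k * y ?M t)"
    have "norm G \<le> norm (z t) + norm (\<i> * \<epsilon> / 2 * (y m t + k * y ?M t)) + norm (\<epsilon> * q t / 4 * x ?M t)
       + norm (\<i> * s t / 4 * (x m t + k * x ?M t)) + norm (\<epsilon> * \<i> * c t / 4 * (y m t + k * y ?M t))"
      unfolding G_def by (rule five)
    moreover have "norm (\<i> * \<epsilon> / 2 * (y m t + k * y ?M t)) \<le> (norm (y m t) + 2 * norm (y ?M t)) / 2"
      using two[of "y m t" "y ?M t"] by (simp add: norm_mult norm_divide ne)
    moreover have "norm (\<epsilon> * q t / 4 * x ?M t) = norm (x ?M t * q t) / 4" by (simp add: norm_mult norm_divide ne)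
    moreover have "norm (\<i> * s t / 4 * (x m t + k * x ?M t)) \<le> (norm (x m t * s t) + 2 * norm (x ?M t * s t)) / 4"
      using mul[of "\<i> * s t / 4" "x m t" "x ?M t"] by (simp add: norm_mult norm_divide mult.commute)
    moreover have "norm (\<epsilon> * \<i> * c t / 4 * (y m t + k * y ?M t)) \<le> (norm (c t * y m t) + 2 * norm (c t * y ?M t)) / 4"
      using mul[of "\<epsilon> * \<i> * c t / 4" "y m t" "y ?M t"] by (simp add: norm_mult norm_divide ne)
    moreover have "norm (k * (\<epsilon> * \<i> * c t / 4 * x ?M t - \<i> * s t / 4 * y ?M t)) \<le> (norm (x ?M t * c t) + norm (s t * y ?M t)) / 2"
    proof -
      have "norm (\<epsilon> * \<i> * c t / 4 * x ?M t - \<i> * s t / 4 * y ?M t) \<le> norm (x ?M t * c t) / 4 + norm (s t * y ?M t) / 4"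
        using norm_triangle_ineq4[of "\<epsilon> * \<i> * c t / 4 * x ?M t" "\<i> * s t / 4 * y ?M t"] by (simp add: norm_mult norm_divide ne mult.commute)
      from order_trans[OF k2 mult_left_mono[OF this]] show ?thesis by (simp add: field_simps)
    qed
    moreover have ar: "F + G' \<le> z' + (y1 + (y2 + (xq + (xs1 + (xs2 + (sy + (xc + (c1 + (c2 + 0)))))))))"
      if "G' \<le> z' + A + Q + B + C" "A \<le> (y1 + 2 * y2) / 2" "Q = xq / 4" "B \<le> (xs1 + 2 * xs2) / 4"
        "C \<le> (c1 + 2 * c2) / 4" "F \<le> (xc + sy) / 2"
        "0 \<le> y1" "0 \<le> xq" "0 \<le> xs1" "0 \<le> xs2" "0 \<le> sy" "0 \<le> xc" "0 \<le> c1" "0 \<le> c2"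
      for F G' z' A Q B C y1 y2 xq xs1 xs2 sy xc c1 c2 :: real
    proof -
      have "A \<le> y1 / 2 + y2" "B \<le> xs1 / 4 + xs2 / 2" "C \<le> c1 / 4 + c2 / 2" "F \<le> xc / 2 + sy / 2"
        using that by (simp_all add: add_divide_distrib)
      then show ?thesis using that by linarith
    qed
    ultimately have "norm (k * (\<epsilon> * \<i> * c t / 4 * x ?M t - \<i> * s t / 4 * y ?M t)) + norm G \<le> \<phi> t"
      unfolding \<phi>_def ws_def list.map sum_list.Cons sum_list.Nil by (intro ar) (assumption | rule norm_ge_zero)+
    then have "norm k ^ ?M * (norm (k * (\<epsilon> * \<i> * c t / 4 * x ?M t - \<i> * s t / 4 * y ?M t)) + norm G) \<le> norm k ^ ?M * \<phi> t"
      by (intro mult_left_mono) auto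
    moreover have "f k t = k ^ ?M * (k * (\<epsilon> * \<i> * c t / 4 * x ?M t - \<i> * s t / 4 * y ?M t))" "g k t = k ^ ?M * G"
      by (simp_all add: f_def g_def G_def)
    ultimately show ?thesis by (simp only: norm_mult norm_power distrib_left)
  qed
  have "\<phi> t \<ge> 0" for t by (simp add: \<phi>_def ws_def)
  moreover have "(\<lambda>t. (1 + t) ^ n * \<phi> t) integrable_on {0..}" "\<phi> integrable_on {0..}"
    unfolding \<phi>_def[abs_def] by (rule wl0_norm_sum(1)[of ws n, OF ws] wl0_norm_sum(2)[of ws n, OF ws]; assumption)+
  ultimately show ?thesis using sys bd by blast
qed

section \<open>The gauge transformation\<close>

text \<open>C and S are the cosine and sine of half the angle, \<open>q + 2 p\<close> is the coefficient of the original system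
  that q replaces, and \<open>\<sigma>\<close> is the sign that makes the rotation tend to the identity at infinity.\<close>

locale gauged = potential q s c for q s c +
  fixes n m :: nat and p C S :: "real \<Rightarrow> complex" and \<sigma> :: complex
  assumes wq: "wl n (Suc m) q" and ws: "wl n (Suc m) s" and wc: "wl n (Suc m) c"
    and cp: "continuous_on {0..} p" and Lp: "p absolutely_integrable_on {0..}"
    and aC: "antideriv C (\<lambda>t. - S t * p t / 2)" and aS: "antideriv S (\<lambda>t. C t * p t / 2)"
    and CS: "\<And>t. C t * C t + S t * S t = 1"
    and c_eq: "\<And>t. c t = - 2 * S t * S t" and s_eq: "\<And>t. s t = 2 * S t * C t"
    and C1: "\<And>t. norm (C t) \<le> 1" and S1: "\<And>t. norm (S t) \<le> 1"
    and \<sigma>2: "\<sigma> * \<sigma> = 1" and \<sigma>1: "norm \<sigma> = 1"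
begin

lemma cC: "continuous_on {0..} C" and cS: "continuous_on {0..} S"
  using antideriv_continuous aC aS by auto

text \<open>The system for a column of the original equation, with its pole at k = 0.\<close>

definition usys where
  "usys \<epsilon> k = colsys (phase \<epsilon> k) (\<lambda>t. - \<epsilon> * \<i> * c t / (4 * k)) (\<lambda>t. - \<epsilon> * (q t + 2 * p t) / 4 - \<i> * s t / (4 * k))
     (\<lambda>t. \<epsilon> * (q t + 2 * p t) / 4 - \<i> * s t / (4 * k)) (\<lambda>t. \<epsilon> * \<i> * c t / (4 * k)) (\<lambda>_. 0) (\<lambda>_. 0)"

lemma usys_swap:
  assumes "usys \<epsilon> k u w"
  shows "usys (- \<epsilon>) k (\<lambda>t. exp (- phase \<epsilon> k * of_real t) * w t) (\<lambda>t. exp (- phase \<epsilon> k * of_real t) * u t)"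
  using colsys_swap[OF assms[unfolded usys_def]] unfolding usys_def phase_minus by simp

definition gu where "gu \<epsilon> u w t = \<sigma> * (C t * u t + \<epsilon> * S t * w t)"
definition gw where "gw \<epsilon> u w t = \<sigma> * (- \<epsilon> * S t * u t + C t * w t)"

text \<open>The terms with \<open>1 / k\<close> in the original system and the term \<open>1 / k\<close> of the phase form a matrix that the
  rotation by the half angle diagonalizes; the derivative of the rotation accounts for the change from
  \<open>q + 2 p\<close> to q.\<close>

lemma gauge_gsys:
  assumes u: "usys \<epsilon> k u w" and \<epsilon>: "\<epsilon> * \<epsilon> = 1" and k: "k \<noteq> 0"
  shows "gsys \<epsilon> k q s c (\<lambda>_. 0) (\<lambda>_. 0) (gu \<epsilon> u w) (gw \<epsilon> u w)"
proof -
  define l where "l = 1 / k"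
  define h where "h = phase \<epsilon> k"
  have h2: "2 * h = \<i> * \<epsilon> * (k + l)" by (simp add: h_def phase_def theta2_def l_def)
  have dk: "z / (4 * k) = z * l / 4" for z by (simp add: l_def)
  let ?u' = "\<lambda>t. - \<epsilon> * \<i> * c t / (4 * k) * u t + (- \<epsilon> * (q t + 2 * p t) / 4 - \<i> * s t / (4 * k)) * w t + 0"
  let ?w' = "\<lambda>t. phase \<epsilon> k * w t + ((\<epsilon> * (q t + 2 * p t) / 4 - \<i> * s t / (4 * k)) * u t + \<epsilon> * \<i> * c t / (4 * k) * w t + 0)"
  have au: "antideriv u ?u'" and aw: "antideriv w ?w'"
    using u by (auto simp: usys_def colsys_def)
  have dC: "continuous_on {0..} (\<lambda>t. - S t * p t / 2)" and dS: "continuous_on {0..} (\<lambda>t. C t * p t / 2)"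
    by (intro continuous_intros cC cS cp; simp)+
  note Cu = antideriv_mult[OF aC dC au] and Sw = antideriv_mult[OF aS dS aw] and Su = antideriv_mult[OF aS dS au] and Cw = antideriv_mult[OF aC dC aw]
  note Gu = antideriv_cmult[OF antideriv_add[OF Cu antideriv_cmult[OF Sw, of \<epsilon>]], of \<sigma>]
  note Gw = antideriv_cmult[OF antideriv_add[OF antideriv_cmult[OF Su, of "- \<epsilon>"] Cw], of \<sigma>]
  show ?thesis unfolding gsys_def colsys_def
  proof (intro conjI)
    show "antideriv (gu \<epsilon> u w) (\<lambda>t. - \<epsilon> * \<i> * k * c t / 4 * gu \<epsilon> u w t + (- \<epsilon> * q t / 4 + \<i> * k * s t / 4) * gw \<epsilon> u w t + 0)"
    proof (rule antideriv_cong[OF Gu])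
      fix t :: real
      show "\<sigma> * (C t * u t + \<epsilon> * (S t * w t)) = gu \<epsilon> u w t" by (simp add: gu_def)
      let ?X = "- S t * p t / 2 * u t + C t * (- \<epsilon> * \<i> * c t * l / 4 * u t + (- \<epsilon> * (q t + 2 * p t) / 4 - \<i> * s t * l / 4) * w t)
          + \<epsilon> * (C t * p t / 2 * w t + S t * (h * w t + ((\<epsilon> * (q t + 2 * p t) / 4 - \<i> * s t * l / 4) * u t + \<epsilon> * \<i> * c t * l / 4 * w t)))"
      let ?Y = "- \<epsilon> * \<i> * k * c t / 4 * (C t * u t + \<epsilon> * S t * w t) + (- \<epsilon> * q t / 4 + \<i> * k * s t / 4) * (- \<epsilon> * S t * u t + C t * w t)"
      have "4 * ?X = 4 * ?Y"
        using CS[of t] \<epsilon> h2 c_eq[of t] s_eq[of t] by algebra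
      then have alg: "?X = ?Y" by (rule mult_left_cancel[THEN iffD1, rotated]) simp
      show "\<sigma> * (- S t * p t / 2 * u t + C t * ?u' t + \<epsilon> * (C t * p t / 2 * w t + S t * ?w' t))
        = - \<epsilon> * \<i> * k * c t / 4 * gu \<epsilon> u w t + (- \<epsilon> * q t / 4 + \<i> * k * s t / 4) * gw \<epsilon> u w t + 0"
        unfolding gu_def gw_def h_def[symmetric] dk add_0_right alg
        by (simp only: distrib_left mult.left_commute[of _ \<sigma>])
    qed
    show "antideriv (gw \<epsilon> u w) (\<lambda>t. phase \<epsilon> k * gw \<epsilon> u w t + ((\<epsilon> * q t / 4 + \<i> * k * s t / 4) * gu \<epsilon> u w t + \<epsilon> * \<i> * k * c t / 4 * gw \<epsilon> u w t + 0))"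
    proof (rule antideriv_cong[OF Gw])
      fix t :: real
      show "\<sigma> * (- \<epsilon> * (S t * u t) + C t * w t) = gw \<epsilon> u w t" by (simp add: gw_def)
      let ?X = "- \<epsilon> * (C t * p t / 2 * u t + S t * (- \<epsilon> * \<i> * c t * l / 4 * u t + (- \<epsilon> * (q t + 2 * p t) / 4 - \<i> * s t * l / 4) * w t))
          + (- S t * p t / 2 * w t + C t * (h * w t + ((\<epsilon> * (q t + 2 * p t) / 4 - \<i> * s t * l / 4) * u t + \<epsilon> * \<i> * c t * l / 4 * w t)))"
      let ?Y = "h * (- \<epsilon> * S t * u t + C t * w t) + ((\<epsilon> * q t / 4 + \<i> * k * s t / 4) * (C t * u t + \<epsilon> * S t * w t) + \<epsilon> * \<i> * k * c t / 4 * (- \<epsilon> * S t * u t + C t * w t))"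
      have "4 * ?X = 4 * ?Y"
        using CS[of t] \<epsilon> h2 c_eq[of t] s_eq[of t] by algebra
      then have alg: "?X = ?Y" by (rule mult_left_cancel[THEN iffD1, rotated]) simp
      show "\<sigma> * (- \<epsilon> * (C t * p t / 2 * u t + S t * ?u' t) + (- S t * p t / 2 * w t + C t * ?w' t))
        = phase \<epsilon> k * gw \<epsilon> u w t + ((\<epsilon> * q t / 4 + \<i> * k * s t / 4) * gu \<epsilon> u w t + \<epsilon> * \<i> * k * c t / 4 * gw \<epsilon> u w t + 0)"
        unfolding gu_def gw_def h_def[symmetric] dk add_0_right alg
        by (simp only: distrib_left mult.left_commute[of _ \<sigma>])
    qed
  qed
qed

lemma ungauge:
  assumes \<epsilon>: "\<epsilon> * \<epsilon> = 1"
  shows "u t = \<sigma> * (C t * gu \<epsilon> u w t - \<epsilon> * S t * gw \<epsilon> u w t)" "w t = \<sigma> * (\<epsilon> * S t * gu \<epsilon> u w t + C t * gw \<epsilon> u w t)"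
proof -
  have "\<sigma> * (C t * gu \<epsilon> u w t - \<epsilon> * S t * gw \<epsilon> u w t) = (\<sigma> * \<sigma>) * (C t * C t + (\<epsilon> * \<epsilon>) * (S t * S t)) * u t"
    by (simp add: gu_def gw_def algebra_simps)
  then show "u t = \<sigma> * (C t * gu \<epsilon> u w t - \<epsilon> * S t * gw \<epsilon> u w t)" by (simp add: \<sigma>2 \<epsilon> CS)
  have "\<sigma> * (\<epsilon> * S t * gu \<epsilon> u w t + C t * gw \<epsilon> u w t) = (\<sigma> * \<sigma>) * (C t * C t + (\<epsilon> * \<epsilon>) * (S t * S t)) * w t"
    by (simp add: gu_def gw_def algebra_simps)
  then show "w t = \<sigma> * (\<epsilon> * S t * gu \<epsilon> u w t + C t * gw \<epsilon> u w t)" by (simp add: \<sigma>2 \<epsilon> CS)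
qed

lemma usys_holomorphic:
  assumes sys: "\<And>k. k \<noteq> 0 \<Longrightarrow> usys \<epsilon> k (u k) (w k)"
    and init: "\<And>k. k \<noteq> 0 \<Longrightarrow> u k 0 = u0" "\<And>k. k \<noteq> 0 \<Longrightarrow> w k 0 = w0" and t: "t \<ge> 0"
  shows "(\<lambda>k. u k t) holomorphic_on - {0}" "(\<lambda>k. w k t) holomorphic_on - {0}"
proof -
  let ?a = "\<lambda>k t. - \<epsilon> * \<i> * c t / (4 * k)" and ?b = "\<lambda>k t. - \<epsilon> * (q t + 2 * p t) / 4 - \<i> * s t / (4 * k)"
  let ?c = "\<lambda>k t. \<epsilon> * (q t + 2 * p t) / 4 - \<i> * s t / (4 * k)" and ?d = "\<lambda>k t. phase \<epsilon> k + \<epsilon> * \<i> * c t / (4 * k)"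
  have L: "laurent_coef ?a" "laurent_coef ?b" "laurent_coef ?c" "laurent_coef ?d"
  proof -
    show "laurent_coef ?a"
      by (rule laurent_coefI[where p = "\<lambda>_. 0" and r = "\<lambda>_. 0" and l = "\<lambda>t. - \<epsilon> * \<i> * c t / 4"])
        (auto intro!: continuous_intros cc cs cq cp)
    show "laurent_coef ?b"
      by (rule laurent_coefI[where p = "\<lambda>t. - \<epsilon> * (q t + 2 * p t) / 4" and r = "\<lambda>_. 0" and l = "\<lambda>t. - \<i> * s t / 4"])
        (auto intro!: continuous_intros cc cs cq cp)
    show "laurent_coef ?c"
      by (rule laurent_coefI[where p = "\<lambda>t. \<epsilon> * (q t + 2 * p t) / 4" and r = "\<lambda>_. 0" and l = "\<lambda>t. - \<i> * s t / 4"])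
        (auto intro!: continuous_intros cc cs cq cp)
    show "laurent_coef ?d"
      by (rule laurent_coefI[where p = "\<lambda>_. 0" and r = "\<lambda>_. \<i> * \<epsilon> / 2" and l = "\<lambda>t. \<i> * \<epsilon> / 2 + \<epsilon> * \<i> * c t / 4"])
        (auto intro!: continuous_intros cc cs cq cp simp: phase_def theta2_def distrib_left add_divide_distrib)
  qed
  have "colsys 0 (?a k) (?b k) (?c k) (?d k) (\<lambda>_. 0) (\<lambda>_. 0) (u k) (w k)" if "k \<noteq> 0" for k
    using colsys_absorb[OF sys[OF that, unfolded usys_def]] .
  from colsys_holomorphic[OF L this init t]
  show "(\<lambda>k. u k t) holomorphic_on - {0}" "(\<lambda>k. w k t) holomorphic_on - {0}" by auto
qed

text \<open>The pair of truncated series solves the gauged system up to a residual of order \<open>m + 1\<close> in k.\<close>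

definition trunc :: "complex \<Rightarrow> (nat \<Rightarrow> real \<Rightarrow> complex) \<Rightarrow> (nat \<Rightarrow> real \<Rightarrow> complex) \<Rightarrow> bool" where
  "trunc \<epsilon> x y \<longleftrightarrow> (\<exists>\<phi> f g. (\<forall>k. k \<noteq> 0 \<longrightarrow> gsys \<epsilon> k q s c (f k) (g k) (\<lambda>t. \<Sum>j\<le>Suc m. k ^ j * x j t) (\<lambda>t. \<Sum>j\<le>Suc m. k ^ j * y j t)) \<and>
     (\<forall>k t. k \<noteq> 0 \<longrightarrow> norm k \<le> 2 \<longrightarrow> t \<ge> 0 \<longrightarrow> norm (f k t) + norm (g k t) \<le> norm k ^ Suc m * \<phi> t) \<and>
     (\<lambda>t. (1 + t) ^ n * \<phi> t) integrable_on {0..} \<and> \<phi> integrable_on {0..} \<and> (\<forall>t. \<phi> t \<ge> 0))"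

abbreviation psum :: "(nat \<Rightarrow> real \<Rightarrow> complex) \<Rightarrow> complex \<Rightarrow> real \<Rightarrow> complex" where
  "psum x k t \<equiv> (\<Sum>j\<le>Suc m. k ^ j * x j t)"

lemma gu_hol:
  assumes "(\<lambda>k. u k t) holomorphic_on A" "(\<lambda>k. w k t) holomorphic_on A"
  shows "(\<lambda>k. gu \<epsilon> (u k) (w k) t) holomorphic_on A" "(\<lambda>k. gw \<epsilon> (u k) (w k) t) holomorphic_on A"
  unfolding gu_def gw_def by (intro holomorphic_intros assms)+

lemma phase_holomorphic: "phase \<epsilon> holomorphic_on - {0}"
  unfolding phase_def[abs_def] theta2_def[abs_def] by (intro holomorphic_intros) auto

section \<open>Errors of the truncated expansions\<close>

text \<open>The approximation of a column combines truncated solutions for the sign \<open>\<epsilon>\<close> with truncated solutions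
  for the opposite sign, multiplied by \<open>exp (h t)\<close>. The coefficients a and b are the entries of the column of the
  inverse gauge matrix at time 0, and together with the normalization of the coefficients at time 0 they
  make the error vanish there. Where the real part of the phase has the opposite sign, the same estimate applies after
  the exchange of the components.\<close>

lemma U_error:
  fixes su fu :: "complex \<Rightarrow> real \<Rightarrow> complex"
  assumes \<epsilon>: "\<epsilon> * \<epsilon> = 1" "norm \<epsilon> = 1"
    and sys: "\<And>k. k \<noteq> 0 \<Longrightarrow> usys \<epsilon> k (su k) (fu k)" and init: "\<And>k. k \<noteq> 0 \<Longrightarrow> su k 0 = 1" "\<And>k. k \<noteq> 0 \<Longrightarrow> fu k 0 = 0"
    and tr: "trunc \<epsilon> xz yz" "trunc \<epsilon> xv yv" "trunc (- \<epsilon>) xz' yz'" "trunc (- \<epsilon>) xv' yv'"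
    and z0: "\<And>k. psum xz k 0 + psum yv' k 0 = 1" "\<And>k. psum xv k 0 + psum yz' k 0 = 0"
      "\<And>k. psum yz k 0 + psum xv' k 0 = 0" "\<And>k. psum yv k 0 + psum xz' k 0 = 1"
  defines "a \<equiv> \<sigma> * C 0" and "b \<equiv> - \<epsilon> * \<sigma> * S 0"
  defines "Yu \<equiv> \<lambda>k t. gu \<epsilon> (su k) (fu k) t - (a * psum xz k t + b * psum xv k t) - exp (phase \<epsilon> k * of_real t) * (a * psum yv' k t + b * psum yz' k t)"
    and "Yw \<equiv> \<lambda>k t. gw \<epsilon> (su k) (fu k) t - (a * psum yz k t + b * psum yv k t) - exp (phase \<epsilon> k * of_real t) * (a * psum xv' k t + b * psum xz' k t)"
  shows "\<And>t. t \<ge> 0 \<Longrightarrow> (\<lambda>k. Yu k t) holomorphic_on - {0}" "\<And>t. t \<ge> 0 \<Longrightarrow> (\<lambda>k. Yw k t) holomorphic_on - {0}"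
    and "\<exists>K\<ge>0. \<forall>j\<le>n. \<forall>t\<ge>0. \<forall>k. k \<noteq> 0 \<longrightarrow> norm k \<le> 1 \<longrightarrow>
      (Re (phase \<epsilon> k) \<le> 0 \<longrightarrow> norm ((deriv ^^ j) (\<lambda>k. Yu k t) k) \<le> K * ((1 + t) ^ j * norm k ^ Suc m / norm k ^ (2 * j)) \<and>
         norm ((deriv ^^ j) (\<lambda>k. Yw k t) k) \<le> K * ((1 + t) ^ j * norm k ^ Suc m / norm k ^ (2 * j))) \<and>
      (Re (phase \<epsilon> k) \<ge> 0 \<longrightarrow> norm ((deriv ^^ j) (\<lambda>k. exp (- phase \<epsilon> k * of_real t) * Yu k t) k) \<le> K * ((1 + t) ^ j * norm k ^ Suc m / norm k ^ (2 * j)) \<and>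
         norm ((deriv ^^ j) (\<lambda>k. exp (- phase \<epsilon> k * of_real t) * Yw k t) k) \<le> K * ((1 + t) ^ j * norm k ^ Suc m / norm k ^ (2 * j)))"
proof -
  have hol: "(\<lambda>k. Yu k t) holomorphic_on - {0}" "(\<lambda>k. Yw k t) holomorphic_on - {0}" if t: "t \<ge> 0" for t
    unfolding Yu_def Yw_def
    by (intro holomorphic_intros gu_hol usys_holomorphic[OF sys init t] holomorphic_on_compose_gen[OF _ holomorphic_on_exp, unfolded o_def] phase_holomorphic; auto)+
  then show "\<And>t. t \<ge> 0 \<Longrightarrow> (\<lambda>k. Yu k t) holomorphic_on - {0}" "\<And>t. t \<ge> 0 \<Longrightarrow> (\<lambda>k. Yw k t) holomorphic_on - {0}" by auto
  obtain \<phi>1 f1 g1 where 1: "\<And>k. k \<noteq> 0 \<Longrightarrow> gsys \<epsilon> k q s c (f1 k) (g1 k) (psum xz k) (psum yz k)"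
    "\<And>k t. k \<noteq> 0 \<Longrightarrow> norm k \<le> 2 \<Longrightarrow> t \<ge> 0 \<Longrightarrow> norm (f1 k t) + norm (g1 k t) \<le> norm k ^ Suc m * \<phi>1 t"
    "\<phi>1 integrable_on {0..}" "\<And>t. \<phi>1 t \<ge> 0" using tr(1) unfolding trunc_def by blast
  obtain \<phi>2 f2 g2 where 2: "\<And>k. k \<noteq> 0 \<Longrightarrow> gsys \<epsilon> k q s c (f2 k) (g2 k) (psum xv k) (psum yv k)"
    "\<And>k t. k \<noteq> 0 \<Longrightarrow> norm k \<le> 2 \<Longrightarrow> t \<ge> 0 \<Longrightarrow> norm (f2 k t) + norm (g2 k t) \<le> norm k ^ Suc m * \<phi>2 t"
    "\<phi>2 integrable_on {0..}" "\<And>t. \<phi>2 t \<ge> 0" using tr(2) unfolding trunc_def by blast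
  obtain \<phi>3 f3 g3 where 3: "\<And>k. k \<noteq> 0 \<Longrightarrow> gsys (- \<epsilon>) k q s c (f3 k) (g3 k) (psum xz' k) (psum yz' k)"
    "\<And>k t. k \<noteq> 0 \<Longrightarrow> norm k \<le> 2 \<Longrightarrow> t \<ge> 0 \<Longrightarrow> norm (f3 k t) + norm (g3 k t) \<le> norm k ^ Suc m * \<phi>3 t"
    "\<phi>3 integrable_on {0..}" "\<And>t. \<phi>3 t \<ge> 0" using tr(3) unfolding trunc_def by blast
  obtain \<phi>4 f4 g4 where 4: "\<And>k. k \<noteq> 0 \<Longrightarrow> gsys (- \<epsilon>) k q s c (f4 k) (g4 k) (psum xv' k) (psum yv' k)"
    "\<And>k t. k \<noteq> 0 \<Longrightarrow> norm k \<le> 2 \<Longrightarrow> t \<ge> 0 \<Longrightarrow> norm (f4 k t) + norm (g4 k t) \<le> norm k ^ Suc m * \<phi>4 t"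
    "\<phi>4 integrable_on {0..}" "\<And>t. \<phi>4 t \<ge> 0" using tr(4) unfolding trunc_def by blast
  define \<phi> where "\<phi> t = \<phi>1 t + \<phi>2 t + \<phi>3 t + \<phi>4 t" for t
  have \<phi>i: "\<phi> integrable_on {0..}" unfolding \<phi>_def[abs_def] by (intro integrable_add 1 2 3 4)
  have \<phi>0: "\<phi> t \<ge> 0" for t using 1(4)[of t] 2(4)[of t] 3(4)[of t] 4(4)[of t] by (simp add: \<phi>_def)
  define ex where "ex k t = exp (phase \<epsilon> k * of_real t)" for k t
  define F where "F k t = - (a * f1 k t + b * f2 k t) - ex k t * (a * g4 k t + b * g3 k t)" for k t
  define G where "G k t = - (a * g1 k t + b * g2 k t) - ex k t * (a * f4 k t + b * f3 k t)" for k t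
  have Ysys: "gsys \<epsilon> k q s c (F k) (G k) (Yu k) (Yw k)" if k: "k \<noteq> 0" for k
  proof -
    note A = gsys_lincomb[OF 1(1)[OF k] 2(1)[OF k], of a b]
    note B = gsys_swap[OF gsys_lincomb[OF 4(1)[OF k] 3(1)[OF k], of a b]]
    note Y1 = gsys_lincomb[OF gauge_gsys[OF sys[OF k] \<epsilon>(1) k] A, of 1 "-1"]
    note Y2 = gsys_lincomb[OF Y1 B[unfolded minus_minus phase_minus], of 1 "-1"]
    show ?thesis unfolding gsys_def
      by (rule colsys_cong[OF Y2[unfolded gsys_def]])
        (simp_all add: Yu_def Yw_def F_def G_def ex_def)
  qed
  have a1: "norm a \<le> 1" "norm b \<le> 1"
    using C1[of 0] S1[of 0] by (simp_all add: a_def b_def norm_mult \<sigma>1 \<epsilon>)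
  have ab: "norm (a * x + b * y) \<le> norm x + norm y" for x y
  proof -
    have "norm (a * x + b * y) \<le> norm (a * x) + norm (b * y)" by (rule norm_triangle_ineq)
    also have "\<dots> \<le> 1 * norm x + 1 * norm y"
      unfolding norm_mult using a1 by (intro add_mono mult_right_mono) auto
    finally show ?thesis by simp
  qed
  have FG: "norm (F k t) + norm (G k t) \<le> norm k ^ Suc m * (1 + norm (ex k t)) * \<phi> t"
    if k: "k \<noteq> 0" "norm k \<le> 2" and t: "t \<ge> 0" for k t
  proof -
    let ?K = "norm k ^ Suc m" and ?e = "norm (ex k t)"
    have tri: "norm (- X - ex k t * Z) \<le> x + ?e * z" if "norm X \<le> x" "norm Z \<le> z" for X Z x z
    proof -
      have "norm (- X - ex k t * Z) \<le> norm X + ?e * norm Z"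
        using norm_triangle_ineq4[of "- X" "ex k t * Z"] by (simp only: norm_minus_cancel norm_mult)
      also have "\<dots> \<le> x + ?e * z" using that by (intro add_mono mult_left_mono) auto
      finally show ?thesis .
    qed
    have f: "norm (F k t) \<le> (norm (f1 k t) + norm (f2 k t)) + ?e * (norm (g4 k t) + norm (g3 k t))"
      unfolding F_def by (rule tri[OF ab ab])
    have g: "norm (G k t) \<le> (norm (g1 k t) + norm (g2 k t)) + ?e * (norm (f4 k t) + norm (f3 k t))"
      unfolding G_def by (rule tri[OF ab ab])
    have "norm (F k t) + norm (G k t) \<le> ((norm (f1 k t) + norm (g1 k t)) + (norm (f2 k t) + norm (g2 k t)))
       + ?e * ((norm (f3 k t) + norm (g3 k t)) + (norm (f4 k t) + norm (g4 k t)))"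
      using add_mono[OF f g] by (simp add: algebra_simps)
    also have "\<dots> \<le> (?K * \<phi>1 t + ?K * \<phi>2 t) + ?e * (?K * \<phi>3 t + ?K * \<phi>4 t)"
      using 1(2)[OF k t] 2(2)[OF k t] 3(2)[OF k t] 4(2)[OF k t] by (intro add_mono mult_left_mono) auto
    also have "\<dots> = ?K * ((\<phi>1 t + \<phi>2 t) + ?e * (\<phi>3 t + \<phi>4 t))" by (simp add: algebra_simps)
    also have "\<dots> \<le> ?K * (\<phi> t + ?e * \<phi> t)"
      using 1(4)[of t] 2(4)[of t] 3(4)[of t] 4(4)[of t] by (intro mult_left_mono add_mono) (auto simp: \<phi>_def)
    finally show ?thesis by (simp add: algebra_simps)
  qed
  have Y0: "Yu k 0 = 0" "Yw k 0 = 0" if "k \<noteq> 0" for k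
  proof -
    have "Yu k 0 = a - (a * (psum xz k 0 + psum yv' k 0) + b * (psum xv k 0 + psum yz' k 0))"
      using init[OF that] by (simp add: Yu_def gu_def a_def b_def distrib_left diff_diff_eq add_ac del: sum.atMost_Suc)
    then show "Yu k 0 = 0" unfolding z0 by simp
    have "Yw k 0 = b - (a * (psum yz k 0 + psum xv' k 0) + b * (psum yv k 0 + psum xz' k 0))"
      using init[OF that] by (simp add: Yw_def gw_def a_def b_def distrib_left diff_diff_eq mult_ac add_ac del: sum.atMost_Suc)
    then show "Yw k 0 = 0" unfolding z0 by simp
  qed
  define K0 where "K0 = E * (2 ^ Suc m * (1 + exp 1) * integral {0..} \<phi>)"
  have K00: "K0 \<ge> 0" unfolding K0_def using E_ge_1 integral_nonneg[OF \<phi>i \<phi>0] by auto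
  define K where "K = fact n * 4 ^ n * K0"
  have K: "fact j * 4 ^ j * K0 * X \<le> K * X" if "j \<le> n" "X \<ge> 0" for j X
    unfolding K_def using that K00 fact_mono[OF that(1), where 'a = real]
    by (intro mult_right_mono mult_mono power_increasing) auto
  have swapped: "gsys (- \<epsilon>) k q s c (\<lambda>t. exp (- phase \<epsilon> k * of_real t) * G k t) (\<lambda>t. exp (- phase \<epsilon> k * of_real t) * F k t)
           (\<lambda>t. exp (- phase \<epsilon> k * of_real t) * Yw k t) (\<lambda>t. exp (- phase \<epsilon> k * of_real t) * Yu k t)" if "k \<noteq> 0" for k
    by (rule gsys_swap[OF Ysys[OF that]])
  have FG': "norm (exp (- phase \<epsilon> k * of_real t) * G k t) + norm (exp (- phase \<epsilon> k * of_real t) * F k t) \<le> norm k ^ Suc m * (1 + norm (exp (phase (- \<epsilon>) k * of_real t))) * \<phi> t"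
    if k: "k \<noteq> 0" "norm k \<le> 2" and t: "t \<ge> 0" for k t
  proof -
    let ?e = "norm (exp (- phase \<epsilon> k * of_real t))"
    have "exp (- phase \<epsilon> k * of_real t) * ex k t = 1" unfolding ex_def by (simp flip: exp_add)
    then have e1: "?e * norm (ex k t) = 1" by (metis norm_mult norm_one)
    have "?e * (norm (F k t) + norm (G k t)) \<le> ?e * (norm k ^ Suc m * (1 + norm (ex k t)) * \<phi> t)"
      by (intro mult_left_mono FG k t) auto
    also have "\<dots> = norm k ^ Suc m * (?e + ?e * norm (ex k t)) * \<phi> t" by (simp only: algebra_simps)
    finally show ?thesis unfolding e1 phase_minus by (simp only: norm_mult distrib_left add.commute)
  qed
  have holx: "(\<lambda>k. exp (- phase \<epsilon> k * of_real t) * Yw k t) holomorphic_on - {0}" "(\<lambda>k. exp (- phase \<epsilon> k * of_real t) * Yu k t) holomorphic_on - {0}" if t: "t \<ge> 0" for t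
    by (intro holomorphic_intros hol t holomorphic_on_compose_gen[OF _ holomorphic_on_exp, unfolded o_def] phase_holomorphic; auto)+
  have init': "exp (- phase \<epsilon> k * of_real 0) * Yw k 0 = 0" "exp (- phase \<epsilon> k * of_real 0) * Yu k 0 = 0" if "k \<noteq> 0" for k
    using Y0[OF that] by auto
  have e': "norm (- \<epsilon>) = 1" using \<epsilon> by simp
  have fwd: "norm ((deriv ^^ j) (\<lambda>k. Yu k t) k) \<le> fact j * 4 ^ j * K0 * ((1 + t) ^ j * norm k ^ Suc m / norm k ^ (2 * j))"
    "norm ((deriv ^^ j) (\<lambda>k. Yw k t) k) \<le> fact j * 4 ^ j * K0 * ((1 + t) ^ j * norm k ^ Suc m / norm k ^ (2 * j))"
    if k: "k \<noteq> 0" "norm k \<le> 1" and re: "Re (phase \<epsilon> k) \<le> 0" and t: "t \<ge> 0" for j k t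
    unfolding K0_def
    by (rule forward_error[where f = F and g = G and u = Yu and w = Yw and \<phi> = \<phi> and \<epsilon> = \<epsilon>];
        (rule \<epsilon>(2) Ysys Y0 FG[unfolded ex_def] \<phi>i \<phi>0 k re t hol[OF t]; assumption))+
  have bwd: "norm ((deriv ^^ j) (\<lambda>k. exp (- phase \<epsilon> k * of_real t) * Yw k t) k) \<le> fact j * 4 ^ j * K0 * ((1 + t) ^ j * norm k ^ Suc m / norm k ^ (2 * j))"
    "norm ((deriv ^^ j) (\<lambda>k. exp (- phase \<epsilon> k * of_real t) * Yu k t) k) \<le> fact j * 4 ^ j * K0 * ((1 + t) ^ j * norm k ^ Suc m / norm k ^ (2 * j))"
    if k: "k \<noteq> 0" "norm k \<le> 1" and re: "Re (phase (- \<epsilon>) k) \<le> 0" and t: "t \<ge> 0" for j k t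
    unfolding K0_def
    by (rule forward_error[where f = "\<lambda>k t. exp (- phase \<epsilon> k * of_real t) * G k t" and g = "\<lambda>k t. exp (- phase \<epsilon> k * of_real t) * F k t"
          and u = "\<lambda>k t. exp (- phase \<epsilon> k * of_real t) * Yw k t" and w = "\<lambda>k t. exp (- phase \<epsilon> k * of_real t) * Yu k t" and \<phi> = \<phi> and \<epsilon> = "- \<epsilon>"];
        (rule e' swapped init' FG' \<phi>i \<phi>0 k re t holx[OF t]; assumption))+
  show "\<exists>K\<ge>0. \<forall>j\<le>n. \<forall>t\<ge>0. \<forall>k. k \<noteq> 0 \<longrightarrow> norm k \<le> 1 \<longrightarrow>
      (Re (phase \<epsilon> k) \<le> 0 \<longrightarrow> norm ((deriv ^^ j) (\<lambda>k. Yu k t) k) \<le> K * ((1 + t) ^ j * norm k ^ Suc m / norm k ^ (2 * j)) \<and>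
         norm ((deriv ^^ j) (\<lambda>k. Yw k t) k) \<le> K * ((1 + t) ^ j * norm k ^ Suc m / norm k ^ (2 * j))) \<and>
      (Re (phase \<epsilon> k) \<ge> 0 \<longrightarrow> norm ((deriv ^^ j) (\<lambda>k. exp (- phase \<epsilon> k * of_real t) * Yu k t) k) \<le> K * ((1 + t) ^ j * norm k ^ Suc m / norm k ^ (2 * j)) \<and>
         norm ((deriv ^^ j) (\<lambda>k. exp (- phase \<epsilon> k * of_real t) * Yw k t) k) \<le> K * ((1 + t) ^ j * norm k ^ Suc m / norm k ^ (2 * j)))"
  proof (intro exI[of _ K] conjI allI impI)
    show "K \<ge> 0" using K00 by (simp add: K_def)
    fix j t k assume j: "j \<le> n" and t: "t \<ge> (0::real)" and k: "k \<noteq> (0::complex)" "norm k \<le> 1"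
    let ?X = "(1 + t) ^ j * norm k ^ Suc m / norm k ^ (2 * j)"
    have X: "?X \<ge> 0" using t by simp
    note Kj = K[OF j X]
    { assume re: "Re (phase \<epsilon> k) \<le> 0"
      show "norm ((deriv ^^ j) (\<lambda>k. Yu k t) k) \<le> K * ?X"
        by (rule order_trans[OF fwd(1)[OF k re t] Kj])
      show "norm ((deriv ^^ j) (\<lambda>k. Yw k t) k) \<le> K * ?X"
        by (rule order_trans[OF fwd(2)[OF k re t] Kj])
    }
    { assume "Re (phase \<epsilon> k) \<ge> 0"
      then have re: "Re (phase (- \<epsilon>) k) \<le> 0" by (simp add: phase_minus)
      show "norm ((deriv ^^ j) (\<lambda>k. exp (- phase \<epsilon> k * of_real t) * Yw k t) k) \<le> K * ?X"
        by (rule order_trans[OF bwd(1)[OF k re t] Kj])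
      show "norm ((deriv ^^ j) (\<lambda>k. exp (- phase \<epsilon> k * of_real t) * Yu k t) k) \<le> K * ?X"
        by (rule order_trans[OF bwd(2)[OF k re t] Kj])
    }
  qed
qed

text \<open>The columns of U serve as the fundamental solutions that are holomorphic on the punctured plane; their
  determinant does not vanish since it is explicitly known.\<close>

lemma T_error:
  fixes su fu sv fv ts tf :: "complex \<Rightarrow> real \<Rightarrow> complex"
  assumes \<epsilon>: "\<epsilon> * \<epsilon> = 1" "norm \<epsilon> = 1"
    and sysu: "\<And>k. k \<noteq> 0 \<Longrightarrow> usys \<epsilon> k (su k) (fu k)" and initu: "\<And>k. k \<noteq> 0 \<Longrightarrow> su k 0 = 1" "\<And>k. k \<noteq> 0 \<Longrightarrow> fu k 0 = 0"
    and sysv: "\<And>k. k \<noteq> 0 \<Longrightarrow> usys (- \<epsilon>) k (sv k) (fv k)" and initv: "\<And>k. k \<noteq> 0 \<Longrightarrow> sv k 0 = 1" "\<And>k. k \<noteq> 0 \<Longrightarrow> fv k 0 = 0"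
    and tr: "trunc \<epsilon> x y"
    and T: "\<And>k. k \<noteq> 0 \<Longrightarrow> norm k \<le> 1 \<Longrightarrow> Re (phase \<epsilon> k) \<ge> 0 \<Longrightarrow> usys \<epsilon> k (ts k) (tf k)"
    and tlim: "\<And>k. k \<noteq> 0 \<Longrightarrow> norm k \<le> 1 \<Longrightarrow> Re (phase \<epsilon> k) \<ge> 0 \<Longrightarrow> (ts k \<longlongrightarrow> 1) at_top"
      "\<And>k. k \<noteq> 0 \<Longrightarrow> norm k \<le> 1 \<Longrightarrow> Re (phase \<epsilon> k) \<ge> 0 \<Longrightarrow> (tf k \<longlongrightarrow> 0) at_top"
    and Clim: "((\<lambda>t. \<sigma> * C t) \<longlongrightarrow> 1) at_top" and Slim: "(S \<longlongrightarrow> 0) at_top"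
    and xlim: "\<And>k. (psum x k \<longlongrightarrow> 1) at_top" and ylim: "\<And>k. (psum y k \<longlongrightarrow> 0) at_top"
  shows "\<exists>K\<ge>0. \<forall>j\<le>n. \<forall>t\<ge>0. \<forall>D. open D \<longrightarrow> 0 \<notin> D \<longrightarrow> (\<forall>k\<in>closure D - {0}. norm k \<le> 1 \<and> Re (phase \<epsilon> k) \<ge> 0) \<longrightarrow>
     scal_deriv_le j D (\<lambda>k. gu \<epsilon> (ts k) (tf k) t - psum x k t) (\<lambda>k. K * (norm k ^ Suc m / norm k ^ (2 * j) / (1 + t) ^ (n - j))) \<and>
     scal_deriv_le j D (\<lambda>k. gw \<epsilon> (ts k) (tf k) t - psum y k t) (\<lambda>k. K * (norm k ^ Suc m / norm k ^ (2 * j) / (1 + t) ^ (n - j)))"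
proof -
  obtain \<phi> f g where 1: "\<And>k. k \<noteq> 0 \<Longrightarrow> gsys \<epsilon> k q s c (f k) (g k) (psum x k) (psum y k)"
    "\<And>k t. k \<noteq> 0 \<Longrightarrow> norm k \<le> 2 \<Longrightarrow> t \<ge> 0 \<Longrightarrow> norm (f k t) + norm (g k t) \<le> norm k ^ Suc m * \<phi> t"
    "(\<lambda>t. (1 + t) ^ n * \<phi> t) integrable_on {0..}" "\<phi> integrable_on {0..}" "\<And>t. \<phi> t \<ge> 0" using tr unfolding trunc_def by blast
  define ex where "ex k t = exp (phase \<epsilon> k * of_real t)" for k t
  have sysw: "usys \<epsilon> k (\<lambda>t. ex k t * fv k t) (\<lambda>t. ex k t * sv k t)" if "k \<noteq> 0" for k
    using usys_swap[OF sysv[OF that]] unfolding minus_minus phase_minus ex_def .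
  have P: "gsys \<epsilon> k q s c (\<lambda>_. 0) (\<lambda>_. 0) (gu \<epsilon> (su k) (fu k)) (gw \<epsilon> (su k) (fu k))" if "k \<noteq> 0" for k
    by (rule gauge_gsys[OF sysu \<epsilon>(1)]) (rule that)+
  have R: "gsys \<epsilon> k q s c (\<lambda>_. 0) (\<lambda>_. 0) (gu \<epsilon> (\<lambda>t. ex k t * fv k t) (\<lambda>t. ex k t * sv k t)) (gw \<epsilon> (\<lambda>t. ex k t * fv k t) (\<lambda>t. ex k t * sv k t))" if "k \<noteq> 0" for k
    by (rule gauge_gsys[OF sysw \<epsilon>(1)]) (rule that)+
  have gT: "gsys \<epsilon> k q s c (\<lambda>_. 0) (\<lambda>_. 0) (gu \<epsilon> (ts k) (tf k)) (gw \<epsilon> (ts k) (tf k))"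
    if "k \<noteq> 0" "norm k \<le> 1" "Re (phase \<epsilon> k) \<ge> 0" for k
    by (rule gauge_gsys[OF T \<epsilon>(1)]) (rule that)+
  have det: "gu \<epsilon> (su k) (fu k) t * gw \<epsilon> (\<lambda>t. ex k t * fv k t) (\<lambda>t. ex k t * sv k t) t
     - gw \<epsilon> (su k) (fu k) t * gu \<epsilon> (\<lambda>t. ex k t * fv k t) (\<lambda>t. ex k t * sv k t) t \<noteq> 0" if k: "k \<noteq> 0" and t: "t \<ge> 0" for k t
  proof -
    have "gu \<epsilon> (su k) (fu k) t * gw \<epsilon> (\<lambda>t. ex k t * fv k t) (\<lambda>t. ex k t * sv k t) t
     - gw \<epsilon> (su k) (fu k) t * gu \<epsilon> (\<lambda>t. ex k t * fv k t) (\<lambda>t. ex k t * sv k t) t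
     = exp (phase \<epsilon> k * of_real t) * (gu \<epsilon> (su k) (fu k) 0 * gw \<epsilon> (\<lambda>t. ex k t * fv k t) (\<lambda>t. ex k t * sv k t) 0
     - gw \<epsilon> (su k) (fu k) 0 * gu \<epsilon> (\<lambda>t. ex k t * fv k t) (\<lambda>t. ex k t * sv k t) 0)"
      by (rule colsys_wronskian[OF P[OF k, unfolded gsys_def] R[OF k, unfolded gsys_def] _ _ _ _ _ t])
        (auto intro!: continuous_intros cc cs cq)
    also have "gu \<epsilon> (su k) (fu k) 0 * gw \<epsilon> (\<lambda>t. ex k t * fv k t) (\<lambda>t. ex k t * sv k t) 0
     - gw \<epsilon> (su k) (fu k) 0 * gu \<epsilon> (\<lambda>t. ex k t * fv k t) (\<lambda>t. ex k t * sv k t) 0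
     = (\<sigma> * \<sigma>) * (C 0 * C 0 + (\<epsilon> * \<epsilon>) * (S 0 * S 0))"
      using initu[OF k] initv[OF k] by (simp add: gu_def gw_def ex_def algebra_simps)
    also have "\<dots> = 1" by (simp add: \<sigma>2 \<epsilon> CS)
    finally show ?thesis by simp
  qed
  have holex: "(\<lambda>k. ex k t * h k) holomorphic_on - {0}" if "h holomorphic_on - {0}" for h t
    unfolding ex_def by (intro holomorphic_intros that holomorphic_on_compose_gen[OF _ holomorphic_on_exp, unfolded o_def] phase_holomorphic; auto)
  have hu: "(\<lambda>k. su k t) holomorphic_on - {0}" "(\<lambda>k. fu k t) holomorphic_on - {0}" if "t \<ge> 0" for t
    by (rule usys_holomorphic[where u = su and w = fu and \<epsilon> = \<epsilon>]; (rule sysu initu that; assumption))+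
  have hv: "(\<lambda>k. sv k t) holomorphic_on - {0}" "(\<lambda>k. fv k t) holomorphic_on - {0}" if "t \<ge> 0" for t
    by (rule usys_holomorphic[where u = sv and w = fv and \<epsilon> = "- \<epsilon>"]; (rule sysv initv that; assumption))+
  have holp: "(\<lambda>k. psum z k t) holomorphic_on - {0}" for z t by (intro holomorphic_intros)
  have holw: "(\<lambda>k. gu \<epsilon> (\<lambda>t. ex k t * fv k t) (\<lambda>t. ex k t * sv k t) t) holomorphic_on - {0}"
    "(\<lambda>k. gw \<epsilon> (\<lambda>t. ex k t * fv k t) (\<lambda>t. ex k t * sv k t) t) holomorphic_on - {0}" if "t \<ge> 0" for t
    by (rule gu_hol; rule holex[OF hv(2)[OF that]] holex[OF hv(1)[OF that]])+
  have hgu: "(\<lambda>k. gu \<epsilon> (su k) (fu k) t) holomorphic_on - {0}" and hgw: "(\<lambda>k. gw \<epsilon> (su k) (fu k) t) holomorphic_on - {0}" if "t \<ge> 0" for t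
    by (rule gu_hol; rule hu[OF that])+
  have gul: "((\<lambda>t. gu \<epsilon> (ts k) (tf k) t - psum x k t) \<longlongrightarrow> 0) at_top"
    "((\<lambda>t. gw \<epsilon> (ts k) (tf k) t - psum y k t) \<longlongrightarrow> 0) at_top" if k: "k \<noteq> 0" "norm k \<le> 1" "Re (phase \<epsilon> k) \<ge> 0" for k
  proof -
    have "((\<lambda>t. (\<sigma> * C t) * ts k t + \<sigma> * \<epsilon> * S t * tf k t - psum x k t) \<longlongrightarrow> 1 * 1 + \<sigma> * \<epsilon> * 0 * 0 - 1) at_top"
      by (intro tendsto_intros tlim[OF k] Clim Slim xlim)
    then show "((\<lambda>t. gu \<epsilon> (ts k) (tf k) t - psum x k t) \<longlongrightarrow> 0) at_top"
      by (simp add: gu_def algebra_simps del: sum.atMost_Suc)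
    have "((\<lambda>t. - \<sigma> * \<epsilon> * S t * ts k t + (\<sigma> * C t) * tf k t - psum y k t) \<longlongrightarrow> - \<sigma> * \<epsilon> * 0 * 1 + 1 * 0 - 0) at_top"
      by (intro tendsto_intros tlim[OF k] Clim Slim ylim)
    then show "((\<lambda>t. gw \<epsilon> (ts k) (tf k) t - psum y k t) \<longlongrightarrow> 0) at_top"
      by (simp add: gw_def algebra_simps del: sum.atMost_Suc)
  qed
  have \<phi>ab: "\<phi> integrable_on {a..b}" if "0 \<le> a" for a b by (rule integrable_on_subinterval[OF 1(4)]) (use that in auto)
  define A where "A = integral {0..} (\<lambda>t. (1 + t) ^ n * \<phi> t)"
  have A0: "A \<ge> 0" unfolding A_def using 1(5) by (intro integral_nonneg[OF 1(3)]) auto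
  define K where "K = fact n * 4 ^ n * 2 ^ n * (E * E * 2 ^ Suc m) * A"
  have be: "scal_deriv_le j D (\<lambda>k. gu \<epsilon> (ts k) (tf k) t - psum x k t) (\<lambda>k. fact j * 4 ^ j * 2 ^ j * (E * E * 2 ^ Suc m) / (1 + t) ^ (n - j) * norm k ^ Suc m / norm k ^ (2 * j) * A)"
    "scal_deriv_le j D (\<lambda>k. gw \<epsilon> (ts k) (tf k) t - psum y k t) (\<lambda>k. fact j * 4 ^ j * 2 ^ j * (E * E * 2 ^ Suc m) / (1 + t) ^ (n - j) * norm k ^ Suc m / norm k ^ (2 * j) * A)"
    if D: "open D" "0 \<notin> D" "\<And>k. k \<in> closure D - {0} \<Longrightarrow> norm k \<le> 1 \<and> Re (phase \<epsilon> k) \<ge> 0" and j: "j \<le> n" and t: "t \<ge> 0" for D j t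
    unfolding A_def
    by (rule backward_error[where \<epsilon> = \<epsilon> and pu = "\<lambda>k. gu \<epsilon> (su k) (fu k)" and pw = "\<lambda>k. gw \<epsilon> (su k) (fu k)"
          and ru = "\<lambda>k. gu \<epsilon> (\<lambda>t. ex k t * fv k t) (\<lambda>t. ex k t * sv k t)" and rw = "\<lambda>k. gw \<epsilon> (\<lambda>t. ex k t * fv k t) (\<lambda>t. ex k t * sv k t)"
          and \<tau>u = "psum x" and \<tau>w = "psum y" and xu = "\<lambda>k. gu \<epsilon> (ts k) (tf k)" and xw = "\<lambda>k. gw \<epsilon> (ts k) (tf k)" and f = f and g = g];
        (rule \<epsilon>(2) P R det hgu hgw holw holp 1 \<phi>ab gT gul D j t; assumption))+
  have mono: "fact j * 4 ^ j * 2 ^ j * (E * E * 2 ^ Suc m) / (1 + t) ^ (n - j) * norm k ^ Suc m / norm k ^ (2 * j) * A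
    \<le> K * (norm k ^ Suc m / norm k ^ (2 * j) / (1 + t) ^ (n - j))" if "j \<le> n" "t \<ge> 0" for j t and k :: complex
  proof -
    have "fact j * 4 ^ j * 2 ^ j * (E * E * 2 ^ Suc m) * A \<le> K"
      unfolding K_def using that(1) A0 E_ge_1 fact_mono[OF that(1), where 'a = real]
      by (intro mult_right_mono mult_mono power_increasing) auto
    then have "fact j * 4 ^ j * 2 ^ j * (E * E * 2 ^ Suc m) * A * (norm k ^ Suc m / norm k ^ (2 * j) / (1 + t) ^ (n - j)) \<le> K * (norm k ^ Suc m / norm k ^ (2 * j) / (1 + t) ^ (n - j))"
      using that by (intro mult_right_mono) auto
    then show ?thesis by (simp add: mult_ac)
  qed
  show ?thesis
  proof (intro exI[of _ K] conjI allI impI)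
    show "K \<ge> 0" using A0 E_ge_1 by (simp add: K_def)
    fix j t D assume j: "j \<le> n" and t: "t \<ge> (0::real)" and D: "open D" "0 \<notin> D" "\<forall>k\<in>closure D - {0}. norm k \<le> 1 \<and> Re (phase \<epsilon> k) \<ge> 0"
    show "scal_deriv_le j D (\<lambda>k. gu \<epsilon> (ts k) (tf k) t - psum x k t) (\<lambda>k. K * (norm k ^ Suc m / norm k ^ (2 * j) / (1 + t) ^ (n - j)))"
      by (rule scal_deriv_le_mono[OF be(1) mono[OF j t]]) (use D j t in auto)
    show "scal_deriv_le j D (\<lambda>k. gw \<epsilon> (ts k) (tf k) t - psum y k t) (\<lambda>k. K * (norm k ^ Suc m / norm k ^ (2 * j) / (1 + t) ^ (n - j)))"
      by (rule scal_deriv_le_mono[OF be(2) mono[OF j t]]) (use D j t in auto)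
  qed
qed

section \<open>Uniform bounds on the solutions\<close>

definition v2 where "v2 t = v t + 2 * norm (p t)"

lemma v2_integrable: "v2 integrable_on {0..}"
proof -
  have "(\<lambda>t. norm (p t)) integrable_on {0..}" using Lp by (simp add: absolutely_integrable_on_def)
  then show ?thesis unfolding v2_def[abs_def] by (intro integrable_add v_integrable integrable_on_mult_right)
qed

lemma v2_cont: "continuous_on {0..} v2" unfolding v2_def by (intro continuous_intros v_continuous cp)

lemma v2_nonneg: "v2 t \<ge> 0" using v_nonneg[of t] by (simp add: v2_def)

lemma v2_le:
  assumes "0 \<le> x" shows "integral {x..y} v2 \<le> integral {0..} v2"
proof (rule integral_subset_le)
  show sub: "{x..y} \<subseteq> {0..}" using assms by auto
  show "v2 integrable_on {x..y}" by (rule integrable_on_subinterval[OF v2_integrable sub])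
qed (simp_all add: v2_integrable v2_nonneg)

lemma usys_bounds:
  assumes sys: "usys \<epsilon> k u w" and \<epsilon>: "norm \<epsilon> = 1" and k: "norm k \<ge> 1"
  shows "column_bounds (phase \<epsilon> k) (\<lambda>t. - \<epsilon> * \<i> * c t / (4 * k)) (\<lambda>t. - \<epsilon> * (q t + 2 * p t) / 4 - \<i> * s t / (4 * k))
     (\<lambda>t. \<epsilon> * (q t + 2 * p t) / 4 - \<i> * s t / (4 * k)) (\<lambda>t. \<epsilon> * \<i> * c t / (4 * k)) (\<lambda>_. 0) (\<lambda>_. 0) u w v2 (\<lambda>_. 0)"
proof
  fix t :: real
  have k0: "k \<noteq> 0" using k by auto
  have kx: "x / (4 * norm k) \<le> x / 4" if "x \<ge> 0" for x
    using k that by (intro divide_left_mono) auto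
  have d: "norm (\<epsilon> * \<i> * c t / (4 * k)) \<le> norm (c t) / 4" "norm (- \<epsilon> * \<i> * c t / (4 * k)) \<le> norm (c t) / 4"
    using kx[of "norm (c t)"] by (simp_all add: norm_mult norm_divide \<epsilon>)
  have ks: "norm (\<i> * s t / (4 * k)) \<le> norm (s t) / 4"
    using kx[of "norm (s t)"] by (simp_all add: norm_mult norm_divide \<epsilon>)
  have qp: "norm (\<epsilon> * (q t + 2 * p t) / 4) \<le> (norm (q t) + 2 * norm (p t)) / 4" "norm (- \<epsilon> * (q t + 2 * p t) / 4) \<le> (norm (q t) + 2 * norm (p t)) / 4"
    using norm_triangle_ineq[of "q t" "2 * p t"] by (simp_all add: norm_mult norm_divide \<epsilon>)
  have b: "norm (\<epsilon> * (q t + 2 * p t) / 4 - \<i> * s t / (4 * k)) \<le> (norm (q t) + 2 * norm (p t)) / 4 + norm (s t) / 4"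
    "norm (- \<epsilon> * (q t + 2 * p t) / 4 - \<i> * s t / (4 * k)) \<le> (norm (q t) + 2 * norm (p t)) / 4 + norm (s t) / 4"
    by (rule order_trans[OF norm_triangle_ineq4 add_mono], rule qp, rule ks)+
  have v: "norm (c t) / 4 + ((norm (q t) + 2 * norm (p t)) / 4 + norm (s t) / 4) \<le> v2 t"
    using norm_ge_zero[of "c t"] norm_ge_zero[of "q t"] norm_ge_zero[of "p t"] norm_ge_zero[of "s t"]
    unfolding v2_def v_def by (simp add: field_simps)
  show "norm (- \<epsilon> * \<i> * c t / (4 * k)) + norm (\<epsilon> * (q t + 2 * p t) / 4 - \<i> * s t / (4 * k)) \<le> v2 t"
    by (rule order_trans[OF add_mono[OF d(2) b(1)] v])
  show "norm (- \<epsilon> * (q t + 2 * p t) / 4 - \<i> * s t / (4 * k)) + norm (\<epsilon> * \<i> * c t / (4 * k)) \<le> v2 t"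
    using order_trans[OF add_mono[OF d(1) b(2)] v] by (simp only: add.commute)
next
  show "colsys (phase \<epsilon> k) (\<lambda>t. - \<epsilon> * \<i> * c t / (4 * k)) (\<lambda>t. - \<epsilon> * (q t + 2 * p t) / 4 - \<i> * s t / (4 * k))
     (\<lambda>t. \<epsilon> * (q t + 2 * p t) / 4 - \<i> * s t / (4 * k)) (\<lambda>t. \<epsilon> * \<i> * c t / (4 * k)) (\<lambda>_. 0) (\<lambda>_. 0) u w"
    using sys by (simp add: usys_def)
  have k0: "k \<noteq> 0" using k by auto
qed (use k in \<open>auto intro!: continuous_intros cq cs cc cp v2_cont\<close>)

lemma gauge_norm:
  assumes "norm \<epsilon> = 1"
  shows "norm (gu \<epsilon> u w t) + norm (gw \<epsilon> u w t) \<le> 2 * (norm (u t) + norm (w t))"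
    and "\<epsilon> * \<epsilon> = 1 \<Longrightarrow> norm (u t) + norm (w t) \<le> 2 * (norm (gu \<epsilon> u w t) + norm (gw \<epsilon> u w t))"
proof -
  have 1: "norm (\<sigma> * (x + y)) \<le> norm x' + norm y'" if "norm x \<le> norm x'" "norm y \<le> norm y'" for x y and x' y' :: complex
    using norm_triangle_ineq[of x y] that by (simp add: norm_mult \<sigma>1)
  have 2: "norm (C t * z) \<le> norm z" "norm (\<epsilon> * S t * z) \<le> norm z" "norm (- \<epsilon> * S t * z) \<le> norm z" "norm (- (\<epsilon> * S t * z)) \<le> norm z" for z
    using C1[of t] S1[of t] by (simp_all add: norm_mult assms mult_left_le_one_le)
  have "norm (gu \<epsilon> u w t) \<le> norm (u t) + norm (w t)" "norm (gw \<epsilon> u w t) \<le> norm (u t) + norm (w t)"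
    unfolding gu_def gw_def by (intro 1 2)+
  then show "norm (gu \<epsilon> u w t) + norm (gw \<epsilon> u w t) \<le> 2 * (norm (u t) + norm (w t))" by simp
  show "norm (u t) + norm (w t) \<le> 2 * (norm (gu \<epsilon> u w t) + norm (gw \<epsilon> u w t))" if e: "\<epsilon> * \<epsilon> = 1"
  proof -
    have "norm (u t) \<le> norm (gu \<epsilon> u w t) + norm (gw \<epsilon> u w t)"
      by (subst ungauge(1)[OF e, of u t w], unfold diff_conv_add_uminus, intro 1 2)
    moreover have "norm (w t) \<le> norm (gu \<epsilon> u w t) + norm (gw \<epsilon> u w t)"
      by (subst ungauge(2)[OF e, of w t u], intro 1 2)
    ultimately show ?thesis by simp
  qed
qed

definition B where "B = 4 * E + exp (integral {0..} v2)"

text \<open>For \<open>|k| \<le> 1\<close> the gauged system has uniformly bounded coefficients, and for \<open>|k| \<ge> 1\<close> the original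
  one has.\<close>

lemma usys_forward_bound:
  assumes u: "usys \<epsilon> k u w" and \<epsilon>: "\<epsilon> * \<epsilon> = 1" "norm \<epsilon> = 1" and k: "k \<noteq> 0" and re: "Re (phase \<epsilon> k) \<le> 0" and t: "t \<ge> 0"
  shows "norm (u t) + norm (w t) \<le> B * (norm (u 0) + norm (w 0))"
proof (cases "norm k \<le> 1")
  case True
  have "norm (u t) + norm (w t) \<le> 2 * (norm (gu \<epsilon> u w t) + norm (gw \<epsilon> u w t))" by (rule gauge_norm(2)[OF \<epsilon>(2,1)])
  also have "norm (gu \<epsilon> u w t) + norm (gw \<epsilon> u w t) \<le> E * (norm (gu \<epsilon> u w 0) + norm (gw \<epsilon> u w 0) + integral {0..t} (\<lambda>_. 0))"
    by (rule gsys_forward[OF gauge_gsys[OF u \<epsilon>(1) k] \<epsilon>(2) k True t _ re]) (use t in auto)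
  also have "\<dots> \<le> E * (2 * (norm (u 0) + norm (w 0)))" using gauge_norm(1)[OF \<epsilon>(2), of u w 0] E_ge_1 by simp
  finally have "norm (u t) + norm (w t) \<le> (4 * E) * (norm (u 0) + norm (w 0))" by (simp add: algebra_simps)
  also have "\<dots> \<le> B * (norm (u 0) + norm (w 0))" by (intro mult_right_mono) (auto simp: B_def)
  finally show ?thesis .
next
  case False
  then have k1: "norm k \<ge> 1" by simp
  interpret cb: column_bounds "phase \<epsilon> k" "\<lambda>t. - \<epsilon> * \<i> * c t / (4 * k)" "\<lambda>t. - \<epsilon> * (q t + 2 * p t) / 4 - \<i> * s t / (4 * k)"
     "\<lambda>t. \<epsilon> * (q t + 2 * p t) / 4 - \<i> * s t / (4 * k)" "\<lambda>t. \<epsilon> * \<i> * c t / (4 * k)" "\<lambda>_. 0" "\<lambda>_. 0" u w v2 "\<lambda>_. 0"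
    by (rule usys_bounds[OF u \<epsilon>(2) k1])
  have "cb.Y t \<le> 1 * (cb.Y 0 + integral {0..t} (\<lambda>_. 0)) * exp (1 * integral {0..t} v2)"
    by (rule cb.forward_bound) (use t re in \<open>auto simp: norm_exp_eq_Re mult_nonpos_nonneg\<close>)
  also have "\<dots> = exp (integral {0..t} v2) * cb.Y 0" by simp
  also have "\<dots> \<le> B * cb.Y 0"
    using v2_le[of 0 t] E_ge_1 by (intro mult_right_mono) (auto simp: B_def cb.Y_def intro: order_trans[of _ "exp (integral {0..} v2)"])
  finally show ?thesis by (simp add: cb.Y_def)
qed

lemma usys_backward_bound:
  assumes u: "usys \<epsilon> k u w" and \<epsilon>: "\<epsilon> * \<epsilon> = 1" "norm \<epsilon> = 1" and k: "k \<noteq> 0" and re: "Re (phase \<epsilon> k) \<ge> 0" and t: "0 \<le> t" "t \<le> r"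
  shows "norm (u t) + norm (w t) \<le> B * (norm (u r) + norm (w r))"
proof (cases "norm k \<le> 1")
  case True
  have r: "r \<ge> 0" using t by simp
  have "norm (u t) + norm (w t) \<le> 2 * (norm (gu \<epsilon> u w t) + norm (gw \<epsilon> u w t))" by (rule gauge_norm(2)[OF \<epsilon>(2,1)])
  also have "norm (gu \<epsilon> u w t) + norm (gw \<epsilon> u w t) \<le> E * (norm (gu \<epsilon> u w r) + norm (gw \<epsilon> u w r) + integral {t..r} (\<lambda>_. 0))"
    by (rule gsys_backward[OF gauge_gsys[OF u \<epsilon>(1) k] \<epsilon>(2) k True r _ re]) (use t in auto)
  also have "\<dots> \<le> E * (2 * (norm (u r) + norm (w r)))" using gauge_norm(1)[OF \<epsilon>(2), of u w r] E_ge_1 by simp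
  finally have "norm (u t) + norm (w t) \<le> (4 * E) * (norm (u r) + norm (w r))" by (simp add: algebra_simps)
  also have "\<dots> \<le> B * (norm (u r) + norm (w r))" by (intro mult_right_mono) (auto simp: B_def)
  finally show ?thesis .
next
  case False
  then have k1: "norm k \<ge> 1" by simp
  interpret cb: column_bounds "phase \<epsilon> k" "\<lambda>t. - \<epsilon> * \<i> * c t / (4 * k)" "\<lambda>t. - \<epsilon> * (q t + 2 * p t) / 4 - \<i> * s t / (4 * k)"
     "\<lambda>t. \<epsilon> * (q t + 2 * p t) / 4 - \<i> * s t / (4 * k)" "\<lambda>t. \<epsilon> * \<i> * c t / (4 * k)" "\<lambda>_. 0" "\<lambda>_. 0" u w v2 "\<lambda>_. 0"
    by (rule usys_bounds[OF u \<epsilon>(2) k1])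
  have "cb.Y t \<le> 1 * (cb.Y r + integral {t..r} (\<lambda>_. 0)) * exp (1 * integral {t..r} v2)"
    by (rule cb.backward_bound) (use t re in \<open>auto simp: norm_exp_eq_Re mult_nonneg_nonpos\<close>)
  also have "\<dots> = exp (integral {t..r} v2) * cb.Y r" by simp
  also have "\<dots> \<le> B * cb.Y r"
    using v2_le[of t r] t E_ge_1 by (intro mult_right_mono) (auto simp: B_def cb.Y_def intro: order_trans[of _ "exp (integral {0..} v2)"])
  finally show ?thesis by (simp add: cb.Y_def)
qed

end

text \<open>The Volterra equation yields the limit of \<open>exp (- h t) w(t)\<close> only, which is weaker when the real part of
  h is positive. The backward Gronwall inequality for \<open>exp (- h t) w(t)\<close> bounds w by a tail of the
  integral of v.\<close>

lemma fast_tendsto_zero: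
  assumes sys: "colsys h a b c d (\<lambda>_. 0) (\<lambda>_. 0) u w"
    and cc: "continuous_on {0..} c" and cd: "continuous_on {0..} d" and cv: "continuous_on {0..} v" and v: "v integrable_on {0..}"
    and cv1: "\<And>t. t \<ge> 0 \<Longrightarrow> norm (c t) \<le> v t" and dv: "\<And>t. t \<ge> 0 \<Longrightarrow> norm (d t) \<le> v t"
    and re: "Re h \<ge> 0" and u: "\<And>t. t \<ge> 0 \<Longrightarrow> norm (u t) \<le> M"
    and lim: "((\<lambda>t. exp (- h * of_real t) * w t) \<longlongrightarrow> 0) at_top"
  shows "(w \<longlongrightarrow> 0) at_top"
proof -
  define W where "W t = exp (- h * of_real t) * w t" for t
  have v0: "v t \<ge> 0" if "t \<ge> 0" for t using cv1[OF that] norm_ge_zero order_trans by blast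
  have M0: "M \<ge> 0" using u[of 0] norm_ge_zero[of "u 0"] by linarith
  have aw: "antideriv w (\<lambda>t. h * w t + (c t * u t + d t * w t + 0))" and au: "antideriv u (\<lambda>t. a t * u t + b t * w t + 0)"
    using sys by (auto simp: colsys_def)
  have cw: "continuous_on {0..} w" and cu: "continuous_on {0..} u" using aw au antideriv_continuous by auto
  have aW: "antideriv W (\<lambda>t. exp (- h * of_real t) * (c t * u t + d t * w t))"
    unfolding W_def by (rule antideriv_cong[OF antideriv_exp_mult[OF aw, of "- h"]]) (auto simp: algebra_simps)
  define V where "V = integral {0..} v"
  have vab: "v integrable_on {x..y}" if "0 \<le> x" for x y by (rule integrable_on_subinterval[OF v]) (use that in auto)
  have vai: "v absolutely_integrable_on {0..}"
    by (rule nonnegative_absolutely_integrable_1[OF v]) (use v0 in auto)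
  define m where "m x = norm (exp (- h * of_real x))" for x
  have m: "m s \<le> m x" if "x \<le> s" for x s
    using re that by (simp add: m_def norm_exp_eq_Re mult_left_mono)
  have main: "norm (W x) \<le> (norm (W y) + m x * M * integral {x..} v) * exp V" if x: "0 \<le> x" "x \<le> y" for x y
  proof -
    define c0 where "c0 = norm (W y) + m x * M * integral {x..} v"
    have vx: "v integrable_on {x..}"
      using set_integrable_subset[OF vai, of "{x..}"] x by (auto intro!: set_lebesgue_integral_eq_integral(1))
    have "norm (W x) \<le> c0 * exp (integral {x..y} v)"
    proof (rule gronwall_backward[OF x(2)])
      show "continuous_on {x..y} (\<lambda>x. norm (W x))" unfolding W_def using x
        by (intro continuous_intros continuous_on_subset[OF cw]) auto
      show "continuous_on {x..y} v" using x by (intro continuous_on_subset[OF cv]) auto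
      show "v t \<ge> 0" if "t \<in> {x..y}" for t using that x by (intro v0) auto
      fix t assume t: "t \<in> {x..y}"
      have iW: "(\<lambda>s. v s * norm (W s)) integrable_on {t..y}"
        unfolding W_def using x t by (intro integrable_continuous_real continuous_intros continuous_on_subset[OF cw] continuous_on_subset[OF cv]) auto
      have "W y - W t = integral {t..y} (\<lambda>t. exp (- h * of_real t) * (c t * u t + d t * w t))"
        by (rule antideriv_diff_eq[OF aW]) (use t x in auto)
      also have "norm \<dots> \<le> integral {t..y} (\<lambda>s. m x * M * v s + v s * norm (W s))"
      proof (rule integral_norm_bound_integral)
        show "(\<lambda>t. exp (- h * of_real t) * (c t * u t + d t * w t)) integrable_on {t..y}"
          by (rule antideriv_int[OF aW]) (use t x in auto)
        show "(\<lambda>s. m x * M * v s + v s * norm (W s)) integrable_on {t..y}"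
          using t x by (intro integrable_add iW integrable_on_mult_right vab) auto
        fix r assume r: "r \<in> {t..y}"
        then have r0: "r \<ge> 0" using t x by auto
        have "norm (exp (- h * of_real r) * (c r * u r + d r * w r)) = m r * norm (c r * u r + d r * w r)"
          by (simp only: norm_mult m_def)
        also have "\<dots> \<le> m r * (norm (c r * u r) + norm (d r * w r))"
          by (intro mult_left_mono norm_triangle_ineq) (simp add: m_def)
        also have "\<dots> = m r * (norm (c r) * norm (u r)) + norm (d r) * norm (W r)"
          by (simp only: norm_mult m_def W_def distrib_left mult_ac)
        also have "\<dots> \<le> m x * (v r * M) + v r * norm (W r)"
          using m[of x r] r t cv1[OF r0] dv[OF r0] u[OF r0] v0[OF r0] M0
          by (intro add_mono mult_mono) (auto simp: m_def)
        finally show "norm (exp (- h * of_real r) * (c r * u r + d r * w r)) \<le> m x * M * v r + v r * norm (W r)" by (simp add: mult_ac)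
      qed
      also have "\<dots> = m x * M * integral {t..y} v + integral {t..y} (\<lambda>s. v s * norm (W s))"
        using t x iW by (subst Henstock_Kurzweil_Integration.integral_add) (auto intro!: integrable_on_mult_right vab)
      also have "integral {t..y} v \<le> integral {x..} v"
        using t x by (intro integral_subset_le vab vx) (auto intro!: v0)
      finally have "norm (W y - W t) \<le> m x * M * integral {x..} v + integral {t..y} (\<lambda>s. v s * norm (W s))"
        using M0 by (simp add: mult_left_mono m_def)
      then show "norm (W t) \<le> c0 + integral {t..y} (\<lambda>s. v s * norm (W s))"
        using norm_triangle_ineq2[of "W t" "W y"] by (simp add: c0_def norm_minus_commute)
    qed
    also have "\<dots> \<le> c0 * exp V"
    proof (rule mult_left_mono)
      show "exp (integral {x..y} v) \<le> exp V"
      proof -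
        have "integral {x..y} v \<le> integral {0..} v"
          by (rule integral_subset_le) (use x in \<open>auto intro: vab v v0\<close>)
        then show ?thesis by (simp add: V_def)
      qed
      show "0 \<le> c0"
      proof -
        have "integral {x..} v \<ge> 0" by (rule integral_nonneg[OF vx]) (use x in \<open>auto intro: v0\<close>)
        then show ?thesis unfolding c0_def m_def using M0 by simp
      qed
    qed
    finally show ?thesis by (simp add: c0_def)
  qed
  have bound: "norm (w x) \<le> M * integral {x..} v * exp V" if x: "x \<ge> 0" for x
  proof -
    have "((\<lambda>y. (norm (W y) + m x * M * integral {x..} v) * exp V) \<longlongrightarrow> (norm (0::complex) + m x * M * integral {x..} v) * exp V) at_top"
      using lim unfolding W_def by (intro tendsto_intros)
    then have "norm (W x) \<le> (norm (0::complex) + m x * M * integral {x..} v) * exp V"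
    proof (rule tendsto_lowerbound)
      show "\<forall>\<^sub>F y in at_top. norm (W x) \<le> (norm (W y) + m x * M * integral {x..} v) * exp V"
        using eventually_ge_at_top[of x] by eventually_elim (rule main[OF x])
    qed simp
    then have "m x * norm (w x) \<le> m x * (M * integral {x..} v * exp V)" by (simp add: W_def m_def norm_mult mult_ac)
    moreover have "m x > 0" by (simp add: m_def)
    ultimately show ?thesis by (simp add: mult_le_cancel_left_pos)
  qed
  have "((\<lambda>x. M * integral {x..} v * exp V) \<longlongrightarrow> M * 0 * exp V) at_top"
    by (intro tendsto_intros integral_tail(3) vai)
  then have l: "((\<lambda>x. M * integral {x..} v * exp V) \<longlongrightarrow> 0) at_top" by simp
  show ?thesis
  proof (rule Lim_null_comparison[OF _ l])
    show "\<forall>\<^sub>F x in at_top. norm (w x) \<le> M * integral {x..} v * exp V"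
      using eventually_ge_at_top[of 0] by eventually_elim (rule bound)
  qed
qed

section \<open>Entries of the matrices\<close>

lemma mat2_entries [simp]:
  "mat2 a b c d $ 1 $ 1 = a" "mat2 a b c d $ 1 $ 2 = b" "mat2 a b c d $ 2 $ 1 = c" "mat2 a b c d $ 2 $ 2 = d"
  by (simp_all add: mat2_def)

lemma smat_entry [simp]: "(c *\<^sub>M A) $ i $ j = c * A $ i $ j"
  by (simp add: smat_def map_matrix_def)

lemma mmult_entry: "((A :: cmat) ** B) $ i $ j = A $ i $ 1 * B $ 1 $ j + A $ i $ 2 * B $ 2 $ j"
  by (simp add: matrix_matrix_mult_def sum_2)

lemma part_entries [simp]:
  "off_part A $ 1 $ 1 = 0" "off_part A $ 1 $ 2 = A $ 1 $ 2" "off_part A $ 2 $ 1 = A $ 2 $ 1" "off_part A $ 2 $ 2 = 0"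
  "diag_part A $ 1 $ 1 = A $ 1 $ 1" "diag_part A $ 1 $ 2 = 0" "diag_part A $ 2 $ 1 = 0" "diag_part A $ 2 $ 2 = A $ 2 $ 2"
  by (simp_all add: off_part_def diag_part_def)

lemma exp_sigma3_entries [simp]:
  "exp_sigma3 a $ 1 $ 1 = exp a" "exp_sigma3 a $ 1 $ 2 = 0" "exp_sigma3 a $ 2 $ 1 = 0" "exp_sigma3 a $ 2 $ 2 = exp (- a)"
  by (simp_all add: exp_sigma3_def)

lemma exp_ad_sigma3_entries:
  "exp_ad_sigma3 a A $ 1 $ 1 = A $ 1 $ 1" "exp_ad_sigma3 a A $ 1 $ 2 = exp (2 * a) * A $ 1 $ 2"
  "exp_ad_sigma3 a A $ 2 $ 1 = exp (- (2 * a)) * A $ 2 $ 1" "exp_ad_sigma3 a A $ 2 $ 2 = A $ 2 $ 2"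
proof -
  have e: "exp a * exp a = exp (2 * a)" "exp (- a) * exp (- a) = exp (- (2 * a))" "exp a * exp (- a) = 1"
    by (simp_all add: exp_add[symmetric])
  have "exp a * z * exp a = (exp a * exp a) * z" "exp (- a) * z * exp (- a) = (exp (- a) * exp (- a)) * z"
    "exp a * z * exp (- a) = (exp a * exp (- a)) * z" "exp (- a) * z * exp a = (exp a * exp (- a)) * z" for z by (simp_all only: mult_ac)
  then show "exp_ad_sigma3 a A $ 1 $ 1 = A $ 1 $ 1" "exp_ad_sigma3 a A $ 1 $ 2 = exp (2 * a) * A $ 1 $ 2"
    "exp_ad_sigma3 a A $ 2 $ 1 = exp (- (2 * a)) * A $ 2 $ 1" "exp_ad_sigma3 a A $ 2 $ 2 = A $ 2 $ 2"
    by (simp_all add: exp_ad_sigma3_def mmult_entry e)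
qed

lemma mat1_entries [simp]:
  "(mat 1 :: cmat) $ 1 $ 1 = 1" "(mat 1 :: cmat) $ 1 $ 2 = 0" "(mat 1 :: cmat) $ 2 $ 1 = 0" "(mat 1 :: cmat) $ 2 $ 2 = 1"
  by (simp_all add: mat_def)

lemma sigma_entries [simp]:
  "sigma1 $ 1 $ 1 = 0" "sigma1 $ 1 $ 2 = 1" "sigma1 $ 2 $ 1 = 1" "sigma1 $ 2 $ 2 = 0"
  "sigma2 $ 1 $ 1 = 0" "sigma2 $ 1 $ 2 = - \<i>" "sigma2 $ 2 $ 1 = \<i>" "sigma2 $ 2 $ 2 = 0"
  "sigma3 $ 1 $ 1 = 1" "sigma3 $ 1 $ 2 = 0" "sigma3 $ 2 $ 1 = 0" "sigma3 $ 2 $ 2 = - 1"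
  by (simp_all add: sigma1_def sigma2_def sigma3_def)

text \<open>The sign of the phase, the index of the slow entry and the index of the fast entry of a column. The
  slow entry is the diagonal one, so a is also the index of the column.\<close>

definition side :: "complex \<Rightarrow> 2 \<Rightarrow> 2 \<Rightarrow> bool" where
  "side \<epsilon> a b \<longleftrightarrow> \<epsilon> = 1 \<and> a = 1 \<and> b = 2 \<or> \<epsilon> = - 1 \<and> a = 2 \<and> b = 1"

lemma side_swap: "side \<epsilon> a b \<Longrightarrow> side (- \<epsilon>) b a"
  by (auto simp: side_def)

lemma side_square: "side \<epsilon> a b \<Longrightarrow> \<epsilon> * \<epsilon> = 1" and side_norm: "side \<epsilon> a b \<Longrightarrow> norm \<epsilon> = 1"
  by (auto simp: side_def)

lemma bounded_linear_entry: "bounded_linear (\<lambda>A :: cmat. A $ i $ j)"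
  by (rule bounded_linear_compose[OF bounded_linear_vec_nth bounded_linear_vec_nth])

section \<open>Volterra equations\<close>

text \<open>A nonzero constant term is compatible with the kernel only if there is no phase.\<close>

lemma volterra_forward:
  fixes h :: complex
  assumes ai: "\<And>t. t \<ge> 0 \<Longrightarrow> (\<lambda>s. exp (h * of_real (t - s)) * g s) absolutely_integrable_on {0..t}"
    and w: "\<And>t. t \<ge> 0 \<Longrightarrow> w t = w0 + integral {0..t} (\<lambda>s. exp (h * of_real (t - s)) * g s)"
    and h0: "w0 = 0 \<or> h = 0"
  shows "antideriv w (\<lambda>t. h * w t + g t)" "w 0 = w0"
proof -
  have ee: "exp (- h * of_real s) * g s = exp (- h * of_real t) * (exp (h * of_real (t - s)) * g s)" for s t
    by (simp add: exp_add[symmetric] algebra_simps)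
  have ee': "exp (h * of_real (t - s)) * g s = exp (h * of_real t) * (exp (- h * of_real s) * g s)" for s t
    by (simp add: exp_add[symmetric] algebra_simps)
  define G where "G s = exp (- h * of_real s) * g s" for s
  have aG: "antideriv (\<lambda>t. integral {0..t} G) G"
    unfolding antideriv_def
  proof (intro allI impI conjI)
    fix t :: real assume t: "t \<ge> 0"
    show "G absolutely_integrable_on {0..t}" unfolding G_def ee[of _ t]
      by (rule set_integrable_mult_right) (use ai[OF t] in simp)
  qed simp
  have wt: "w t = w0 + exp (h * of_real t) * integral {0..t} G" if t: "t \<ge> 0" for t
    unfolding w[OF t] G_def ee'[of t] by simp
  have "antideriv (\<lambda>t. w0 + exp (h * of_real t) * integral {0..t} G) (\<lambda>t. 0 + exp (h * of_real t) * (h * integral {0..t} G + G t))"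
    by (rule antideriv_add[OF antideriv_const antideriv_exp_mult[OF aG]])
  then show "antideriv w (\<lambda>t. h * w t + g t)"
  proof (rule antideriv_cong)
    fix t :: real assume t: "t \<ge> 0"
    show "w0 + exp (h * of_real t) * integral {0..t} G = w t" using wt[OF t] by simp
    have "exp (h * of_real t) * G t = g t" by (simp add: G_def mult.assoc[symmetric] exp_add[symmetric])
    then show "0 + exp (h * of_real t) * (h * integral {0..t} G + G t) = h * w t + g t"
      using h0 unfolding wt[OF t] by (auto simp: algebra_simps)
  qed
  show "w 0 = w0" using w[of 0] by simp
qed

lemma volterra_backward:
  fixes h :: complex
  assumes ai: "\<And>t. t \<ge> 0 \<Longrightarrow> (\<lambda>s. exp (h * of_real (t - s)) * g s) absolutely_integrable_on {t..}"
    and w: "\<And>t. t \<ge> 0 \<Longrightarrow> w t = w0 - integral {t..} (\<lambda>s. exp (h * of_real (t - s)) * g s)"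
    and h0: "w0 = 0 \<or> h = 0"
  shows "antideriv w (\<lambda>t. h * w t + g t)"
    and "((\<lambda>t. exp (- h * of_real t) * w t) \<longlongrightarrow> w0) at_top"
    and "\<exists>M. \<forall>t\<ge>0. norm (exp (- h * of_real t) * w t) \<le> M"
proof -
  have ee': "exp (h * of_real (t - s)) * g s = exp (h * of_real t) * (exp (- h * of_real s) * g s)" for s t
    by (simp add: exp_add[symmetric] algebra_simps)
  define G where "G s = exp (- h * of_real s) * g s" for s
  have aiG: "G absolutely_integrable_on {0..}"
    using ai[of 0] by (simp add: G_def[abs_def])
  define I where "I t = w0 - integral {t..} G" for t
  have I: "I t = (w0 - integral {0..} G) + integral {0..t} G" if "t \<ge> 0" for t
    using integral_tail(2)[OF aiG that] by (simp add: I_def algebra_simps)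
  have aI: "antideriv I G"
    unfolding antideriv_def
  proof (intro allI impI conjI)
    fix t :: real assume t: "t \<ge> 0"
    show "G absolutely_integrable_on {0..t}" by (rule set_integrable_subset[OF aiG]) auto
    show "I t = I 0 + integral {0..t} G" using I[OF t] by (simp add: I_def)
  qed
  have wt: "w t = exp (h * of_real t) * I t" if t: "t \<ge> 0" for t
  proof -
    have "integral {t..} (\<lambda>s. exp (h * of_real (t - s)) * g s) = exp (h * of_real t) * integral {t..} G"
      unfolding G_def ee'[of t] by simp
    then show ?thesis unfolding w[OF t] I_def using h0 by (auto simp: algebra_simps)
  qed
  have wi: "exp (- h * of_real t) * w t = I t" if t: "t \<ge> 0" for t
    unfolding wt[OF t] by (simp add: mult.assoc[symmetric] exp_add[symmetric])
  show "antideriv w (\<lambda>t. h * w t + g t)"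
  proof (rule antideriv_cong[OF antideriv_exp_mult[OF aI]])
    fix t :: real assume t: "t \<ge> 0"
    show "exp (h * of_real t) * I t = w t" using wt[OF t] by simp
    have "exp (h * of_real t) * G t = g t" by (simp add: G_def mult.assoc[symmetric] exp_add[symmetric])
    then show "exp (h * of_real t) * (h * I t + G t) = h * w t + g t"
      unfolding wt[OF t] by (simp add: algebra_simps)
  qed
  have "(I \<longlongrightarrow> w0 - 0) at_top" unfolding I_def by (intro tendsto_intros integral_tail(3) aiG)
  then have "(I \<longlongrightarrow> w0) at_top" by simp
  then show "((\<lambda>t. exp (- h * of_real t) * w t) \<longlongrightarrow> w0) at_top"
  proof (rule Lim_transform_eventually)
    show "\<forall>\<^sub>F t in at_top. I t = exp (- h * of_real t) * w t"
      using eventually_ge_at_top[of 0] by eventually_elim (rule wi[symmetric])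
  qed
  have "norm (I t) \<le> norm w0 + integral {0..} (\<lambda>s. norm (G s))" if t: "t \<ge> 0" for t
  proof -
    have Gt: "G absolutely_integrable_on {t..}" by (rule set_integrable_subset[OF aiG]) (use t in auto)
    have nt: "(\<lambda>s. norm (G s)) integrable_on {t..}" "(\<lambda>s. norm (G s)) integrable_on {0..}"
      using Gt aiG by (simp_all add: absolutely_integrable_on_def)
    have "norm (integral {t..} G) \<le> integral {t..} (\<lambda>s. norm (G s))"
      by (rule integral_norm_bound_integral[OF set_lebesgue_integral_eq_integral(1)[OF Gt] nt(1)]) simp
    also have "\<dots> \<le> integral {0..} (\<lambda>s. norm (G s))"
      by (rule integral_subset_le[OF _ nt]) (use t in auto)
    finally show ?thesis unfolding I_def using norm_triangle_ineq4[of w0 "integral {t..} G"] by linarith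
  qed
  then show "\<exists>M. \<forall>t\<ge>0. norm (exp (- h * of_real t) * w t) \<le> M" using wi by (metis)
qed

section \<open>The sign of the phase and the spectral domains\<close>

lemma Re_phase:
  assumes "k \<noteq> 0" and that: "Im \<epsilon> = 0"
  shows "Re (phase \<epsilon> k) = - Re \<epsilon> * Im k * ((norm k)\<^sup>2 - 1) / (2 * (norm k)\<^sup>2)"
proof -
  define r where "r = (Re k)\<^sup>2 + (Im k)\<^sup>2"
  have r: "r \<noteq> 0" "(norm k)\<^sup>2 = r" using assms by (auto simp: r_def cmod_power2 complex_eq_iff sum_power2_eq_zero_iff)
  have e: "\<epsilon> = of_real (Re \<epsilon>)" using that by (simp add: complex_eq_iff)
  have "phase \<epsilon> k = of_real (Re \<epsilon> / 2) * (\<i> * (k + 1 / k))"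
    unfolding phase_def theta2_def by (subst e) simp
  also have "Re \<dots> = - Re \<epsilon> * (Im k - Im k / r) / 2"
    by (simp add: Im_divide r_def right_diff_distrib)
  finally have "Re (phase \<epsilon> k) = - Re \<epsilon> * (Im k - Im k / r) / 2" .
  also have "\<dots> = - Re \<epsilon> * Im k * (r - 1) / (2 * r)" using r(1) by (simp add: field_simps)
  finally show ?thesis by (simp only: r)
qed

text \<open>The closed set of parameters at which the phase has nonnegative real part, together with 0.\<close>

definition slab :: "complex \<Rightarrow> complex set" where
  "slab \<epsilon> = {k. Re \<epsilon> * Im k * ((norm k)\<^sup>2 - 1) \<le> 0}"

lemma closed_slab: "closed (slab \<epsilon>)"
  unfolding slab_def by (intro closed_Collect_le continuous_intros)

lemma slab_iff:
  assumes "k \<noteq> 0" "side \<epsilon> a b" shows "k \<in> slab \<epsilon> \<longleftrightarrow> Re (phase \<epsilon> k) \<ge> 0" "k \<in> slab (- \<epsilon>) \<longleftrightarrow> Re (phase \<epsilon> k) \<le> 0"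
proof -
  have "Im \<epsilon> = 0" using assms(2) by (auto simp: side_def)
  then show "k \<in> slab \<epsilon> \<longleftrightarrow> Re (phase \<epsilon> k) \<ge> 0" "k \<in> slab (- \<epsilon>) \<longleftrightarrow> Re (phase \<epsilon> k) \<le> 0"
    using assms(1) by (simp_all add: Re_phase slab_def zero_le_divide_iff divide_le_0_iff zero_le_mult_iff)
qed

lemma domain_in_slab:
  "closure Dminus \<subseteq> slab 1" "closure Dplus \<subseteq> slab (- 1)"
  "closure D2 \<subseteq> slab 1 \<inter> {k. norm k \<le> 1}" "closure D3 \<subseteq> slab (- 1) \<inter> {k. norm k \<le> 1}"
proof -
  have sq: "(norm (k::complex))\<^sup>2 \<le> 1 \<longleftrightarrow> norm k \<le> 1" "1 \<le> (norm k)\<^sup>2 \<longleftrightarrow> 1 \<le> norm k" for k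
    by (metis abs_norm_cancel abs_square_le_1, metis abs_norm_cancel abs_square_less_1 linorder_not_le)
  have c: "closed (slab \<epsilon> \<inter> {k. norm k \<le> 1})" for \<epsilon>
    by (intro closed_Int closed_slab closed_Collect_le continuous_intros)
  show "closure Dminus \<subseteq> slab 1" "closure Dplus \<subseteq> slab (- 1)"
    by (rule closure_minimal[OF _ closed_slab];
        auto simp: Dminus_def Dplus_def slab_def D1_def D2_def D3_def D4_def mult_le_0_iff zero_le_mult_iff sq)+
  show "closure D2 \<subseteq> slab 1 \<inter> {k. norm k \<le> 1}" "closure D3 \<subseteq> slab (- 1) \<inter> {k. norm k \<le> 1}"
    by (rule closure_minimal[OF _ c];
        auto simp: slab_def D2_def D3_def mult_le_0_iff zero_le_mult_iff sq)+
qed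

text \<open>Points of the closed unit disc are approached from inside the disc along segments to \<open>\<plusminus> \<i> / 2\<close>, except
  on the half of the unit circle that bounds only the outer component, which is approached radially from
  outside.\<close>

lemma slab_in_domain:
  assumes k: "norm k \<le> 1"
  shows "k \<in> slab 1 \<Longrightarrow> k \<in> closure Dminus" "k \<in> slab (- 1) \<Longrightarrow> k \<in> closure Dplus"
proof -
  have sq: "(norm k)\<^sup>2 \<ge> 1 \<longleftrightarrow> norm k = 1"
    using k power_le_one[of "norm k" 2] by (smt (verit) norm_ge_zero one_power2 power2_eq_imp_eq)
  define r where "r n = inverse (real (Suc n))" for n
  have r: "r n > 0" "r n \<le> 1" "r \<longlonglongrightarrow> 0" for n
    using LIMSEQ_inverse_real_of_nat by (auto simp: r_def[abs_def] inverse_le_1_iff)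
  have nin: "norm ((1 - r n) *\<^sub>R k + r n *\<^sub>R (z / 2)) < 1" if "norm z = 1" for n z
  proof -
    have "norm ((1 - r n) *\<^sub>R k + r n *\<^sub>R (z / 2)) \<le> norm ((1 - r n) *\<^sub>R k) + norm (r n *\<^sub>R (z / 2))"
      by (rule norm_triangle_ineq)
    also have "\<dots> = (1 - r n) * norm k + r n / 2" using r(1,2)[of n] that by (simp add: norm_divide)
    also have "\<dots> \<le> (1 - r n) * 1 + r n / 2" using r(1,2)[of n] k by (intro add_right_mono mult_left_mono) auto
    finally show ?thesis using r(1)[of n] by simp
  qed
  have lin: "(\<lambda>n. (1 - r n) *\<^sub>R k + r n *\<^sub>R (z / 2)) \<longlonglongrightarrow> (1 - 0) *\<^sub>R k + 0 *\<^sub>R (z / 2)" for z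
    by (intro tendsto_intros r)
  have lout: "(\<lambda>n. (1 + r n) *\<^sub>R k) \<longlonglongrightarrow> (1 + 0) *\<^sub>R k" by (intro tendsto_intros r)
  have out: "norm ((1 + r n) *\<^sub>R k) > 1" if "norm k = 1" for n using r(1)[of n] that by simp
  have cl: "x \<in> closure S" if "f \<longlonglongrightarrow> x" "\<And>n. f n \<in> S" for f x and S :: "complex set"
    unfolding closure_sequential using that by blast
  have im: "Im ((1 - r n) *\<^sub>R k + r n *\<^sub>R (\<i> / 2)) > 0" if "Im k \<ge> 0" for n
    using r(1,2)[of n] that by (simp add: add_nonneg_pos)
  have im': "Im ((1 - r n) *\<^sub>R k + r n *\<^sub>R (- \<i> / 2)) < 0" if "Im k \<le> 0" for n
    using r(1,2)[of n] that mult_nonneg_nonpos[of "1 - r n" "Im k"] by simp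
  show "k \<in> closure Dminus" if "k \<in> slab 1"
  proof (cases "Im k \<ge> 0")
    case True
    show ?thesis
    proof (rule cl)
      show "(\<lambda>n. (1 - r n) *\<^sub>R k + r n *\<^sub>R (\<i> / 2)) \<longlonglongrightarrow> k" using lin by simp
      show "(1 - r n) *\<^sub>R k + r n *\<^sub>R (\<i> / 2) \<in> Dminus" for n
        unfolding Dminus_def D2_def using im[OF True, of n] nin[of \<i> n] by simp
    qed
  next
    case False
    then have n1: "norm k = 1" using that sq by (simp add: slab_def mult_le_0_iff)
    show ?thesis
    proof (rule cl)
      show "(\<lambda>n. (1 + r n) *\<^sub>R k) \<longlonglongrightarrow> k" using lout by simp
      show "(1 + r n) *\<^sub>R k \<in> Dminus" for n
        unfolding Dminus_def D4_def using False out[OF n1, of n] r(1)[of n] by (auto simp: mult_less_0_iff)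
    qed
  qed
  show "k \<in> closure Dplus" if "k \<in> slab (- 1)"
  proof (cases "Im k \<le> 0")
    case True
    show ?thesis
    proof (rule cl)
      show "(\<lambda>n. (1 - r n) *\<^sub>R k + r n *\<^sub>R (- \<i> / 2)) \<longlonglongrightarrow> k" using lin[of "- \<i>"] by simp
      show "(1 - r n) *\<^sub>R k + r n *\<^sub>R (- \<i> / 2) \<in> Dplus" for n
        unfolding Dplus_def D3_def using im'[OF True, of n] nin[of "- \<i>" n] by simp
    qed
  next
    case False
    then have n1: "norm k = 1" using that sq by (simp add: slab_def zero_le_mult_iff)
    show ?thesis
    proof (rule cl)
      show "(\<lambda>n. (1 + r n) *\<^sub>R k) \<longlonglongrightarrow> k" using lout by simp
      show "(1 + r n) *\<^sub>R k \<in> Dplus" for n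
        unfolding Dplus_def D1_def using False out[OF n1, of n] r(1)[of n] by (auto simp: zero_less_mult_iff)
    qed
  qed
qed

section \<open>Columns\<close>

lemma norm_vec2_le: "norm (x :: complex^2) \<le> norm (x $ 1) + norm (x $ 2)"
  unfolding norm_vec_def using L2_set_le_sum[of UNIV "\<lambda>i. norm (x $ i)"] by (simp add: sum_2)

lemma col_deriv_leI:
  fixes f :: "complex \<Rightarrow> complex^2"
  assumes ab: "side \<epsilon> a b" and f: "scal_deriv_le j D (\<lambda>k. f k $ a) B" "scal_deriv_le j D (\<lambda>k. f k $ b) B"
    and B: "\<And>k. k \<in> closure D - {0} \<Longrightarrow> 2 * B k \<le> B' k"
  shows "col_deriv_le j D f B'"
proof -
  have 12: "scal_deriv_le j D (\<lambda>k. f k $ 1) B" "scal_deriv_le j D (\<lambda>k. f k $ 2) B" using ab f by (auto simp: side_def)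
  obtain g where g: "(\<lambda>k. f k $ 1) holomorphic_on D" "continuous_on (closure D - {0}) (\<lambda>k. f k $ 1)"
     "continuous_on (closure D - {0}) g" "\<forall>k\<in>D. g k = (deriv ^^ j) (\<lambda>k. f k $ 1) k" "\<forall>k\<in>closure D - {0}. norm (g k) \<le> B k"
    using 12(1) unfolding scal_deriv_le_def by blast
  obtain h where h: "(\<lambda>k. f k $ 2) holomorphic_on D" "continuous_on (closure D - {0}) (\<lambda>k. f k $ 2)"
     "continuous_on (closure D - {0}) h" "\<forall>k\<in>D. h k = (deriv ^^ j) (\<lambda>k. f k $ 2) k" "\<forall>k\<in>closure D - {0}. norm (h k) \<le> B k"
    using 12(2) unfolding scal_deriv_le_def by blast
  define G :: "complex \<Rightarrow> complex^2" where "G k = (\<chi> i. if i = 1 then g k else h k)" for k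
  have G: "G k $ 1 = g k" "G k $ 2 = h k" for k by (simp_all add: G_def)
  have cont: "continuous_on A F" if "continuous_on A (\<lambda>k. F k $ 1)" "continuous_on A (\<lambda>k. F k $ 2)" for A and F :: "complex \<Rightarrow> complex^2"
  proof -
    have "continuous_on A (\<lambda>k. \<chi> i. F k $ i)"
    proof (rule continuous_on_vec_lambda)
      fix i :: 2 show "continuous_on A (\<lambda>k. F k $ i)" using that exhaust_2[of i] by auto
    qed
    then show ?thesis by simp
  qed
  show ?thesis unfolding col_deriv_le_def has_ext_deriv_def
  proof (intro exI[of _ G] conjI ballI)
    show "\<forall>i. (\<lambda>k. f k $ i) holomorphic_on D" using g(1) h(1) by (simp add: forall_2)
    show "continuous_on (closure D - {0}) f" by (rule cont[OF g(2) h(2)])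
    show "continuous_on (closure D - {0}) G" by (rule cont) (simp_all add: G g(3) h(3))
    show "\<forall>i. G k $ i = (deriv ^^ j) (\<lambda>z. f z $ i) k" if "k \<in> D" for k using g(4) h(4) that by (simp add: forall_2 G)
    show "norm (G k) \<le> B' k" if "k \<in> closure D - {0}" for k
      using norm_vec2_le[of "G k"] g(5)[rule_format, OF that] h(5)[rule_format, OF that] B[OF that] by (simp add: G)
  qed
qed

text \<open>The matrix recursion decouples into columns. In each column, the part to which P projects is the fast
  entry, determined algebraically, and the other one is determined by its derivative.\<close>

lemma formal_recursion_entries:
  fixes P Q :: "cmat \<Rightarrow> cmat" and V0 V1 :: "real \<Rightarrow> cmat" and X :: "nat \<Rightarrow> real \<Rightarrow> cmat"
  assumes rec: "formal_recursion P Q V0 V1 m X" and ab: "side \<epsilon> a b"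
    and P: "\<And>A :: cmat. P A $ b $ l = A $ b $ l" "\<And>A. P A $ a $ l = 0"
    and Q: "\<And>A. Q A $ a $ l = A $ a $ l" "\<And>A. Q A $ b $ l = 0"
    and V0: "\<And>t. V0 t $ 1 $ 1 = 0" "\<And>t. V0 t $ 2 $ 2 = 0" "\<And>t. V0 t $ b $ a = \<epsilon> * q t / 4" "\<And>t. V0 t $ a $ b = - \<epsilon> * q t / 4"
    and V1: "\<And>t. V1 t $ 1 $ 2 = \<i> * s t / 4" "\<And>t. V1 t $ 2 $ 1 = \<i> * s t / 4" "\<And>t. V1 t $ a $ a = - \<epsilon> * \<i> * c t / 4" "\<And>t. V1 t $ b $ b = \<epsilon> * \<i> * c t / 4"
    and j: "j \<le> m" and t: "t \<ge> 0"
  shows "((\<lambda>t. X j t $ b $ l) has_vector_derivative vector_derivative (\<lambda>s. P (X j s)) (at t within {0..}) $ b $ l) (at t within {0..})"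
    and "X (Suc j) t $ b $ l = 2 * \<i> * \<epsilon> * (- vector_derivative (\<lambda>s. P (X j s)) (at t within {0..}) $ b $ l + \<epsilon> * \<i> / 2 * (if j = 0 then 0 else X (j - 1) t $ b $ l)
        + \<epsilon> * q t / 4 * X j t $ a $ l + \<i> * s t / 4 * (if j = 0 then 0 else X (j - 1) t $ a $ l) + \<epsilon> * \<i> * c t / 4 * (if j = 0 then 0 else X (j - 1) t $ b $ l))"
    and "((\<lambda>t. X (Suc j) t $ a $ l) has_vector_derivative
        - \<epsilon> * q t / 4 * X (Suc j) t $ b $ l + \<i> * s t / 4 * X j t $ b $ l - \<epsilon> * \<i> * c t / 4 * X j t $ a $ l) (at t within {0..})"
proof -
  let ?d = "vector_derivative (\<lambda>s. P (X j s)) (at t within {0..})"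
  have 1: "(\<lambda>s. P (X j s)) differentiable (at t within {0..})"
    and 2: "P (X (Suc j) t) = (- 2 * \<i>) *\<^sub>M (sigma3 **
          (- ?d - (\<i> / 2) *\<^sub>M (sigma3 ** P (prev X j t)) + V0 t ** Q (X j t)
           + off_part (V1 t) ** Q (prev X j t) + diag_part (V1 t) ** P (prev X j t)))"
    and 3: "((\<lambda>s. Q (X (Suc j) s)) has_vector_derivative
          (V0 t ** P (X (Suc j) t) + off_part (V1 t) ** P (X j t) + diag_part (V1 t) ** Q (X j t))) (at t within {0..})"
    using rec j t unfolding formal_recursion_def by blast+
  have "((\<lambda>s. P (X j s)) has_vector_derivative ?d) (at t within {0..})"
    using 1 by (simp add: vector_derivative_works)
  from bounded_linear.has_vector_derivative[OF bounded_linear_entry[of b l] this]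
  show "((\<lambda>t. X j t $ b $ l) has_vector_derivative ?d $ b $ l) (at t within {0..})" by (simp only: P)
  have pv: "prev X j t $ i $ l = (if j = 0 then 0 else X (j - 1) t $ i $ l)" for i by (simp add: prev_def)
  have mm: "(A ** M) $ i $ l = A $ i $ a * M $ a $ l + A $ i $ b * M $ b $ l" for A M :: cmat and i
    using ab by (auto simp: side_def mmult_entry)
  have VV: "V0 t $ a $ a = 0" "V0 t $ b $ b = 0" "V1 t $ a $ b = \<i> * s t / 4" "V1 t $ b $ a = \<i> * s t / 4"
    using ab V0(1,2)[of t] V1(1,2)[of t] by (auto simp: side_def)
  have parts: "off_part A $ a $ a = 0" "off_part A $ b $ b = 0" "off_part A $ a $ b = A $ a $ b" "off_part A $ b $ a = A $ b $ a"
    "diag_part A $ a $ b = 0" "diag_part A $ b $ a = 0" "diag_part A $ a $ a = A $ a $ a" "diag_part A $ b $ b = A $ b $ b" for A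
    using ab by (auto simp: side_def)
  have s3: "(sigma3 ** M) $ b $ l = - \<epsilon> * M $ b $ l" for M :: cmat using ab by (auto simp: side_def mmult_entry)
  have s0: "(V0 t ** M) $ b $ l = \<epsilon> * q t / 4 * M $ a $ l" "(V0 t ** M) $ a $ l = - \<epsilon> * q t / 4 * M $ b $ l" for M :: cmat
    by (simp_all add: mm V0(3,4) VV)
  have so: "(off_part (V1 t) ** M) $ b $ l = \<i> * s t / 4 * M $ a $ l" "(off_part (V1 t) ** M) $ a $ l = \<i> * s t / 4 * M $ b $ l" for M :: cmat
    by (simp_all add: mm parts VV)
  have sd: "(diag_part (V1 t) ** M) $ b $ l = \<epsilon> * \<i> * c t / 4 * M $ b $ l" "(diag_part (V1 t) ** M) $ a $ l = - \<epsilon> * \<i> * c t / 4 * M $ a $ l" for M :: cmat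
    by (simp_all add: mm parts V1(3,4))
  have "X (Suc j) t $ b $ l = P (X (Suc j) t) $ b $ l" by (simp only: P)
  then show "X (Suc j) t $ b $ l = 2 * \<i> * \<epsilon> * (- ?d $ b $ l + \<epsilon> * \<i> / 2 * (if j = 0 then 0 else X (j - 1) t $ b $ l)
        + \<epsilon> * q t / 4 * X j t $ a $ l + \<i> * s t / 4 * (if j = 0 then 0 else X (j - 1) t $ a $ l) + \<epsilon> * \<i> * c t / 4 * (if j = 0 then 0 else X (j - 1) t $ b $ l))"
    unfolding 2 by (simp add: s3 s0 so sd P Q pv)
  from bounded_linear.has_vector_derivative[OF bounded_linear_entry[of a l] 3]
  show "((\<lambda>t. X (Suc j) t $ a $ l) has_vector_derivative
        - \<epsilon> * q t / 4 * X (Suc j) t $ b $ l + \<i> * s t / 4 * X j t $ b $ l - \<epsilon> * \<i> * c t / 4 * X j t $ a $ l) (at t within {0..})"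
    by (simp add: s0 so sd P Q)
qed

section \<open>The columns of T and U\<close>

locale boundary_data = gauged q s c n m p C S \<sigma>
  for q s c n m p C S \<sigma> +
  fixes g0 g0t g1 :: "real \<Rightarrow> real" and N :: int
  assumes q_eq: "\<And>t. q t = of_real (g1 t - g0t t)" and p_eq: "\<And>t. p t = of_real (g0t t)"
    and s_sin: "\<And>t. s t = of_real (sin (g0 t))" and c_cos: "\<And>t. c t = of_real (cos (g0 t) - 1)"
    and C_cos: "\<And>t. C t = of_real (cos (g0 t / 2))" and S_sin: "\<And>t. S t = of_real (sin (g0 t / 2))"
    and \<sigma>_eq: "\<sigma> = (- 1) powi N"
begin

abbreviation Vm where "Vm \<equiv> Vmat g0 g0t g1"

lemma Vmat_side:
  assumes "side \<epsilon> a b"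
  shows "Vm t k $ a $ a = - \<epsilon> * \<i> * c t / (4 * k)"
    "Vm t k $ a $ b = - \<epsilon> * (q t + 2 * p t) / 4 - \<i> * s t / (4 * k)"
    "Vm t k $ b $ a = \<epsilon> * (q t + 2 * p t) / 4 - \<i> * s t / (4 * k)"
    "Vm t k $ b $ b = \<epsilon> * \<i> * c t / (4 * k)"
proof -
  have i: "\<i> * (\<i> * x) = - x" for x :: complex by (simp add: mult.assoc[symmetric])
  define l where "l = 1 / k"
  have lk: "x / (4 * k) = x * l / 4" for x by (simp add: l_def)
  have V: "Vm t k = (- (\<i> * of_real (g1 t + g0t t) / 4)) *\<^sub>M sigma2
     + l *\<^sub>M ((- (\<i> * of_real (sin (g0 t)) / 4)) *\<^sub>M sigma1 - (\<i> * of_real (cos (g0 t) - 1) / 4) *\<^sub>M sigma3)"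
    by (simp only: Vmat_def l_def)
  have e: "Vm t k $ 1 $ 1 = - \<i> * c t / (4 * k)" "Vm t k $ 1 $ 2 = - (q t + 2 * p t) / 4 - \<i> * s t / (4 * k)"
    "Vm t k $ 2 $ 1 = (q t + 2 * p t) / 4 - \<i> * s t / (4 * k)" "Vm t k $ 2 $ 2 = \<i> * c t / (4 * k)"
    unfolding lk by (simp_all add: V q_eq p_eq s_sin c_cos i field_simps)
  define Q where "Q = q t + 2 * p t"
  note e = e[folded Q_def]
  show "Vm t k $ a $ a = - \<epsilon> * \<i> * c t / (4 * k)"
    "Vm t k $ a $ b = - \<epsilon> * (q t + 2 * p t) / 4 - \<i> * s t / (4 * k)"
    "Vm t k $ b $ a = \<epsilon> * (q t + 2 * p t) / 4 - \<i> * s t / (4 * k)"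
    "Vm t k $ b $ b = \<epsilon> * \<i> * c t / (4 * k)"
    unfolding Q_def[symmetric] using assms by (auto simp: side_def e)
qed

lemma integrand_side:
  assumes "side \<epsilon> a b"
  shows "volterra_integrand V X t k r $ a $ a = V r k $ a $ a * X r k $ a $ a + V r k $ a $ b * X r k $ b $ a"
    "volterra_integrand V X t k r $ b $ a =
       exp (phase \<epsilon> k * of_real (t - r)) * (V r k $ b $ a * X r k $ a $ a + V r k $ b $ b * X r k $ b $ a)"
proof -
  have e: "exp (2 * (\<i> * theta2 k * of_real (r - t))) = exp (phase (- 1) k * of_real (t - r))"
    "exp (- (2 * (\<i> * theta2 k * of_real (r - t)))) = exp (phase 1 k * of_real (t - r))"
    by (simp_all add: phase_def algebra_simps)
  from assms consider "\<epsilon> = 1" "a = 1" "b = 2" | "\<epsilon> = - 1" "a = 2" "b = 1" by (auto simp: side_def)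
  then have "volterra_integrand V X t k r $ a $ a = V r k $ a $ a * X r k $ a $ a + V r k $ a $ b * X r k $ b $ a \<and>
    volterra_integrand V X t k r $ b $ a =
       exp (phase \<epsilon> k * of_real (t - r)) * (V r k $ b $ a * X r k $ a $ a + V r k $ b $ b * X r k $ b $ a)"
  proof cases
    case 1
    show ?thesis unfolding 1 volterra_integrand_def exp_ad_sigma3_entries e mmult_entry by (intro conjI refl)
  next
    case 2
    show ?thesis unfolding 2 volterra_integrand_def exp_ad_sigma3_entries e mmult_entry
      by (intro conjI) (simp_all only: add.commute)
  qed
  then show "volterra_integrand V X t k r $ a $ a = V r k $ a $ a * X r k $ a $ a + V r k $ a $ b * X r k $ b $ a"
    "volterra_integrand V X t k r $ b $ a =
       exp (phase \<epsilon> k * of_real (t - r)) * (V r k $ b $ a * X r k $ a $ a + V r k $ b $ b * X r k $ b $ a)" by auto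
qed

text \<open>The integrands of the Volterra equations for the slow and the fast entry, without the kernel.\<close>

definition gslow where "gslow \<epsilon> k u w t = - \<epsilon> * \<i> * c t / (4 * k) * u t + (- \<epsilon> * (q t + 2 * p t) / 4 - \<i> * s t / (4 * k)) * w t"
definition gfast where "gfast \<epsilon> k u w t = (\<epsilon> * (q t + 2 * p t) / 4 - \<i> * s t / (4 * k)) * u t + \<epsilon> * \<i> * c t / (4 * k) * w t"

lemma usysI:
  assumes "antideriv u (\<lambda>t. 0 * u t + gslow \<epsilon> k u w t)" "antideriv w (\<lambda>t. phase \<epsilon> k * w t + gfast \<epsilon> k u w t)"
  shows "usys \<epsilon> k u w"
  using assms by (simp add: usys_def colsys_def gslow_def gfast_def)

lemma integrand_entries:
  assumes "side \<epsilon> a b"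
  shows "(\<lambda>r. volterra_integrand Vm X t k r $ a $ a) = (\<lambda>r. exp (0 * of_real (t - r)) * gslow \<epsilon> k (\<lambda>t. X t k $ a $ a) (\<lambda>t. X t k $ b $ a) r)"
    "(\<lambda>r. volterra_integrand Vm X t k r $ b $ a) = (\<lambda>r. exp (phase \<epsilon> k * of_real (t - r)) * gfast \<epsilon> k (\<lambda>t. X t k $ a $ a) (\<lambda>t. X t k $ b $ a) r)"
  by (simp_all add: fun_eq_iff integrand_side[OF assms] Vmat_side[OF assms] gslow_def gfast_def)

lemma U_column:
  assumes U: "is_U Vm U" and ab: "side \<epsilon> a b" and k: "k \<noteq> 0"
  shows "usys \<epsilon> k (\<lambda>t. U t k $ a $ a) (\<lambda>t. U t k $ b $ a)" "U 0 k $ a $ a = 1" "U 0 k $ b $ a = 0"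
proof -
  let ?I = "\<lambda>t. volterra_integrand Vm U t k"
  have ai: "?I t absolutely_integrable_on {0..t}" and eq: "U t k = mat 1 + integral {0..t} (?I t)" if "t \<ge> 0" for t
    using U k that unfolding is_U_def by blast+
  have aie: "(\<lambda>r. ?I t r $ i $ l) absolutely_integrable_on {0..t}" if "t \<ge> 0" for t i l
    using absolutely_integrable_linear[OF ai[OF that] bounded_linear_entry[of i l]] by (simp add: o_def)
  have eqe: "U t k $ i $ l = (mat 1 :: cmat) $ i $ l + integral {0..t} (\<lambda>r. ?I t r $ i $ l)" if t: "t \<ge> 0" for t i l
  proof -
    have "integral {0..t} (\<lambda>r. ?I t r $ i $ l) = integral {0..t} (?I t) $ i $ l"
      using integral_linear[OF set_lebesgue_integral_eq_integral(1)[OF ai[OF t]] bounded_linear_entry[of i l]] by (simp add: o_def)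
    then show ?thesis using eq[OF t] by simp
  qed
  have m1: "(mat 1 :: cmat) $ a $ a = 1" "(mat 1 :: cmat) $ b $ a = 0" using ab by (auto simp: side_def)
  note slow = volterra_forward[OF aie[of _ a a, unfolded integrand_entries(1)[OF ab]] eqe[of _ a a, unfolded integrand_entries(1)[OF ab]]]
  note fast = volterra_forward[OF aie[of _ b a, unfolded integrand_entries(2)[OF ab]] eqe[of _ b a, unfolded integrand_entries(2)[OF ab]]]
  show "U 0 k $ a $ a = 1" "U 0 k $ b $ a = 0" using eqe[of 0] by (simp_all add: m1)
  show "usys \<epsilon> k (\<lambda>t. U t k $ a $ a) (\<lambda>t. U t k $ b $ a)"
    by (rule usysI; rule slow(1) fast(1)) (simp_all add: m1)
qed

lemma T_column:
  assumes T: "volterra_infinity_col Vm T a k" and ab: "side \<epsilon> a b" and k: "k \<noteq> 0" and re: "Re (phase \<epsilon> k) \<ge> 0"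
  shows "usys \<epsilon> k (\<lambda>t. T t k $ a $ a) (\<lambda>t. T t k $ b $ a)"
    and "((\<lambda>t. T t k $ a $ a) \<longlongrightarrow> 1) at_top" "((\<lambda>t. T t k $ b $ a) \<longlongrightarrow> 0) at_top"
proof -
  let ?I = "\<lambda>t. volterra_integrand Vm T t k"
  have ai: "(\<lambda>r. column a (?I t r)) absolutely_integrable_on {t..}"
    and eq: "column a (T t k) = column a (mat 1) - integral {t..} (\<lambda>r. column a (?I t r))" if "t \<ge> 0" for t
    using T that unfolding volterra_infinity_col_def by blast+
  have aie: "(\<lambda>r. ?I t r $ i $ a) absolutely_integrable_on {t..}" if "t \<ge> 0" for t i
    using absolutely_integrable_linear[OF ai[OF that] bounded_linear_vec_nth[of i]] by (simp add: o_def column_def)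
  have eqe: "T t k $ i $ a = (mat 1 :: cmat) $ i $ a - integral {t..} (\<lambda>r. ?I t r $ i $ a)" if t: "t \<ge> 0" for t i
  proof -
    have "integral {t..} (\<lambda>r. ?I t r $ i $ a) = integral {t..} (\<lambda>r. column a (?I t r)) $ i"
      using integral_linear[OF set_lebesgue_integral_eq_integral(1)[OF ai[OF t]] bounded_linear_vec_nth[of i]] by (simp add: o_def column_def)
    then show ?thesis using arg_cong[OF eq[OF t], of "\<lambda>x. x $ i"] by (simp add: column_def)
  qed
  have m1: "(mat 1 :: cmat) $ a $ a = 1" "(mat 1 :: cmat) $ b $ a = 0" using ab by (auto simp: side_def)
  note slow = volterra_backward[OF aie[of _ a, unfolded integrand_entries(1)[OF ab]] eqe[of _ a, unfolded integrand_entries(1)[OF ab]]]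
  note fast = volterra_backward[OF aie[of _ b, unfolded integrand_entries(2)[OF ab]] eqe[of _ b, unfolded integrand_entries(2)[OF ab]]]
  show us: "usys \<epsilon> k (\<lambda>t. T t k $ a $ a) (\<lambda>t. T t k $ b $ a)"
    by (rule usysI; rule slow(1) fast(1)) (simp_all add: m1)
  show "((\<lambda>t. T t k $ a $ a) \<longlongrightarrow> 1) at_top" using slow(2) by (simp add: m1)
  have "\<exists>M. \<forall>t\<ge>0. norm (T t k $ a $ a) \<le> M" using slow(3) by (simp add: m1)
  then obtain M where M: "\<And>t. t \<ge> 0 \<Longrightarrow> norm (T t k $ a $ a) \<le> M" by blast
  have fl: "((\<lambda>t. exp (- phase \<epsilon> k * of_real t) * T t k $ b $ a) \<longlongrightarrow> 0) at_top" using fast(2) by (simp add: m1)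
  define W where "W t = (1 + 1 / norm k) * v2 t" for t
  have n\<epsilon>: "norm \<epsilon> = 1" using ab by (rule side_norm)
  have v: "norm (q t) + norm (s t) + norm (c t) + 2 * norm (p t) = v2 t" for t by (simp add: v2_def v_def)
  have Wb: "x + y / norm k \<le> W t" if "x \<le> v2 t" "y \<le> v2 t" for x y t
    using divide_right_mono[OF that(2), of "norm k"] that(1) by (simp add: W_def distrib_right)
  show "((\<lambda>t. T t k $ b $ a) \<longlongrightarrow> 0) at_top"
  proof (rule fast_tendsto_zero[OF us[unfolded usys_def] _ _ _ _ _ _ re M fl])
    show "continuous_on {0..} W" "W integrable_on {0..}"
      unfolding W_def[abs_def] by (intro continuous_intros v2_cont integrable_on_mult_right v2_integrable)+
    show "continuous_on {0..} (\<lambda>t. \<epsilon> * (q t + 2 * p t) / 4 - \<i> * s t / (4 * k))" "continuous_on {0..} (\<lambda>t. \<epsilon> * \<i> * c t / (4 * k))"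
      using k by (auto intro!: continuous_intros cq cs cc cp)
    fix t :: real
    have tri: "norm (q t + 2 * p t) \<le> norm (q t) + 2 * norm (p t)" using norm_triangle_ineq[of "q t" "2 * p t"] by (simp add: norm_mult)
    have "norm (\<epsilon> * (q t + 2 * p t) / 4 - \<i> * s t / (4 * k)) \<le> norm (\<epsilon> * (q t + 2 * p t) / 4) + norm (\<i> * s t / (4 * k))"
      by (rule norm_triangle_ineq4)
    also have "\<dots> = norm (q t + 2 * p t) / 4 + (norm (s t) / 4) / norm k" by (simp add: norm_mult norm_divide n\<epsilon>)
    also have "\<dots> \<le> W t"
      using tri v[of t] norm_ge_zero[of "q t"] norm_ge_zero[of "p t"] norm_ge_zero[of "c t"] norm_ge_zero[of "s t"]
      by (intro Wb) linarith+
    finally show "norm (\<epsilon> * (q t + 2 * p t) / 4 - \<i> * s t / (4 * k)) \<le> W t" .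
    have "norm (\<epsilon> * \<i> * c t / (4 * k)) = 0 + (norm (c t) / 4) / norm k" by (simp add: norm_mult norm_divide n\<epsilon>)
    also have "\<dots> \<le> W t"
      using v[of t] norm_ge_zero[of "q t"] norm_ge_zero[of "p t"] norm_ge_zero[of "c t"] norm_ge_zero[of "s t"]
      by (intro Wb) linarith+
    finally show "norm (\<epsilon> * \<i> * c t / (4 * k)) \<le> W t" .
  qed
qed

lemma Vhat_side:
  assumes "side \<epsilon> a b"
  shows "Vhat0 g0t g1 t $ 1 $ 1 = 0" "Vhat0 g0t g1 t $ 2 $ 2 = 0"
    "Vhat0 g0t g1 t $ b $ a = \<epsilon> * q t / 4" "Vhat0 g0t g1 t $ a $ b = - \<epsilon> * q t / 4"
    "Vhat1 g0 t $ 1 $ 2 = \<i> * s t / 4" "Vhat1 g0 t $ 2 $ 1 = \<i> * s t / 4"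
    "Vhat1 g0 t $ a $ a = - \<epsilon> * \<i> * c t / 4" "Vhat1 g0 t $ b $ b = \<epsilon> * \<i> * c t / 4"
proof -
  have i: "\<i> * x * \<i> = - x" for x :: complex
  proof -
    have "\<i> * x * \<i> = (\<i> * \<i>) * x" by (simp only: mult_ac)
    then show ?thesis by simp
  qed
  show "Vhat0 g0t g1 t $ 1 $ 1 = 0" "Vhat0 g0t g1 t $ 2 $ 2 = 0"
    "Vhat0 g0t g1 t $ b $ a = \<epsilon> * q t / 4" "Vhat0 g0t g1 t $ a $ b = - \<epsilon> * q t / 4"
    "Vhat1 g0 t $ 1 $ 2 = \<i> * s t / 4" "Vhat1 g0 t $ 2 $ 1 = \<i> * s t / 4"
    "Vhat1 g0 t $ a $ a = - \<epsilon> * \<i> * c t / 4" "Vhat1 g0 t $ b $ b = \<epsilon> * \<i> * c t / 4"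
    using assms by (auto simp: side_def Vhat0_def Vhat1_def q_eq s_sin c_cos i)
qed

lemma trunc_slow:
  assumes rec: "formal_recursion off_part diag_part (Vhat0 g0t g1) (Vhat1 g0) m X" and X0: "\<And>t. t \<ge> 0 \<Longrightarrow> X 0 t = mat 1"
    and ab: "side \<epsilon> a b"
  shows "trunc \<epsilon> (\<lambda>j t. X j t $ a $ a) (\<lambda>j t. X j t $ b $ a)"
proof -
  have P: "off_part A $ b $ a = A $ b $ a" "off_part A $ a $ a = 0" "diag_part A $ a $ a = A $ a $ a" "diag_part A $ b $ a = 0" for A
    using ab by (auto simp: side_def)
  note R = formal_recursion_entries[OF rec ab, of a, OF P Vhat_side[OF ab]]
  show ?thesis unfolding trunc_def
    by (rule truncated_solution[where ?c0.0 = 1, OF wq ws wc side_square[OF ab] _ _ R(1) R(2) R(3)])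
      (use ab in \<open>auto simp: X0 side_def\<close>)
qed

text \<open>The coefficients W begin with 0, and the diagonal entries play the part of the fast component. Hence column
  b, and not a, carries the sign \<open>\<epsilon>\<close>.\<close>

lemma trunc_fast:
  assumes rec: "formal_recursion diag_part off_part (Vhat0 g0t g1) (Vhat1 g0) m X" and X0: "\<And>t. t \<ge> 0 \<Longrightarrow> X 0 t = 0"
    and ab: "side \<epsilon> a b"
  shows "trunc \<epsilon> (\<lambda>j t. X j t $ a $ b) (\<lambda>j t. X j t $ b $ b)"
proof -
  have P: "diag_part A $ b $ b = A $ b $ b" "diag_part A $ a $ b = 0" "off_part A $ a $ b = A $ a $ b" "off_part A $ b $ b = 0" for A
    using ab by (auto simp: side_def)
  note R = formal_recursion_entries[OF rec ab, of b, OF P Vhat_side[OF ab]]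
  show ?thesis unfolding trunc_def
    by (rule truncated_solution[where ?c0.0 = 0, OF wq ws wc side_square[OF ab] _ _ R(1) R(2) R(3)])
      (use ab in \<open>auto simp: X0 side_def\<close>)
qed

lemma psum_split: "psum x k t = x 0 t + (\<Sum>j=1..m+1. k ^ j * x j t)"
proof -
  have "{..Suc m} = insert 0 {1..m+1}" by auto
  then show ?thesis by simp
qed

lemma That_entry:
  assumes "X 0 t = mat 1"
  shows "That_p m X t k $ i $ l = psum (\<lambda>j t. X j t $ i $ l) k t"
proof -
  have "That_p m X t k $ i $ l = (mat 1 :: cmat) $ i $ l + (\<Sum>j=1..m+1. k ^ j * X j t $ i $ l)"
    by (simp add: That_p_def)
  also have "\<dots> = psum (\<lambda>j t. X j t $ i $ l) k t"
    using psum_split[where x = "\<lambda>j t. X j t $ i $ l" and k = k and t = t] by (simp only: assms)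
  finally show ?thesis .
qed

lemma G0_side:
  assumes "side \<epsilon> a b"
  shows "G0 N g0 t $ a $ a = \<sigma> * C t" "G0 N g0 t $ a $ b = - \<epsilon> * \<sigma> * S t"
    "G0 N g0 t $ b $ a = \<epsilon> * \<sigma> * S t" "G0 N g0 t $ b $ b = \<sigma> * C t"
  using assms by (auto simp: side_def G0_def \<sigma>_eq C_cos S_sin)

lemma G0_inverse:
  "matrix_inv (G0 N g0 t) = \<sigma> *\<^sub>M mat2 (C t) (S t) (- S t) (C t)"
proof -
  let ?A = "G0 N g0 t" and ?B = "\<sigma> *\<^sub>M mat2 (C t) (S t) (- S t) (C t)"
  have G: "G0 N g0 t = \<sigma> *\<^sub>M mat2 (C t) (- S t) (S t) (C t)" by (simp add: G0_def \<sigma>_eq C_cos S_sin)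
  have e: "\<sigma> * C t * (\<sigma> * C t) + \<sigma> * S t * (\<sigma> * S t) = 1"
  proof -
    have "\<sigma> * C t * (\<sigma> * C t) + \<sigma> * S t * (\<sigma> * S t) = (\<sigma> * \<sigma>) * (C t * C t + S t * S t)" by (simp add: algebra_simps)
    then show ?thesis by (simp add: \<sigma>2 CS)
  qed
  have AB: "?A ** ?B = mat 1" and BA: "?B ** ?A = mat 1"
    unfolding G by (simp_all add: vec_eq_iff forall_2 mmult_entry e) (use e in \<open>simp_all add: algebra_simps\<close>)
  have "?A ** matrix_inv ?A = mat 1 \<and> matrix_inv ?A ** ?A = mat 1"
    unfolding matrix_inv_def by (rule someI[of _ ?B]) (simp add: AB BA)
  then have "matrix_inv ?A = (?B ** ?A) ** matrix_inv ?A" by (simp add: BA)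
  also have "\<dots> = ?B ** (?A ** matrix_inv ?A)" by (simp add: matrix_mul_assoc)
  finally show ?thesis using \<open>?A ** matrix_inv ?A = mat 1 \<and> _\<close> by simp
qed

text \<open>Conjugation by the exponential multiplies the off-diagonal entry of the constant matrix by the phase factor.
  This recombines the two columns of the series into a part without and a part with the phase.\<close>

lemma U_approx_side:
  fixes Zh Wh :: "nat \<Rightarrow> real \<Rightarrow> cmat" and k :: complex and t :: real
  assumes ab: "side \<epsilon> a b" and Z0: "Zh 0 t = mat 1" and W0: "Wh 0 t = 0"
  defines "\<alpha> \<equiv> \<sigma> * C 0" and "\<beta> \<equiv> - \<epsilon> * \<sigma> * S 0"
  defines "Z \<equiv> \<lambda>i l. psum (\<lambda>j t. Zh j t $ i $ l) k t" and "W \<equiv> \<lambda>i l. psum (\<lambda>j t. Wh j t $ i $ l) k t"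
  defines "X \<equiv> \<lambda>i. (\<alpha> * Z i a + \<beta> * W i b) + exp (phase \<epsilon> k * of_real t) * (\<alpha> * W i a + \<beta> * Z i b)"
  shows "U_approx N g0 m Zh Wh t k $ a $ a = \<sigma> * (C t * X a - \<epsilon> * S t * X b)"
    "U_approx N g0 m Zh Wh t k $ b $ a = \<sigma> * (\<epsilon> * S t * X a + C t * X b)"
proof -
  define ex where "ex = exp (phase \<epsilon> k * of_real t)"
  define M where "M = exp_ad_sigma3 (- \<i> * theta2 k * of_real t) (matrix_inv (G0 N g0 0))"
  have mm: "(A ** B) $ i $ l = A $ i $ a * B $ a $ l + A $ i $ b * B $ b $ l" for A B :: cmat and i l
    using ab by (auto simp: side_def mmult_entry)
  have M: "M $ a $ a = \<alpha>" "M $ b $ a = ex * \<beta>"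
    using ab unfolding M_def G0_inverse \<alpha>_def \<beta>_def ex_def
    by (auto simp: side_def exp_ad_sigma3_entries phase_def mult_ac)
  let ?e = "exp_sigma3 (2 * \<i> * theta2 k * of_real t)"
  have e: "?e $ a $ a = ex" "?e $ b $ b = 1 / ex" "?e $ a $ b = 0" "?e $ b $ a = 0"
    using ab unfolding ex_def by (auto simp: side_def phase_def exp_minus divide_inverse)
  define ZZ where "ZZ = mat 1 + (\<Sum>j=1..m+1. (k ^ j) *\<^sub>M Zh j t)"
  define WW where "WW = (\<Sum>j=1..m+1. (k ^ j) *\<^sub>M Wh j t)"
  have Zs: "ZZ $ i $ l = Z i l" for i l
    using That_entry[where X = Zh, OF Z0, of k i l] by (simp only: That_p_def Z_def ZZ_def)
  have Ws: "WW $ i $ l = W i l" for i l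
    using psum_split[where x = "\<lambda>j t. Wh j t $ i $ l" and k = k and t = t]
    by (simp only: W_def WW_def sum_component smat_entry W0 zero_index add_0_left)
  have Uhat: "Uhat_p m Zh Wh t k = ZZ + WW ** ?e" by (simp only: Uhat_p_def ZZ_def WW_def)
  have Uh: "Uhat_p m Zh Wh t k $ i $ a = Z i a + ex * W i a" "Uhat_p m Zh Wh t k $ i $ b = Z i b + W i b / ex" for i
    unfolding Uhat by (simp_all add: mm Zs Ws e)
  have ex: "ex \<noteq> 0" by (simp add: ex_def)
  have X: "(Uhat_p m Zh Wh t k ** M) $ i $ a = X i" for i
    unfolding mm Uh M X_def ex_def[symmetric] using ex by (simp add: field_simps)
  have U: "U_approx N g0 m Zh Wh t k = G0 N g0 t ** (Uhat_p m Zh Wh t k ** M)"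
    unfolding U_approx_def M_def by (simp add: matrix_mul_assoc)
  show "U_approx N g0 m Zh Wh t k $ a $ a = \<sigma> * (C t * X a - \<epsilon> * S t * X b)"
    "U_approx N g0 m Zh Wh t k $ b $ a = \<sigma> * (\<epsilon> * S t * X a + C t * X b)"
    unfolding U mm[of "G0 N g0 t"] X G0_side[OF ab] by (simp_all add: algebra_simps)
qed

text \<open>The gauge matrix does not depend on k and its entries are bounded by 1, so estimates for the gauged
  components carry over to the column.\<close>

lemma rotated_column:
  assumes ab: "side \<epsilon> a b" and D: "open D"
    and f: "scal_deriv_le j D Fu b'" "scal_deriv_le j D Fw b'"
    and M: "\<And>k. M k $ a $ a = \<sigma> * (C t * Fu k - \<epsilon> * S t * Fw k)" "\<And>k. M k $ b $ a = \<sigma> * (\<epsilon> * S t * Fu k + C t * Fw k)"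
  shows "col_deriv_le j D (\<lambda>k. column a (M k)) (\<lambda>k. 4 * b' k)"
proof -
  have nn: "norm (\<sigma> * C t) \<le> 1" "norm (- \<sigma> * \<epsilon> * S t) \<le> 1" "norm (\<sigma> * \<epsilon> * S t) \<le> 1"
    using C1[of t] S1[of t] by (simp_all add: norm_mult \<sigma>1 side_norm[OF ab])
  obtain g :: "complex \<Rightarrow> complex" where "\<And>k. k \<in> closure D - {0} \<Longrightarrow> norm (g k) \<le> b' k" using f(1) unfolding scal_deriv_le_def by blast
  then have b0: "b' k \<ge> 0" if "k \<in> closure D - {0}" for k using that norm_ge_zero order_trans by blast
  have 2: "norm x * b' k + norm y * b' k \<le> 2 * b' k" if "norm x \<le> 1" "norm y \<le> 1" "k \<in> closure D - {0}" for x y :: complex and k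
    using add_mono[OF mult_right_mono[OF that(1) b0[OF that(3)]] mult_right_mono[OF that(2) b0[OF that(3)]]] by simp
  have 1: "scal_deriv_le j D (\<lambda>k. column a (M k) $ a) (\<lambda>k. 2 * b' k)"
    using scal_deriv_le_mono[OF scal_deriv_le_lincomb[OF f D, of "\<sigma> * C t" "- \<sigma> * \<epsilon> * S t"] 2[OF nn(1,2)]]
    by (simp add: column_def M algebra_simps)
  have 3: "scal_deriv_le j D (\<lambda>k. column a (M k) $ b) (\<lambda>k. 2 * b' k)"
    using scal_deriv_le_mono[OF scal_deriv_le_lincomb[OF f D, of "\<sigma> * \<epsilon> * S t" "\<sigma> * C t"] 2[OF nn(3,1)]]
    by (simp add: column_def M algebra_simps)
  show ?thesis by (rule col_deriv_leI[OF ab 1 3]) simp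
qed

lemma U_column_error:
  assumes U: "is_U Vm U" and ZW: "U_coeffs (Vhat0 g0t g1) (Vhat1 g0) m Zh Wh" and ab: "side \<epsilon> a b"
  defines "R \<equiv> \<lambda>t k. U t k - U_approx N g0 m Zh Wh t k"
  shows "\<exists>K\<ge>0. \<forall>j\<le>n. \<forall>t\<ge>0. \<forall>D. open D \<longrightarrow> 0 \<notin> D \<longrightarrow> (\<forall>k\<in>closure D - {0}. norm k \<le> 1) \<longrightarrow>
      ((\<forall>k\<in>closure D - {0}. Re (phase \<epsilon> k) \<le> 0) \<longrightarrow>
         col_deriv_le j D (\<lambda>k. column a (R t k)) (\<lambda>k. K * ((1 + t) ^ j * norm k ^ Suc m / norm k ^ (2 * j)))) \<and>
      ((\<forall>k\<in>closure D - {0}. Re (phase \<epsilon> k) \<ge> 0) \<longrightarrow>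
         col_deriv_le j D (\<lambda>k. column a (R t k ** exp_sigma3 (- 2 * \<i> * theta2 k * of_real t))) (\<lambda>k. K * ((1 + t) ^ j * norm k ^ Suc m / norm k ^ (2 * j))))"
proof -
  have Z0: "Zh 0 t = mat 1" and W0: "Wh 0 t = 0" if "t \<ge> 0" for t using ZW that unfolding U_coeffs_def by blast+
  have rZ: "formal_recursion off_part diag_part (Vhat0 g0t g1) (Vhat1 g0) m Zh"
    and rW: "formal_recursion diag_part off_part (Vhat0 g0t g1) (Vhat1 g0) m Wh"
    using ZW unfolding U_coeffs_def by blast+
  have ZW0: "Zh j 0 + Wh j 0 = 0" if "j \<in> {1..m+1}" for j using ZW that unfolding U_coeffs_def by blast
  have init: "psum (\<lambda>j t. Zh j t $ i $ l) k 0 + psum (\<lambda>j t. Wh j t $ i $ l) k 0 = (mat 1 :: cmat) $ i $ l" for i l k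
  proof -
    have z: "Zh j 0 $ i $ l + Wh j 0 $ i $ l = (if j = 0 then (mat 1 :: cmat) $ i $ l else 0)" if "j \<le> Suc m" for j
      using arg_cong[OF ZW0[of j], of "\<lambda>A. A $ i $ l"] that by (cases "j = 0") (simp_all add: Z0 W0)
    have "psum (\<lambda>j t. Zh j t $ i $ l) k 0 + psum (\<lambda>j t. Wh j t $ i $ l) k 0 = (\<Sum>j\<le>Suc m. k ^ j * (Zh j 0 $ i $ l + Wh j 0 $ i $ l))"
      unfolding distrib_left sum.distrib ..
    also have "\<dots> = (\<Sum>j\<le>Suc m. if j = 0 then (mat 1 :: cmat) $ i $ l else 0)"
      by (rule sum.cong) (auto simp: z)
    also have "\<dots> = (mat 1 :: cmat) $ i $ l" by (simp only: sum.delta finite_atMost) simp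
    finally show ?thesis .
  qed
  have m1: "(mat 1 :: cmat) $ a $ a = 1" "(mat 1 :: cmat) $ b $ a = 0" "(mat 1 :: cmat) $ a $ b = 0" "(mat 1 :: cmat) $ b $ b = 1"
    using ab by (auto simp: side_def)
  define \<alpha> where "\<alpha> = \<sigma> * C 0"
  define \<beta> where "\<beta> = - \<epsilon> * \<sigma> * S 0"
  define z where "z i l k t = psum (\<lambda>j t. Zh j t $ i $ l) k t" for i l k t
  define w where "w i l k t = psum (\<lambda>j t. Wh j t $ i $ l) k t" for i l k t
  define X where "X i k t = (\<alpha> * z i a k t + \<beta> * w i b k t) + exp (phase \<epsilon> k * of_real t) * (\<alpha> * w i a k t + \<beta> * z i b k t)" for i k t
  define Yu where "Yu k t = gu \<epsilon> (\<lambda>t. U t k $ a $ a) (\<lambda>t. U t k $ b $ a) t - X a k t" for k t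
  define Yw where "Yw k t = gw \<epsilon> (\<lambda>t. U t k $ a $ a) (\<lambda>t. U t k $ b $ a) t - X b k t" for k t
  have Yu': "Yu k t = gu \<epsilon> (\<lambda>t. U t k $ a $ a) (\<lambda>t. U t k $ b $ a) t - (\<sigma> * C 0 * z a a k t + (- \<epsilon> * \<sigma> * S 0) * w a b k t)
      - exp (phase \<epsilon> k * of_real t) * (\<sigma> * C 0 * w a a k t + (- \<epsilon> * \<sigma> * S 0) * z a b k t)" for k t
    by (simp add: Yu_def X_def \<alpha>_def \<beta>_def)
  have Yw': "Yw k t = gw \<epsilon> (\<lambda>t. U t k $ a $ a) (\<lambda>t. U t k $ b $ a) t - (\<sigma> * C 0 * z b a k t + (- \<epsilon> * \<sigma> * S 0) * w b b k t)
      - exp (phase \<epsilon> k * of_real t) * (\<sigma> * C 0 * w b a k t + (- \<epsilon> * \<sigma> * S 0) * z b b k t)" for k t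
    by (simp add: Yw_def X_def \<alpha>_def \<beta>_def)
  note err = U_error[OF side_square[OF ab] side_norm[OF ab] U_column[OF U ab]
      trunc_slow[OF rZ Z0 ab] trunc_fast[OF rW W0 ab] trunc_slow[OF rZ Z0 side_swap[OF ab]] trunc_fast[OF rW W0 side_swap[OF ab]],
      folded z_def w_def, folded Yu' Yw']
  have in0: "z a a k 0 + w a a k 0 = 1" "w a b k 0 + z a b k 0 = 0" "z b a k 0 + w b a k 0 = 0" "w b b k 0 + z b b k 0 = 1" for k
    using init[where i = a and l = a and k = k] init[where i = a and l = b and k = k] init[where i = b and l = a and k = k] init[where i = b and l = b and k = k]
    unfolding z_def w_def m1 by (simp_all add: add.commute)
  note err = err[OF _ _ _ _ _ _ _ in0]
  have hol: "(\<lambda>k. Yu k t) holomorphic_on - {0}" "(\<lambda>k. Yw k t) holomorphic_on - {0}" if t: "t \<ge> 0" for t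
    by (rule err(1,2)[OF _ _ _ _ _ _ _ t]; assumption)+
  have K: "\<exists>K\<ge>0. \<forall>j\<le>n. \<forall>t\<ge>0. \<forall>k. k \<noteq> 0 \<longrightarrow> norm k \<le> 1 \<longrightarrow>
      (Re (phase \<epsilon> k) \<le> 0 \<longrightarrow> norm ((deriv ^^ j) (\<lambda>k. Yu k t) k) \<le> K * ((1 + t) ^ j * norm k ^ Suc m / norm k ^ (2 * j)) \<and>
         norm ((deriv ^^ j) (\<lambda>k. Yw k t) k) \<le> K * ((1 + t) ^ j * norm k ^ Suc m / norm k ^ (2 * j))) \<and>
      (Re (phase \<epsilon> k) \<ge> 0 \<longrightarrow> norm ((deriv ^^ j) (\<lambda>k. exp (- phase \<epsilon> k * of_real t) * Yu k t) k) \<le> K * ((1 + t) ^ j * norm k ^ Suc m / norm k ^ (2 * j)) \<and>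
         norm ((deriv ^^ j) (\<lambda>k. exp (- phase \<epsilon> k * of_real t) * Yw k t) k) \<le> K * ((1 + t) ^ j * norm k ^ Suc m / norm k ^ (2 * j)))"
    by (rule err(3); assumption)
  then obtain K where K0: "K \<ge> 0" and K: "\<And>j t k. j \<le> n \<Longrightarrow> t \<ge> 0 \<Longrightarrow> k \<noteq> 0 \<Longrightarrow> norm k \<le> 1 \<Longrightarrow>
      (Re (phase \<epsilon> k) \<le> 0 \<longrightarrow> norm ((deriv ^^ j) (\<lambda>k. Yu k t) k) \<le> K * ((1 + t) ^ j * norm k ^ Suc m / norm k ^ (2 * j)) \<and>
         norm ((deriv ^^ j) (\<lambda>k. Yw k t) k) \<le> K * ((1 + t) ^ j * norm k ^ Suc m / norm k ^ (2 * j))) \<and>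
      (Re (phase \<epsilon> k) \<ge> 0 \<longrightarrow> norm ((deriv ^^ j) (\<lambda>k. exp (- phase \<epsilon> k * of_real t) * Yu k t) k) \<le> K * ((1 + t) ^ j * norm k ^ Suc m / norm k ^ (2 * j)) \<and>
         norm ((deriv ^^ j) (\<lambda>k. exp (- phase \<epsilon> k * of_real t) * Yw k t) k) \<le> K * ((1 + t) ^ j * norm k ^ Suc m / norm k ^ (2 * j)))"
    by blast
  have RA: "R t k $ a $ a = \<sigma> * (C t * Yu k t - \<epsilon> * S t * Yw k t)" if t: "t \<ge> 0" for t k
  proof -
    have "U_approx N g0 m Zh Wh t k $ a $ a = \<sigma> * (C t * X a k t - \<epsilon> * S t * X b k t)"
      unfolding X_def z_def w_def \<alpha>_def \<beta>_def by (rule U_approx_side(1)[where Zh = Zh and Wh = Wh, OF ab Z0[OF t] W0[OF t]])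
    then have "R t k $ a $ a = U t k $ a $ a - \<sigma> * (C t * X a k t - \<epsilon> * S t * X b k t)" by (simp add: R_def)
    also have "U t k $ a $ a = \<sigma> * (C t * gu \<epsilon> (\<lambda>t. U t k $ a $ a) (\<lambda>t. U t k $ b $ a) t - \<epsilon> * S t * gw \<epsilon> (\<lambda>t. U t k $ a $ a) (\<lambda>t. U t k $ b $ a) t)"
      by (rule ungauge(1)[OF side_square[OF ab], where u = "\<lambda>t. U t k $ a $ a"])
    finally show ?thesis by (simp add: Yu_def Yw_def algebra_simps)
  qed
  have RB: "R t k $ b $ a = \<sigma> * (\<epsilon> * S t * Yu k t + C t * Yw k t)" if t: "t \<ge> 0" for t k
  proof -
    have "U_approx N g0 m Zh Wh t k $ b $ a = \<sigma> * (\<epsilon> * S t * X a k t + C t * X b k t)"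
      unfolding X_def z_def w_def \<alpha>_def \<beta>_def by (rule U_approx_side(2)[where Zh = Zh and Wh = Wh, OF ab Z0[OF t] W0[OF t]])
    then have "R t k $ b $ a = U t k $ b $ a - \<sigma> * (\<epsilon> * S t * X a k t + C t * X b k t)" by (simp add: R_def)
    also have "U t k $ b $ a = \<sigma> * (\<epsilon> * S t * gu \<epsilon> (\<lambda>t. U t k $ a $ a) (\<lambda>t. U t k $ b $ a) t + C t * gw \<epsilon> (\<lambda>t. U t k $ a $ a) (\<lambda>t. U t k $ b $ a) t)"
      by (rule ungauge(2)[OF side_square[OF ab], where w = "\<lambda>t. U t k $ b $ a"])
    finally show ?thesis by (simp add: Yu_def Yw_def algebra_simps)
  qed
  have RE: "(R t k ** exp_sigma3 (- 2 * \<i> * theta2 k * of_real t)) $ i $ a = exp (- phase \<epsilon> k * of_real t) * R t k $ i $ a" for t k i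
    using ab by (auto simp: side_def mmult_entry phase_def)
  have hole: "(\<lambda>k. exp (- phase \<epsilon> k * of_real t) * f k) holomorphic_on - {0}" if "f holomorphic_on - {0}" for f t
    by (intro holomorphic_intros that holomorphic_on_compose_gen[OF _ holomorphic_on_exp, unfolded o_def] phase_holomorphic; auto)
  show ?thesis
  proof (intro exI[of _ "4 * K"] conjI allI impI)
    show "0 \<le> 4 * K" using K0 by simp
    fix j and t :: real and D :: "complex set" assume j: "j \<le> n" and t: "(t::real) \<ge> 0" and D: "open D" "0 \<notin> D" and D1: "\<forall>k\<in>closure D - {0}. norm k \<le> 1"
    let ?b = "\<lambda>k. K * ((1 + t) ^ j * norm k ^ Suc m / norm k ^ (2 * j))"
    {
      assume re: "\<forall>k\<in>closure D - {0}. Re (phase \<epsilon> k) \<le> 0"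
      have "scal_deriv_le j D (\<lambda>k. Yu k t) ?b" "scal_deriv_le j D (\<lambda>k. Yw k t) ?b"
        by (rule scal_deriv_le_holomorphic[OF hol(1)[OF t] D(2)], use K[OF j t] D1 re in blast)
          (rule scal_deriv_le_holomorphic[OF hol(2)[OF t] D(2)], use K[OF j t] D1 re in blast)
      from rotated_column[OF ab D(1) this RA[OF t] RB[OF t]]
      show "col_deriv_le j D (\<lambda>k. column a (R t k)) (\<lambda>k. 4 * K * ((1 + t) ^ j * norm k ^ Suc m / norm k ^ (2 * j)))"
        by (simp only: mult.assoc)
    next
      assume re: "\<forall>k\<in>closure D - {0}. Re (phase \<epsilon> k) \<ge> 0"
      have f: "scal_deriv_le j D (\<lambda>k. exp (- phase \<epsilon> k * of_real t) * Yu k t) ?b" "scal_deriv_le j D (\<lambda>k. exp (- phase \<epsilon> k * of_real t) * Yw k t) ?b"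
        by (rule scal_deriv_le_holomorphic[OF hole[OF hol(1)[OF t]] D(2)], use K[OF j t] D1 re in blast)
          (rule scal_deriv_le_holomorphic[OF hole[OF hol(2)[OF t]] D(2)], use K[OF j t] D1 re in blast)
      have "col_deriv_le j D (\<lambda>k. column a (R t k ** exp_sigma3 (- 2 * \<i> * theta2 k * of_real t))) (\<lambda>k. 4 * ?b k)"
        by (rule rotated_column[where t = t, OF ab D(1) f]; unfold RE RA[OF t] RB[OF t]) (simp_all add: algebra_simps)
      then show "col_deriv_le j D (\<lambda>k. column a (R t k ** exp_sigma3 (- 2 * \<i> * theta2 k * of_real t))) (\<lambda>k. 4 * K * ((1 + t) ^ j * norm k ^ Suc m / norm k ^ (2 * j)))"
        by (simp only: mult.assoc)
    }
  qed
qed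

lemma T_column_error:
  assumes U: "is_U Vm U" and ab: "side \<epsilon> a b"
    and T: "\<And>k. k \<noteq> 0 \<Longrightarrow> norm k \<le> 1 \<Longrightarrow> Re (phase \<epsilon> k) \<ge> 0 \<Longrightarrow> volterra_infinity_col Vm T a k"
    and Th: "T_coeffs (Vhat0 g0t g1) (Vhat1 g0) m Th"
    and Clim: "((\<lambda>t. \<sigma> * C t) \<longlongrightarrow> 1) at_top" and Slim: "(S \<longlongrightarrow> 0) at_top"
  shows "\<exists>K\<ge>0. \<forall>j\<le>n. \<forall>t\<ge>0. \<forall>D. open D \<longrightarrow> 0 \<notin> D \<longrightarrow> (\<forall>k\<in>closure D - {0}. norm k \<le> 1 \<and> Re (phase \<epsilon> k) \<ge> 0) \<longrightarrow>
      col_deriv_le j D (\<lambda>k. column a (T t k - G0 N g0 t ** That_p m Th t k)) (\<lambda>k. K * (norm k ^ Suc m / norm k ^ (2 * j) / (1 + t) ^ (n - j)))"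
proof -
  have T0: "Th 0 t = mat 1" if "t \<ge> 0" for t using Th that unfolding T_coeffs_def by blast
  have rT: "formal_recursion off_part diag_part (Vhat0 g0t g1) (Vhat1 g0) m Th" using Th unfolding T_coeffs_def by blast
  have Tl: "(Th j \<longlongrightarrow> 0) at_top" if "j \<in> {1..m+1}" for j using Th that unfolding T_coeffs_def by blast
  define z where "z i k t = psum (\<lambda>j t. Th j t $ i $ a) k t" for i k t
  have zlim: "(z i k \<longlongrightarrow> (mat 1 :: cmat) $ i $ a) at_top" for i k
  proof (rule Lim_transform_eventually)
    have "((\<lambda>t. (mat 1 :: cmat) $ i $ a + (\<Sum>j=1..m+1. k ^ j * Th j t $ i $ a)) \<longlongrightarrow> (mat 1 :: cmat) $ i $ a + (\<Sum>j=1..m+1. k ^ j * (0 :: cmat) $ i $ a)) at_top"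
      by (intro tendsto_intros tendsto_vec_nth Tl)
    moreover have "(\<Sum>j=1..m+1. k ^ j * (0 :: cmat) $ i $ a) = 0" by (intro sum.neutral) simp
    ultimately show "((\<lambda>t. (mat 1 :: cmat) $ i $ a + (\<Sum>j=1..m+1. k ^ j * Th j t $ i $ a)) \<longlongrightarrow> (mat 1 :: cmat) $ i $ a) at_top" by (simp only: add_0_right)
    show "\<forall>\<^sub>F t in at_top. (mat 1 :: cmat) $ i $ a + (\<Sum>j=1..m+1. k ^ j * Th j t $ i $ a) = z i k t"
      using eventually_ge_at_top[of 0]
    proof eventually_elim
      case (elim t)
      show ?case using psum_split[where x = "\<lambda>j t. Th j t $ i $ a" and k = k and t = t] by (simp only: z_def T0[OF elim])
    qed
  qed
  have m1: "(mat 1 :: cmat) $ a $ a = 1" "(mat 1 :: cmat) $ b $ a = 0" using ab by (auto simp: side_def)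
  define Yu where "Yu k t = gu \<epsilon> (\<lambda>t. T t k $ a $ a) (\<lambda>t. T t k $ b $ a) t - z a k t" for k t
  define Yw where "Yw k t = gw \<epsilon> (\<lambda>t. T t k $ a $ a) (\<lambda>t. T t k $ b $ a) t - z b k t" for k t
  have "\<exists>K\<ge>0. \<forall>j\<le>n. \<forall>t\<ge>0. \<forall>D. open D \<longrightarrow> 0 \<notin> D \<longrightarrow> (\<forall>k\<in>closure D - {0}. norm k \<le> 1 \<and> Re (phase \<epsilon> k) \<ge> 0) \<longrightarrow>
     scal_deriv_le j D (\<lambda>k. Yu k t) (\<lambda>k. K * (norm k ^ Suc m / norm k ^ (2 * j) / (1 + t) ^ (n - j))) \<and>
     scal_deriv_le j D (\<lambda>k. Yw k t) (\<lambda>k. K * (norm k ^ Suc m / norm k ^ (2 * j) / (1 + t) ^ (n - j)))"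
    unfolding Yu_def Yw_def z_def
  proof (rule T_error[OF side_square[OF ab] side_norm[OF ab] U_column[OF U ab] U_column[OF U side_swap[OF ab]] trunc_slow[OF rT T0 ab] T_column[OF T ab] Clim Slim])
    show "((\<lambda>t. psum (\<lambda>j t. Th j t $ a $ a) k t) \<longlongrightarrow> 1) at_top" "((\<lambda>t. psum (\<lambda>j t. Th j t $ b $ a) k t) \<longlongrightarrow> 0) at_top" for k
      using zlim[of a k] zlim[of b k] by (simp_all only: z_def[abs_def] m1)
  qed
  then obtain K where K0: "K \<ge> 0" and K: "\<forall>j\<le>n. \<forall>t\<ge>0. \<forall>D. open D \<longrightarrow> 0 \<notin> D \<longrightarrow> (\<forall>k\<in>closure D - {0}. norm k \<le> 1 \<and> Re (phase \<epsilon> k) \<ge> 0) \<longrightarrow>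
     scal_deriv_le j D (\<lambda>k. Yu k t) (\<lambda>k. K * (norm k ^ Suc m / norm k ^ (2 * j) / (1 + t) ^ (n - j))) \<and>
     scal_deriv_le j D (\<lambda>k. Yw k t) (\<lambda>k. K * (norm k ^ Suc m / norm k ^ (2 * j) / (1 + t) ^ (n - j)))"
    by (elim exE conjE) (rule that)
  have mm: "(A ** M) $ i $ l = A $ i $ a * M $ a $ l + A $ i $ b * M $ b $ l" for A M :: cmat and i l
    using ab by (auto simp: side_def mmult_entry)
  have RA: "(T t k - G0 N g0 t ** That_p m Th t k) $ a $ a = \<sigma> * (C t * Yu k t - \<epsilon> * S t * Yw k t)" if t: "t \<ge> 0" for t k
  proof -
    have "(T t k - G0 N g0 t ** That_p m Th t k) $ a $ a = T t k $ a $ a - \<sigma> * (C t * z a k t - \<epsilon> * S t * z b k t)"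
      unfolding z_def That_entry[where X = Th, OF T0[OF t], symmetric] by (simp add: mm G0_side[OF ab] algebra_simps)
    also have "T t k $ a $ a = \<sigma> * (C t * gu \<epsilon> (\<lambda>t. T t k $ a $ a) (\<lambda>t. T t k $ b $ a) t - \<epsilon> * S t * gw \<epsilon> (\<lambda>t. T t k $ a $ a) (\<lambda>t. T t k $ b $ a) t)"
      by (rule ungauge(1)[OF side_square[OF ab], where u = "\<lambda>t. T t k $ a $ a"])
    finally show ?thesis by (simp add: Yu_def Yw_def algebra_simps)
  qed
  have RB: "(T t k - G0 N g0 t ** That_p m Th t k) $ b $ a = \<sigma> * (\<epsilon> * S t * Yu k t + C t * Yw k t)" if t: "t \<ge> 0" for t k
  proof -
    have "(T t k - G0 N g0 t ** That_p m Th t k) $ b $ a = T t k $ b $ a - \<sigma> * (\<epsilon> * S t * z a k t + C t * z b k t)"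
      unfolding z_def That_entry[where X = Th, OF T0[OF t], symmetric] by (simp add: mm G0_side[OF ab] algebra_simps)
    also have "T t k $ b $ a = \<sigma> * (\<epsilon> * S t * gu \<epsilon> (\<lambda>t. T t k $ a $ a) (\<lambda>t. T t k $ b $ a) t + C t * gw \<epsilon> (\<lambda>t. T t k $ a $ a) (\<lambda>t. T t k $ b $ a) t)"
      by (rule ungauge(2)[OF side_square[OF ab], where w = "\<lambda>t. T t k $ b $ a"])
    finally show ?thesis by (simp add: Yu_def Yw_def algebra_simps)
  qed
  show ?thesis
  proof (intro exI[of _ "4 * K"] conjI allI impI)
    show "0 \<le> 4 * K" using K0 by simp
    fix j and t :: real and D :: "complex set" assume j: "j \<le> n" and t: "(t::real) \<ge> 0" and D: "open D" "0 \<notin> D" and D1: "\<forall>k\<in>closure D - {0}. norm k \<le> 1 \<and> Re (phase \<epsilon> k) \<ge> 0"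
    note f = K[THEN spec, THEN mp, OF j, THEN spec, THEN mp, OF t, THEN spec, THEN mp, OF D(1), THEN mp, OF D(2), THEN mp, OF D1]
    from rotated_column[OF ab D(1) f[THEN conjunct1] f[THEN conjunct2] RA[OF t] RB[OF t]]
    show "col_deriv_le j D (\<lambda>k. column a (T t k - G0 N g0 t ** That_p m Th t k)) (\<lambda>k. 4 * K * (norm k ^ Suc m / norm k ^ (2 * j) / (1 + t) ^ (n - j)))"
      by (simp only: mult.assoc)
  qed
qed

lemma column_norm_le:
  assumes "side \<epsilon> a b" shows "norm (column a (M :: cmat)) \<le> norm (M $ a $ a) + norm (M $ b $ a)"
  using norm_vec2_le[of "column a M"] assms by (auto simp: side_def column_def)

lemma U_column_bound:
  assumes U: "is_U Vm U" and ab: "side \<epsilon> a b" and k: "k \<noteq> 0" and t: "t \<ge> 0"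
  shows "Re (phase \<epsilon> k) \<le> 0 \<Longrightarrow> norm (column a (U t k)) \<le> B"
    and "Re (phase \<epsilon> k) \<ge> 0 \<Longrightarrow> norm (column a (U t k ** exp_sigma3 (- 2 * \<i> * theta2 k * of_real t))) \<le> B"
proof -
  note u = U_column[OF U ab k]
  show "norm (column a (U t k)) \<le> B" if re: "Re (phase \<epsilon> k) \<le> 0"
    using usys_forward_bound[OF u(1) side_square[OF ab] side_norm[OF ab] k re t] column_norm_le[OF ab, of "U t k"]
    by (simp add: u)
  note ba = side_swap[OF ab]
  show "norm (column a (U t k ** exp_sigma3 (- 2 * \<i> * theta2 k * of_real t))) \<le> B" if re: "Re (phase \<epsilon> k) \<ge> 0"
  proof -
    have re': "Re (phase (- \<epsilon>) k) \<le> 0" using re by (simp add: phase_minus)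
    have E: "(U t k ** exp_sigma3 (- 2 * \<i> * theta2 k * of_real t)) $ i $ a = exp (- phase \<epsilon> k * of_real t) * U t k $ i $ a" for i
      using ab by (auto simp: side_def mmult_entry phase_def)
    show ?thesis
      using usys_forward_bound[OF usys_swap[OF u(1)] side_square[OF ba] side_norm[OF ba] k re' t]
        column_norm_le[OF ab, of "U t k ** exp_sigma3 (- 2 * \<i> * theta2 k * of_real t)"]
      unfolding E by (simp add: u)
  qed
qed

text \<open>Backward bounds from time r, where r tends to infinity and the column tends to a unit vector.\<close>

lemma T_column_bound:
  assumes T: "volterra_infinity_col Vm T a k" and ab: "side \<epsilon> a b" and k: "k \<noteq> 0" and re: "Re (phase \<epsilon> k) \<ge> 0" and t: "t \<ge> 0"
  shows "norm (column a (T t k)) \<le> B"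
proof -
  note u = T_column[OF T ab k re]
  have "norm (T t k $ a $ a) + norm (T t k $ b $ a) \<le> B * (norm (1::complex) + norm (0::complex))"
  proof (rule tendsto_lowerbound)
    show "((\<lambda>r. B * (norm (T r k $ a $ a) + norm (T r k $ b $ a))) \<longlongrightarrow> B * (norm (1::complex) + norm (0::complex))) at_top"
      by (intro tendsto_intros u)
    show "\<forall>\<^sub>F r in at_top. norm (T t k $ a $ a) + norm (T t k $ b $ a) \<le> B * (norm (T r k $ a $ a) + norm (T r k $ b $ a))"
      using eventually_ge_at_top[of t] by eventually_elim (rule usys_backward_bound[OF u(1) side_square[OF ab] side_norm[OF ab] k re t])
  qed simp
  then show ?thesis using column_norm_le[OF ab, of "T t k"] by simp
qed

end

section \<open>Regularity and decay of the boundary values\<close>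

lemma weighted_imp_wl:
  fixes f :: "real \<Rightarrow> real"
  assumes "(\<lambda>t. (1 + t) ^ n * f t) absolutely_integrable_on {0..}"
  shows "wl n 0 (\<lambda>t. of_real (f t))" "f absolutely_integrable_on {0..}"
proof -
  show w: "wl n 0 (\<lambda>t. of_real (f t))"
    using absolutely_integrable_linear[OF assms bounded_linear_of_real] by (simp add: o_def)
  show "f absolutely_integrable_on {0..}"
    using absolutely_integrable_linear[OF wl0_imp_abs_int[OF w] bounded_linear_Re] by (simp add: o_def)
qed

lemma wl_chain:
  fixes d :: "nat \<Rightarrow> real \<Rightarrow> complex"
  assumes "\<And>i. i < M \<Longrightarrow> antideriv (d i) (d (Suc i))" and "\<And>i. i0 \<le> i \<Longrightarrow> i \<le> M \<Longrightarrow> wl n 0 (d i)"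
  shows "i0 \<le> i \<Longrightarrow> i + r \<le> M \<Longrightarrow> wl n r (d i)"
proof (induction r arbitrary: i)
  case 0
  then show ?case using assms(2) by simp
next
  case (Suc r)
  have "wl n r (d (Suc i))" by (rule Suc.IH) (use Suc.prems in auto)
  moreover have "antideriv (d i) (d (Suc i))" by (rule assms(1)) (use Suc.prems in auto)
  moreover have "wl n 0 (d i)" by (rule assms(2)) (use Suc.prems in auto)
  ultimately show ?case unfolding wl_Suc bl_def by blast
qed

lemma antideriv_of_real:
  fixes f f' :: "real \<Rightarrow> real"
  assumes "continuous_on {0..} f'" "\<And>t. t \<ge> 0 \<Longrightarrow> (f has_real_derivative f' t) (at t within {0..})"
  shows "antideriv (\<lambda>t. of_real (f t)) (\<lambda>t. of_real (f' t))"
proof (rule antideriv_of_deriv)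
  show "continuous_on {0..} (\<lambda>t. complex_of_real (f' t))" by (intro continuous_intros assms)
  fix t :: real assume "t \<ge> 0"
  then have "(f has_vector_derivative f' t) (at t within {0..})"
    using assms(2) by (simp add: has_real_derivative_iff_has_vector_derivative)
  from bounded_linear.has_vector_derivative[OF bounded_linear_of_real this]
  show "((\<lambda>t. complex_of_real (f t)) has_vector_derivative complex_of_real (f' t)) (at t within {0..})" .
qed

text \<open>Integrability of the derivative gives a limit, and the integrals over \<open>[t, t + 1]\<close> tend both to this limit
  and to 0.\<close>

lemma antideriv_tendsto_zero:
  assumes F: "antideriv F f" and iF: "F absolutely_integrable_on {0..}" and jf: "f absolutely_integrable_on {0..}"
  shows "(F \<longlongrightarrow> 0) at_top"
proof -
  define L where "L = F 0 + integral {0..} f"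
  have cF: "continuous_on {0..} F" using F by (rule antideriv_continuous)
  have FL: "(F \<longlongrightarrow> L) at_top"
  proof (rule Lim_transform_eventually)
    show "((\<lambda>t. F 0 + integral {0..t} f) \<longlongrightarrow> L) at_top"
      unfolding L_def by (intro tendsto_intros integral_tail(1) jf)
    show "\<forall>\<^sub>F t in at_top. F 0 + integral {0..t} f = F t"
      using eventually_ge_at_top[of 0] by eventually_elim (rule antideriv_at[OF F, symmetric])
  qed
  define I where "I t = integral {t..t+1} F" for t
  have I0: "(I \<longlongrightarrow> 0) at_top"
  proof (rule Lim_transform_eventually)
    have l: "((\<lambda>t. integral {0..t} F) \<longlongrightarrow> integral {0..} F) at_top" by (rule integral_tail(1)[OF iF])
    have "filterlim (\<lambda>t::real. t + 1) at_top at_top" by (rule filterlim_at_top_mono[OF filterlim_ident]) simp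
    from tendsto_diff[OF filterlim_compose[OF l this] l]
    show "((\<lambda>t. integral {0..t+1} F - integral {0..t} F) \<longlongrightarrow> 0) at_top" by simp
    show "\<forall>\<^sub>F t in at_top. integral {0..t+1} F - integral {0..t} F = I t"
      using eventually_ge_at_top[of 0]
    proof eventually_elim
      case (elim t)
      have "F integrable_on {0..t+1}" by (intro integrable_continuous_real continuous_on_subset[OF cF]) auto
      then show ?case using Henstock_Kurzweil_Integration.integral_combine[of 0 t "t + 1" F] elim by (simp add: I_def algebra_simps)
    qed
  qed
  have "(I \<longlongrightarrow> L) at_top"
  proof (rule tendstoI)
    fix e :: real assume e: "e > 0"
    then have "\<forall>\<^sub>F t in at_top. dist (F t) L < e / 2" using FL tendstoD half_gt_zero by blast
    then obtain T where T: "\<And>t. t \<ge> T \<Longrightarrow> dist (F t) L < e / 2" unfolding eventually_at_top_linorder by blast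
    show "\<forall>\<^sub>F t in at_top. dist (I t) L < e"
      using eventually_ge_at_top[of "max 0 T"]
    proof eventually_elim
      case (elim t)
      have c: "continuous_on {t..t+1} F" by (rule continuous_on_subset[OF cF]) (use elim in auto)
      have "norm (integral {t..t+1} (\<lambda>s. F s - L)) \<le> (e / 2) * (t + 1 - t)"
      proof (rule integral_bound)
        show "continuous_on {t..t+1} (\<lambda>s. F s - L)" by (intro continuous_intros c)
        show "norm (F s - L) \<le> e / 2" if "s \<in> {t..t+1}" for s using T[of s] that elim by (simp add: dist_norm less_imp_le)
      qed simp
      moreover have "integral {t..t+1} (\<lambda>s. F s - L) = I t - L"
        using Henstock_Kurzweil_Integration.integral_diff[OF integrable_continuous_real[OF c] integrable_continuous_real[OF continuous_on_const[of _ L]]] by (simp add: I_def)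
      ultimately show ?case using e by (simp add: dist_norm)
    qed
  qed
  then have "L = 0" using tendsto_unique[OF _ _ I0] by simp
  then show ?thesis using FL by simp
qed

text \<open>This transfers the integrability of \<open>g0 - 2 \<pi> N\<close> to the coefficients s and c.\<close>

lemma sin_cos_near_period:
  fixes x :: real
  shows "\<bar>sin x\<bar> \<le> \<bar>x - 2 * pi * of_int N\<bar>" "\<bar>cos x - 1\<bar> \<le> \<bar>x - 2 * pi * of_int N\<bar>"
proof -
  define y where "y = x - 2 * pi * of_int N"
  have p: "sin (2 * pi * of_int N) = (0::real)" "cos (2 * pi * of_int N) = (1::real)"
    by (simp_all add: sin_integer_2pi cos_integer_2pi)
  have "x = y + 2 * pi * of_int N" by (simp add: y_def)
  then have xy: "sin x = sin y" "cos x = cos y" by (simp_all add: sin_add cos_add p)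
  show "\<bar>sin x\<bar> \<le> \<bar>x - 2 * pi * of_int N\<bar>" unfolding xy y_def[symmetric] by (rule abs_sin_x_le_abs_x)
  have "cos y - 1 = - 2 * (sin (y / 2) * sin (y / 2))" using cos_double_sin[of "y / 2"] by (simp add: power2_eq_square)
  then have "\<bar>cos y - 1\<bar> = 2 * (\<bar>sin (y / 2)\<bar> * \<bar>sin (y / 2)\<bar>)" by (simp add: abs_mult)
  also have "\<dots> \<le> 2 * (\<bar>y / 2\<bar> * 1)" by (intro mult_left_mono mult_mono abs_sin_x_le_abs_x) auto
  finally show "\<bar>cos x - 1\<bar> \<le> \<bar>x - 2 * pi * of_int N\<bar>" unfolding xy y_def[symmetric] by simp
qed

lemma wl0_dominated:
  fixes f g :: "real \<Rightarrow> real"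
  assumes g: "(\<lambda>t. (1 + t) ^ n * g t) absolutely_integrable_on {0..}" and f: "continuous_on {0..} f" and fg: "\<And>t. \<bar>f t\<bar> \<le> \<bar>g t\<bar>"
  shows "wl n 0 (\<lambda>t. of_real (f t))"
proof (rule weighted_imp_wl)
  show "(\<lambda>t. (1 + t) ^ n * f t) absolutely_integrable_on {0..}"
  proof (rule measurable_bounded_by_integrable_imp_absolutely_integrable)
    show "(\<lambda>t. (1 + t) ^ n * f t) \<in> borel_measurable (lebesgue_on {0..})"
      by (intro continuous_imp_measurable_on_sets_lebesgue continuous_intros f) auto
    show "(\<lambda>t. norm ((1 + t) ^ n * g t)) integrable_on {0..}" using g by (simp only: absolutely_integrable_on_def)
    show "norm ((1 + t) ^ n * f t) \<le> norm ((1 + t) ^ n * g t)" for t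
      unfolding norm_mult using fg[of t] by (intro mult_left_mono) auto
  qed simp
qed

lemma col_deriv_le_mono:
  assumes "col_deriv_le j D f b" "\<And>k. k \<in> closure D - {0} \<Longrightarrow> b k \<le> b' k"
  shows "col_deriv_le j D f b'"
  using assms unfolding col_deriv_le_def by (meson order_trans)

lemma norm_power_quotient:
  assumes "k \<noteq> 0" shows "norm (k::complex) ^ Suc m / norm k ^ (2 * j) = norm k powi (int m + 1 - 2 * int j)"
proof -
  have "norm k powi (int (Suc m) - int (2 * j)) = norm k powi int (Suc m) / norm k powi int (2 * j)"
    using assms by (intro power_int_diff) simp
  moreover have "int (Suc m) - int (2 * j) = int m + 1 - 2 * int j" by simp
  ultimately show ?thesis by (simp only: power_int_of_nat)
qed

section \<open>Behaviour as k tends to 0\<close>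

theorem corollary4p4:
  fixes m n :: nat and N :: int
    and g0 g1 :: "real \<Rightarrow> real" and d0 d1 :: "nat \<Rightarrow> real \<Rightarrow> real"
    and T U :: "real \<Rightarrow> complex \<Rightarrow> complex^2^2"
    and Th Zh Wh :: "nat \<Rightarrow> real \<Rightarrow> complex^2^2"
  assumes m: "m \<ge> 1" and n: "n \<ge> 1"
    and g0: "weak_derivs (m + 2) g0 d0"
    and g1: "weak_derivs (m + 1) g1 d1"
    and g0_L1: "(\<lambda>t. (1 + t) ^ n * (g0 t - 2 * pi * of_int N)) absolutely_integrable_on {0..}"
    and d0_L1: "\<And>i. i \<in> {1..m + 2} \<Longrightarrow> (\<lambda>t. (1 + t) ^ n * d0 i t) absolutely_integrable_on {0..}"
    and d1_L1: "\<And>i. i \<in> {0..m + 1} \<Longrightarrow> (\<lambda>t. (1 + t) ^ n * d1 i t) absolutely_integrable_on {0..}"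
    and T: "is_T (Vmat g0 (d0 1) g1) T"
    and U: "is_U (Vmat g0 (d0 1) g1) U"
    and Th: "T_coeffs (Vhat0 (d0 1) g1) (Vhat1 g0) m Th"
    and ZW: "U_coeffs (Vhat0 (d0 1) g1) (Vhat1 g0) m Zh Wh"
  shows "(\<exists>C>0. \<forall>j\<le>n. \<forall>t\<ge>0.
      cols_deriv_le j D2 D3
        (\<lambda>k. T t k - G0 N g0 t ** That_p m Th t k)
        (\<lambda>k. C * cmod k powi (int m + 1 - 2 * int j) / (1 + t) ^ (n - j)) \<and>
      cols_deriv_le j D3 D2
        (\<lambda>k. U t k - U_approx N g0 m Zh Wh t k)
        (\<lambda>k. C * (1 + t) ^ (j + 2) * cmod k powi (int m + 1 - 2 * int j)
              * exp (C * t * cmod k ^ (m + 1))) \<and>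
      cols_deriv_le j D2 D3
        (\<lambda>k. (U t k - U_approx N g0 m Zh Wh t k) ** exp_sigma3 (- 2 * \<i> * theta2 k * of_real t))
        (\<lambda>k. C * (1 + t) ^ (j + 2) * cmod k powi (int m + 1 - 2 * int j)
              * exp (C * t * cmod k ^ (m + 1))))
    \<and> (\<forall>t\<ge>0.
      cols_bounded Dminus Dplus (T t) \<and>
      cols_bounded Dplus Dminus (U t) \<and>
      cols_bounded Dminus Dplus (\<lambda>k. U t k ** exp_sigma3 (- 2 * \<i> * theta2 k * of_real t)))"
proof -
  have d00: "d0 0 = g0" and d10: "d1 0 = g1" using g0 g1 by (auto simp: weak_derivs_def)
  have cd0: "continuous_on {0..} (d0 i)" and hd0: "has_weak_deriv (d0 i) (d0 (Suc i))" if "i < m + 2" for i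
    using g0 that by (auto simp: weak_derivs_def)
  have cd1: "continuous_on {0..} (d1 i)" and hd1: "has_weak_deriv (d1 i) (d1 (Suc i))" if "i < m + 1" for i
    using g1 that by (auto simp: weak_derivs_def)
  have sub: "f absolutely_integrable_on {0..t}" if "f absolutely_integrable_on {0..}" for f :: "real \<Rightarrow> real" and t
    by (rule set_integrable_subset[OF that]) auto
  have A0: "antideriv (\<lambda>t. of_real (d0 i t)) (\<lambda>t. of_real (d0 (Suc i) t))" if i: "i < m + 2" for i
  proof (rule weak_deriv_imp_antideriv[OF cd0[OF i] hd0[OF i]])
    show "d0 (Suc i) absolutely_integrable_on {0..t}" for t
      by (rule sub[OF weighted_imp_wl(2)[OF d0_L1]]) (use i in auto)
  qed
  have A1: "antideriv (\<lambda>t. of_real (d1 i t)) (\<lambda>t. of_real (d1 (Suc i) t))" if i: "i < m + 1" for i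
  proof (rule weak_deriv_imp_antideriv[OF cd1[OF i] hd1[OF i]])
    show "d1 (Suc i) absolutely_integrable_on {0..t}" for t
      by (rule sub[OF weighted_imp_wl(2)[OF d1_L1]]) (use i in auto)
  qed
  define p where "p t = complex_of_real (d0 1 t)" for t
  define q where "q t = complex_of_real (g1 t - d0 1 t)" for t
  define s where "s t = complex_of_real (sin (g0 t))" for t
  define c where "c t = complex_of_real (cos (g0 t) - 1)" for t
  define C where "C t = complex_of_real (cos (g0 t / 2))" for t
  define S where "S t = complex_of_real (sin (g0 t / 2))" for t
  define \<sigma> :: complex where "\<sigma> = (- 1) powi N"
  have w0: "wl n 0 (\<lambda>t. of_real (d0 i t))" if "1 \<le> i" "i \<le> m + 2" for i
    by (rule weighted_imp_wl(1)[OF d0_L1]) (use that in auto)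
  have w1: "wl n 0 (\<lambda>t. of_real (d1 i t))" if "0 \<le> i" "i \<le> m + 1" for i
    by (rule weighted_imp_wl(1)[OF d1_L1]) (use that in auto)
  have wp: "wl n (Suc m) p" unfolding p_def[abs_def]
    by (rule wl_chain[where M = "m + 2" and ?i0.0 = 1 and d = "\<lambda>i t. of_real (d0 i t)", OF A0 w0]) simp_all
  have wg: "wl n (Suc m) (\<lambda>t. complex_of_real (g1 t))" unfolding d10[symmetric]
    by (rule wl_chain[where M = "m + 1" and ?i0.0 = 0 and d = "\<lambda>i t. of_real (d1 i t)", OF A1 w1]) simp_all
  have wq: "wl n (Suc m) q"
    by (rule wl_cong[OF wl_diff[OF wg wp]]) (simp add: q_def p_def)
  have cg: "continuous_on {0..} g0" and cg': "continuous_on {0..} (d0 1)" using cd0[of 0] cd0[of 1] d00 by auto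
  have dg: "(g0 has_real_derivative d0 1 t) (at t within {0..})" if t: "t \<ge> 0" for t
  proof -
    have "((\<lambda>t. complex_of_real (d0 0 t)) has_vector_derivative of_real (d0 (Suc 0) t)) (at t within {0..})"
      by (rule antideriv_deriv[OF A0 _ t], simp) (use cg' in simp)
    from bounded_linear.has_vector_derivative[OF bounded_linear_Re this]
    show ?thesis by (simp add: d00 has_real_derivative_iff_has_vector_derivative)
  qed
  have as: "antideriv s (\<lambda>t. (c t + 1) * p t)"
    by (rule antideriv_cong[OF antideriv_of_real[of "\<lambda>t. cos (g0 t) * d0 1 t" "\<lambda>t. sin (g0 t)"]])
      (auto intro!: continuous_intros derivative_eq_intros cg cg' cg'[unfolded One_nat_def] dg simp: s_def c_def p_def)
  have ac: "antideriv c (\<lambda>t. - s t * p t)"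
    by (rule antideriv_cong[OF antideriv_of_real[of "\<lambda>t. - sin (g0 t) * d0 1 t" "\<lambda>t. cos (g0 t) - 1"]])
      (auto intro!: continuous_intros derivative_eq_intros cg cg' cg'[unfolded One_nat_def] dg simp: s_def c_def p_def)
  have aC: "antideriv C (\<lambda>t. - S t * p t / 2)"
    by (rule antideriv_cong[OF antideriv_of_real[of "\<lambda>t. - sin (g0 t / 2) * (d0 1 t / 2)" "\<lambda>t. cos (g0 t / 2)"]])
      (auto intro!: continuous_intros derivative_eq_intros cg cg' cg'[unfolded One_nat_def] dg simp: C_def S_def p_def)
  have aS: "antideriv S (\<lambda>t. C t * p t / 2)"
    by (rule antideriv_cong[OF antideriv_of_real[of "\<lambda>t. cos (g0 t / 2) * (d0 1 t / 2)" "\<lambda>t. sin (g0 t / 2)"]])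
      (auto intro!: continuous_intros derivative_eq_intros cg cg' cg'[unfolded One_nat_def] dg simp: C_def S_def p_def)
  have ws0: "wl n 0 s" unfolding s_def[abs_def]
    by (rule wl0_dominated[OF g0_L1 _ sin_cos_near_period(1)]) (intro continuous_intros cg)
  have wc0: "wl n 0 c" unfolding c_def[abs_def]
    by (rule wl0_dominated[OF g0_L1 _ sin_cos_near_period(2)]) (intro continuous_intros cg)
  have ws: "wl n (Suc m) s" and wc: "wl n (Suc m) c" using wl_trig[OF wp ws0 wc0 as ac order_refl] by auto
  have CS: "C t * C t + S t * S t = 1" for t
  proof -
    have e: "cos (g0 t / 2) * cos (g0 t / 2) + sin (g0 t / 2) * sin (g0 t / 2) = 1"
      using sin_cos_squared_add2[of "g0 t / 2"] by (simp add: power2_eq_square)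
    show ?thesis by (simp only: C_def S_def of_real_mult[symmetric] of_real_add[symmetric] e of_real_1)
  qed
  have c_eq: "c t = - 2 * S t * S t" and s_eq: "s t = 2 * S t * C t" for t
    using cos_double_sin[of "g0 t / 2"] sin_double[of "g0 t / 2"] by (simp_all add: C_def S_def c_def s_def power2_eq_square)
  have C1: "norm (C t) \<le> 1" and S1: "norm (S t) \<le> 1" for t by (simp_all add: C_def S_def)
  \<comment> \<open>The sign of the rotation by \<open>\<pi> N\<close>, the limit of the half angle.\<close>
  have sg: "\<sigma> = (if even N then 1 else - 1)" by (simp add: \<sigma>_def power_int_minus_left)
  have \<sigma>2: "\<sigma> * \<sigma> = 1" and \<sigma>1: "norm \<sigma> = 1" by (auto simp: sg)
  note L = wl0_imp_abs_int[OF wl_imp_wl0]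
  interpret boundary_data q s c n m p C S \<sigma> g0 "d0 1" g1 N
    by unfold_locales
      (rule wl_continuous[OF wq] wl_continuous[OF ws] wl_continuous[OF wc] wl_continuous[OF wp] L[OF wq] L[OF ws] L[OF wc] L[OF wp]
        wq ws wc aC aS CS c_eq s_eq C1 S1 \<sigma>2 \<sigma>1 q_def p_def s_def c_def C_def S_def \<sigma>_def)+
  have glim: "(g0 \<longlongrightarrow> 2 * pi * of_int N) at_top"
  proof -
    let ?F = "\<lambda>t. complex_of_real (g0 t - 2 * pi * of_int N)"
    have "antideriv ?F p"
      by (rule antideriv_cong[OF antideriv_diff[OF A0[of 0] antideriv_const[of "of_real (2 * pi * of_int N)"]]]) (auto simp: d00 p_def)
    moreover have "?F absolutely_integrable_on {0..}" by (rule wl0_imp_abs_int[OF weighted_imp_wl(1)[OF g0_L1]])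
    ultimately have "(?F \<longlongrightarrow> 0) at_top" by (rule antideriv_tendsto_zero) (rule L[OF wp])
    from tendsto_add[OF tendsto_Re[OF this] tendsto_const[of "2 * pi * of_int N"]] show ?thesis by simp
  qed
  have ends: "\<sigma> * of_real (cos (2 * pi * of_int N / 2)) = 1" "sin (2 * pi * of_int N / 2) = 0"
    by (simp_all add: cos_npi_int sin_npi_int sg)
  have "((\<lambda>t. \<sigma> * C t) \<longlongrightarrow> \<sigma> * of_real (cos (2 * pi * of_int N / 2))) at_top"
    unfolding C_def by (intro tendsto_intros glim; simp)
  then have Clim: "((\<lambda>t. \<sigma> * C t) \<longlongrightarrow> 1) at_top" unfolding ends .
  have "(S \<longlongrightarrow> of_real (sin (2 * pi * of_int N / 2))) at_top"
    unfolding S_def[abs_def] by (intro tendsto_intros glim; simp)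
  then have Slim: "(S \<longlongrightarrow> 0) at_top" unfolding ends of_real_0 .
  have sd: "side 1 1 2" "side (- 1) 2 1" by (simp_all add: side_def)
  have T1: "volterra_infinity_col Vm T 1 k" if "k \<noteq> 0" "norm k \<le> 1" "Re (phase 1 k) \<ge> 0" for k
    using T slab_in_domain(1)[OF that(2)] slab_iff(1)[OF that(1) sd(1)] that unfolding is_T_def by blast
  have T2: "volterra_infinity_col Vm T 2 k" if "k \<noteq> 0" "norm k \<le> 1" "Re (phase (- 1) k) \<ge> 0" for k
    using T slab_in_domain(2)[OF that(2)] slab_iff(1)[OF that(1) sd(2)] that unfolding is_T_def by blast
  have oD: "open D2" "open D3" "0 \<notin> D2" "0 \<notin> D3"
    unfolding D2_def D3_def by (auto intro!: open_Collect_conj open_Collect_less continuous_intros)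
  have Dm: "Re (phase 1 k) \<ge> 0 \<and> Re (phase (- 1) k) \<le> 0" if "k \<in> closure Dminus - {0}" for k
    using domain_in_slab(1) slab_iff(1)[OF _ sd(1), of k] slab_iff(2)[OF _ sd(2), of k] that by auto
  have Dp: "Re (phase (- 1) k) \<ge> 0 \<and> Re (phase 1 k) \<le> 0" if "k \<in> closure Dplus - {0}" for k
    using domain_in_slab(2) slab_iff(2)[OF _ sd(1), of k] slab_iff(1)[OF _ sd(2), of k] that by auto
  have D2: "norm k \<le> 1 \<and> Re (phase 1 k) \<ge> 0 \<and> Re (phase (- 1) k) \<le> 0" if "k \<in> closure D2 - {0}" for k
    using domain_in_slab(3) slab_iff(1)[OF _ sd(1), of k] slab_iff(2)[OF _ sd(2), of k] that by auto
  have D3: "norm k \<le> 1 \<and> Re (phase (- 1) k) \<ge> 0 \<and> Re (phase 1 k) \<le> 0" if "k \<in> closure D3 - {0}" for k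
    using domain_in_slab(4) slab_iff(2)[OF _ sd(1), of k] slab_iff(1)[OF _ sd(2), of k] that by auto
  have z2: "\<forall>k\<in>closure D2 - {0}. norm k \<le> 1" "\<forall>k\<in>closure D2 - {0}. Re (phase 1 k) \<ge> 0" "\<forall>k\<in>closure D2 - {0}. Re (phase (- 1) k) \<le> 0"
    "\<forall>k\<in>closure D2 - {0}. norm k \<le> 1 \<and> Re (phase 1 k) \<ge> 0"
    using D2 by auto
  have z3: "\<forall>k\<in>closure D3 - {0}. norm k \<le> 1" "\<forall>k\<in>closure D3 - {0}. Re (phase (- 1) k) \<ge> 0" "\<forall>k\<in>closure D3 - {0}. Re (phase 1 k) \<le> 0"
    "\<forall>k\<in>closure D3 - {0}. norm k \<le> 1 \<and> Re (phase (- 1) k) \<ge> 0"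
    using D3 by auto
  let ?R = "\<lambda>t k. U t k - U_approx N g0 m Zh Wh t k" and ?Q = "\<lambda>t k. T t k - G0 N g0 t ** That_p m Th t k"
  let ?e = "\<lambda>t k. exp_sigma3 (- 2 * \<i> * theta2 k * of_real t)"
  obtain K1 where K1: "K1 \<ge> 0" and U1: "\<forall>j\<le>n. \<forall>t\<ge>0. \<forall>D. open D \<longrightarrow> 0 \<notin> D \<longrightarrow> (\<forall>k\<in>closure D - {0}. norm k \<le> 1) \<longrightarrow>
      ((\<forall>k\<in>closure D - {0}. Re (phase 1 k) \<le> 0) \<longrightarrow> col_deriv_le j D (\<lambda>k. column 1 (?R t k)) (\<lambda>k. K1 * ((1 + t) ^ j * norm k ^ Suc m / norm k ^ (2 * j)))) \<and>
      ((\<forall>k\<in>closure D - {0}. Re (phase 1 k) \<ge> 0) \<longrightarrow> col_deriv_le j D (\<lambda>k. column 1 (?R t k ** ?e t k)) (\<lambda>k. K1 * ((1 + t) ^ j * norm k ^ Suc m / norm k ^ (2 * j))))"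
    using U_column_error[OF U ZW sd(1)] by (elim exE conjE) (rule that)
  obtain K2 where K2: "K2 \<ge> 0" and U2: "\<forall>j\<le>n. \<forall>t\<ge>0. \<forall>D. open D \<longrightarrow> 0 \<notin> D \<longrightarrow> (\<forall>k\<in>closure D - {0}. norm k \<le> 1) \<longrightarrow>
      ((\<forall>k\<in>closure D - {0}. Re (phase (- 1) k) \<le> 0) \<longrightarrow> col_deriv_le j D (\<lambda>k. column 2 (?R t k)) (\<lambda>k. K2 * ((1 + t) ^ j * norm k ^ Suc m / norm k ^ (2 * j)))) \<and>
      ((\<forall>k\<in>closure D - {0}. Re (phase (- 1) k) \<ge> 0) \<longrightarrow> col_deriv_le j D (\<lambda>k. column 2 (?R t k ** ?e t k)) (\<lambda>k. K2 * ((1 + t) ^ j * norm k ^ Suc m / norm k ^ (2 * j))))"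
    using U_column_error[OF U ZW sd(2)] by (elim exE conjE) (rule that)
  obtain K3 where K3: "K3 \<ge> 0" and T1e: "\<forall>j\<le>n. \<forall>t\<ge>0. \<forall>D. open D \<longrightarrow> 0 \<notin> D \<longrightarrow> (\<forall>k\<in>closure D - {0}. norm k \<le> 1 \<and> Re (phase 1 k) \<ge> 0) \<longrightarrow>
      col_deriv_le j D (\<lambda>k. column 1 (?Q t k)) (\<lambda>k. K3 * (norm k ^ Suc m / norm k ^ (2 * j) / (1 + t) ^ (n - j)))"
    by (rule exE[OF T_column_error[OF U sd(1) T1 Th Clim Slim]]; (assumption | (elim conjE, rule that; assumption)))
  obtain K4 where K4: "K4 \<ge> 0" and T2e: "\<forall>j\<le>n. \<forall>t\<ge>0. \<forall>D. open D \<longrightarrow> 0 \<notin> D \<longrightarrow> (\<forall>k\<in>closure D - {0}. norm k \<le> 1 \<and> Re (phase (- 1) k) \<ge> 0) \<longrightarrow>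
      col_deriv_le j D (\<lambda>k. column 2 (?Q t k)) (\<lambda>k. K4 * (norm k ^ Suc m / norm k ^ (2 * j) / (1 + t) ^ (n - j)))"
    by (rule exE[OF T_column_error[OF U sd(2) T2 Th Clim Slim]]; (assumption | (elim conjE, rule that; assumption)))
  \<comment> \<open>One constant for all six estimates; the summand 1 makes it positive.\<close>
  define M where "M = 1 + K1 + K2 + K3 + K4"
  have M: "M > 0" "K1 \<le> M" "K2 \<le> M" "K3 \<le> M" "K4 \<le> M" using K1 K2 K3 K4 by (auto simp: M_def)
  have bT: "K * (norm k ^ Suc m / norm k ^ (2 * j) / (1 + t) ^ (n - j)) \<le> M * cmod k powi (int m + 1 - 2 * int j) / (1 + t) ^ (n - j)"
    if "K \<le> M" "t \<ge> 0" "k \<noteq> 0" for K t k j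
  proof -
    have "K * (norm k powi (int m + 1 - 2 * int j) / (1 + t) ^ (n - j)) \<le> M * (norm k powi (int m + 1 - 2 * int j) / (1 + t) ^ (n - j))"
      using that by (intro mult_right_mono) auto
    then show ?thesis unfolding norm_power_quotient[OF that(3)] by simp
  qed
  have bU: "K * ((1 + t) ^ j * norm k ^ Suc m / norm k ^ (2 * j)) \<le> M * (1 + t) ^ (j + 2) * cmod k powi (int m + 1 - 2 * int j) * exp (M * t * cmod k ^ (m + 1))"
    if "K \<le> M" "t \<ge> 0" "k \<noteq> 0" for K t k j
  proof -
    have e: "exp (M * t * cmod k ^ (m + 1)) \<ge> 1" using that M by simp
    have "K * ((1 + t) ^ j * norm k powi (int m + 1 - 2 * int j)) \<le> M * ((1 + t) ^ (j + 2) * norm k powi (int m + 1 - 2 * int j))"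
      using that M(1) by (intro mult_mono power_increasing) auto
    also have "\<dots> \<le> M * ((1 + t) ^ (j + 2) * norm k powi (int m + 1 - 2 * int j)) * exp (M * t * cmod k ^ (m + 1))"
      using that M(1) e mult_left_mono[OF e, of "M * ((1 + t) ^ (j + 2) * norm k powi (int m + 1 - 2 * int j))"] by simp
    finally show ?thesis using norm_power_quotient[OF that(3), of m j] by (simp add: mult.assoc times_divide_eq_right[symmetric] del: times_divide_eq_right power_Suc)
  qed
  have bounds: "cols_deriv_le j D2 D3 (?Q t) (\<lambda>k. M * cmod k powi (int m + 1 - 2 * int j) / (1 + t) ^ (n - j)) \<and>
      cols_deriv_le j D3 D2 (?R t) (\<lambda>k. M * (1 + t) ^ (j + 2) * cmod k powi (int m + 1 - 2 * int j) * exp (M * t * cmod k ^ (m + 1))) \<and>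
      cols_deriv_le j D2 D3 (\<lambda>k. ?R t k ** ?e t k) (\<lambda>k. M * (1 + t) ^ (j + 2) * cmod k powi (int m + 1 - 2 * int j) * exp (M * t * cmod k ^ (m + 1)))"
    if j: "j \<le> n" and t: "t \<ge> 0" for j t
  proof -
    note u1 = U1[THEN spec, THEN mp, OF j, THEN spec, THEN mp, OF t, THEN spec, THEN mp, THEN mp, THEN mp]
    note u2 = U2[THEN spec, THEN mp, OF j, THEN spec, THEN mp, OF t, THEN spec, THEN mp, THEN mp, THEN mp]
    note t1 = T1e[THEN spec, THEN mp, OF j, THEN spec, THEN mp, OF t, THEN spec, THEN mp, OF oD(1), THEN mp, OF oD(3), THEN mp, OF z2(4)]
    note t2 = T2e[THEN spec, THEN mp, OF j, THEN spec, THEN mp, OF t, THEN spec, THEN mp, OF oD(2), THEN mp, OF oD(4), THEN mp, OF z3(4)]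
    note r1 = u1[OF oD(2,4) z3(1), THEN conjunct1, THEN mp, OF z3(3)] and e1 = u1[OF oD(1,3) z2(1), THEN conjunct2, THEN mp, OF z2(2)]
    note r2 = u2[OF oD(1,3) z2(1), THEN conjunct1, THEN mp, OF z2(3)] and e2 = u2[OF oD(2,4) z3(1), THEN conjunct2, THEN mp, OF z3(2)]
    show ?thesis unfolding cols_deriv_le_def
      by (intro conjI col_deriv_le_mono[OF t1 bT[OF M(4) t]] col_deriv_le_mono[OF t2 bT[OF M(5) t]]
        col_deriv_le_mono[OF r1 bU[OF M(2) t]] col_deriv_le_mono[OF r2 bU[OF M(3) t]]
        col_deriv_le_mono[OF e1 bU[OF M(2) t]] col_deriv_le_mono[OF e2 bU[OF M(3) t]]) auto
  qed
  have cb: "cols_bounded X Y F" if "\<And>k. k \<in> closure X - {0} \<Longrightarrow> norm (column 1 (F k)) \<le> B" "\<And>k. k \<in> closure Y - {0} \<Longrightarrow> norm (column 2 (F k)) \<le> B"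
    for X Y and F :: "complex \<Rightarrow> cmat"
    unfolding cols_bounded_def using that by (auto intro!: boundedI[where B = B])
  have "cols_bounded Dminus Dplus (T t) \<and> cols_bounded Dplus Dminus (U t) \<and> cols_bounded Dminus Dplus (\<lambda>k. U t k ** ?e t k)" if t: "t \<ge> 0" for t
  proof (intro conjI; rule cb)
    fix k assume k: "k \<in> closure Dminus - {0}"
    then have k0: "k \<noteq> 0" and re: "Re (phase 1 k) \<ge> 0" "Re (phase (- 1) k) \<le> 0" using Dm[OF k] by auto
    have Tk: "volterra_infinity_col Vm T 1 k" using T k unfolding is_T_def by blast
    show "norm (column 1 (T t k)) \<le> B" by (rule T_column_bound[OF Tk sd(1) k0 re(1) t])
    show "norm (column 2 (U t k)) \<le> B" by (rule U_column_bound(1)[OF U sd(2) k0 t re(2)])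
    show "norm (column 1 (U t k ** ?e t k)) \<le> B" by (rule U_column_bound(2)[OF U sd(1) k0 t re(1)])
  next
    fix k assume k: "k \<in> closure Dplus - {0}"
    then have k0: "k \<noteq> 0" and re: "Re (phase (- 1) k) \<ge> 0" "Re (phase 1 k) \<le> 0" using Dp[OF k] by auto
    have Tk: "volterra_infinity_col Vm T 2 k" using T k unfolding is_T_def by blast
    show "norm (column 2 (T t k)) \<le> B" by (rule T_column_bound[OF Tk sd(2) k0 re(1) t])
    show "norm (column 1 (U t k)) \<le> B" by (rule U_column_bound(1)[OF U sd(1) k0 t re(2)])
    show "norm (column 2 (U t k ** ?e t k)) \<le> B" by (rule U_column_bound(2)[OF U sd(2) k0 t re(1)])
  qed
  then show ?thesis using bounds M(1) by blast
qed

end
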